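(* Let $\alpha\neq\beta$ be ordinals. For an ordinal $\gamma$ let $H_\gamma$ be the Hilbert space of density character $\aleph_\gamma$, $\mathcal{B}_\gamma=\mathcal{B}(H_\gamma)$, and $\mathcal{C}_\gamma=\mathcal{B}_\gamma/\mathcal{K}(H_\gamma)$, where $\mathcal{K}(H_\gamma)$ is the ideal of compact operators. Then the projections of $\mathcal{C}_\alpha$ and of $\mathcal{C}_\beta$, as posets with respect to the Murray–von Neumann order, are elementarily equivalent if and only if $\alpha=\beta \bmod \omega^\omega$ (ordinal exponentiation); likewise, the infinite projections of $\mathcal{B}_\alpha$ and of $\mathcal{B}_\beta$, as posets with respect to the Murray–von Neumann order, are elementarily equivalent if and only if $\alpha=\beta\bmod\omega^\omega$. Consequently, if $\alpha\not\equiv\beta$ (as ordered sets) then $\mathcal{B}_\alpha\not\equiv\mathcal{B}_\beta$ and $\mathcal{C}_\alpha\not\equiv\mathcal{C}_\beta$ (as C*-algebras).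
   Context: The Murray–von Neumann order on projections of a C*-algebra is: $p\le_{MvN} q$ iff $p$ is Murray–von Neumann equivalent to a subprojection of $q$; as a poset, projections are considered up to Murray–von Neumann equivalence. A projection is infinite if it is Murray–von Neumann equivalent to a proper subprojection of itself. Elementary equivalence of posets and of ordinals ($\alpha\equiv\beta$ meaning $(\alpha,<)\equiv(\beta,<)$) is in classical first-order logic in the language of order. $\alpha=\beta\bmod\omega^\omega$ means: writing $\alpha=\omega^\omega\cdot\alpha'+\gamma$ and $\beta=\omega^\omega\cdot\beta'+\delta$ with $\gamma,\delta<\omega^\omega$, one has $\gamma=\delta$, and $\alpha'=0$ if and only if $\beta'=0$ (this is the classical characterization of $(\alpha,<)\equiv(\beta,<)$). Elementary equivalence of C*-algebras is in continuous logic: formulas are built from norms $\|P(\bar x)\|$ of $*$-polynomials with complex coefficients (constant terms being allowed for unital algebras) by applying continuous real functions and taking $\sup$ and $\inf$ over variables ranging over the closed unit ball; a sentence is a formula without free variables; $A\equiv B$ if the same sentences have value $0$ in $A$ and in $B$. *)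

theory Defs
  imports "HOL-Analysis.Analysis" "HOL-Algebra.QuotRing"
begin

unbundle cardinal_syntax

section \<open>First-order logic in the language of order\<close>

text \<open>Formulas have equality and one binary relation symbol; variables are named by natural
  numbers. A structure is a universe together with a relation on it. The universe is kept
  separately, because it is not the field of a strict order, and it may be empty (the ordinal 0);
  quantifiers range over the universe only.\<close>

datatype fo_formula =
    FEq nat nat
  | FRel nat nat
  | FNot fo_formula
  | FAnd fo_formula fo_formula
  | FEx nat fo_formula

type_synonym 'a fo_struct = "'a set \<times> 'a rel"

primrec fo_free :: "fo_formula \<Rightarrow> nat set" where
  "fo_free (FEq i j) = {i, j}"
| "fo_free (FRel i j) = {i, j}"
| "fo_free (FNot \<phi>) = fo_free \<phi>"
| "fo_free (FAnd \<phi> \<psi>) = fo_free \<phi> \<union> fo_free \<psi>"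
| "fo_free (FEx i \<phi>) = fo_free \<phi> - {i}"

primrec fo_sat :: "'a fo_struct \<Rightarrow> fo_formula \<Rightarrow> (nat \<Rightarrow> 'a) \<Rightarrow> bool" where
  "fo_sat M (FEq i j) e \<longleftrightarrow> e i = e j"
| "fo_sat M (FRel i j) e \<longleftrightarrow> (e i, e j) \<in> snd M"
| "fo_sat M (FNot \<phi>) e \<longleftrightarrow> \<not> fo_sat M \<phi> e"
| "fo_sat M (FAnd \<phi> \<psi>) e \<longleftrightarrow> fo_sat M \<phi> e \<and> fo_sat M \<psi> e"
| "fo_sat M (FEx i \<phi>) e \<longleftrightarrow> (\<exists>a\<in>fst M. fo_sat M \<phi> (e(i := a)))"

definition fo_equiv :: "'a fo_struct \<Rightarrow> 'b fo_struct \<Rightarrow> bool" where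
  "fo_equiv M N \<longleftrightarrow>
     (\<forall>\<phi>. fo_free \<phi> = {} \<longrightarrow> fo_sat M \<phi> (\<lambda>_. undefined) = fo_sat N \<phi> (\<lambda>_. undefined))"


section \<open>Ordinals\<close>

text \<open>An ordinal is a well-order in the sense of the library (\<^const>\<open>Well_order\<close>, a reflexive
  relation), equality of ordinals is \<^const>\<open>ordIso\<close>, and 0 is the empty relation.\<close>

definition ord_struct :: "'a rel \<Rightarrow> 'a fo_struct" where
  "ord_struct r = (Field r, r - Id)"

definition ord_sum :: "'a rel \<Rightarrow> 'b rel \<Rightarrow> ('a + 'b) rel" where
  "ord_sum r s = {(Inl x, Inl y) | x y. (x, y) \<in> r} \<union> {(Inr x, Inr y) | x y. (x, y) \<in> s}
     \<union> {(Inl x, Inr y) | x y. x \<in> Field r \<and> y \<in> Field s}"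

text \<open>The product of \<open>r\<close> and \<open>s\<close> is \<open>s\<close> copies of \<open>r\<close>: the second coordinate is the most
  significant one.\<close>

definition ord_prod :: "'a rel \<Rightarrow> 'b rel \<Rightarrow> ('a \<times> 'b) rel" where
  "ord_prod r s = {((x, i), (y, j)) | x i y j.
     x \<in> Field r \<and> y \<in> Field r \<and> i \<in> Field s \<and> j \<in> Field s \<and>
     ((i \<noteq> j \<and> (i, j) \<in> s) \<or> (i = j \<and> (x, y) \<in> r))}"

text \<open>The ordinal power of \<open>\<omega>\<close> to the \<open>\<omega>\<close>: finitely supported functions from \<open>\<omega>\<close> to \<open>\<omega>\<close>
  (the coefficients of a Cantor normal form), compared at the largest argument where they differ.\<close>

definition omega_omega :: "(nat \<Rightarrow> nat) rel" where
  "omega_omega = {(f, g). finite {n. f n \<noteq> 0} \<and> finite {n. g n \<noteq> 0} \<and>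
     (f = g \<or> (\<exists>m. f m < g m \<and> (\<forall>n>m. f n = g n)))}"

text \<open>The quotient and remainder of the division of \<open>r\<close> do not exceed \<open>r\<close>, so well-orders on the
  type of \<open>r\<close> suffice for them.\<close>

definition eq_mod_omega_omega :: "'a rel \<Rightarrow> 'b rel \<Rightarrow> bool" where
  "eq_mod_omega_omega r s \<longleftrightarrow>
     (\<exists>(r' :: 'a rel) (c :: 'a rel) (s' :: 'b rel) (d :: 'b rel).
        Well_order r' \<and> Well_order c \<and> Well_order s' \<and> Well_order d \<and>
        r =o ord_sum (ord_prod omega_omega r') c \<and> c <o omega_omega \<and>
        s =o ord_sum (ord_prod omega_omega s') d \<and> d <o omega_omega \<and>
        c =o d \<and> (r' = {} \<longleftrightarrow> s' = {}))"

text \<open>\<open>is_aleph r k\<close>: the cardinal \<open>k\<close> is \<open>\<aleph>\<^sub>r\<close>. A cardinal is an initial ordinal, so the infinite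
  cardinals below \<open>k\<close> are its proper initial segments that are infinite and are themselves
  cardinals; \<open>k\<close> is \<open>\<aleph>\<^sub>r\<close> iff their order type is \<open>r\<close>.\<close>

definition is_aleph :: "'a rel \<Rightarrow> 'k rel \<Rightarrow> bool" where
  "is_aleph r k \<longleftrightarrow> Card_order k \<and> infinite (Field k) \<and>
     Restr k {x \<in> Field k. infinite (underS k x) \<and> Card_order (Restr k (underS k x))} =o r"

definition has_density_character :: "'h::topological_space itself \<Rightarrow> 'k rel \<Rightarrow> bool" where
  "has_density_character _ k \<longleftrightarrow>
     (\<exists>D::'h set. closure D = UNIV \<and> |D| =o k) \<and> (\<forall>D::'h set. closure D = UNIV \<longrightarrow> k \<le>o |D| )"


section \<open>Complex Hilbert spaces\<close>

class complex_hilbert_space = banach +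
  fixes scaleC :: "complex \<Rightarrow> 'a \<Rightarrow> 'a" (infixr \<open>*\<^sub>C\<close> 75)
    and cinner :: "'a \<Rightarrow> 'a \<Rightarrow> complex"
  assumes scaleC_add_right: "c *\<^sub>C (x + y) = c *\<^sub>C x + c *\<^sub>C y"
    and scaleC_add_left: "(c + d) *\<^sub>C x = c *\<^sub>C x + d *\<^sub>C x"
    and scaleC_scaleC: "c *\<^sub>C (d *\<^sub>C x) = (c * d) *\<^sub>C x"
    and scaleR_eq_scaleC: "t *\<^sub>R x = complex_of_real t *\<^sub>C x"
    and cinner_commute: "cinner x y = cnj (cinner y x)"
    and cinner_add_left: "cinner (x + y) z = cinner x z + cinner y z"
    and cinner_scaleC_left: "cinner (c *\<^sub>C x) y = c * cinner x y"
    and cinner_self: "cinner x x = complex_of_real ((norm x)\<^sup>2)"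

definition bounded_clinear :: "('a::complex_hilbert_space \<Rightarrow> 'b::complex_hilbert_space) \<Rightarrow> bool" where
  "bounded_clinear f \<longleftrightarrow> bounded_linear f \<and> (\<forall>c x. f (c *\<^sub>C x) = c *\<^sub>C f x)"

definition hilbert_adjoint ::
  "('a::complex_hilbert_space \<Rightarrow> 'b::complex_hilbert_space) \<Rightarrow> 'b \<Rightarrow> 'a" where
  "hilbert_adjoint f = (THE g. bounded_clinear g \<and> (\<forall>x y. cinner (f x) y = cinner x (g y)))"

definition compact_operator ::
  "('a::complex_hilbert_space \<Rightarrow> 'b::complex_hilbert_space) \<Rightarrow> bool" where
  "compact_operator f \<longleftrightarrow> bounded_clinear f \<and> compact (closure (f ` cball 0 1))"


section \<open>The C*-algebras of bounded operators and the Calkin algebras\<close>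

record 'a cstar_algebra = "'a ring" +
  cscale :: "complex \<Rightarrow> 'a \<Rightarrow> 'a"
  cstar :: "'a \<Rightarrow> 'a"
  cnorm :: "'a \<Rightarrow> real"

definition bounded_operators :: "'h::complex_hilbert_space itself \<Rightarrow> ('h \<Rightarrow> 'h) cstar_algebra" where
  "bounded_operators _ =
     \<lparr>carrier = {f. bounded_clinear f},
      mult = (\<circ>),
      one = id,
      zero = (\<lambda>_. 0),
      add = (\<lambda>f g x. f x + g x),
      cscale = (\<lambda>c f x. c *\<^sub>C f x),
      cstar = hilbert_adjoint,
      cnorm = onorm\<rparr>"

text \<open>The quotient by a closed two-sided *-ideal: the quotient ring of the library, with the
  operations on cosets induced by those on representatives, and the quotient norm.\<close>

definition cstar_quotient :: "'a cstar_algebra \<Rightarrow> 'a set \<Rightarrow> 'a set cstar_algebra" where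
  "cstar_quotient A I = ring.extend (A Quot I)
     (cstar_algebra.fields
        (\<lambda>c X. \<Union>x\<in>X. I +>\<^bsub>A\<^esub> cscale A c x)
        (\<lambda>X. \<Union>x\<in>X. I +>\<^bsub>A\<^esub> cstar A x)
        (\<lambda>X. Inf (cnorm A ` X)))"

definition calkin_algebra :: "'h::complex_hilbert_space itself \<Rightarrow> ('h \<Rightarrow> 'h) set cstar_algebra" where
  "calkin_algebra H = cstar_quotient (bounded_operators H) {f. compact_operator f}"


section \<open>Projections and the Murray--von Neumann order\<close>

definition projections :: "'a cstar_algebra \<Rightarrow> 'a set" where
  "projections A = {p \<in> carrier A. p \<otimes>\<^bsub>A\<^esub> p = p \<and> cstar A p = p}"

definition subprojection :: "'a cstar_algebra \<Rightarrow> 'a \<Rightarrow> 'a \<Rightarrow> bool" where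
  "subprojection A p q \<longleftrightarrow> p \<in> projections A \<and> q \<in> projections A \<and> q \<otimes>\<^bsub>A\<^esub> p = p"

definition mvn_equiv :: "'a cstar_algebra \<Rightarrow> 'a \<Rightarrow> 'a \<Rightarrow> bool" where
  "mvn_equiv A p q \<longleftrightarrow> p \<in> projections A \<and> q \<in> projections A \<and>
     (\<exists>v\<in>carrier A. cstar A v \<otimes>\<^bsub>A\<^esub> v = p \<and> v \<otimes>\<^bsub>A\<^esub> cstar A v = q)"

definition mvn_le :: "'a cstar_algebra \<Rightarrow> 'a \<Rightarrow> 'a \<Rightarrow> bool" where
  "mvn_le A p q \<longleftrightarrow> (\<exists>r. subprojection A r q \<and> mvn_equiv A p r)"

definition infinite_projections :: "'a cstar_algebra \<Rightarrow> 'a set" where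
  "infinite_projections A =
     {p \<in> projections A. \<exists>q. subprojection A q p \<and> q \<noteq> p \<and> mvn_equiv A p q}"

text \<open>The poset of the projections in \<open>P\<close> up to Murray--von Neumann equivalence.\<close>

definition mvn_poset :: "'a cstar_algebra \<Rightarrow> 'a set \<Rightarrow> 'a set fo_struct" where
  "mvn_poset A P =
     (let U = P // {(p, q). p \<in> P \<and> q \<in> P \<and> mvn_equiv A p q}
      in (U, {(X, Y). X \<in> U \<and> Y \<in> U \<and> (\<exists>p\<in>X. \<exists>q\<in>Y. mvn_le A p q)}))"


section \<open>Continuous logic of unital C*-algebras\<close>

text \<open>Terms denoting *-polynomials with complex coefficients and constant terms.\<close>

datatype star_poly =
    SVar nat
  | SOne
  | SScale complex star_poly
  | SAdd star_poly star_poly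
  | SMult star_poly star_poly
  | SStar star_poly

text \<open>In \<open>CConn u [\<phi>\<^sub>0, \<dots>, \<phi>\<^sub>n\<^sub>-\<^sub>1]\<close> the connective is a continuous function of \<open>n\<close> real
  variables, given as a function on real sequences that is continuous for the product topology
  and is evaluated at sequences vanishing from the index \<open>n\<close> on. Every continuous function of
  \<open>n\<close> real variables arises in this way.\<close>

datatype cl_formula =
    CNorm star_poly
  | CConn "(nat \<Rightarrow> real) \<Rightarrow> real" "cl_formula list"
  | CSup nat cl_formula
  | CInf nat cl_formula

primrec star_poly_vars :: "star_poly \<Rightarrow> nat set" where
  "star_poly_vars (SVar i) = {i}"
| "star_poly_vars SOne = {}"
| "star_poly_vars (SScale c t) = star_poly_vars t"
| "star_poly_vars (SAdd s t) = star_poly_vars s \<union> star_poly_vars t"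
| "star_poly_vars (SMult s t) = star_poly_vars s \<union> star_poly_vars t"
| "star_poly_vars (SStar t) = star_poly_vars t"

primrec star_poly_eval :: "'a cstar_algebra \<Rightarrow> star_poly \<Rightarrow> (nat \<Rightarrow> 'a) \<Rightarrow> 'a" where
  "star_poly_eval A (SVar i) e = e i"
| "star_poly_eval A SOne e = \<one>\<^bsub>A\<^esub>"
| "star_poly_eval A (SScale c t) e = cscale A c (star_poly_eval A t e)"
| "star_poly_eval A (SAdd s t) e = star_poly_eval A s e \<oplus>\<^bsub>A\<^esub> star_poly_eval A t e"
| "star_poly_eval A (SMult s t) e = star_poly_eval A s e \<otimes>\<^bsub>A\<^esub> star_poly_eval A t e"
| "star_poly_eval A (SStar t) e = cstar A (star_poly_eval A t e)"

primrec cl_wf :: "cl_formula \<Rightarrow> bool" where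
  "cl_wf (CNorm t) \<longleftrightarrow> True"
| "cl_wf (CConn u \<phi>s) \<longleftrightarrow> continuous_on UNIV u \<and> list_all id (map cl_wf \<phi>s)"
| "cl_wf (CSup i \<phi>) \<longleftrightarrow> cl_wf \<phi>"
| "cl_wf (CInf i \<phi>) \<longleftrightarrow> cl_wf \<phi>"

primrec cl_free :: "cl_formula \<Rightarrow> nat set" where
  "cl_free (CNorm t) = star_poly_vars t"
| "cl_free (CConn u \<phi>s) = \<Union> (set (map cl_free \<phi>s))"
| "cl_free (CSup i \<phi>) = cl_free \<phi> - {i}"
| "cl_free (CInf i \<phi>) = cl_free \<phi> - {i}"

definition unit_ball :: "'a cstar_algebra \<Rightarrow> 'a set" where
  "unit_ball A = {a \<in> carrier A. cnorm A a \<le> 1}"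

text \<open>The real \<^const>\<open>Sup\<close> and \<^const>\<open>Inf\<close> are not junk values here: in a well-formed sentence
  all variables range over the unit ball, where all subformulas are bounded.\<close>

primrec cl_eval :: "'a cstar_algebra \<Rightarrow> cl_formula \<Rightarrow> (nat \<Rightarrow> 'a) \<Rightarrow> real" where
  "cl_eval A (CNorm t) e = cnorm A (star_poly_eval A t e)"
| "cl_eval A (CConn u \<phi>s) e =
     u (\<lambda>i. if i < length \<phi>s then map (\<lambda>\<phi>. cl_eval A \<phi> e) \<phi>s ! i else 0)"
| "cl_eval A (CSup i \<phi>) e = (SUP a\<in>unit_ball A. cl_eval A \<phi> (e(i := a)))"
| "cl_eval A (CInf i \<phi>) e = (INF a\<in>unit_ball A. cl_eval A \<phi> (e(i := a)))"

definition cstar_equiv :: "'a cstar_algebra \<Rightarrow> 'b cstar_algebra \<Rightarrow> bool" where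
  "cstar_equiv A B \<longleftrightarrow>
     (\<forall>\<phi>. cl_wf \<phi> \<and> cl_free \<phi> = {} \<longrightarrow>
        (cl_eval A \<phi> (\<lambda>_. undefined) = 0 \<longleftrightarrow> cl_eval B \<phi> (\<lambda>_. undefined) = 0))"

end

theory Submission
  imports Defs
begin

text \<open>
  The Murray--von Neumann order compares ranks. In \<open>B(H)\<close> a projection is infinite iff its rank
  is infinite, and infinite projections are ordered and identified as the cardinals that are
  their ranks. The same holds for projections of infinite rank modulo the compact operators:
  every projection of the Calkin algebra lifts to a projection (\<open>projection_lifting\<close>), and if
  \<open>p = v\<^sup>* v\<close> and \<open>v v\<^sup>* \<le> q\<close> modulo compact operators then \<open>p = v\<^sup>* q v v\<^sup>* v\<close> modulo compact
  operators, so that the rank of \<open>p\<close> is at most the rank of \<open>q\<close> (\<open>rank_le_of_mvn_le\<close>). The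
  projections of finite rank are 0 in the Calkin algebra. Hence, for a space of infinite dimension
  \<open>\<aleph>\<^sub>\<gamma>\<close>, the two posets are the order of the infinite cardinals up to \<open>\<aleph>\<^sub>\<gamma>\<close>, of order type \<open>\<gamma> + 1\<close>
  (\<open>infinite_projections_poset\<close>), and the same order with one more least element, of order type
  \<open>1 + \<gamma> + 1\<close> (\<open>calkin_projections_poset\<close>).

  It remains to compare ordinals. Every ordinal \<open>\<gamma>\<close> is the initial segment below some element
  \<open>(f, j)\<close> of a product \<open>\<omega>\<^sup>\<omega> \<cdot> R\<close>, where the position of \<open>j\<close> in \<open>R\<close> is the quotient of \<open>\<gamma>\<close> by
  \<open>\<omega>\<^sup>\<omega>\<close> and \<open>f\<close> lists the coefficients of the Cantor normal form of the remainder. A back-and-forth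
  argument shows that the theory of the segment depends only on \<open>f\<close> and on whether \<open>j\<close> is least
  (\<open>segment_fo_equiv\<close>). Conversely \<open>\<gamma> + 1\<close>, the segment together with \<open>(f, j)\<close>, determines these
  data: the multiples of \<open>\<omega>\<^sup>k\<close> are definable, and the coefficient at \<open>k\<close> counts the multiples of
  \<open>\<omega>\<^sup>k\<close> above the last multiple of the next power (\<open>segment_fo_equiv_iff\<close>). The passage from \<open>\<gamma>\<close>
  to \<open>1 + \<gamma>\<close> only adds 1 to a finite \<open>\<gamma>\<close> (\<open>bump_inject\<close>). Together with the description of
  equality modulo \<open>\<omega>\<^sup>\<omega>\<close> by coefficients this gives the two equivalences (\<open>ranks_compare\<close>).

  For the statement on C*-algebras, the order of the infinite ranks is interpreted in both
  algebras by formulas of continuous logic. The formulas do not single out projections but the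
  elements \<open>x\<close> of the unit ball for which \<open>x v x\<close> is close to \<open>x\<close> for some contraction \<open>v\<close>.
  For these the distance to the operators of rank less than a given cardinal is either close to 0
  or not much below 1 (\<open>near_gap\<close>), so that they have a rank that is stable under small errors,
  and \<open>x\<close> has at most the rank of \<open>y\<close> iff \<open>x\<close> is close to \<open>v y w\<close> for some contractions \<open>v\<close> and \<open>w\<close>
  (\<open>rank_class_factor\<close>, \<open>rank_class_le\<close>). Truncating the formulas makes them two-valued. What is
  left is to exclude the compact operators. In the Calkin algebra they are 0. In \<open>B(H)\<close> one asks
  for contractions \<open>v\<close> and \<open>w\<close> such that \<open>1 + 2 v x w\<close> is close to an isometry that is not onto;
  if \<open>x\<close> is close to a compact operator there are none, since a compact perturbation of an
  operator near the identity is onto if it is bounded below (\<open>near_compact_not_shift\<close>). A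
  first-order sentence on the ranks thus becomes a continuous sentence with value 0 or 1
  (\<open>interprets_fo_equiv\<close>), and elementarily equivalent algebras have elementarily equivalent
  orders of ranks.

  The nonzero spaces of finite dimension have density character \<open>\<aleph>\<^sub>0\<close> as well. In this case there are no
  infinite ranks; since the ordinals differ, the other space is infinite-dimensional, and the
  posets are told apart by their numbers of elements.
\<close>

section \<open>The order \<open>\<omega>\<^sup>\<omega> \<cdot> R\<close>\<close>

text \<open>Elements of products are quantified over as points of an order, not as pairs.\<close>

declare split_paired_All [simp del] split_paired_Ex [simp del]

definition fin_supp :: "(nat => nat) => bool" where
  "fin_supp f \<longleftrightarrow> finite {n. f n \<noteq> 0}"

definition cless :: "(nat => nat) => (nat => nat) => bool" where
  "cless f g \<longleftrightarrow> (\<exists>m. f m < g m \<and> (\<forall>n>m. f n = g n))"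

lemma clessI: "f m < g m ==> (\<And>n. n > m ==> f n = g n) ==> cless f g"
  unfolding cless_def by blast

lemma cless_irrefl [simp]: "\<not> cless f f"
  unfolding cless_def by simp

lemma cless_trans:
  assumes "cless f g" "cless g h" shows "cless f h"
proof -
  obtain m where m: "f m < g m" "\<forall>n>m. f n = g n" using assms(1) unfolding cless_def by blast
  obtain l where l: "g l < h l" "\<forall>n>l. g n = h n" using assms(2) unfolding cless_def by blast
  show ?thesis
  proof (rule clessI[of _ "max m l"])
    show "f (max m l) < h (max m l)"
      using m l by (cases m l rule: linorder_cases) (auto simp: max_def)
    show "f n = h n" if "n > max m l" for n using m l that by simp
  qed
qed

lemma cless_asym: "cless f g ==> \<not> cless g f"
  using cless_trans cless_irrefl by blast

lemma cless_linear:
  assumes "fin_supp f" "fin_supp g" "f \<noteq> g" shows "cless f g \<or> cless g f"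
proof -
  have fin: "finite {n. f n \<noteq> g n}"
    by (rule finite_subset[of _ "{n. f n \<noteq> 0} \<union> {n. g n \<noteq> 0}"])
      (use assms in \<open>auto simp: fin_supp_def\<close>)
  have ne: "{n. f n \<noteq> g n} \<noteq> {}" using assms(3) by auto
  define m where "m = Max {n. f n \<noteq> g n}"
  have "f m \<noteq> g m" using Max_in[OF fin ne] by (simp add: m_def)
  moreover have "f n = g n" if "n > m" for n
    using Max_ge[OF fin, of n] that unfolding m_def by auto
  ultimately show ?thesis unfolding cless_def by (metis linorder_neqE_nat)
qed

lemma fin_supp_fun_upd [simp]: "fin_supp f ==> fin_supp (f(n := k))"
  unfolding fin_supp_def by (rule finite_subset[of _ "insert n {n. f n \<noteq> 0}"]) auto

lemma fin_supp_zero [simp]: "fin_supp (\<lambda>_. 0)"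
  unfolding fin_supp_def by simp

lemma fin_supp_cut [simp]: "fin_supp f ==> fin_supp (\<lambda>k. if k < n then 0 else f k)"
  unfolding fin_supp_def by (rule finite_subset[of _ "{n. f n \<noteq> 0}"]) auto

lemma fin_supp_mix [simp]:
  "fin_supp f ==> fin_supp g ==> fin_supp (\<lambda>k. if k < n then f k else g k)"
  unfolding fin_supp_def
  by (rule finite_subset[of _ "{n. f n \<noteq> 0} \<union> {n. g n \<noteq> 0}"]) auto

lemma omega_omega_iff:
  "(f, g) \<in> omega_omega \<longleftrightarrow> fin_supp f \<and> fin_supp g \<and> (f = g \<or> cless f g)"
  unfolding omega_omega_def fin_supp_def cless_def by auto

lemma Field_omega_omega: "Field omega_omega = {f. fin_supp f}"
  unfolding Field_def by (auto simp: omega_omega_iff)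

text \<open>Minimal elements are found one coefficient at a time, the most significant one first.\<close>

lemma bounded_supp_minimal:
  assumes "Q \<noteq> {}" "\<forall>f\<in>Q. \<forall>k\<ge>n. f k = 0"
  shows "\<exists>z\<in>Q. \<forall>y\<in>Q. \<not> cless y z"
  using assms
proof (induction n arbitrary: Q)
  case 0
  then obtain f where f: "f \<in> Q" by blast
  have "g = (\<lambda>_. 0)" if "g \<in> Q" for g using 0 that by auto
  then show ?case using f by (metis cless_irrefl)
next
  case (Suc n)
  define m where "m = (LEAST m. \<exists>f\<in>Q. f n = m)"
  have "\<exists>f\<in>Q. f n = m" unfolding m_def
    by (rule LeastI_ex) (use Suc.prems in blast)
  then obtain f where f: "f \<in> Q" "f n = m" by blast
  have least: "m \<le> g n" if "g \<in> Q" for g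
    unfolding m_def using that by (auto intro: Least_le)
  define Q' where "Q' = (\<lambda>g. g(n := 0)) ` {g \<in> Q. g n = m}"
  have "\<exists>z\<in>Q'. \<forall>y\<in>Q'. \<not> cless y z"
  proof (rule Suc.IH)
    show "Q' \<noteq> {}" using f by (auto simp: Q'_def)
    show "\<forall>f\<in>Q'. \<forall>k\<ge>n. f k = 0" using Suc.prems(2) by (auto simp: Q'_def nat_less_le Suc_le_eq)
  qed
  then obtain z where z: "z \<in> Q" "z n = m" and
    zmin: "\<forall>y\<in>{g\<in>Q. g n = m}. \<not> cless (y(n := 0)) (z(n := 0))" by (auto simp: Q'_def)
  have "\<not> cless y z" if y: "y \<in> Q" for y
  proof
    assume "cless y z"
    then obtain l where l: "y l < z l" "\<forall>k>l. y k = z k" unfolding cless_def by blast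
    have "l \<le> n" using l(1) Suc.prems(2) z(1) by (metis less_zeroE not_less_eq_eq)
    have "l \<noteq> n" using least[OF y] l(1) z(2) by auto
    then have "l < n" using \<open>l \<le> n\<close> by simp
    then have "y n = m" using l z by simp
    moreover have "cless (y(n := 0)) (z(n := 0))"
      by (rule clessI[of _ l]) (use l \<open>l < n\<close> in auto)
    ultimately show False using zmin y by blast
  qed
  then show ?case using z by blast
qed

lemma cless_minimal:
  assumes "Q \<noteq> {}" "\<forall>f\<in>Q. fin_supp f"
  shows "\<exists>z\<in>Q. \<forall>y\<in>Q. \<not> cless y z"
proof -
  obtain f where f: "f \<in> Q" using assms by blast
  then have "finite {n. f n \<noteq> 0}" using assms(2) by (auto simp: fin_supp_def)
  then obtain n where n: "\<forall>k\<ge>n. f k = 0"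
    by (metis (mono_tags, lifting) finite_nat_set_iff_bounded linorder_not_less mem_Collect_eq)
  define Q' where "Q' = {g\<in>Q. \<forall>k\<ge>n. g k = 0}"
  have "\<exists>z\<in>Q'. \<forall>y\<in>Q'. \<not> cless y z"
    by (rule bounded_supp_minimal[of _ n]) (use f n in \<open>auto simp: Q'_def\<close>)
  then obtain z where z: "z \<in> Q'" "\<forall>y\<in>Q'. \<not> cless y z" by blast
  have "\<not> cless y z" if y: "y \<in> Q" for y
  proof
    assume c: "cless y z"
    then obtain l where l: "y l < z l" "\<forall>k>l. y k = z k" unfolding cless_def by blast
    have "l < n" using l(1) z(1) unfolding Q'_def
      by (metis (mono_tags, lifting) linorder_not_less mem_Collect_eq not_less_zero)
    then have "y \<in> Q'" using y l z(1) unfolding Q'_def by auto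
    then show False using z c by blast
  qed
  then show ?thesis using z(1) unfolding Q'_def by blast
qed

abbreviation omega_times :: "'a rel => ((nat => nat) \<times> 'a) rel" where
  "omega_times R \<equiv> ord_prod omega_omega R"

lemma omega_times_iff:
  "((g, i), (h, l)) \<in> omega_times R \<longleftrightarrow>
     fin_supp g \<and> fin_supp h \<and> i \<in> Field R \<and> l \<in> Field R \<and>
     (i \<noteq> l \<and> (i, l) \<in> R \<or> i = l \<and> (g = h \<or> cless g h))"
  unfolding ord_prod_def by (auto simp: Field_omega_omega omega_omega_iff)

lemma Field_omega_times:
  assumes "Well_order R"
  shows "Field (omega_times R) = {f. fin_supp f} \<times> Field R"
proof
  show "Field (omega_times R) \<subseteq> {f. fin_supp f} \<times> Field R"
  proof
    fix x assume "x \<in> Field (omega_times R)"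
    then obtain y where "(x, y) \<in> omega_times R \<or> (y, x) \<in> omega_times R"
      by (auto simp: Field_def)
    then show "x \<in> {f. fin_supp f} \<times> Field R"
      by (cases x, cases y) (auto simp: omega_times_iff)
  qed
  show "{f. fin_supp f} \<times> Field R \<subseteq> Field (omega_times R)"
  proof
    fix x assume "x \<in> {f. fin_supp f} \<times> Field R"
    then have "(x, x) \<in> omega_times R" by (cases x) (auto simp: omega_times_iff)
    then show "x \<in> Field (omega_times R)" by (rule FieldI1)
  qed
qed

lemma Well_orderI:
  fixes r :: "'a rel"
  assumes "Refl r" "trans r" "antisym r" "Total r"
    "\<And>Q. Q \<noteq> {} ==> Q \<subseteq> Field r ==> \<exists>z\<in>Q. \<forall>y\<in>Q. (y, z) \<in> r --> y = z"
  shows "Well_order r"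
proof -
  have "wf (r - Id)" unfolding wf_eq_minimal
  proof (intro allI impI)
    fix Q :: "'a set" and x assume x: "x \<in> Q"
    show "\<exists>z\<in>Q. \<forall>y. (y, z) \<in> r - Id --> y \<notin> Q"
    proof (cases "Q \<subseteq> Field r")
      case True
      then show ?thesis using assms(5)[of Q] x by blast
    next
      case False
      then obtain z where "z \<in> Q" "z \<notin> Field r" by blast
      then show ?thesis by (metis DiffD1 FieldI2)
    qed
  qed
  moreover have "r \<subseteq> Field r \<times> Field r" by (auto simp: Field_def)
  ultimately show ?thesis using assms(1-4) by (simp add: order_on_defs)
qed

lemma Well_order_facts:
  assumes "Well_order r"
  shows "\<And>x. x \<in> Field r ==> (x, x) \<in> r"
    and "\<And>x y z. (x, y) \<in> r ==> (y, z) \<in> r ==> (x, z) \<in> r"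
    and "\<And>x y. (x, y) \<in> r ==> (y, x) \<in> r ==> x = y"
    and "\<And>x y. x \<in> Field r ==> y \<in> Field r ==> (x, y) \<in> r \<or> (y, x) \<in> r"
proof -
  have r: "Refl r" "trans r" "antisym r" "Total r" using assms by (simp_all add: order_on_defs)
  show R: "(x, x) \<in> r" if "x \<in> Field r" for x using r(1) that by (rule refl_onD)
  show "(x, z) \<in> r" if "(x, y) \<in> r" "(y, z) \<in> r" for x y z using r(2) that by (rule transD)
  show "x = y" if "(x, y) \<in> r" "(y, x) \<in> r" for x y using r(3) that by (rule antisymD)
  show "(x, y) \<in> r \<or> (y, x) \<in> r" if "x \<in> Field r" "y \<in> Field r" for x y
    using r(4) R that unfolding total_on_def by (cases "x = y") auto
qed

lemma Well_order_minimal: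
  assumes "Well_order r" "Q \<noteq> {}" "Q \<subseteq> Field r"
  shows "\<exists>z\<in>Q. \<forall>y\<in>Q. (z, y) \<in> r"
proof -
  have "wf (r - Id)" using assms(1) by (simp add: order_on_defs)
  then obtain z where z: "z \<in> Q" "\<forall>y. (y, z) \<in> r - Id --> y \<notin> Q"
    using assms(2) unfolding wf_eq_minimal by blast
  have "(z, y) \<in> r" if "y \<in> Q" for y
  proof (cases "y = z")
    case True
    then show ?thesis using Well_order_facts(1)[OF assms(1)] z(1) assms(3) by blast
  next
    case False
    then have "(y, z) \<notin> r" using z(2) that by blast
    then show ?thesis using Well_order_facts(4)[OF assms(1), of y z] that z(1) assms(3) by blast
  qed
  then have "\<forall>y\<in>Q. (z, y) \<in> r" by simp
  then show ?thesis by (rule bexI[OF _ z(1)])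
qed

lemma Well_order_omega_omega: "Well_order omega_omega"
proof (rule Well_orderI)
  show "Refl omega_omega"
    by (rule refl_onI) (simp add: omega_omega_iff Field_omega_omega)
  show "trans omega_omega"
    by (rule transI) (auto simp: omega_omega_iff intro: cless_trans)
  show "antisym omega_omega"
    by (rule antisymI) (auto simp: omega_omega_iff dest: cless_asym)
  show "Total omega_omega"
    by (rule total_onI) (simp add: omega_omega_iff Field_omega_omega cless_linear)
  fix Q :: "(nat => nat) set" assume Q: "Q \<noteq> {}" "Q \<subseteq> Field omega_omega"
  then have "\<exists>z\<in>Q. \<forall>y\<in>Q. \<not> cless y z" by (intro cless_minimal) (auto simp: Field_omega_omega)
  then obtain z where z: "z \<in> Q" "\<forall>y\<in>Q. \<not> cless y z" by blast
  then have "\<forall>y\<in>Q. (y, z) \<in> omega_omega --> y = z" by (simp add: omega_omega_iff)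
  then show "\<exists>z\<in>Q. \<forall>y\<in>Q. (y, z) \<in> omega_omega --> y = z" by (rule bexI[OF _ z(1)])
qed

lemma Well_order_omega_times:
  assumes R: "Well_order R" shows "Well_order (omega_times R)"
proof (rule Well_orderI)
  note RF = Well_order_facts[OF R]
  show "Refl (omega_times R)"
    by (auto simp: refl_on_def Field_omega_times[OF R] omega_times_iff)
  show "trans (omega_times R)"
  proof (rule transI)
    fix x y z assume "(x, y) \<in> omega_times R" "(y, z) \<in> omega_times R"
    then show "(x, z) \<in> omega_times R"
      using RF(2)[of "snd x" "snd y" "snd z"] RF(3)[of "snd x" "snd y"]
	cless_trans[of "fst x" "fst y" "fst z"]
      by (cases x, cases y, cases z) (auto simp: omega_times_iff)
  qed
  show "antisym (omega_times R)"
  proof (rule antisymI)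
    fix x y assume "(x, y) \<in> omega_times R" "(y, x) \<in> omega_times R"
    then show "x = y"
      using RF(3)[of "snd x" "snd y"] cless_asym[of "fst x" "fst y"]
      by (cases x, cases y) (auto simp: omega_times_iff)
  qed
  show "Total (omega_times R)"
    unfolding total_on_def Field_omega_times[OF R]
  proof (intro ballI impI)
    fix x y assume "x \<in> {f. fin_supp f} \<times> Field R" "y \<in> {f. fin_supp f} \<times> Field R" "x \<noteq> y"
    then show "(x, y) \<in> omega_times R \<or> (y, x) \<in> omega_times R"
      using RF(4) cless_linear by (cases x, cases y) (auto simp: omega_times_iff)
  qed
  fix Q :: "((nat => nat) \<times> 'a) set" assume Q: "Q \<noteq> {}" "Q \<subseteq> Field (omega_times R)"
  have sub: "Q \<subseteq> {f. fin_supp f} \<times> Field R" using Q Field_omega_times[OF R] by blast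
  have "\<exists>i\<in>snd ` Q. \<forall>k\<in>snd ` Q. (i, k) \<in> R"
    by (rule Well_order_minimal[OF R]) (use Q sub in auto)
  then obtain i where i: "i \<in> snd ` Q" "\<forall>k\<in>snd ` Q. (i, k) \<in> R" by blast
  have "\<exists>z\<in>{g. (g, i) \<in> Q}. \<forall>y\<in>{g. (g, i) \<in> Q}. \<not> cless y z"
    by (rule cless_minimal) (use i(1) sub in auto)
  then obtain z where z: "(z, i) \<in> Q" "\<forall>y. (y, i) \<in> Q --> \<not> cless y z" by blast
  have "y = (z, i)" if y: "y \<in> Q" "(y, (z, i)) \<in> omega_times R" for y
  proof -
    obtain h k where yy: "y = (h, k)" by (cases y)
    have "(i, k) \<in> R" using i(2) y(1) yy by force
    then have "k = i" using y(2) RF(3) unfolding yy omega_times_iff by blast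
    then show ?thesis using y z yy by (auto simp: omega_times_iff)
  qed
  then show "\<exists>z\<in>Q. \<forall>y\<in>Q. (y, z) \<in> omega_times R --> y = z" using z(1) by blast
qed

section \<open>Back-and-forth between two products\<close>

lemma fo_sat_cong:
  "(\<forall>i\<in>fo_free \<phi>. e i = e' i) ==> fo_sat M \<phi> e = fo_sat M \<phi> e'"
proof (induction \<phi> arbitrary: e e')
  case (FEx i \<phi>)
  have "fo_sat M \<phi> (e(i := a)) = fo_sat M \<phi> (e'(i := a))" for a
    by (rule FEx.IH) (use FEx.prems in auto)
  then show ?case by simp
next
  case (FAnd \<phi> \<psi>)
  then show ?case by (metis Un_iff fo_free.simps(4) fo_sat.simps(4))
qed auto

lemma fo_sat_iso:
  assumes "bij_betw h (fst M) (fst N)"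
    and "\<forall>x\<in>fst M. \<forall>y\<in>fst M. (x, y) \<in> snd M \<longleftrightarrow> (h x, h y) \<in> snd N"
    and "\<forall>i\<in>fo_free \<phi>. e i \<in> fst M \<and> e' i = h (e i)"
  shows "fo_sat M \<phi> e \<longleftrightarrow> fo_sat N \<phi> e'"
  using assms(3)
proof (induction \<phi> arbitrary: e e')
  case (FEq i j)
  then show ?case using assms(1) by (auto simp: bij_betw_def inj_on_def)
next
  case (FEx i \<phi>)
  have *: "fo_sat M \<phi> (e(i := a)) = fo_sat N \<phi> (e'(i := h a))" if "a \<in> fst M" for a
    by (rule FEx.IH) (use FEx.prems that in auto)
  have "fst N = h ` fst M" using assms(1) by (simp add: bij_betw_def)
  then show ?case using * by auto
next
  case (FAnd \<phi> \<psi>)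
  then show ?case by (metis Un_iff fo_free.simps(4) fo_sat.simps(4))
qed (use assms(2) in auto)

lemma fo_equiv_sym: "fo_equiv M N ==> fo_equiv N M"
  and fo_equiv_trans: "fo_equiv M N ==> fo_equiv N K ==> fo_equiv M K"
  unfolding fo_equiv_def by auto

lemma fo_equiv_closed:
  assumes "fo_equiv M N" "fo_free \<phi> = {}"
  shows "fo_sat M \<phi> e = fo_sat N \<phi> e'"
proof -
  have "fo_sat M \<phi> e = fo_sat M \<phi> (\<lambda>_. undefined)" "fo_sat N \<phi> e' = fo_sat N \<phi> (\<lambda>_. undefined)"
    by (rule fo_sat_cong, simp add: assms(2))+
  then show ?thesis using assms unfolding fo_equiv_def by simp
qed

lemma fo_equiv_iso:
  assumes "bij_betw h (fst M) (fst N)"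
    and "\<forall>x\<in>fst M. \<forall>y\<in>fst M. (x, y) \<in> snd M \<longleftrightarrow> (h x, h y) \<in> snd N"
  shows "fo_equiv M N"
  unfolding fo_equiv_def using fo_sat_iso[OF assms] by blast

primrec qrank :: "fo_formula => nat" where
  "qrank (FEq i j) = 0"
| "qrank (FRel i j) = 0"
| "qrank (FNot \<phi>) = qrank \<phi>"
| "qrank (FAnd \<phi> \<psi>) = max (qrank \<phi>) (qrank \<psi>)"
| "qrank (FEx i \<phi>) = Suc (qrank \<phi>)"

definition same_block :: "nat => (nat => nat) \<times> 'a => (nat => nat) \<times> 'a => bool" where
  "same_block n x y \<longleftrightarrow> snd x = snd y \<and> (\<forall>k\<ge>n. fst x k = fst y k)"

text \<open>The invariant of the game with \<open>n\<close> moves left: corresponding elements have the same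
  coefficients below \<open>n\<close>, are ordered alike, and lie in the same or in different blocks of
  length \<open>\<omega>\<^sup>n\<close> alike.\<close>

definition game_pos ::
  "'a rel => 'b rel => nat => (((nat => nat) \<times> 'a) \<times> ((nat => nat) \<times> 'b)) set => bool" where
  "game_pos R S n Z \<longleftrightarrow> finite Z \<and>
     (\<forall>x x'. (x, x') \<in> Z --> x \<in> Field (omega_times R) \<and> x' \<in> Field (omega_times S) \<and>
	(\<forall>k<n. fst x k = fst x' k)) \<and>
     (\<forall>x x' y y'. (x, x') \<in> Z --> (y, y') \<in> Z -->
	((x, y) \<in> omega_times R \<longleftrightarrow> (x', y') \<in> omega_times S) \<and>
	(same_block n x y \<longleftrightarrow> same_block n x' y'))"

lemma same_block_refl [simp]: "same_block n x x"
  and same_block_sym: "same_block n x y ==> same_block n y x"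
  and same_block_trans: "same_block n x y ==> same_block n y z ==> same_block n x z"
  unfolding same_block_def by auto

lemma same_block_Suc:
  "same_block n x y \<longleftrightarrow> same_block (Suc n) x y \<and> fst x n = fst y n"
proof -
  have "(\<forall>k\<ge>n. P k) \<longleftrightarrow> (\<forall>k\<ge>Suc n. P k) \<and> P n" for P :: "nat => bool"
    by (metis Suc_leD Suc_leI le_neq_implies_less order_refl)
  from this[of "\<lambda>k. fst x k = fst y k"] show ?thesis unfolding same_block_def by blast
qed

lemma game_posI:
  assumes "finite Z"
    and "\<And>x x'. (x, x') \<in> Z ==> x \<in> Field (omega_times R) \<and> x' \<in> Field (omega_times S)"
    and "\<And>x x' k. (x, x') \<in> Z ==> k < n ==> fst x k = fst x' k"
    and "\<And>x x' y y'. (x, x') \<in> Z ==> (y, y') \<in> Z ==>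
      ((x, y) \<in> omega_times R \<longleftrightarrow> (x', y') \<in> omega_times S) \<and>
      (same_block n x y \<longleftrightarrow> same_block n x' y')"
  shows "game_pos R S n Z"
  unfolding game_pos_def using assms by simp

lemma game_posD:
  assumes "game_pos R S n Z"
  shows "finite Z"
    and "\<And>x x'. (x, x') \<in> Z ==> x \<in> Field (omega_times R)"
    and "\<And>x x'. (x, x') \<in> Z ==> x' \<in> Field (omega_times S)"
    and "\<And>x x' k. (x, x') \<in> Z ==> k < n ==> fst x k = fst x' k"
    and "\<And>x x' y y'. (x, x') \<in> Z ==> (y, y') \<in> Z ==>
      (x, y) \<in> omega_times R \<longleftrightarrow> (x', y') \<in> omega_times S"
    and "\<And>x x' y y'. (x, x') \<in> Z ==> (y, y') \<in> Z ==> same_block n x y \<longleftrightarrow> same_block n x' y'"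
  using assms unfolding game_pos_def by simp_all

lemma game_pos_converse:
  assumes "game_pos R S n Z" shows "game_pos S R n (Z\<inverse>)"
  using game_posD[OF assms] by (intro game_posI) auto

lemma game_pos_pred:
  assumes "game_pos R S (Suc n) Z" shows "game_pos R S n Z"
proof (rule game_posI)
  note D = game_posD[OF assms]
  fix x x' y y' assume xy: "(x, x') \<in> Z" "(y, y') \<in> Z"
  have "fst x n = fst x' n" "fst y n = fst y' n" using D(4) xy by auto
  then show "((x, y) \<in> omega_times R \<longleftrightarrow> (x', y') \<in> omega_times S) \<and>
      (same_block n x y \<longleftrightarrow> same_block n x' y')"
    unfolding same_block_Suc[of n] using D(5,6)[OF xy] by simp
qed (use game_posD[OF assms] in auto)

lemma game_pos_mono:
  assumes "game_pos R S n Z" "m \<le> n" shows "game_pos R S m Z"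
  using assms(2,1) by (induction rule: inc_induct) (auto intro: game_pos_pred)

lemma cless_cong_low:
  assumes "\<forall>k<n. g k = g' k" "\<forall>k<n. h k = h' k" "\<forall>k\<ge>n. g k = h k" "cless g h"
  shows "cless g' h' \<or> (\<exists>k\<ge>n. g' k \<noteq> h' k)"
proof (rule disjCI)
  assume *: "\<not> (\<exists>k\<ge>n. g' k \<noteq> h' k)"
  obtain m where m: "g m < h m" "\<forall>k>m. g k = h k" using assms(4) unfolding cless_def by blast
  have "m < n" using m(1) assms(3) by (metis linorder_not_le nat_less_le)
  show "cless g' h'"
  proof (rule clessI[of _ m])
    show "g' m < h' m" using m(1) \<open>m < n\<close> assms by simp
    show "g' k = h' k" if "k > m" for k
      using * m(2) that assms(1,2) by (cases "k < n") auto
  qed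
qed

lemma cless_cong_high:
  assumes "\<forall>k\<ge>n. g k = h k" "\<exists>q\<ge>n. p q \<noteq> h q"
  shows "cless g p ==> cless h p" and "cless p g ==> cless p h"
proof -
  obtain q where q: "q \<ge> n" "p q \<noteq> h q" using assms(2) by blast
  show "cless h p" if gp: "cless g p"
  proof -
    obtain m where m: "g m < p m" "\<forall>k>m. g k = p k" using gp unfolding cless_def by blast
    have "m \<ge> n" using m(2) q assms(1) by (metis linorder_not_le order_less_le_trans)
    then show ?thesis using m assms(1) by (intro clessI[of _ m]) auto
  qed
  show "cless p h" if pg: "cless p g"
  proof -
    obtain m where m: "p m < g m" "\<forall>k>m. p k = g k" using pg unfolding cless_def by blast
    have "m \<ge> n" using m(2) q assms(1) by (metis linorder_not_le order_less_le_trans)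
    then show ?thesis using m assms(1) by (intro clessI[of _ m]) auto
  qed
qed

text \<open>Inside a block the order is decided by the low coefficients; between different blocks it
  is decided by the blocks.\<close>

lemma order_in_block:
  assumes "same_block n x y" "same_block n x' y'"
    and "\<forall>k<n. fst x k = fst x' k" "\<forall>k<n. fst y k = fst y' k"
    and "x \<in> Field (omega_times R)" "y \<in> Field (omega_times R)"
    and "x' \<in> Field (omega_times S)" "y' \<in> Field (omega_times S)"
    and "Well_order R" "Well_order S"
  shows "(x, y) \<in> omega_times R \<longleftrightarrow> (x', y') \<in> omega_times S"
proof -
  obtain g i h l where xy: "x = (g, i)" "y = (h, l)" by fastforce
  obtain g' i' h' l' where xy': "x' = (g', i')" "y' = (h', l')" by fastforce
  have il: "l = i" "l' = i'" using assms(1,2) by (auto simp: xy xy' same_block_def)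
  have F: "fin_supp g" "fin_supp h" "i \<in> Field R" "fin_supp g'" "fin_supp h'" "i' \<in> Field S"
    using assms(5-8) Field_omega_times[OF assms(9)] Field_omega_times[OF assms(10)]
    by (auto simp: xy xy')
  have hi: "\<forall>k\<ge>n. g k = h k" "\<forall>k\<ge>n. g' k = h' k" using assms(1,2)
    by (auto simp: xy xy' same_block_def)
  have lo: "\<forall>k<n. g k = g' k" "\<forall>k<n. h k = h' k" using assms(3,4) by (auto simp: xy xy')
  have eq: "u = v" if "\<forall>k\<ge>n. u k = v k" "\<forall>k<n. u k = v k" for u v :: "nat => nat"
  proof
    show "u k = v k" for k using that by (cases "k < n") auto
  qed
  have "g = h \<longleftrightarrow> g' = h'" using hi lo eq[of g h] eq[of g' h'] by auto
  moreover have "cless g h \<longleftrightarrow> cless g' h'"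
    using cless_cong_low[of n g g' h h'] cless_cong_low[of n g' g h' h] hi lo by auto
  ultimately show ?thesis using F il by (auto simp: xy xy' omega_times_iff)
qed

lemma order_between_blocks:
  assumes "same_block n x y" "\<not> same_block n z y"
    and "x \<in> Field (omega_times R)" "y \<in> Field (omega_times R)" "z \<in> Field (omega_times R)"
    and R: "Well_order R"
  shows "(x, z) \<in> omega_times R \<longleftrightarrow> (y, z) \<in> omega_times R"
    and "(z, x) \<in> omega_times R \<longleftrightarrow> (z, y) \<in> omega_times R"
proof -
  obtain g i h p k where xyz: "x = (g, i)" "y = (h, i)" "z = (p, k)"
    using assms(1) by (cases x, cases y, cases z) (auto simp: same_block_def)
  have F: "fin_supp g" "fin_supp h" "fin_supp p" "i \<in> Field R" "k \<in> Field R"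
    using assms(3-5) Field_omega_times[OF R] by (auto simp: xyz)
  have hi: "\<forall>k\<ge>n. g k = h k" using assms(1) by (auto simp: xyz same_block_def)
  have *: "(g = p \<or> cless g p \<longleftrightarrow> h = p \<or> cless h p) \<and> (p = g \<or> cless p g \<longleftrightarrow> p = h \<or> cless p h)"
    if "i = k"
  proof -
    from assms(2) that obtain q where q: "q \<ge> n" "p q \<noteq> h q" by (auto simp: xyz same_block_def)
    have "g \<noteq> p" "h \<noteq> p" using hi q by auto
    moreover have "\<forall>k\<ge>n. h k = g k" "\<exists>q\<ge>n. p q \<noteq> g q" "\<exists>q\<ge>n. p q \<noteq> h q" using hi q by auto
    then have "cless g p \<longleftrightarrow> cless h p" "cless p g \<longleftrightarrow> cless p h"
      using cless_cong_high[of n g h p] cless_cong_high[of n h g p] hi by auto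
    ultimately show ?thesis by auto
  qed
  then show "(x, z) \<in> omega_times R \<longleftrightarrow> (y, z) \<in> omega_times R"
    "(z, x) \<in> omega_times R \<longleftrightarrow> (z, y) \<in> omega_times R"
    using F by (auto simp: xyz omega_times_iff)
qed

lemma same_block_convex:
  assumes "same_block n a b" "(a, x) \<in> omega_times R" "(x, b) \<in> omega_times R" and R: "Well_order R"
  shows "same_block n x a"
proof (rule ccontr)
  assume n: "\<not> same_block n x a"
  have F: "a \<in> Field (omega_times R)" "b \<in> Field (omega_times R)" "x \<in> Field (omega_times R)"
    using assms(2,3) by (auto intro: FieldI1 FieldI2)
  have "(b, x) \<in> omega_times R"
    using order_between_blocks(1)[OF same_block_sym[OF assms(1)] n F(2,1,3) R] assms(2) by simp
  then have "x = b"
    using Well_order_facts(3)[OF Well_order_omega_times[OF R]] assms(3) by blast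
  then show False using n same_block_sym[OF assms(1)] by simp
qed

lemma game_pos_insert:
  assumes Z: "game_pos R S n Z" and R: "Well_order R" and S: "Well_order S"
    and F: "x \<in> Field (omega_times R)" "x' \<in> Field (omega_times S)"
    and low: "\<forall>k<n. fst x k = fst x' k"
    and new: "\<And>z z'. (z, z') \<in> Z ==>
      ((x, z) \<in> omega_times R \<longleftrightarrow> (x', z') \<in> omega_times S) \<and>
      ((z, x) \<in> omega_times R \<longleftrightarrow> (z', x') \<in> omega_times S) \<and>
      (same_block n x z \<longleftrightarrow> same_block n x' z')"
  shows "game_pos R S n (insert (x, x') Z)"
proof (rule game_posI)
  note D = game_posD[OF Z]
  have refl: "(x, x) \<in> omega_times R" "(x', x') \<in> omega_times S"
    by (rule Well_order_facts(1)[OF Well_order_omega_times[OF R] F(1)],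
	rule Well_order_facts(1)[OF Well_order_omega_times[OF S] F(2)])
  fix u u' v v' assume uv: "(u, u') \<in> insert (x, x') Z" "(v, v') \<in> insert (x, x') Z"
  consider "u = x" "u' = x'" "v = x" "v' = x'" | "u = x" "u' = x'" "(v, v') \<in> Z"
    | "(u, u') \<in> Z" "v = x" "v' = x'" | "(u, u') \<in> Z" "(v, v') \<in> Z"
    using uv by blast
  then show "((u, v) \<in> omega_times R \<longleftrightarrow> (u', v') \<in> omega_times S) \<and>
      (same_block n u v \<longleftrightarrow> same_block n u' v')"
  proof cases
    case 1
    then show ?thesis using refl by simp
  next
    case 2
    then show ?thesis using new[OF 2(3)] by simp
  next
    case 3
    have "same_block n u x \<longleftrightarrow> same_block n x u" "same_block n u' x' \<longleftrightarrow> same_block n x' u'"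
      using same_block_sym by metis+
    then show ?thesis using new[OF 3(1)] 3(2,3) by simp
  next
    case 4
    then show ?thesis using D(5)[OF 4] D(6)[OF 4] by simp
  qed
qed (use game_posD[OF Z] F low in auto)

lemma finite_has_greatest:
  assumes "finite A" "A \<noteq> {}" "A \<subseteq> Field r" "Well_order r"
  shows "\<exists>a\<in>A. \<forall>y\<in>A. (y, a) \<in> r"
  using assms(1-3)
proof (induction rule: finite_ne_induct)
  case (singleton x)
  then show ?case using Well_order_facts(1)[OF assms(4)] by simp
next
  case (insert x F)
  then obtain a where a: "a \<in> F" "\<forall>y\<in>F. (y, a) \<in> r" by auto
  note W = Well_order_facts[OF assms(4)]
  have "(x, a) \<in> r \<or> (a, x) \<in> r" using W(4) insert.prems a(1) by blast
  then show ?case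
  proof
    assume "(x, a) \<in> r"
    then show ?thesis using a by (intro bexI[of _ a]) auto
  next
    assume ax: "(a, x) \<in> r"
    then have "\<forall>y\<in>F. (y, x) \<in> r" using a(2) W(2) by blast
    moreover have "(x, x) \<in> r" using W(1) insert.prems by simp
    ultimately show ?thesis by (intro bexI[of _ x]) auto
  qed
qed

text \<open>The answer to a move inside a block that is already represented keeps the position inside
  the block. A move into a new block is answered in the next block of order \<open>n\<close> above the
  closest marked element below; this costs one coefficient.\<close>

lemma game_pos_extend:
  assumes R: "Well_order R" and S: "Well_order S" and Z: "game_pos R S (Suc n) Z"
    and ob: "(bR, bS) \<in> Z" "(bR, x) \<in> omega_times R"
    and tb: "(tR, tS) \<in> Z" "(x, tR) \<in> omega_times R"
  shows "\<exists>x'. game_pos R S n (insert (x, x') Z)"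
proof -
  note D = game_posD[OF Z]
  note WR = Well_order_facts[OF Well_order_omega_times[OF R]]
  note WS = Well_order_facts[OF Well_order_omega_times[OF S]]
  have xF: "x \<in> Field (omega_times R)" using ob(2) by (rule FieldI2)
  then have xfin: "fin_supp (fst x)" "snd x \<in> Field R" by (auto simp: Field_omega_times[OF R])
  have Sfin: "fin_supp (fst z')" "snd z' \<in> Field S" if "(z, z') \<in> Z" for z z'
    using D(3)[OF that] by (auto simp: Field_omega_times[OF S])
  show ?thesis
  proof (cases "\<exists>y y'. (y, y') \<in> Z \<and> same_block (Suc n) x y")
    case True
    then obtain y y' where y: "(y, y') \<in> Z" "same_block (Suc n) x y" by blast
    \<comment> \<open>\<open>x'\<close> has the position in the block of \<open>y'\<close> that \<open>x\<close> has in the block of \<open>y\<close>.\<close>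
    define x' where "x' = (\<lambda>k. if k < Suc n then fst x k else fst y' k, snd y')"
    have xy': "same_block (Suc n) x' y'" by (simp add: x'_def same_block_def)
    have x'F: "x' \<in> Field (omega_times S)"
      using Sfin[OF y(1)] xfin by (simp add: x'_def Field_omega_times[OF S])
    have low: "\<forall>k<Suc n. fst x k = fst x' k" by (simp add: x'_def)
    have "game_pos R S (Suc n) (insert (x, x') Z)"
    proof (rule game_pos_insert[OF Z R S xF x'F low])
      fix z z' assume z: "(z, z') \<in> Z"
      have zF: "z \<in> Field (omega_times R)" "z' \<in> Field (omega_times S)" using D(2,3)[OF z] by auto
      have yF: "y \<in> Field (omega_times R)" "y' \<in> Field (omega_times S)" using D(2,3)[OF y(1)] by auto
      have zlow: "\<forall>k<Suc n. fst z k = fst z' k" using D(4)[OF z] by simp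
      have zy: "same_block (Suc n) z y \<longleftrightarrow> same_block (Suc n) z' y'" using D(6)[OF z y(1)] .
      have b: "same_block (Suc n) x z \<longleftrightarrow> same_block (Suc n) z y"
	"same_block (Suc n) x' z' \<longleftrightarrow> same_block (Suc n) z' y'"
	using y(2) xy' same_block_sym same_block_trans by meson+
      show "((x, z) \<in> omega_times R \<longleftrightarrow> (x', z') \<in> omega_times S) \<and>
	((z, x) \<in> omega_times R \<longleftrightarrow> (z', x') \<in> omega_times S) \<and>
	(same_block (Suc n) x z \<longleftrightarrow> same_block (Suc n) x' z')"
      proof (cases "same_block (Suc n) z y")
	case True
	then have xz: "same_block (Suc n) x z" "same_block (Suc n) x' z'" using b zy by auto
	then show ?thesis
	  using order_in_block[OF xz low zlow xF zF(1) x'F zF(2) R S]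
	    order_in_block[OF xz[THEN same_block_sym] zlow low zF(1) xF zF(2) x'F R S] by simp
      next
	case False
	then have False': "\<not> same_block (Suc n) z' y'" using zy by simp
	show ?thesis
	  using order_between_blocks[OF y(2) False xF yF(1) zF(1) R]
	    order_between_blocks[OF xy' False' x'F yF(2) zF(2) S] D(5)[OF z y(1)] D(5)[OF y(1) z]
	    b zy by simp
      qed
    qed
    then show ?thesis using game_pos_pred by blast
  next
    case new: False
    have WRO: "Well_order (omega_times R)" by (rule Well_order_omega_times[OF R])
    have "\<exists>a\<in>{y \<in> fst ` Z. (y, x) \<in> omega_times R}.
	\<forall>y\<in>{y \<in> fst ` Z. (y, x) \<in> omega_times R}. (y, a) \<in> omega_times R"
    proof (rule finite_has_greatest[OF _ _ _ WRO])
      show "finite {y \<in> fst ` Z. (y, x) \<in> omega_times R}" using D(1) by simp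
      have "bR \<in> fst ` Z" using ob(1) by (rule rev_image_eqI) simp
      then show "{y \<in> fst ` Z. (y, x) \<in> omega_times R} \<noteq> {}" using ob(2) by blast
      show "{y \<in> fst ` Z. (y, x) \<in> omega_times R} \<subseteq> Field (omega_times R)"
	by (auto intro: FieldI1)
    qed
    then obtain a a' where a: "(a, a') \<in> Z" "(a, x) \<in> omega_times R"
      and amax: "\<And>z z'. (z, z') \<in> Z ==> (z, x) \<in> omega_times R ==> (z, a) \<in> omega_times R"
      by force
    have "\<exists>a\<in>{y \<in> fst ` Z. (x, y) \<in> omega_times R}.
	\<forall>y\<in>{y \<in> fst ` Z. (x, y) \<in> omega_times R}. (a, y) \<in> omega_times R"
    proof (rule Well_order_minimal[OF WRO])
      have "tR \<in> fst ` Z" using tb(1) by (rule rev_image_eqI) simp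
      then show "{y \<in> fst ` Z. (x, y) \<in> omega_times R} \<noteq> {}" using tb(2) by blast
      show "{y \<in> fst ` Z. (x, y) \<in> omega_times R} \<subseteq> Field (omega_times R)"
	by (auto intro: FieldI2)
    qed
    then obtain b b' where b: "(b, b') \<in> Z" "(x, b) \<in> omega_times R"
      and bmin: "\<And>z z'. (z, z') \<in> Z ==> (x, z) \<in> omega_times R ==> (b, z) \<in> omega_times R"
      by force
    have nab: "\<not> same_block (Suc n) a b"
      using same_block_convex[OF _ a(2) b(2) R] new a(1) by blast
    then have nab': "\<not> same_block (Suc n) b' a'" using D(6)[OF a(1) b(1)] same_block_sym by blast
    have ab': "(a', b') \<in> omega_times S" using D(5)[OF a(1) b(1)] WR(2)[OF a(2) b(2)] by simp
    \<comment> \<open>The next block of length \<open>\<omega>\<^sup>n\<close> above that of \<open>a'\<close> is still below \<open>b'\<close>, since \<open>a'\<close> and \<open>b'\<close>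
      are in different blocks of the next larger length.\<close>
    define x' where
      "x' = (\<lambda>k. if k < n then fst x k else ((fst a')(n := Suc (fst a' n))) k, snd a')"
    have x'F: "x' \<in> Field (omega_times S)"
      using Sfin[OF a(1)] xfin
      by (simp add: x'_def Field_omega_times[OF S] del: fun_upd_apply)
    have a'F: "a' \<in> Field (omega_times S)" "b' \<in> Field (omega_times S)"
      using D(3) a(1) b(1) by auto
    have low: "\<forall>k<n. fst x k = fst x' k" by (simp add: x'_def)
    have xa': "same_block (Suc n) x' a'" by (simp add: x'_def same_block_def)
    have nth: "fst x' n = Suc (fst a' n)" by (simp add: x'_def)
    have "cless (fst a') (fst x')" by (rule clessI[of _ n]) (simp_all add: x'_def)
    then have ax': "(a', x') \<in> omega_times S"
      using x'F a'F by (cases a', cases x') (simp add: omega_times_iff Field_omega_times[OF S] x'_def)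
    have xb': "(x', b') \<in> omega_times S"
      using order_between_blocks(1)[OF xa' nab' x'F a'F S] ab' by simp
    have "game_pos R S n (insert (x, x') Z)"
    proof (rule game_pos_insert[OF game_pos_pred[OF Z] R S xF x'F low])
      fix z z' assume z: "(z, z') \<in> Z"
      have zF: "z \<in> Field (omega_times R)" "z' \<in> Field (omega_times S)" using D(2,3)[OF z] by auto
      have nb: "\<not> same_block n x z"
	using new z same_block_Suc[of n x z] by blast
      then have neq: "x \<noteq> z" by auto
      consider "(z, x) \<in> omega_times R" | "(x, z) \<in> omega_times R" using WR(4)[OF zF(1) xF] by blast
      then show "((x, z) \<in> omega_times R \<longleftrightarrow> (x', z') \<in> omega_times S) \<and>
	((z, x) \<in> omega_times R \<longleftrightarrow> (z', x') \<in> omega_times S) \<and>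
	(same_block n x z \<longleftrightarrow> same_block n x' z')"
      proof cases
	case 1
	then have "(z, a) \<in> omega_times R" using amax z by blast
	then have za': "(z', a') \<in> omega_times S" using D(5)[OF z a(1)] by simp
	have zx': "(z', x') \<in> omega_times S" using WS(2)[OF za' ax'] .
	have "(x, z) \<notin> omega_times R" using 1 WR(3) neq by blast
	moreover have "(x', z') \<notin> omega_times S"
	proof
	  assume "(x', z') \<in> omega_times S"
	  then have "x' = a'" using WS(3)[OF ax'] WS(2) za' by blast
	  then show False using nth by simp
	qed
	moreover have "\<not> same_block n x' z'"
	proof
	  assume "same_block n x' z'"
	  then have "same_block n a' z'"
	    using same_block_convex[OF _ za' ax' S] same_block_sym by blast
	  then have "same_block n x' a'"
	    using \<open>same_block n x' z'\<close> same_block_sym same_block_trans by blast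
	  then show False using nth by (simp add: same_block_def)
	qed
	ultimately show ?thesis using 1 zx' nb by simp
      next
	case 2
	then have "(b, z) \<in> omega_times R" using bmin z by blast
	then have bz': "(b', z') \<in> omega_times S" using D(5)[OF b(1) z] by simp
	have xz': "(x', z') \<in> omega_times S" using WS(2)[OF xb' bz'] .
	have "(z, x) \<notin> omega_times R" using 2 WR(3) neq by blast
	moreover have "(z', x') \<notin> omega_times S"
	proof
	  assume "(z', x') \<in> omega_times S"
	  then have "x' = b'" using WS(3)[OF xb'] WS(2) bz' by blast
	  then show False using xa' nab' by simp
	qed
	moreover have "\<not> same_block n x' z'"
	proof
	  assume "same_block n x' z'"
	  then have "same_block (Suc n) x' z'" using same_block_Suc by blast
	  then have "same_block (Suc n) b' x'" using same_block_convex[OF _ xb' bz' S] by blast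
	  then show False using xa' nab' same_block_trans by blast
	qed
	ultimately show ?thesis using 2 xz' nb by simp
      qed
    qed
    then show ?thesis by blast
  qed
qed

text \<open>With \<open>b\<close> the elements up to \<open>t\<close> with the reflexive order, without \<open>b\<close> the elements
  below \<open>t\<close> with the strict order.\<close>

definition segment :: "bool => 'a rel => (nat => nat) \<times> 'a => ((nat => nat) \<times> 'a) fo_struct" where
  "segment b R t = ({x. (x, t) \<in> omega_times R \<and> (b \<or> x \<noteq> t)},
     if b then omega_times R else omega_times R - Id)"

lemma game_sat:
  assumes R: "Well_order R" and S: "Well_order S"
    and "game_pos R S (qrank \<phi>) Z" "(bR, bS) \<in> Z" "(tR, tS) \<in> Z"
    and "\<forall>x\<in>Field (omega_times R). (bR, x) \<in> omega_times R"
    and "\<forall>x\<in>Field (omega_times S). (bS, x) \<in> omega_times S"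
    and "\<forall>i\<in>fo_free \<phi>. (e i, e' i) \<in> Z"
  shows "fo_sat (segment b R tR) \<phi> e \<longleftrightarrow> fo_sat (segment b S tS) \<phi> e'"
  using assms(3-5,8)
proof (induction \<phi> arbitrary: e e' Z)
  note WR = Well_order_facts[OF Well_order_omega_times[OF R]]
  note WS = Well_order_facts[OF Well_order_omega_times[OF S]]
  have eq: "x = y \<longleftrightarrow> x' = y'" if "game_pos R S n Z" "(x, x') \<in> Z" "(y, y') \<in> Z" for n Z x x' y y'
  proof -
    note D = game_posD[OF that(1)]
    have "x = y \<longleftrightarrow> (x, y) \<in> omega_times R \<and> (y, x) \<in> omega_times R"
      using WR(1)[OF D(2)[OF that(2)]] WR(3) by blast
    moreover have "x' = y' \<longleftrightarrow> (x', y') \<in> omega_times S \<and> (y', x') \<in> omega_times S"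
      using WS(1)[OF D(3)[OF that(2)]] WS(3) by blast
    ultimately show ?thesis using D(5)[OF that(2,3)] D(5)[OF that(3,2)] by simp
  qed
  {
    case (FEq i j)
    then show ?case using eq[OF FEq(1)] by simp
  next
    case (FRel i j)
    then have "(e i, e' i) \<in> Z" "(e j, e' j) \<in> Z" by auto
    from eq[OF FRel(1) this] game_posD(5)[OF FRel(1) this] show ?case
      by (simp add: segment_def)
  next
    case (FNot \<phi>)
    then show ?case by simp
  next
    case (FAnd \<phi> \<psi>)
    have "game_pos R S (qrank \<phi>) Z" "game_pos R S (qrank \<psi>) Z"
      by (rule game_pos_mono[OF FAnd.prems(1)], simp)+
    moreover have "\<forall>i\<in>fo_free \<phi>. (e i, e' i) \<in> Z" "\<forall>i\<in>fo_free \<psi>. (e i, e' i) \<in> Z"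
      using FAnd.prems(4) by auto
    ultimately have "fo_sat (segment b R tR) \<phi> e = fo_sat (segment b S tS) \<phi> e'"
      "fo_sat (segment b R tR) \<psi> e = fo_sat (segment b S tS) \<psi> e'"
      using FAnd.IH(1)[OF _ FAnd.prems(2,3)] FAnd.IH(2)[OF _ FAnd.prems(2,3)] by blast+
    then show ?case by simp
  next
    case (FEx i \<phi>)
    have Z: "game_pos R S (Suc (qrank \<phi>)) Z" using FEx.prems(1) by simp
    have memb: "x \<in> fst (segment b R tR) \<longleftrightarrow> x' \<in> fst (segment b S tS)"
      if "game_pos R S n Z'" "(x, x') \<in> Z'" "(tR, tS) \<in> Z'" for n Z' x x'
      using eq[OF that(1,2,3)] game_posD(5)[OF that(1,2,3)] by (simp add: segment_def)
    have IH: "fo_sat (segment b R tR) \<phi> (e(i := x)) \<longleftrightarrow> fo_sat (segment b S tS) \<phi> (e'(i := x'))"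
      if "game_pos R S (qrank \<phi>) (insert (x, x') Z)" for x x'
      by (rule FEx.IH[OF that]) (use FEx.prems in auto)
    show ?case
    proof
      assume "fo_sat (segment b R tR) (FEx i \<phi>) e"
      then obtain x where x: "x \<in> fst (segment b R tR)" "fo_sat (segment b R tR) \<phi> (e(i := x))"
	by auto
      then have xt: "(x, tR) \<in> omega_times R" by (simp add: segment_def)
      have "(bR, x) \<in> omega_times R" using assms(6) FieldI1[OF xt] by blast
      then obtain x' where x': "game_pos R S (qrank \<phi>) (insert (x, x') Z)"
	using game_pos_extend[OF R S Z FEx.prems(2) _ FEx.prems(3) xt] by blast
      have "x' \<in> fst (segment b S tS)" using memb[OF x', of x x'] x(1) FEx.prems(3) by blast
      then show "fo_sat (segment b S tS) (FEx i \<phi>) e'" using IH[OF x'] x(2) by auto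
    next
      assume "fo_sat (segment b S tS) (FEx i \<phi>) e'"
      then obtain x' where x: "x' \<in> fst (segment b S tS)" "fo_sat (segment b S tS) \<phi> (e'(i := x'))"
	by auto
      then have xt: "(x', tS) \<in> omega_times S" by (simp add: segment_def)
      have "(bS, x') \<in> omega_times S" using assms(7) FieldI1[OF xt] by blast
      then obtain x where "game_pos S R (qrank \<phi>) (insert (x', x) (Z\<inverse>))"
	using game_pos_extend[OF S R game_pos_converse[OF Z], of bS bR x' tS tR] FEx.prems(2,3) xt
	by blast
      moreover have "(insert (x', x) (Z\<inverse>))\<inverse> = insert (x, x') Z" by auto
      ultimately have x': "game_pos R S (qrank \<phi>) (insert (x, x') Z)"
	using game_pos_converse by metis
      have "x \<in> fst (segment b R tR)" using memb[OF x', of x x'] x(1) FEx.prems(3) by blast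
      then show "fo_sat (segment b R tR) (FEx i \<phi>) e" using IH[OF x'] x(2) by auto
    qed
  }
qed

lemma Well_order_bottom:
  assumes "Well_order R" "i \<in> Field R"
  obtains z where "z \<in> Field R" "\<forall>x\<in>Field R. (z, x) \<in> R" "z = i \<longleftrightarrow> underS R i = {}"
proof -
  obtain z where z: "z \<in> Field R" "\<forall>x\<in>Field R. (z, x) \<in> R"
    using Well_order_minimal[OF assms(1), of "Field R"] assms(2) by blast
  have "z = i \<longleftrightarrow> underS R i = {}"
    using z Well_order_facts(3)[OF assms(1)] assms(2) unfolding underS_def
    by (auto dest: FieldI1)
  then show ?thesis using that z by blast
qed

lemma omega_times_bottom:
  assumes R: "Well_order R" and z: "z \<in> Field R" "\<forall>x\<in>Field R. (z, x) \<in> R"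
    and x: "x \<in> Field (omega_times R)"
  shows "(((\<lambda>_. 0), z), x) \<in> omega_times R"
proof -
  obtain g k where gk: "x = (g, k)" "fin_supp g" "k \<in> Field R"
    using x by (cases x) (simp add: Field_omega_times[OF R])
  have "(\<lambda>_. 0) = g \<or> cless (\<lambda>_. 0) g"
    using cless_linear[OF fin_supp_zero gk(2)] by (auto simp: cless_def)
  then show ?thesis using gk z by (simp add: omega_times_iff)
qed

text \<open>The game starts with the least elements and the end points of the two segments. Least element
  and end point lie in different blocks of every order \<open>n\<close> as soon as \<open>i\<close> is not least, and
  otherwise \<open>f\<close> decides; this is where the assumption on \<open>i\<close> and \<open>j\<close> enters.\<close>

theorem segment_fo_equiv:
  assumes R: "Well_order R" and S: "Well_order S"
    and i: "i \<in> Field R" and j: "j \<in> Field S" and f: "fin_supp f"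
    and ij: "underS R i = {} \<longleftrightarrow> underS S j = {}"
  shows "fo_equiv (segment b R (f, i)) (segment b S (f, j))"
  unfolding fo_equiv_def
proof (intro allI impI)
  fix \<phi> assume closed: "fo_free \<phi> = {}"
  obtain z where z: "z \<in> Field R" "\<forall>x\<in>Field R. (z, x) \<in> R" "z = i \<longleftrightarrow> underS R i = {}"
    using Well_order_bottom[OF R i] .
  obtain y where y: "y \<in> Field S" "\<forall>x\<in>Field S. (y, x) \<in> S" "y = j \<longleftrightarrow> underS S j = {}"
    using Well_order_bottom[OF S j] .
  let ?o1 = "((\<lambda>_. 0 :: nat), z)" and ?o2 = "((\<lambda>_. 0 :: nat), y)"
  have zi: "z = i \<longleftrightarrow> y = j" using z y ij by simp
  have F: "(f, i) \<in> Field (omega_times R)" "(f, j) \<in> Field (omega_times S)"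
    "?o1 \<in> Field (omega_times R)" "?o2 \<in> Field (omega_times S)"
    using f i j z y by (auto simp: Field_omega_times R S)
  note b1 = omega_times_bottom[OF R z(1,2)] and b2 = omega_times_bottom[OF S y(1,2)]
  have top: "((f, i), ?o1) \<in> omega_times R \<longleftrightarrow> ((f, j), ?o2) \<in> omega_times S"
  proof -
    have "((f, i), ?o1) \<in> omega_times R \<longleftrightarrow> (f, i) = ?o1"
      using Well_order_facts(1,3)[OF Well_order_omega_times[OF R]] b1[OF F(1)] F(3) by metis
    moreover have "((f, j), ?o2) \<in> omega_times S \<longleftrightarrow> (f, j) = ?o2"
      using Well_order_facts(1,3)[OF Well_order_omega_times[OF S]] b2[OF F(2)] F(4) by metis
    ultimately show ?thesis using zi by auto
  qed
  have "game_pos R S n {(?o1, ?o2), ((f, i), (f, j))}" for n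
  proof (rule game_pos_insert[OF _ R S F(3,4)])
    show "game_pos R S n {((f, i), (f, j))}"
    proof (rule game_posI)
      fix x x' y y' assume "(x, x') \<in> {((f, i), f, j)}" "(y, y') \<in> {((f, i), f, j)}"
      then show "((x, y) \<in> omega_times R \<longleftrightarrow> (x', y') \<in> omega_times S) \<and>
	(same_block n x y \<longleftrightarrow> same_block n x' y')"
	using f i j by (simp add: omega_times_iff)
    qed (use F in auto)
    fix u u' assume "(u, u') \<in> {((f, i), f, j)}"
    then have u: "u = (f, i)" "u' = (f, j)" by auto
    show "((?o1, u) \<in> omega_times R \<longleftrightarrow> (?o2, u') \<in> omega_times S) \<and>
      ((u, ?o1) \<in> omega_times R \<longleftrightarrow> (u', ?o2) \<in> omega_times S) \<and>
      (same_block n ?o1 u \<longleftrightarrow> same_block n ?o2 u')"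
      using b1[OF F(1)] b2[OF F(2)] top zi unfolding u by (simp add: same_block_def)
  qed simp
  then show "fo_sat (segment b R (f, i)) \<phi> (\<lambda>_. undefined) =
      fo_sat (segment b S (f, j)) \<phi> (\<lambda>_. undefined)"
    by (rule game_sat[OF R S, where bR = ?o1 and bS = ?o2]) (use b1 b2 closed in auto)
qed

section \<open>Coefficients of the Cantor normal form are definable\<close>

definition seg_less :: "'a fo_struct => 'a => 'a => bool" where
  "seg_less M x y \<longleftrightarrow> (x, y) \<in> snd M \<and> x \<noteq> y"

text \<open>In an ordinal this says that \<open>x\<close> is a multiple of \<open>\<omega>\<^sup>k\<close>: it is a multiple of the next power
  iff the multiples of \<open>\<omega>\<^sup>k\<close> are unbounded below \<open>x\<close>.\<close>

primrec divisible :: "'a fo_struct => nat => 'a => bool" where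
  "divisible M 0 x \<longleftrightarrow> True"
| "divisible M (Suc k) x \<longleftrightarrow> \<not> (\<exists>y\<in>fst M. seg_less M y x \<and>
     \<not> (\<exists>z\<in>fst M. seg_less M y z \<and> seg_less M z x \<and> divisible M k z))"

primrec many_above :: "'a fo_struct => nat => nat => 'a => bool" where
  "many_above M k 0 x \<longleftrightarrow> True"
| "many_above M k (Suc c) x \<longleftrightarrow>
     (\<exists>y\<in>fst M. seg_less M x y \<and> divisible M k y \<and> many_above M k c y)"

definition FLess :: "nat => nat => fo_formula" where
  "FLess i j = FAnd (FRel i j) (FNot (FEq i j))"

primrec divisible_fm :: "nat => nat => fo_formula" where
  "divisible_fm 0 i = FEq i i"
| "divisible_fm (Suc k) i = FNot (FEx (i + 1) (FAnd (FLess (i + 1) i)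
     (FNot (FEx (i + 2) (FAnd (FLess (i + 1) (i + 2))
	(FAnd (FLess (i + 2) i) (divisible_fm k (i + 2))))))))"

primrec many_above_fm :: "nat => nat => nat => fo_formula" where
  "many_above_fm k 0 i = FEq i i"
| "many_above_fm k (Suc c) i =
     FEx (i + 1) (FAnd (FLess i (i + 1)) (FAnd (divisible_fm k (i + 1)) (many_above_fm k c (i + 1))))"

text \<open>The coefficient at \<open>k\<close> counts the multiples of \<open>\<omega>\<^sup>k\<close> above the last multiple of the next
  power.\<close>

definition coefficient_fm :: "nat => nat => fo_formula" where
  "coefficient_fm k c = FEx 0 (FAnd (divisible_fm (Suc k) 0)
     (FAnd (FNot (FEx 1 (FAnd (FLess 0 1) (divisible_fm (Suc k) 1)))) (many_above_fm k c 0)))"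

text \<open>A segment contains nonzero multiples of all powers of \<open>\<omega>\<close> iff it reaches \<open>\<omega>\<^sup>\<omega>\<close>.\<close>

definition nonzero_divisible_fm :: "nat => fo_formula" where
  "nonzero_divisible_fm k = FEx 0 (FAnd (divisible_fm k 0) (FEx 1 (FLess 1 0)))"

lemma FLess_sat [simp]: "fo_sat M (FLess i j) e \<longleftrightarrow> seg_less M (e i) (e j)"
  and FLess_free [simp]: "fo_free (FLess i j) = {i, j}"
  by (auto simp: FLess_def seg_less_def)

lemma divisible_fm_sat [simp]: "fo_sat M (divisible_fm k i) e \<longleftrightarrow> divisible M k (e i)"
  by (induction k arbitrary: i e) simp_all

lemma divisible_fm_free [simp]: "fo_free (divisible_fm k i) = {i}"
  by (induction k arbitrary: i) auto

lemma many_above_fm_sat [simp]: "fo_sat M (many_above_fm k c i) e \<longleftrightarrow> many_above M k c (e i)"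
  by (induction c arbitrary: i e) simp_all

lemma many_above_fm_free [simp]: "fo_free (many_above_fm k c i) = {i}"
  by (induction c arbitrary: i) auto

lemma coefficient_fm_sat: "fo_sat M (coefficient_fm k c) e \<longleftrightarrow>
    (\<exists>x\<in>fst M. divisible M (Suc k) x \<and> \<not> (\<exists>y\<in>fst M. seg_less M x y \<and> divisible M (Suc k) y) \<and>
      many_above M k c x)"
  by (simp add: coefficient_fm_def del: divisible_fm.simps divisible.simps)

lemma coefficient_fm_free: "fo_free (coefficient_fm k c) = {}"
  by (auto simp: coefficient_fm_def simp del: divisible_fm.simps)

lemma nonzero_divisible_fm_sat: "fo_sat M (nonzero_divisible_fm k) e \<longleftrightarrow>
    (\<exists>x\<in>fst M. divisible M k x \<and> (\<exists>y\<in>fst M. seg_less M y x))"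
  by (simp add: nonzero_divisible_fm_def)

lemma nonzero_divisible_fm_free: "fo_free (nonzero_divisible_fm k) = {}"
  by (auto simp: nonzero_divisible_fm_def)

context
  fixes R :: "'a rel" and f j
  assumes R: "Well_order R" and j: "j \<in> Field R" and f: "fin_supp f"
begin

private abbreviation "M \<equiv> segment True R (f, j)"

private lemma WO: "Well_order (omega_times R)"
  by (rule Well_order_omega_times[OF R])

lemma in_segment_iff: "x \<in> fst M \<longleftrightarrow> (x, (f, j)) \<in> omega_times R"
  by (simp add: segment_def)

lemma seg_less_iff: "seg_less M (g, i) (h, l) \<longleftrightarrow> fin_supp g \<and> fin_supp h \<and> i \<in> Field R \<and> l \<in> Field R \<and>
    (i \<noteq> l \<and> (i, l) \<in> R \<or> i = l \<and> cless g h)"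
  unfolding seg_less_def by (auto simp: segment_def omega_times_iff)

lemma segment_downward: "y \<in> fst M" if "x \<in> fst M" "seg_less M y x"
  using that Well_order_facts(2)[OF WO, of y x "(f, j)"] unfolding in_segment_iff seg_less_def
  by (simp add: segment_def)

lemma segment_fin: "fin_supp g" "i \<in> Field R" if "(g, i) \<in> fst M"
  using that by (auto simp: in_segment_iff omega_times_iff)

lemma divisible_segment:
  "(g, i) \<in> fst M ==> divisible M k (g, i) \<longleftrightarrow> (\<forall>n<k. g n = 0)"
proof (induction k arbitrary: g i)
  case 0
  then show ?case by simp
next
  case (Suc k)
  note fin = segment_fin[OF Suc.prems]
  have sub: "divisible M k z \<longleftrightarrow> (\<forall>n<k. fst z n = 0)" if "seg_less M z (g, i)" for z
    using Suc.IH[of "fst z" "snd z"] segment_downward[OF Suc.prems that] by simp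
  show ?case
  proof
    assume div: "divisible M (Suc k) (g, i)"
    show "\<forall>n<Suc k. g n = 0"
    proof (rule ccontr)
      assume "\<not> (\<forall>n<Suc k. g n = 0)"
      then have ex: "\<exists>n. n < Suc k \<and> g n \<noteq> 0" by blast
      define n where "n = (LEAST n. n < Suc k \<and> g n \<noteq> 0)"
      have n: "n < Suc k" "g n \<noteq> 0" using LeastI_ex[OF ex] by (auto simp: n_def)
      have low: "g m = 0" if "m < n" for m
	using not_less_Least[of m "\<lambda>n. n < Suc k \<and> g n \<noteq> 0"] that n(1) unfolding n_def by auto
      \<comment> \<open>No multiple of \<open>\<omega>\<^sup>k\<close> lies strictly between \<open>h\<close> and \<open>g\<close>.\<close>
      define h where "h = g(n := g n - 1)"
      have hg: "cless h g" by (rule clessI[of _ n]) (use n(2) in \<open>auto simp: h_def\<close>)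
      then have less: "seg_less M (h, i) (g, i)" using fin by (simp add: seg_less_iff h_def)
      then obtain z where z: "seg_less M (h, i) z" "seg_less M z (g, i)" "divisible M k z"
	using div segment_downward[OF Suc.prems less] by auto
      obtain p l where zp: "z = (p, l)" by fastforce
      have l: "l = i"
	using z Well_order_facts(3)[OF R] unfolding zp seg_less_iff by auto
      have p: "cless h p" "cless p g" using z unfolding zp l seg_less_iff by auto
      obtain m where m: "p m < g m" "\<forall>q>m. p q = g q" using p(2) unfolding cless_def by blast
      have mn: "m \<ge> n" using low m(1) by (metis linorder_not_le not_less_zero)
      obtain m' where m': "h m' < p m'" "\<forall>q>m'. h q = p q" using p(1) unfolding cless_def by blast
      have "m = n"
      proof (rule ccontr)
	assume "m \<noteq> n"
	then have "m > n" using mn by simp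
	then have "p m < h m" using m(1) by (simp add: h_def)
	then have "m' > m \<or> m' = m" using m'(2) by (metis linorder_neqE_nat nat_neq_iff)
	then show False using m m' \<open>m > n\<close> by (auto simp: h_def)
      qed
      have "m' < n"
      proof (rule ccontr)
	assume "\<not> m' < n"
	then consider "m' = n" | "m' > n" by linarith
	then show False using m m' \<open>m = n\<close> by cases (auto simp: h_def)
      qed
      then have "p m' \<noteq> 0" "m' < k" using m'(1) n(1) by auto
      then show False using z(3) sub[OF z(2)] by (simp add: zp)
    qed
  next
    assume zero: "\<forall>n<Suc k. g n = 0"
    have "\<exists>z\<in>fst M. seg_less M y z \<and> seg_less M z (g, i) \<and> divisible M k z"
      if y: "y \<in> fst M" "seg_less M y (g, i)" for y
    proof -
      obtain h l where yh: "y = (h, l)" by fastforce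
      note yfin = segment_fin[OF y(1)[unfolded yh]]
      \<comment> \<open>the next multiple of \<open>\<omega>\<^sup>k\<close> above \<open>y\<close>\<close>
      define z where "z = (\<lambda>m. if m < k then 0 else (h(k := Suc (h k))) m)"
      have zfin: "fin_supp z" unfolding z_def using yfin(1) by (intro fin_supp_cut fin_supp_fun_upd)
      have "cless h z" by (rule clessI[of _ k]) (simp_all add: z_def)
      then have yz: "seg_less M y (z, l)" using yfin zfin by (simp add: yh seg_less_iff)
      have zg: "seg_less M (z, l) (g, i)"
      proof (cases "l = i")
	case True
	then obtain m where m: "h m < g m" "\<forall>n>m. h n = g n"
	  using y(2) unfolding yh seg_less_iff cless_def by auto
	have "m > k" using zero m(1) by (metis not_less_eq not_less_zero)
	then have "cless z g" by (intro clessI[of _ m]) (use m in \<open>auto simp: z_def\<close>)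
	then show ?thesis using True fin zfin by (simp add: seg_less_iff)
      next
	case False
	then show ?thesis using y(2) zfin unfolding yh seg_less_iff by auto
      qed
      have "divisible M k (z, l)" using sub[OF zg] by (simp add: z_def)
      then show ?thesis using yz zg segment_downward[OF Suc.prems zg] by blast
    qed
    then show "divisible M (Suc k) (g, i)" by auto
  qed
qed

lemma above_in_segment:
  assumes "(g, j) \<in> fst M" "\<forall>n>k. g n = f n" "seg_less M (g, j) y" "y \<in> fst M"
  obtains h where "y = (h, j)" "\<forall>n>k. h n = f n" "h k \<le> f k" "cless g h"
proof -
  obtain h l where y: "y = (h, l)" by fastforce
  have l: "l = j" using assms(3,4) Well_order_facts(3)[OF R]
    unfolding y seg_less_iff in_segment_iff omega_times_iff by auto
  have gh: "cless g h" using assms(3) unfolding y l seg_less_iff by simp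
  have hf: "h = f \<or> cless h f" using assms(4) unfolding y l in_segment_iff omega_times_iff by simp
  obtain m where m: "g m < h m" "\<forall>n>m. g n = h n" using gh unfolding cless_def by blast
  have "(\<forall>n>k. h n = f n) \<and> h k \<le> f k"
  proof (cases "h = f")
    case False
    then obtain q where q: "h q < f q" "\<forall>n>q. h n = f n" using hf unfolding cless_def by blast
    have "q \<le> k"
    proof (rule ccontr)
      assume "\<not> q \<le> k"
      then have "h q < g q" using q(1) assms(2) by simp
      then have "m > q" using m by (metis linorder_neqE_nat order_less_asym order_less_irrefl)
      then show False using m(1) q(2) assms(2) \<open>\<not> q \<le> k\<close> by simp
    qed
    then show ?thesis using q by (cases "q = k") auto
  qed simp
  then show ?thesis using that y l gh by blast
qed

lemma many_above_segment:
  assumes "\<forall>n<k. g n = 0" "\<forall>n>k. g n = f n" "g k \<le> f k"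
  shows "many_above M k c (g, j) \<longleftrightarrow> g k + c \<le> f k"
  using assms
proof (induction c arbitrary: g)
  case 0
  then show ?case by simp
next
  case (Suc c)
  have gfin: "fin_supp g"
  proof -
    have "g = (\<lambda>m. if m < k then 0 else (f(k := g k)) m)"
    proof
      show "g m = (if m < k then 0 else (f(k := g k)) m)" for m
	using Suc.prems by (cases m k rule: linorder_cases) auto
    qed
    then show ?thesis using fin_supp_cut[OF fin_supp_fun_upd[OF f]] by metis
  qed
  have le_f: "(h, j) \<in> fst M" if "\<forall>n<k. h n = 0" "\<forall>n>k. h n = f n" "h k \<le> f k" "fin_supp h" for h
  proof -
    have "h = f \<or> cless h f"
    proof (rule disjCI)
      assume nc: "\<not> cless h f"
      then have "\<not> h k < f k" using that(2) clessI[of h k f] by blast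
      then have "h k = f k" using that(3) by simp
      have "cless h f \<or> h = f \<or> cless f h" using cless_linear[OF that(4) f] by blast
      moreover have "\<not> cless f h"
      proof
	assume "cless f h"
	then obtain m where m: "f m < h m" by (auto simp: cless_def)
	then show False using that \<open>h k = f k\<close> by (cases m k rule: linorder_cases) auto
      qed
      ultimately show "h = f" using nc by blast
    qed
    then show ?thesis using that(4) f j by (simp add: in_segment_iff omega_times_iff)
  qed
  have gM: "(g, j) \<in> fst M" using le_f Suc.prems gfin by blast
  show ?case
  proof
    assume "many_above M k (Suc c) (g, j)"
    then obtain y where y: "y \<in> fst M" "seg_less M (g, j) y" "divisible M k y" "many_above M k c y"
      by auto
    obtain h where h: "y = (h, j)" "\<forall>n>k. h n = f n" "h k \<le> f k" "cless g h"
      using above_in_segment[OF gM Suc.prems(2) y(2,1)] .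
    have zero: "\<forall>n<k. h n = 0" using divisible_segment y(1,3) unfolding h(1) by blast
    have "h k + c \<le> f k" using Suc.IH[OF zero h(2,3)] y(4) h(1) by simp
    moreover have "g k < h k"
    proof -
      obtain m where m: "g m < h m" using h(4) unfolding cless_def by blast
      then have "m = k" using Suc.prems zero h(2) by (cases m k rule: linorder_cases) auto
      then show ?thesis using m by simp
    qed
    ultimately show "g k + Suc c \<le> f k" by simp
  next
    assume le: "g k + Suc c \<le> f k"
    define h where "h = g(k := Suc (g k))"
    have h: "\<forall>n<k. h n = 0" "\<forall>n>k. h n = f n" "h k \<le> f k" "fin_supp h"
      using Suc.prems gfin le by (auto simp: h_def)
    have "cless g h" by (rule clessI[of _ k]) (auto simp: h_def)
    then have "seg_less M (g, j) (h, j)" using gfin h(4) j by (simp add: seg_less_iff)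
    moreover have "h k + c \<le> f k" using le by (simp add: h_def)
    then have "many_above M k c (h, j)" using Suc.IH[OF h(1-3)] by simp
    moreover have "divisible M k (h, j)" using divisible_segment le_f[OF h] h(1) by blast
    ultimately show "many_above M k (Suc c) (g, j)" using le_f[OF h] by auto
  qed
qed

lemma coefficient_fm_segment: "fo_sat M (coefficient_fm k c) e \<longleftrightarrow> c \<le> f k"
proof -
  define g where "g = (\<lambda>n. if n < Suc k then 0 else f n)"
  have gfin: "fin_supp g" using f by (simp add: g_def)
  have gM: "(g, j) \<in> fst M"
  proof -
    have "g = f \<or> cless g f"
    proof (rule disjCI)
      assume "\<not> cless g f"
      moreover have "\<not> cless f g"
	unfolding cless_def g_def by (metis less_zeroE nat_less_le)
      ultimately show "g = f" using cless_linear[OF gfin f] by blast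
    qed
    then show ?thesis using gfin f j by (simp add: in_segment_iff omega_times_iff)
  qed
  have dg: "divisible M (Suc k) (g, j)" unfolding divisible_segment[OF gM] by (simp add: g_def)
  have top: "\<not> (\<exists>y\<in>fst M. seg_less M (g, j) y \<and> divisible M (Suc k) y)"
  proof
    assume "\<exists>y\<in>fst M. seg_less M (g, j) y \<and> divisible M (Suc k) y"
    then obtain y where y: "y \<in> fst M" "seg_less M (g, j) y" "divisible M (Suc k) y" by blast
    obtain h where h: "y = (h, j)" "\<forall>n>k. h n = f n" "cless g h"
      using above_in_segment[OF gM _ y(2,1), of k] by (auto simp: g_def)
    have "\<forall>n<Suc k. h n = 0" using divisible_segment y(1,3) unfolding h(1) by blast
    then have "h = g" using h(2) by (auto simp: g_def fun_eq_iff not_less_eq)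
    then show False using h(3) by simp
  qed
  have only: "x = (g, j)" if x: "x \<in> fst M" "divisible M (Suc k) x"
    "\<not> (\<exists>y\<in>fst M. seg_less M x y \<and> divisible M (Suc k) y)" for x
  proof -
    have F: "x \<in> Field (omega_times R)" "(g, j) \<in> Field (omega_times R)"
      using x(1) gM by (auto simp: in_segment_iff intro: FieldI1)
    have "\<not> seg_less M x (g, j)" "\<not> seg_less M (g, j) x" using x gM dg top by blast+
    then show ?thesis using Well_order_facts(4)[OF WO F] unfolding seg_less_def
      by (auto simp: segment_def)
  qed
  have "fo_sat M (coefficient_fm k c) e \<longleftrightarrow> many_above M k c (g, j)"
    unfolding coefficient_fm_sat using gM dg top only by blast
  also have "\<dots> \<longleftrightarrow> c \<le> f k"
    using many_above_segment[of k g c] by (simp add: g_def)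
  finally show ?thesis .
qed

lemma nonzero_divisible_fm_segment:
  "(\<forall>k. fo_sat M (nonzero_divisible_fm k) e) \<longleftrightarrow> underS R j \<noteq> {}"
proof
  assume "underS R j \<noteq> {}"
  then obtain i where i: "i \<noteq> j" "(i, j) \<in> R" by (auto simp: underS_def)
  have iF: "i \<in> Field R" using i(2) by (rule FieldI1)
  show "\<forall>k. fo_sat M (nonzero_divisible_fm k) e"
  proof
    fix k
    define g where "g = (\<lambda>_::nat. 0::nat)(k := 1)"
    have gfin: "fin_supp g" unfolding g_def by simp
    have gM: "(g, i) \<in> fst M" using gfin i iF f j by (simp add: in_segment_iff omega_times_iff)
    have "cless (\<lambda>_. 0) g" by (rule clessI[of _ k]) (simp_all add: g_def)
    then have less: "seg_less M ((\<lambda>_. 0), i) (g, i)" using gfin iF by (simp add: seg_less_iff)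
    moreover have "divisible M k (g, i)" unfolding divisible_segment[OF gM] by (simp add: g_def)
    ultimately show "fo_sat M (nonzero_divisible_fm k) e"
      unfolding nonzero_divisible_fm_sat using gM segment_downward[OF gM less] by blast
  qed
next
  assume all: "\<forall>k. fo_sat M (nonzero_divisible_fm k) e"
  show "underS R j \<noteq> {}"
  proof
    assume empty: "underS R j = {}"
    have "finite {n. f n \<noteq> 0}" using f by (simp add: fin_supp_def)
    then obtain k where k: "\<forall>n\<ge>k. f n = 0"
      by (metis (mono_tags, lifting) finite_nat_set_iff_bounded linorder_not_less mem_Collect_eq)
    have "fo_sat M (nonzero_divisible_fm k) e" using all by blast
    then obtain x y where x: "x \<in> fst M" "divisible M k x" "y \<in> fst M" "seg_less M y x"
      unfolding nonzero_divisible_fm_sat by blast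
    have snd_eq: "snd z = j" if "z \<in> fst M" for z
      using that empty by (cases z) (auto simp: in_segment_iff omega_times_iff underS_def)
    obtain g where g: "x = (g, j)" using snd_eq[OF x(1)] by (cases x) simp
    obtain h where h: "y = (h, j)" using snd_eq[OF x(3)] by (cases y) simp
    have "\<forall>n<k. g n = 0" using x(1,2) divisible_segment unfolding g by blast
    moreover have "g = f \<or> cless g f" using x(1) by (simp add: g in_segment_iff omega_times_iff)
    moreover have "\<not> cless g f" if "\<forall>n<k. g n = 0" "g \<noteq> f"
    proof
      assume "cless g f"
      then obtain m where m: "g m < f m" "\<forall>n>m. g n = f n" unfolding cless_def by blast
      have "m < k" using m(1) k by (metis linorder_not_less not_less_zero)
      have "cless h g" using x(4) unfolding g h seg_less_iff by simp
      then obtain q where q: "h q < g q" unfolding cless_def by blast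
      then have "q \<ge> k" using that(1) by (metis linorder_not_less not_less_zero)
      then show False using q m(2) k \<open>m < k\<close> by simp
    qed
    ultimately have zero: "\<forall>n. g n = 0" using k by (metis linorder_not_less)
    have "cless h g" using x(4) unfolding g h seg_less_iff by simp
    then show False using zero by (simp add: cless_def)
  qed
qed

end

text \<open>The segment contains its end point, so there is a last multiple of every power of \<open>\<omega>\<close>, from
  which the coefficients can be counted.\<close>

theorem segment_fo_equiv_iff:
  assumes R: "Well_order R" and S: "Well_order S"
    and i: "i \<in> Field R" and j: "j \<in> Field S" and f: "fin_supp f" and g: "fin_supp g"
  shows "fo_equiv (segment True R (f, i)) (segment True S (g, j)) \<longleftrightarrow>
    f = g \<and> (underS R i = {} \<longleftrightarrow> underS S j = {})"
proof
  assume eq: "fo_equiv (segment True R (f, i)) (segment True S (g, j))"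
  have "c \<le> f k \<longleftrightarrow> c \<le> g k" for c k
    using fo_equiv_closed[OF eq coefficient_fm_free[of k c], of undefined undefined]
    unfolding coefficient_fm_segment[OF R i f] coefficient_fm_segment[OF S j g] .
  then have "f = g" by (intro ext) (metis dual_order.refl order_antisym)
  moreover have "underS R i = {} \<longleftrightarrow> underS S j = {}"
    using fo_equiv_closed[OF eq nonzero_divisible_fm_free, of _ undefined undefined]
      nonzero_divisible_fm_segment[OF R i f, of undefined]
      nonzero_divisible_fm_segment[OF S j g, of undefined] by auto
  ultimately show "f = g \<and> (underS R i = {} \<longleftrightarrow> underS S j = {})" by simp
next
  assume "f = g \<and> (underS R i = {} \<longleftrightarrow> underS S j = {})"
  then show "fo_equiv (segment True R (f, i)) (segment True S (g, j))"
    using segment_fo_equiv[OF R S i j f] by simp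
qed

section \<open>Every ordinal is a proper initial segment of a product\<close>

lemma ordIso_bij:
  fixes r :: "'a rel" and s :: "'b rel"
  assumes "r =o s"
  obtains h where "bij_betw h (Field r) (Field s)"
    and "\<And>a b. a \<in> Field r ==> b \<in> Field r ==> (a, b) \<in> r \<longleftrightarrow> (h a, h b) \<in> s"
  using assms unfolding ordIso_def iso_iff2 by blast

lemma bij_ordIso:
  fixes r :: "'a rel" and s :: "'b rel"
  assumes s: "Well_order s" and h: "bij_betw h (Field r) (Field s)"
    and iff: "\<And>a b. a \<in> Field r ==> b \<in> Field r ==> (a, b) \<in> r \<longleftrightarrow> (h a, h b) \<in> s"
  shows "r =o s"
proof -
  define g where "g = inv_into (Field r) h"
  have inj: "inj_on g (Field s)"
    using h unfolding g_def by (metis bij_betw_imp_surj_on inj_on_inv_into order_refl)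
  have gh: "g (h a) = a" if "a \<in> Field r" for a
    using h that unfolding g_def by (simp add: bij_betw_inv_into_left)
  have hg: "h (g b) = b" "g b \<in> Field r" if "b \<in> Field s" for b
    using h that unfolding g_def by (simp_all add: bij_betw_def f_inv_into_f inv_into_into)
  have "r = dir_image s g"
  proof (intro Set.set_eqI iffI)
    fix p assume "p \<in> r"
    then obtain a b where p: "p = (a, b)" "(a, b) \<in> r" by (cases p) auto
    then have F: "a \<in> Field r" "b \<in> Field r" by (auto intro: FieldI1 FieldI2)
    then have "(h a, h b) \<in> s" using iff p by blast
    then show "p \<in> dir_image s g" using gh F p unfolding dir_image_def by force
  next
    fix p assume "p \<in> dir_image s g"
    then obtain a b where p: "p = (g a, g b)" "(a, b) \<in> s" unfolding dir_image_def by blast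
    then have F: "a \<in> Field s" "b \<in> Field s" by (auto intro: FieldI1 FieldI2)
    then show "p \<in> r" using iff[OF hg(2)[OF F(1)] hg(2)[OF F(2)]] hg(1) p by simp
  qed
  then show ?thesis using dir_image_ordIso[OF s inj] ordIso_symmetric by metis
qed

lemma strict_mono_ordLeq:
  fixes r :: "'a rel" and s :: "'b rel"
  assumes r: "Well_order r" and s: "Well_order s" and F: "\<And>a. a \<in> Field r ==> f a \<in> Field s"
    and mono: "\<And>a b. (a, b) \<in> r ==> a \<noteq> b ==> (f a, f b) \<in> s \<and> f a \<noteq> f b"
  shows "r \<le>o s"
proof (rule ccontr)
  note W = Well_order_facts[OF r]
  assume "\<not> r \<le>o s"
  then have "s <o r" using r s not_ordLeq_iff_ordLess by blast
  then obtain a where a: "a \<in> Field r" "s =o Restr r (underS r a)"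
    using ordLess_iff_ordIso_Restr[OF r s] by blast
  have sub: "underS r a \<subseteq> Field r" by (auto simp: underS_def intro: FieldI1)
  have FR: "Field (Restr r (underS r a)) = underS r a"
    using Refl_Field_Restr2[OF _ sub] r by (auto simp: order_on_defs)
  obtain g where g: "bij_betw g (Field s) (underS r a)"
    "\<And>x y. x \<in> Field s ==> y \<in> Field s ==> (x, y) \<in> s \<longleftrightarrow> (g x, g y) \<in> Restr r (underS r a)"
    using ordIso_bij[OF a(2)] unfolding FR by blast
  define h where "h x = g (f x)" for x
  have hu: "h x \<in> underS r a" if "x \<in> Field r" for x
    unfolding h_def using g(1) F[OF that] by (auto simp: bij_betw_def)
  have hm: "(h x, h y) \<in> r \<and> h x \<noteq> h y" if "(x, y) \<in> r" "x \<noteq> y" for x y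
  proof -
    have fF: "f x \<in> Field s" "f y \<in> Field s" using that F by (auto intro: FieldI1 FieldI2)
    have "h x \<noteq> h y" unfolding h_def using mono[OF that] g(1) fF by (auto simp: bij_betw_def inj_on_def)
    moreover have "(h x, h y) \<in> r" unfolding h_def using mono[OF that] g(2)[OF fF] by blast
    ultimately show ?thesis by simp
  qed
  define Q where "Q = {x \<in> Field r. (h x, x) \<in> r \<and> h x \<noteq> x}"
  have "a \<in> Q" using hu[OF a(1)] a(1) by (auto simp: Q_def underS_def)
  then obtain x where x: "x \<in> Q" "\<forall>y\<in>Q. (x, y) \<in> r"
    using Well_order_minimal[OF r, of Q] by (auto simp: Q_def)
  then have hx: "(h x, x) \<in> r" "h x \<noteq> x" by (auto simp: Q_def)
  have "h x \<in> Q" using hm[OF hx] FieldI1[OF hx(1)] by (simp add: Q_def)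
  then have "(x, h x) \<in> r" using x(2) by blast
  then show False using hx W(3) by blast
qed

lemma underS_Field: "underS r a \<subseteq> Field r"
  by (auto simp: underS_def intro: FieldI1)

lemma Field_Restr_underS:
  assumes "Well_order r" shows "Field (Restr r (underS r a)) = underS r a"
proof -
  have "Refl r" using assms by (simp add: order_on_defs)
  then show ?thesis by (rule Refl_Field_Restr2[OF _ underS_Field])
qed

lemma Field_eq_empty_iff: "Field r = {} \<longleftrightarrow> r = {}"
  by (metis FieldI1 Field_empty ex_in_conv surj_pair)

lemma Well_order_initial: "Well_order r ==> Well_order (Restr r (underS r a))"
  by (rule Well_order_Restr)

lemma ordIso_empty:
  fixes r :: "'a rel" and s :: "'b rel"
  assumes "r =o s"
  shows "r = {} \<longleftrightarrow> s = {}"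
proof -
  from assms obtain h where "bij_betw h (Field r) (Field s)" by (rule ordIso_bij)
  then have "Field r = {} \<longleftrightarrow> Field s = {}" by (auto simp: bij_betw_def)
  then show ?thesis unfolding Field_eq_empty_iff .
qed

lemma in_underS_omega_times:
  assumes "Well_order R" "j \<in> Field R" "fin_supp f"
  shows "(g, i) \<in> underS (omega_times R) (f, j) \<longleftrightarrow> fin_supp g \<and> i \<in> Field R \<and>
    (i \<in> underS R j \<or> i = j \<and> g \<in> underS omega_omega f)"
  using assms by (auto simp: underS_def omega_times_iff omega_omega_iff)

lemma Field_ord_sum: "Field (ord_sum r s) = Inl ` Field r \<union> Inr ` Field s"
proof (intro Set.set_eqI iffI)
  fix x assume "x \<in> Field (ord_sum r s)"
  then obtain y where "(x, y) \<in> ord_sum r s \<or> (y, x) \<in> ord_sum r s" by (auto simp: Field_def)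
  then show "x \<in> Inl ` Field r \<union> Inr ` Field s"
    unfolding ord_sum_def by (auto intro: FieldI1 FieldI2)
next
  fix x assume "x \<in> Inl ` Field r \<union> Inr ` Field s"
  then consider a where "x = Inl a" "a \<in> Field r" | b where "x = Inr b" "b \<in> Field s" by blast
  then show "x \<in> Field (ord_sum r s)"
  proof cases
    case 1
    then obtain y where "(a, y) \<in> r \<or> (y, a) \<in> r" by (auto simp: Field_def)
    then have "(x, Inl y) \<in> ord_sum r s \<or> (Inl y, x) \<in> ord_sum r s" using 1
      unfolding ord_sum_def by auto
    then show ?thesis by (auto intro: FieldI1 FieldI2)
  next
    case 2
    then obtain y where "(b, y) \<in> s \<or> (y, b) \<in> s" by (auto simp: Field_def)
    then have "(x, Inr y) \<in> ord_sum r s \<or> (Inr y, x) \<in> ord_sum r s" using 2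
      unfolding ord_sum_def by auto
    then show ?thesis by (auto intro: FieldI1 FieldI2)
  qed
qed

lemma ord_sum_iff [simp]:
  "(Inl x, Inl y) \<in> ord_sum r s \<longleftrightarrow> (x, y) \<in> r"
  "(Inr u, Inr v) \<in> ord_sum r s \<longleftrightarrow> (u, v) \<in> s"
  "(Inl x, Inr v) \<in> ord_sum r s \<longleftrightarrow> x \<in> Field r \<and> v \<in> Field s"
  "(Inr u, Inl y) \<notin> ord_sum r s"
  by (auto simp: ord_sum_def)

text \<open>The elements of \<open>\<omega>\<^sup>\<omega> \<cdot> R\<close> below \<open>(f, j)\<close> are \<open>\<omega>\<^sup>\<omega> \<cdot> j\<close> followed by the ordinal with
  normal form \<open>f\<close>.\<close>

lemma omega_times_initial:
  fixes R :: "'a rel" and r' :: "'b rel" and c :: "'c rel"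
  assumes R: "Well_order R" and j: "j \<in> Field R" and f: "fin_supp f"
    and r': "r' =o Restr R (underS R j)" and c: "c =o Restr omega_omega (underS omega_omega f)"
  shows "ord_sum (omega_times r') c =o
    Restr (omega_times R) (underS (omega_times R) (f, j))"
proof -
  note FR = Field_Restr_underS[OF R]
  note FO = Field_Restr_underS[OF Well_order_omega_omega]
  have Wr': "Well_order r'" and Wc: "Well_order c" using r' c by (auto simp: ordIso_def)
  obtain \<tau> where \<tau>: "bij_betw \<tau> (Field r') (underS R j)"
    "\<And>a b. a \<in> Field r' ==> b \<in> Field r' ==> (a, b) \<in> r' \<longleftrightarrow> (\<tau> a, \<tau> b) \<in> Restr R (underS R j)"
    using ordIso_bij[OF r'] unfolding FR by blast
  obtain \<sigma> where \<sigma>: "bij_betw \<sigma> (Field c) (underS omega_omega f)"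
    "\<And>a b. a \<in> Field c ==> b \<in> Field c ==>
      (a, b) \<in> c \<longleftrightarrow> (\<sigma> a, \<sigma> b) \<in> Restr omega_omega (underS omega_omega f)"
    using ordIso_bij[OF c] unfolding FO by blast
  have \<tau>in: "\<tau> a \<in> underS R j" "\<tau> a \<noteq> j" "\<tau> a \<in> Field R" "(\<tau> a, j) \<in> R" if "a \<in> Field r'" for a
    using \<tau>(1) that underS_Field[of R j] by (auto simp: bij_betw_def underS_def intro: FieldI1)
  have \<sigma>in: "\<sigma> a \<in> underS omega_omega f" "fin_supp (\<sigma> a)" "cless (\<sigma> a) f" if "a \<in> Field c" for a
    using \<sigma>(1) that by (auto simp: bij_betw_def underS_def omega_omega_iff)
  have \<tau>inj: "\<tau> a = \<tau> b \<longleftrightarrow> a = b" if "a \<in> Field r'" "b \<in> Field r'" for a b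
    using \<tau>(1) that by (auto simp: bij_betw_def inj_on_def)
  have \<sigma>inj: "\<sigma> a = \<sigma> b \<longleftrightarrow> a = b" if "a \<in> Field c" "b \<in> Field c" for a b
    using \<sigma>(1) that by (auto simp: bij_betw_def inj_on_def)
  define h where "h x = (case x of Inl p => (fst p, \<tau> (snd p)) | Inr y => (\<sigma> y, j))" for x
  have hsimps: "h (Inl (g, i)) = (g, \<tau> i)" "h (Inr y) = (\<sigma> y, j)" for g i y
    by (simp_all add: h_def)
  have mixed: "(g, \<tau> i) \<noteq> (\<sigma> y, j)" "(\<sigma> y, j) \<noteq> (g, \<tau> i)" if "i \<in> Field r'" for g i y
    using \<tau>in(2)[OF that] by auto
  let ?s = "Restr (omega_times R) (underS (omega_times R) (f, j))"
  note WO = Well_order_omega_times[OF R]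
  have FL: "Field (ord_sum (omega_times r') c) =
      Inl ` ({f. fin_supp f} \<times> Field r') \<union> Inr ` Field c"
    by (simp add: Field_ord_sum Field_omega_times[OF Wr'])
  note us = in_underS_omega_times[OF R j f]
  have "bij_betw h (Field (ord_sum (omega_times r') c)) (underS (omega_times R) (f, j))"
    unfolding bij_betw_def
  proof
    show "inj_on h (Field (ord_sum (omega_times r') c))"
    proof (rule inj_onI)
      fix x y assume "x \<in> Field (ord_sum (omega_times r') c)" "y \<in> Field (ord_sum (omega_times r') c)"
	"h x = h y"
      then show "x = y" unfolding FL using \<tau>inj \<sigma>inj mixed by (auto simp: hsimps)
    qed
    show "h ` Field (ord_sum (omega_times r') c) = underS (omega_times R) (f, j)"
    proof (intro Set.set_eqI iffI)
      fix x assume "x \<in> h ` Field (ord_sum (omega_times r') c)"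
      then show "x \<in> underS (omega_times R) (f, j)"
	unfolding FL using \<tau>in \<sigma>in j by (auto simp: hsimps us)
    next
      fix x assume x: "x \<in> underS (omega_times R) (f, j)"
      obtain g i where gi: "x = (g, i)" by fastforce
      from x have g: "fin_supp g" and cs: "i \<in> underS R j \<or> i = j \<and> g \<in> underS omega_omega f"
	unfolding gi us by auto
      from cs show "x \<in> h ` Field (ord_sum (omega_times r') c)"
      proof
	assume "i \<in> underS R j"
	then obtain a where a: "a \<in> Field r'" "i = \<tau> a" using \<tau>(1) by (auto simp: bij_betw_def)
	have "x = h (Inl (g, a))" by (simp add: hsimps gi a)
	moreover have "Inl (g, a) \<in> Field (ord_sum (omega_times r') c)" unfolding FL using g a by simp
	ultimately show ?thesis by (rule image_eqI)
      next
	assume ij: "i = j \<and> g \<in> underS omega_omega f"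
	then obtain a where a: "a \<in> Field c" "g = \<sigma> a" using \<sigma>(1) by (auto simp: bij_betw_def)
	have "x = h (Inr a)" using ij by (simp add: hsimps gi a)
	moreover have "Inr a \<in> Field (ord_sum (omega_times r') c)" unfolding FL using a by simp
	ultimately show ?thesis by (rule image_eqI)
      qed
    qed
  qed
  then have bij: "bij_betw h (Field (ord_sum (omega_times r') c)) (Field ?s)"
    unfolding Field_Restr_underS[OF WO] .
  show ?thesis
  proof (rule bij_ordIso[OF Well_order_initial[OF WO] bij])
    fix a b assume ab: "a \<in> Field (ord_sum (omega_times r') c)" "b \<in> Field (ord_sum (omega_times r') c)"
    have "h a \<in> underS (omega_times R) (f, j)" "h b \<in> underS (omega_times R) (f, j)"
      using bij ab unfolding Field_Restr_underS[OF WO] by (auto simp: bij_betw_def)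
    then have "(h a, h b) \<in> ?s \<longleftrightarrow> (h a, h b) \<in> omega_times R" by simp
    also have "\<dots> \<longleftrightarrow> (a, b) \<in> ord_sum (omega_times r') c"
    proof -
      consider g i h' l where "a = Inl (g, i)" "b = Inl (h', l)" "fin_supp g" "fin_supp h'"
	  "i \<in> Field r'" "l \<in> Field r'"
	| g i y where "a = Inl (g, i)" "b = Inr y" "fin_supp g" "i \<in> Field r'" "y \<in> Field c"
	| y h' l where "a = Inr y" "b = Inl (h', l)" "fin_supp h'" "l \<in> Field r'" "y \<in> Field c"
	| y y' where "a = Inr y" "b = Inr y'" "y \<in> Field c" "y' \<in> Field c"
	using ab unfolding FL by blast
      then show ?thesis
      proof cases
	case 1
	have "(\<tau> i, \<tau> l) \<in> R \<longleftrightarrow> (i, l) \<in> r'" using \<tau>(2) \<tau>in(1) 1 by simp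
	then show ?thesis using 1 \<tau>in \<tau>inj by (simp add: hsimps omega_times_iff)
      next
	case 2
	then show ?thesis using \<tau>in \<sigma>in j Field_omega_times[OF Wr'] by (simp add: hsimps omega_times_iff)
      next
	case 3
	have "(j, \<tau> l) \<notin> R" using \<tau>in[OF 3(4)] Well_order_facts(3)[OF R] by blast
	then show ?thesis using 3 \<tau>in(2)[OF 3(4)] by (auto simp: hsimps omega_times_iff)
      next
	case 4
	have "(y, y') \<in> c \<longleftrightarrow> (\<sigma> y, \<sigma> y') \<in> omega_omega" using \<sigma>(2) \<sigma>in(1) 4 by simp
	then show ?thesis using 4 \<sigma>in j by (simp add: hsimps omega_times_iff omega_omega_iff)
      qed
    qed
    finally show "(a, b) \<in> ord_sum (omega_times r') c \<longleftrightarrow> (h a, h b) \<in> ?s" by simp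
  qed
qed

definition add_top :: "'a rel => 'a option rel" where
  "add_top r = {(Some x, Some y) | x y. (x, y) \<in> r} \<union> {(x, None) | x. x \<in> insert None (Some ` Field r)}"

lemma add_top_iff [simp]:
  "(Some x, Some y) \<in> add_top r \<longleftrightarrow> (x, y) \<in> r" "(None, Some y) \<notin> add_top r"
  "(Some x, None) \<in> add_top r \<longleftrightarrow> x \<in> Field r" "(None, None) \<in> add_top r"
  by (auto simp: add_top_def)

lemma Field_add_top: "Field (add_top r) = insert None (Some ` Field r)"
proof (intro Set.set_eqI iffI)
  fix x assume "x \<in> Field (add_top r)"
  then obtain y where "(x, y) \<in> add_top r \<or> (y, x) \<in> add_top r" by (auto simp: Field_def)
  then show "x \<in> insert None (Some ` Field r)"
    by (cases x; cases y) (auto intro: FieldI1 FieldI2)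
next
  fix x assume "x \<in> insert None (Some ` Field r)"
  then have "(x, None) \<in> add_top r" by auto
  then show "x \<in> Field (add_top r)" by (rule FieldI1)
qed

lemma Well_order_add_top:
  assumes r: "Well_order r" shows "Well_order (add_top r)"
proof (rule Well_orderI)
  note W = Well_order_facts[OF r]
  show "Refl (add_top r)"
    by (rule refl_onI) (use W(1) in \<open>auto simp: Field_add_top\<close>)
  show "trans (add_top r)"
  proof (rule transI)
    fix x y z assume "(x, y) \<in> add_top r" "(y, z) \<in> add_top r"
    then show "(x, z) \<in> add_top r"
      by (cases x; cases y; cases z) (auto intro: W(2) FieldI1)
  qed
  show "antisym (add_top r)"
  proof (rule antisymI)
    fix x y assume "(x, y) \<in> add_top r" "(y, x) \<in> add_top r"
    then show "x = y" by (cases x; cases y) (auto intro: W(3))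
  qed
  show "Total (add_top r)"
  proof (rule total_onI)
    fix x y assume "x \<in> Field (add_top r)" "y \<in> Field (add_top r)"
    then show "(x, y) \<in> add_top r \<or> (y, x) \<in> add_top r"
      using W(4) by (cases x; cases y) (auto simp: Field_add_top)
  qed
  fix Q assume Q: "Q \<noteq> {}" "Q \<subseteq> Field (add_top r)"
  show "\<exists>z\<in>Q. \<forall>y\<in>Q. (y, z) \<in> add_top r --> y = z"
  proof (cases "{x. Some x \<in> Q} = {}")
    case True
    then have "y = None" if "y \<in> Q" for y using that by (cases y) auto
    then show ?thesis using Q(1) by blast
  next
    case False
    have "{x. Some x \<in> Q} \<subseteq> Field r" using Q(2) by (auto simp: Field_add_top)
    then obtain z where z: "Some z \<in> Q" "\<forall>y. Some y \<in> Q --> (z, y) \<in> r"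
      using Well_order_minimal[OF r False] by auto
    have "y = Some z" if "y \<in> Q" "(y, Some z) \<in> add_top r" for y
      using that z W(3) by (cases y) auto
    then show ?thesis using z(1) by blast
  qed
qed

lemma underS_add_top: "underS (add_top r) None = Some ` Field r"
proof (rule Set.set_eqI)
  fix x show "x \<in> underS (add_top r) None \<longleftrightarrow> x \<in> Some ` Field r"
    by (cases x) (auto simp: underS_def)
qed

lemma add_top_initial:
  fixes r :: "'a rel"
  assumes r: "Well_order r" shows "r =o Restr (add_top r) (underS (add_top r) None)"
proof (rule bij_ordIso[OF Well_order_initial[OF Well_order_add_top[OF r]]])
  have "bij_betw Some (Field r) (underS (add_top r) None)"
    unfolding underS_add_top by (simp add: bij_betw_def)
  then show "bij_betw Some (Field r) (Field (Restr (add_top r) (underS (add_top r) None)))"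
    unfolding Field_Restr_underS[OF Well_order_add_top[OF r]] .
  show "(a, b) \<in> r \<longleftrightarrow> (Some a, Some b) \<in> Restr (add_top r) (underS (add_top r) None)"
    if "a \<in> Field r" "b \<in> Field r" for a b
    using that by (simp add: underS_add_top)
qed

text \<open>The ordinal \<open>r\<close> is \<open>\<omega>\<^sup>\<omega> \<cdot> r' + \<gamma>\<close>, where \<open>f\<close> lists the coefficients of the Cantor
  normal form of \<open>\<gamma>\<close> and \<open>z\<close> says whether \<open>r'\<close> is zero.\<close>

definition cantor_form :: "'a rel => (nat => nat) => bool => bool" where
  "cantor_form r f z \<longleftrightarrow> (\<exists>(R :: 'a option rel) j. Well_order R \<and> j \<in> Field R \<and> fin_supp f \<and>
     (z \<longleftrightarrow> underS R j = {}) \<and> r =o Restr (omega_times R) (underS (omega_times R) (f, j)))"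

text \<open>\<open>r\<close> embeds below the last copy of \<open>\<omega>\<^sup>\<omega>\<close> in \<open>\<omega>\<^sup>\<omega> \<cdot> (r + 1)\<close>, so it is an initial segment of this
  product.\<close>

lemma cantor_form_exists:
  assumes r: "Well_order r" shows "\<exists>f z. cantor_form r f z"
proof -
  let ?R = "add_top r"
  let ?W = "omega_times ?R" and ?o = "(\<lambda>_::nat. 0::nat, None)"
  have R: "Well_order ?R" by (rule Well_order_add_top[OF r])
  have WO: "Well_order ?W" by (rule Well_order_omega_times[OF R])
  have oF: "?o \<in> Field ?W" by (simp add: Field_omega_times[OF R] Field_add_top)
  have in_o: "(\<lambda>_. 0, Some x) \<in> underS ?W ?o" if "x \<in> Field r" for x
    using that by (simp add: underS_def omega_times_iff Field_add_top)
  have "r \<le>o Restr ?W (underS ?W ?o)"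
  proof (rule strict_mono_ordLeq[OF r Well_order_initial[OF WO], where f = "\<lambda>x. (\<lambda>_. 0, Some x)"])
    show "(\<lambda>_. 0, Some a) \<in> Field (Restr ?W (underS ?W ?o))" if "a \<in> Field r" for a
      unfolding Field_Restr_underS[OF WO] using in_o[OF that] .
    show "((\<lambda>_. 0, Some a), (\<lambda>_. 0, Some b)) \<in> Restr ?W (underS ?W ?o) \<and>
      (\<lambda>_::nat. 0::nat, Some a) \<noteq> (\<lambda>_. 0, Some b)" if ab: "(a, b) \<in> r" "a \<noteq> b" for a b
      using ab FieldI1[OF ab(1)] FieldI2[OF ab(1)] in_o
      by (simp add: omega_times_iff Field_add_top)
  qed
  also have "Restr ?W (underS ?W ?o) <o ?W"
    by (rule underS_Restr_ordLess[OF WO]) (use oF in auto)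
  finally have "r <o ?W" .
  then obtain p where p: "p \<in> Field ?W" "r =o Restr ?W (underS ?W p)"
    using ordLess_iff_ordIso_Restr[OF WO r] by blast
  obtain f j where fj: "p = (f, j)" by fastforce
  then have "fin_supp f" "j \<in> Field ?R" using p(1) by (auto simp: Field_omega_times[OF R])
  then show ?thesis unfolding cantor_form_def using R p(2) unfolding fj by blast
qed

lemma cantor_formI:
  fixes q :: "'a rel" and q' :: "'a rel" and e :: "'b rel"
  assumes q: "q =o ord_sum (omega_times q') e" "Well_order q'"
    "e =o Restr omega_omega (underS omega_omega f)" and f: "fin_supp f"
  shows "cantor_form q f (q' = {})"
  unfolding cantor_form_def
proof (intro exI conjI)
  show "Well_order (add_top q')" by (rule Well_order_add_top[OF q(2)])
  show "None \<in> Field (add_top q')" by (simp add: Field_add_top)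
  show "q' = {} \<longleftrightarrow> underS (add_top q') None = {}"
    by (simp add: underS_add_top Field_eq_empty_iff)
  show "q =o Restr (omega_times (add_top q')) (underS (omega_times (add_top q')) (f, None))"
    by (rule ordIso_transitive[OF q(1) omega_times_initial[OF Well_order_add_top[OF q(2)] _ f
	  add_top_initial[OF q(2)] q(3)]]) (simp add: Field_add_top)
qed (rule f)

lemma eq_mod_cantor_form:
  fixes r :: "'a rel" and s :: "'b rel"
  assumes "eq_mod_omega_omega r s"
  shows "\<exists>f z. cantor_form r f z \<and> cantor_form s f z"
proof -
  from assms obtain r' c :: "'a rel" and s' d :: "'b rel" where wo: "Well_order r'" "Well_order s'"
    and r: "r =o ord_sum (omega_times r') c" and c: "c <o omega_omega"
    and s: "s =o ord_sum (omega_times s') d" and cd: "c =o d" and z: "r' = {} \<longleftrightarrow> s' = {}"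
    unfolding eq_mod_omega_omega_def by blast
  have Wc: "Well_order c" using cd by (simp add: ordIso_def)
  obtain f where f: "fin_supp f" "c =o Restr omega_omega (underS omega_omega f)"
    using c ordLess_iff_ordIso_Restr[OF Well_order_omega_omega Wc]
    by (auto simp: Field_omega_omega)
  have d: "d =o Restr omega_omega (underS omega_omega f)"
    using ordIso_transitive[OF ordIso_symmetric[OF cd] f(2)] .
  from cantor_formI[OF r wo(1) f(2,1)] cantor_formI[OF s wo(2) d f(1)] z show ?thesis by auto
qed

text \<open>Quotient and remainder embed into the ordinal, so that they have copies on its type.\<close>

lemma cantor_form_division:
  fixes r :: "'a rel"
  assumes "cantor_form r f z"
  shows "\<exists>(r' :: 'a rel) (c :: 'a rel). Well_order r' \<and> Well_order c \<and>
    r =o ord_sum (omega_times r') c \<and> c =o Restr omega_omega (underS omega_omega f) \<and>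
    c <o omega_omega \<and> (r' = {} \<longleftrightarrow> z)"
proof -
  from assms obtain R :: "'a option rel" and j where R: "Well_order R" and j: "j \<in> Field R"
    and f: "fin_supp f" and z: "z \<longleftrightarrow> underS R j = {}"
    and r: "r =o Restr (omega_times R) (underS (omega_times R) (f, j))"
    unfolding cantor_form_def by blast
  note WO = Well_order_omega_times[OF R] and OO = Well_order_omega_omega
  note us = in_underS_omega_times[OF R j f]
  have "Restr R (underS R j) \<le>o Restr (omega_times R) (underS (omega_times R) (f, j))"
  proof (rule strict_mono_ordLeq[OF Well_order_initial[OF R] Well_order_initial[OF WO],
	where f = "\<lambda>i. (\<lambda>_. 0, i)"], unfold Field_Restr_underS[OF R] Field_Restr_underS[OF WO])
    show in_us: "(\<lambda>_. 0, a) \<in> underS (omega_times R) (f, j)" if "a \<in> underS R j" for a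
      using that underS_Field[of R j] by (auto simp: us)
    show "((\<lambda>_. 0, a), (\<lambda>_. 0, b)) \<in> Restr (omega_times R) (underS (omega_times R) (f, j)) \<and>
      (\<lambda>_::nat. 0::nat, a) \<noteq> (\<lambda>_. 0, b)" if "(a, b) \<in> Restr R (underS R j)" "a \<noteq> b" for a b
      using that in_us by (auto simp: omega_times_iff intro: FieldI1 FieldI2)
  qed
  also note ordIso_symmetric[OF r]
  finally obtain r' :: "'a rel" where r': "r' =o Restr R (underS R j)"
    using internalize_ordLeq ordIso_symmetric by metis
  have "Restr omega_omega (underS omega_omega f) \<le>o
      Restr (omega_times R) (underS (omega_times R) (f, j))"
  proof (rule strict_mono_ordLeq[OF Well_order_initial[OF OO] Well_order_initial[OF WO],
	where f = "\<lambda>g. (g, j)"], unfold Field_Restr_underS[OF OO] Field_Restr_underS[OF WO])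
    show in_us: "(a, j) \<in> underS (omega_times R) (f, j)" if "a \<in> underS omega_omega f" for a
      unfolding us using that j by (auto simp: underS_def omega_omega_iff)
    show "((a, j), (b, j)) \<in> Restr (omega_times R) (underS (omega_times R) (f, j)) \<and>
      (a, j) \<noteq> (b, j)" if "(a, b) \<in> Restr omega_omega (underS omega_omega f)" "a \<noteq> b" for a b
      using that in_us[of a] in_us[of b] j by (auto simp: omega_times_iff omega_omega_iff)
  qed
  also note ordIso_symmetric[OF r]
  finally obtain c :: "'a rel" where c: "c =o Restr omega_omega (underS omega_omega f)"
    using internalize_ordLeq ordIso_symmetric by metis
  have "r =o ord_sum (omega_times r') c"
    using ordIso_transitive[OF r ordIso_symmetric[OF omega_times_initial[OF R j f r' c]]] .
  moreover have "c <o omega_omega"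
    by (rule ordIso_ordLess_trans[OF c underS_Restr_ordLess[OF OO]])
      (use f in \<open>auto simp: Field_omega_omega\<close>)
  moreover have "r' = {} \<longleftrightarrow> z"
  proof -
    have "Restr R (underS R j) = {} \<longleftrightarrow> underS R j = {}"
      using Field_Restr_underS[OF R, of j] by (auto simp: Field_def)
    then show ?thesis using ordIso_empty[OF r'] z by simp
  qed
  moreover have "Well_order r'" "Well_order c" using r' c by (auto simp: ordIso_def)
  ultimately show ?thesis using c by blast
qed

lemma cantor_form_eq_mod:
  fixes r :: "'a rel" and s :: "'b rel"
  assumes "cantor_form r f z" "cantor_form s f z"
  shows "eq_mod_omega_omega r s"
proof -
  obtain r' c :: "'a rel" where r: "Well_order r'" "Well_order c" "r =o ord_sum (omega_times r') c"
    "c =o Restr omega_omega (underS omega_omega f)" "c <o omega_omega" "r' = {} \<longleftrightarrow> z"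
    using cantor_form_division[OF assms(1)] by blast
  obtain s' d :: "'b rel" where s: "Well_order s'" "Well_order d" "s =o ord_sum (omega_times s') d"
    "d =o Restr omega_omega (underS omega_omega f)" "d <o omega_omega" "s' = {} \<longleftrightarrow> z"
    using cantor_form_division[OF assms(2)] by blast
  have "c =o d" using ordIso_transitive[OF r(4) ordIso_symmetric[OF s(4)]] .
  moreover have "r' = {} \<longleftrightarrow> s' = {}" using r(6) s(6) by simp
  ultimately show ?thesis unfolding eq_mod_omega_omega_def
    using r(1-3,5) s(1-3,5) by blast
qed

section \<open>One point below and one point above\<close>

text \<open>In \<open>\<omega>\<^sup>\<omega> \<cdot> R\<close> this is the map \<open>x \<mapsto> 1 + x\<close>, which moves only the finite ordinals.\<close>

definition bump :: "bool => (nat => nat) => (nat => nat)" where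
  "bump z g = (if z \<and> (\<forall>n>0. g n = 0) then g(0 := Suc (g 0)) else g)"

lemma fin_supp_bump [simp]: "fin_supp g ==> fin_supp (bump z g)"
  by (simp add: bump_def del: fun_upd_apply)

lemma cless_bump:
  assumes "cless f g" shows "cless (bump z f) (bump z g)"
proof -
  obtain m where m: "f m < g m" "\<forall>n>m. f n = g n" using assms unfolding cless_def by blast
  consider "\<not> z" | "z" "\<forall>n>0. f n = 0" "\<forall>n>0. g n = 0" | "z" "\<forall>n>0. f n = 0" "\<exists>n>0. g n \<noteq> 0"
    | "z" "\<exists>n>0. f n \<noteq> 0" "\<forall>n>0. g n = 0" | "z" "\<exists>n>0. f n \<noteq> 0" "\<exists>n>0. g n \<noteq> 0" by blast
  then show ?thesis
  proof cases
    case 1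
    then show ?thesis using assms by (simp add: bump_def)
  next
    case 2
    then have "m = 0" using m(1) by (metis gr0I not_less_zero)
    then show ?thesis using 2 m by (intro clessI[of _ 0]) (simp_all add: bump_def)
  next
    case 3
    then have "m > 0" using m(2) by (metis gr0I)
    have "bump z g = g" using 3 unfolding bump_def by auto
    then show ?thesis using 3 m \<open>m > 0\<close> by (intro clessI[of _ m]) (simp_all add: bump_def)
  next
    case 4
    then have "m = 0" using m(1) by (metis gr0I not_less_zero)
    then show ?thesis using 4 m by auto
  next
    case 5
    then have "bump z f = f" "bump z g = g" unfolding bump_def by auto
    then show ?thesis using assms by simp
  qed
qed

lemma bump_inject:
  assumes "fin_supp f" "fin_supp g"
  shows "bump z f = bump z g \<longleftrightarrow> f = g" and "cless (bump z f) (bump z g) \<longleftrightarrow> cless f g"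
  using assms cless_linear[OF assms] cless_bump[of f g z] cless_bump[of g f z] cless_asym
  by (metis cless_irrefl)+

definition one_plus :: "'a rel => (nat => nat) \<times> 'a => (nat => nat) \<times> 'a" where
  "one_plus R x = (bump (underS R (snd x) = {}) (fst x), snd x)"

lemma one_plus_order:
  assumes R: "Well_order R" and x: "x \<in> Field (omega_times R)" and y: "y \<in> Field (omega_times R)"
  shows "(one_plus R x, one_plus R y) \<in> omega_times R \<longleftrightarrow> (x, y) \<in> omega_times R"
    and "one_plus R x \<in> Field (omega_times R)"
  using x y bump_inject[of "fst x" "fst y"]
  by (cases x; cases y; auto simp: one_plus_def Field_omega_times[OF R] omega_times_iff)+

lemma one_plus_range:
  assumes R: "Well_order R" and z: "z \<in> Field R" "\<forall>x\<in>Field R. (z, x) \<in> R"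
    and x: "x \<in> Field (omega_times R)"
  shows "one_plus R x \<noteq> (\<lambda>_. 0, z)"
    and "x \<noteq> (\<lambda>_. 0, z) ==> \<exists>y\<in>Field (omega_times R). one_plus R y = x"
proof -
  obtain g i where x': "x = (g, i)" "fin_supp g" "i \<in> Field R"
    using x by (cases x) (auto simp: Field_omega_times[OF R])
  have bot: "underS R i = {} \<longleftrightarrow> i = z" if "i \<in> Field R" for i
  proof
    assume "underS R i = {}"
    then show "i = z" using z that by (auto simp: underS_def)
  next
    assume "i = z"
    then show "underS R i = {}"
      using z Well_order_facts(3)[OF R] by (auto simp: underS_def dest: FieldI1)
  qed
  show "one_plus R x \<noteq> (\<lambda>_. 0, z)"
  proof
    assume eq: "one_plus R x = (\<lambda>_. 0, z)"
    then have i: "i = z" and b: "bump True g = (\<lambda>_. 0)"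
      using bot[OF x'(3)] by (auto simp: x' one_plus_def)
    have "\<forall>n>0. g n = 0" using b by (metis bump_def)
    then have "bump True g 0 = Suc (g 0)" by (simp add: bump_def)
    then show False using b by simp
  qed
  show "\<exists>y\<in>Field (omega_times R). one_plus R y = x" if ne: "x \<noteq> (\<lambda>_. 0, z)"
  proof (cases "i = z \<and> (\<forall>n>0. g n = 0)")
    case True
    then have "g 0 \<noteq> 0" using ne by (auto simp: x' fun_eq_iff) (metis gr0I)
    let ?h = "g(0 := g 0 - 1)"
    have "bump True ?h = g" using True \<open>g 0 \<noteq> 0\<close> by (auto simp: bump_def fun_eq_iff)
    then have "one_plus R (?h, z) = x" using True bot[OF z(1)] by (simp add: one_plus_def x')
    moreover have "(?h, z) \<in> Field (omega_times R)" using x' z by (simp add: Field_omega_times[OF R])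
    ultimately show ?thesis by blast
  next
    case False
    then have "bump (underS R i = {}) g = g" using bot[OF x'(3)] by (auto simp: bump_def)
    then have "one_plus R x = x" by (simp add: one_plus_def x')
    then show ?thesis using x by blast
  qed
qed

section \<open>Inner products and orthonormal families\<close>

notation scaleC (infixr \<open>*C\<close> 75)
abbreviation "bclinear \<equiv> bounded_clinear"
abbreviation "adj \<equiv> hilbert_adjoint"

lemma scaleC_right_linear: "bounded_linear (\<lambda>x :: 'a::complex_hilbert_space. c *C x)"
  and norm_scaleC [simp]: "norm (c *C (x :: 'a)) = cmod c * norm x"
proof -
  have n: "norm (c *C x) = cmod c * norm x" for c and x :: 'a
  proof -
    have "complex_of_real ((norm (c *C x))^2) = cinner (c *C x) (c *C x)"
      by (simp add: cinner_self)
    also have "\<dots> = c * cnj (c * cinner x x)"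
      by (metis cinner_commute cinner_scaleC_left)
    also have "\<dots> = complex_of_real ((cmod c * norm x)^2)"
      by (simp add: cinner_self power_mult_distrib complex_norm_square mult.assoc[symmetric]
	  del: of_real_power)
    finally have "(norm (c *C x))^2 = (cmod c * norm x)^2" by (simp only: of_real_eq_iff)
    then show ?thesis by (simp add: power2_eq_iff_nonneg)
  qed
  show "norm (c *C x) = cmod c * norm x" by (rule n)
  show "bounded_linear (\<lambda>x :: 'a. c *C x)"
  proof (rule bounded_linear_intro)
    show "c *C (x + y) = c *C x + c *C y" for x y :: 'a by (rule scaleC_add_right)
    show "c *C (r *\<^sub>R x) = r *\<^sub>R (c *C x)" for r and x :: 'a
      by (simp add: scaleR_eq_scaleC scaleC_scaleC mult.commute)
    show "norm (c *C x) \<le> norm x * cmod c" for x :: 'a by (simp add: n)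
  qed
qed

lemma scaleC_one [simp]: "1 *C (x :: 'a::complex_hilbert_space) = x"
  using scaleR_eq_scaleC[of 1 x] by simp

lemma scaleC_zero_left [simp]: "0 *C (x :: 'a::complex_hilbert_space) = 0"
  using scaleR_eq_scaleC[of 0 x] by simp

lemma scaleC_minus_one [simp]: "(-1) *C (x :: 'a::complex_hilbert_space) = - x"
  using scaleR_eq_scaleC[of "-1" x] by simp

lemma scaleC_zero_right [simp]: "c *C (0 :: 'a::complex_hilbert_space) = 0"
  using bounded_linear.linear[OF scaleC_right_linear, THEN linear_0] .

lemma scaleC_diff_right: "c *C (x - y) = c *C x - c *C (y :: 'a::complex_hilbert_space)"
  using bounded_linear.linear[OF scaleC_right_linear, THEN linear_diff] .

lemma scaleC_diff_left: "(c - d) *C x = c *C x - d *C (x :: 'a::complex_hilbert_space)"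
  using scaleC_add_left[of "c - d" d x] by simp

lemma cinner_add_right:
  "cinner (x :: 'a::complex_hilbert_space) (y + z) = cinner x y + cinner x z"
  by (metis cinner_add_left cinner_commute complex_cnj_add)

lemma cinner_scaleC_right:
  "cinner (x :: 'a::complex_hilbert_space) (c *C y) = cnj c * cinner x y"
  by (metis cinner_commute cinner_scaleC_left complex_cnj_mult)

lemma cinner_zero [simp]:
  "cinner (0 :: 'a::complex_hilbert_space) x = 0" "cinner x (0 :: 'a) = 0"
  using cinner_scaleC_left[of 0 x x] cinner_scaleC_right[of x 0 x] by simp_all

lemma cinner_minus [simp]:
  "cinner (- x :: 'a::complex_hilbert_space) y = - cinner x y" "cinner x (- y :: 'a) = - cinner x y"
  using cinner_scaleC_left[of "-1" x y] cinner_scaleC_right[of x "-1" y] by simp_all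

lemma cinner_diff_left:
  "cinner (x - y :: 'a::complex_hilbert_space) z = cinner x z - cinner y z"
  using cinner_add_left[of x "- y" z] by simp

lemma cinner_diff_right:
  "cinner (x :: 'a::complex_hilbert_space) (y - z) = cinner x y - cinner x z"
  using cinner_add_right[of x y "- z"] by simp

lemmas cinner_linear = cinner_add_left cinner_add_right cinner_diff_left cinner_diff_right
  cinner_scaleC_left cinner_scaleC_right

lemma cinner_sum_left:
  "cinner (sum f A :: 'a::complex_hilbert_space) y = (\<Sum>i\<in>A. cinner (f i) y)"
  by (induction A rule: infinite_finite_induct) (simp_all add: cinner_add_left)

lemma cinner_sum_right:
  "cinner (y :: 'a::complex_hilbert_space) (sum f A) = (\<Sum>i\<in>A. cinner y (f i))"
  by (induction A rule: infinite_finite_induct) (simp_all add: cinner_add_right)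

lemma cinner_eq_0_commute:
  "cinner (x :: 'a::complex_hilbert_space) y = 0 \<longleftrightarrow> cinner y x = 0"
  by (metis cinner_commute complex_cnj_zero)

lemma Re_cinner_self: "Re (cinner x x) = (norm (x :: 'a::complex_hilbert_space))^2"
  by (simp only: cinner_self Re_complex_of_real)

lemma cinner_self_eq_0_iff [simp]: "cinner x x = 0 \<longleftrightarrow> (x :: 'a::complex_hilbert_space) = 0"
  by (simp add: cinner_self)

lemma norm_add_square:
  "(norm (x + y :: 'a::complex_hilbert_space))^2 = (norm x)^2 + 2 * Re (cinner x y) + (norm y)^2"
proof -
  have "Re (cinner y x) = Re (cinner x y)" by (subst cinner_commute) simp
  then show ?thesis by (simp add: Re_cinner_self[symmetric] cinner_linear)
qed

lemma pythagoras:
  assumes "cinner x y = 0"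
  shows "(norm (x + y :: 'a::complex_hilbert_space))^2 = (norm x)^2 + (norm y)^2"
  using norm_add_square[of x y] assms by simp

lemma Cauchy_Schwarz_cinner:
  "cmod (cinner x y) \<le> norm x * norm (y :: 'a::complex_hilbert_space)"
proof (cases "y = 0")
  case False
  define c where "c = cinner x y / complex_of_real ((norm y)^2)"
  have "cinner (x - c *C y) (c *C y) = 0"
    using False by (simp add: cinner_linear cinner_self c_def)
  then have "(norm x)^2 = (norm (x - c *C y))^2 + (norm (c *C y))^2"
    using pythagoras[of "x - c *C y" "c *C y"] by simp
  then have "(norm (c *C y))^2 \<le> (norm x)^2" by simp
  then have "norm (c *C y) \<le> norm x" by (rule power2_le_imp_le) simp
  moreover have "norm (c *C y) = cmod (cinner x y) / norm y"
    using False by (simp add: c_def norm_divide norm_mult power2_eq_square)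
  ultimately show ?thesis using False by (simp add: divide_le_eq)
qed simp

lemma bounded_linear_cinner_left: "bounded_linear (\<lambda>x :: 'a::complex_hilbert_space. cinner x y)"
proof (rule bounded_linear_intro)
  show "norm (cinner x y) \<le> norm x * norm y" for x :: 'a by (rule Cauchy_Schwarz_cinner)
qed (simp_all add: cinner_add_left scaleR_eq_scaleC cinner_scaleC_left scaleR_conv_of_real)

lemma bounded_linear_cinner_right: "bounded_linear (\<lambda>x :: 'a::complex_hilbert_space. cinner y x)"
proof (rule bounded_linear_intro)
  show "norm (cinner y x) \<le> norm x * norm y" for x :: 'a
    using Cauchy_Schwarz_cinner[of y x] by (simp add: mult.commute)
qed (simp_all add: cinner_add_right scaleR_eq_scaleC cinner_scaleC_right scaleR_conv_of_real)

lemma cinner_eqI: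
  assumes "\<And>x. cinner x y = cinner x (z :: 'a::complex_hilbert_space)" shows "y = z"
  using assms[of "y - z"] by (metis cinner_diff_right cinner_self_eq_0_iff right_minus_eq)

definition orthonormal_on :: "('i => 'a::complex_hilbert_space) => 'i set => bool" where
  "orthonormal_on u I \<longleftrightarrow> (\<forall>i\<in>I. \<forall>j\<in>I. cinner (u i) (u j) = (if i = j then 1 else 0))"

lemma orthonormal_onD:
  assumes "orthonormal_on u I" "i \<in> I"
  shows "cinner (u i) (u i) = 1" "norm (u i) = 1" "j \<in> I ==> i \<noteq> j ==> cinner (u i) (u j) = 0"
proof -
  show *: "cinner (u i) (u i) = 1" "j \<in> I ==> i \<noteq> j ==> cinner (u i) (u j) = 0"
    using assms unfolding orthonormal_on_def by auto
  show "norm (u i) = 1" using Re_cinner_self[of "u i"] * by (simp add: power2_eq_1_iff) (smt norm_ge_zero)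
qed

lemma orthonormal_on_subset: "orthonormal_on u I ==> J \<subseteq> I ==> orthonormal_on u J"
  unfolding orthonormal_on_def by blast

lemma cinner_finite_sum:
  assumes "orthonormal_on u F" "finite F" "j \<in> F"
  shows "cinner (\<Sum>i\<in>F. c i *C u i) (u j) = c j"
proof -
  have "cinner (\<Sum>i\<in>F. c i *C u i) (u j) = (\<Sum>i\<in>F. if i = j then c i else 0)"
    unfolding cinner_sum_left using assms
    by (intro sum.cong) (auto simp: cinner_scaleC_left orthonormal_on_def)
  then show ?thesis using assms by simp
qed

lemma norm_finite_sum:
  assumes "orthonormal_on u F" "finite F"
  shows "(norm (\<Sum>i\<in>F. c i *C u i))^2 = (\<Sum>i\<in>F. (cmod (c i))^2)"
proof -
  let ?s = "\<Sum>i\<in>F. c i *C u i"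
  have "cinner ?s ?s = (\<Sum>i\<in>F. cinner ?s (c i *C u i))" by (rule cinner_sum_right)
  also have "\<dots> = (\<Sum>i\<in>F. cnj (c i) * c i)"
    by (intro sum.cong) (simp_all add: cinner_scaleC_right cinner_finite_sum[OF assms])
  also have "\<dots> = complex_of_real (\<Sum>i\<in>F. (cmod (c i))^2)"
    by (simp add: complex_norm_square mult.commute del: of_real_power)
  finally show ?thesis using Re_cinner_self[of ?s] by simp
qed

lemma Bessel_finite:
  assumes "orthonormal_on u F" "finite F"
  shows "(\<Sum>i\<in>F. (cmod (cinner x (u i)))^2) \<le> (norm x)^2"
proof -
  let ?s = "\<Sum>i\<in>F. cinner x (u i) *C u i"
  have "cinner (x - ?s) ?s = 0"
    by (simp add: cinner_sum_right cinner_scaleC_right cinner_diff_left cinner_finite_sum[OF assms])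
  then have "(norm x)^2 = (norm (x - ?s))^2 + (norm ?s)^2"
    using pythagoras[of "x - ?s" ?s] by simp
  then show ?thesis using norm_finite_sum[OF assms] by simp
qed

text \<open>The norm of a finite subsum is determined by its coefficients, so the partial sums are Cauchy
  because those of the squared coefficients are.\<close>

lemma orthonormal_summable:
  fixes u :: "'i => 'a::complex_hilbert_space"
  assumes u: "orthonormal_on u I" and c: "(\<lambda>i. (cmod (c i))^2) summable_on I"
  shows "(\<lambda>i. c i *C u i) summable_on I"
proof -
  let ?f = "\<lambda>i. c i *C u i" and ?g = "\<lambda>i. (cmod (c i))^2"
  let ?F = "filtermap (sum ?f) (finite_subsets_at_top I)"
  obtain S where S: "(?g has_sum S) I" using c by (auto simp: summable_on_def)
  have "cauchy_filter ?F"
    unfolding cauchy_filter_iff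
  proof (intro allI impI)
    fix P :: "'a \<times> 'a => bool" assume "eventually P uniformity"
    then obtain \<epsilon> where \<epsilon>: "\<epsilon> > 0" "\<And>x y. dist x y < \<epsilon> ==> P (x, y)"
      unfolding eventually_uniformity_metric by blast
    define \<delta> where "\<delta> = (\<epsilon> / 2)^2"
    have "\<delta> > 0" using \<epsilon> by (simp add: \<delta>_def)
    then have "\<forall>\<^sub>F G in finite_subsets_at_top I. dist (sum ?g G) S < \<delta> / 2"
      using S unfolding has_sum_def by (intro tendstoD) auto
    then obtain F0 where F0: "finite F0" "F0 \<subseteq> I"
      "\<And>G. finite G ==> F0 \<subseteq> G ==> G \<subseteq> I ==> dist (sum ?g G) S < \<delta> / 2"
      unfolding eventually_finite_subsets_at_top by metis
    have close: "dist (sum ?f G) (sum ?f F0) < \<epsilon> / 2" if G: "finite G" "F0 \<subseteq> G" "G \<subseteq> I" for G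
    proof -
      have "sum ?f G - sum ?f F0 = sum ?f (G - F0)" using sum_diff[OF G(1,2), of ?f] by simp
      then have "(dist (sum ?f G) (sum ?f F0))^2 = sum ?g (G - F0)"
	using norm_finite_sum[OF orthonormal_on_subset[OF u], of "G - F0" c] G
	by (simp add: dist_norm Diff_subset[THEN subset_trans])
      also have "\<dots> = sum ?g G - sum ?g F0" using sum_diff[OF G(1,2), of ?g] by simp
      also have "\<dots> < \<delta>"
	using F0(3)[OF G] F0(3)[OF F0(1) order_refl F0(2)] by (simp add: dist_real_def abs_if split: if_splits)
      finally have "(dist (sum ?f G) (sum ?f F0))^2 < (\<epsilon> / 2)^2" unfolding \<delta>_def .
      then show ?thesis by (rule power2_less_imp_less) (use \<epsilon>(1) in simp)
    qed
    show "\<exists>X. eventually (\<lambda>x. x \<in> X) ?F \<and> (\<forall>z\<in>X \<times> X. P z)"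
    proof (intro exI conjI ballI)
      let ?X = "sum ?f ` {G. finite G \<and> F0 \<subseteq> G \<and> G \<subseteq> I}"
      show "eventually (\<lambda>x. x \<in> ?X) ?F"
	unfolding eventually_filtermap eventually_finite_subsets_at_top
	using F0(1,2) by (intro exI[of _ F0]) auto
      fix z assume "z \<in> ?X \<times> ?X"
      then obtain G H where z: "z = (sum ?f G, sum ?f H)" "finite G" "F0 \<subseteq> G" "G \<subseteq> I"
	"finite H" "F0 \<subseteq> H" "H \<subseteq> I" by auto
      have "dist (sum ?f G) (sum ?f H) < \<epsilon>"
	using close[OF z(2-4)] close[OF z(5-7)] by (rule dist_triangle_half_l)
      then show "P z" using \<epsilon>(2) z(1) by simp
    qed
  qed
  moreover have "?F \<noteq> bot" by (simp add: filtermap_bot_iff)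
  ultimately obtain x where "?F \<le> nhds x"
    using cauchy_filter_convergent' unfolding convergent_filter_iff by blast
  then have "(?f has_sum x) I" unfolding has_sum_def filterlim_def .
  then show ?thesis by (auto simp: summable_on_def)
qed

definition osum :: "('i => 'a::complex_hilbert_space) => 'i set => ('i => complex) => 'a" where
  "osum u I c = infsum (\<lambda>i. c i *C u i) I"

lemma osum_has_sum:
  assumes "orthonormal_on u I" "(\<lambda>i. (cmod (c i))^2) summable_on I"
  shows "((\<lambda>i. c i *C u i) has_sum osum u I c) I"
  using orthonormal_summable[OF assms] unfolding osum_def by (rule has_sum_infsum)

lemma cinner_osum:
  assumes "orthonormal_on u I" "(\<lambda>i. (cmod (c i))^2) summable_on I"
  shows "((\<lambda>i. c i * cinner (u i) y) has_sum cinner (osum u I c) y) I"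
  using has_sum_bounded_linear[OF bounded_linear_cinner_left[of y] osum_has_sum[OF assms]]
  by (simp add: cinner_scaleC_left)

lemma cinner_osum_coeff:
  assumes u: "orthonormal_on u I" and c: "(\<lambda>i. (cmod (c i))^2) summable_on I" and j: "j \<in> I"
  shows "cinner (osum u I c) (u j) = c j"
proof -
  have "((\<lambda>i. c i * cinner (u i) (u j)) has_sum c j) I"
  proof (rule has_sum_finite_neutralI[of "{j}"])
    show "c i * cinner (u i) (u j) = 0" if "i \<in> I - {j}" for i
      using that u j by (simp add: orthonormal_on_def)
    show "c j = (\<Sum>i\<in>{j}. c i * cinner (u i) (u j))"
      using u j by (simp add: orthonormal_on_def)
  qed (use j in auto)
  then show ?thesis using has_sum_unique[OF cinner_osum[OF u c]] by blast
qed

lemma cinner_osum_orthogonal: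
  assumes "orthonormal_on u I" "(\<lambda>i. (cmod (c i))^2) summable_on I"
    and "\<And>i. i \<in> I ==> cinner (u i) y = 0"
  shows "cinner (osum u I c) y = 0"
proof -
  have "((\<lambda>i. c i * cinner (u i) y) has_sum 0) I"
    by (rule has_sum_0) (simp add: assms(3))
  then show ?thesis using has_sum_unique[OF cinner_osum[OF assms(1,2)]] by blast
qed

lemma norm_osum:
  assumes u: "orthonormal_on u I" and c: "(\<lambda>i. (cmod (c i))^2) summable_on I"
  shows "((\<lambda>i. (cmod (c i))^2) has_sum (norm (osum u I c))^2) I"
proof -
  let ?x = "osum u I c"
  have "((\<lambda>i. c i * cinner (u i) ?x) has_sum cinner ?x ?x) I" by (rule cinner_osum[OF u c])
  then have "((\<lambda>i. Re (c i * cinner (u i) ?x)) has_sum Re (cinner ?x ?x)) I"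
    using has_sum_bounded_linear[OF bounded_linear_Re] by blast
  moreover have "Re (c i * cinner (u i) ?x) = (cmod (c i))^2" if "i \<in> I" for i
  proof -
    have "cinner (u i) ?x = cnj (c i)"
      using cinner_osum_coeff[OF u c that] cinner_commute[of "u i" ?x] by simp
    then have "c i * cinner (u i) ?x = complex_of_real ((cmod (c i))^2)"
      by (simp add: complex_norm_square del: of_real_power)
    then show ?thesis by (metis Re_complex_of_real)
  qed
  ultimately have "((\<lambda>i. (cmod (c i))^2) has_sum Re (cinner ?x ?x)) I"
    by (rule has_sum_cong[THEN iffD1, rotated])
  then show ?thesis by (simp only: Re_cinner_self)
qed

lemma Bessel:
  assumes u: "orthonormal_on u I"
  shows "(\<lambda>i. (cmod (cinner x (u i)))^2) summable_on I"
proof (rule nonneg_bdd_above_summable_on)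
  show "bdd_above (sum (\<lambda>i. (cmod (cinner x (u i)))^2) ` {F. F \<subseteq> I \<and> finite F})"
    by (rule bdd_aboveI2[of _ _ "(norm x)^2"])
      (use Bessel_finite orthonormal_on_subset[OF u] in auto)
qed simp

lemma countable_nonorthogonal:
  assumes u: "orthonormal_on u I"
  shows "countable {i\<in>I. cinner x (u i) \<noteq> 0}"
proof -
  have "(\<lambda>i. norm ((cmod (cinner x (u i)))^2)) summable_on I" using Bessel[OF u] by simp
  then have "countable {i\<in>I. (cmod (cinner x (u i)))^2 \<noteq> 0}" by (rule abs_summable_countable)
  then show ?thesis by simp
qed

section \<open>Closed subspaces and projections\<close>

definition csubspace :: "'a::complex_hilbert_space set => bool" where
  "csubspace M \<longleftrightarrow> 0 \<in> M \<and> (\<forall>x\<in>M. \<forall>y\<in>M. x + y \<in> M) \<and> (\<forall>c. \<forall>x\<in>M. c *C x \<in> M)"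

lemma csubspace_minus: "csubspace M ==> x \<in> M ==> y \<in> M ==> x - y \<in> M"
  unfolding csubspace_def by (metis scaleC_minus_one diff_conv_add_uminus)

lemma csubspace_sum: "csubspace M ==> (\<And>i. i \<in> F ==> f i \<in> M) ==> sum f F \<in> M"
  by (induction F rule: infinite_finite_induct) (auto simp: csubspace_def)

lemma osum_in_subspace:
  assumes M: "csubspace M" "closed M" and uM: "\<And>i. i \<in> I ==> u i \<in> M"
    and u: "orthonormal_on u I" and c: "(\<lambda>i. (cmod (c i))^2) summable_on I"
  shows "osum u I c \<in> M"
proof (rule Lim_in_closed_set[OF M(2)])
  show "((\<lambda>F. \<Sum>i\<in>F. c i *C u i) \<longlongrightarrow> osum u I c) (finite_subsets_at_top I)"
    using osum_has_sum[OF u c] unfolding has_sum_def .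
  show "\<forall>\<^sub>F F in finite_subsets_at_top I. (\<Sum>i\<in>F. c i *C u i) \<in> M"
    unfolding eventually_finite_subsets_at_top
  proof (intro exI[of _ "{}"] conjI allI impI)
    fix F assume F: "finite F \<and> {} \<subseteq> F \<and> F \<subseteq> I"
    have "c i *C u i \<in> M" if "i \<in> F" for i
      using that F uM M(1) by (auto simp: csubspace_def)
    then show "(\<Sum>i\<in>F. c i *C u i) \<in> M" by (rule csubspace_sum[OF M(1)])
  qed simp_all
qed simp

lemma ex_maximal_orthonormal:
  assumes M: "csubspace M"
  shows "\<exists>B\<subseteq>M. orthonormal_on (\<lambda>b. b) B \<and> (\<forall>x\<in>M. (\<forall>b\<in>B. cinner x b = 0) --> x = 0)"
proof -
  let ?A = "{B. B \<subseteq> M \<and> orthonormal_on (\<lambda>b. b) B}"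
  have "\<exists>B\<in>?A. \<forall>X\<in>?A. B \<subseteq> X --> X = B"
  proof (rule subset_Zorn')
    fix C assume C: "subset.chain ?A C"
    have "orthonormal_on (\<lambda>b. b) (\<Union>C)"
      unfolding orthonormal_on_def
    proof (intro ballI)
      fix x y assume "x \<in> \<Union>C" "y \<in> \<Union>C"
      then obtain X Y where XY: "X \<in> C" "Y \<in> C" "x \<in> X" "y \<in> Y" by blast
      then have "X \<subseteq> Y \<or> Y \<subseteq> X" "X \<in> ?A" "Y \<in> ?A"
	using C unfolding subset_chain_def by blast+
      then show "cinner x y = (if x = y then 1 else 0)"
	using XY unfolding orthonormal_on_def by auto
    qed
    moreover have "\<Union>C \<subseteq> M" using C by (auto simp: subset.chain_def)
    ultimately show "\<Union>C \<in> ?A" by simp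
  qed
  then obtain B where "B \<in> ?A" and B_max: "\<forall>X\<in>?A. B \<subseteq> X --> X = B" by (rule bexE)
  then have B: "B \<subseteq> M" "orthonormal_on (\<lambda>b. b) B" by simp_all
  have max: "X = B" if "X \<subseteq> M" "orthonormal_on (\<lambda>b. b) X" "B \<subseteq> X" for X
    using B_max that by simp
  have "x = 0" if x: "x \<in> M" "\<forall>b\<in>B. cinner x b = 0" for x
  proof (rule ccontr)
    assume "x \<noteq> 0"
    define y where "y = complex_of_real (1 / norm x) *C x"
    have y: "y \<in> M" "norm y = 1" "\<forall>b\<in>B. cinner y b = 0"
      using x M \<open>x \<noteq> 0\<close> by (auto simp: y_def csubspace_def cinner_scaleC_left norm_divide)
    then have yy: "cinner y y = 1" by (simp add: cinner_self)
    have "orthonormal_on (\<lambda>b. b) (insert y B)"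
      unfolding orthonormal_on_def
    proof (intro ballI)
      fix a b assume "a \<in> insert y B" "b \<in> insert y B"
      then show "cinner a b = (if a = b then 1 else 0)"
	using y(3) yy B(2) cinner_eq_0_commute unfolding orthonormal_on_def by (metis insertE zero_neq_one)
    qed
    then have "y \<in> B" using max[of "insert y B"] y(1) B(1) by blast
    then show False using y(3) yy by simp
  qed
  then show ?thesis using B by blast
qed

definition basis_of :: "'a::complex_hilbert_space set => 'a set => bool" where
  "basis_of B M \<longleftrightarrow> B \<subseteq> M \<and> orthonormal_on (\<lambda>b. b) B \<and>
     (\<forall>x\<in>M. osum (\<lambda>b. b) B (cinner x) = x)"

lemma osum_coeff_orthogonal:
  assumes "orthonormal_on u I" "i \<in> I"
  shows "cinner (x - osum u I (\<lambda>i. cinner x (u i))) (u i) = 0"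
  using cinner_osum_coeff[OF assms(1) Bessel[OF assms(1)] assms(2)] by (simp add: cinner_diff_left)

lemma ex_basis:
  assumes M: "csubspace M" "closed M" shows "\<exists>B. basis_of B M"
proof -
  obtain B where B: "B \<subseteq> M" "orthonormal_on (\<lambda>b. b) B"
    and max: "\<And>x. x \<in> M ==> \<forall>b\<in>B. cinner x b = 0 ==> x = 0"
    using ex_maximal_orthonormal[OF M(1)] by blast
  have "osum (\<lambda>b. b) B (cinner x) = x" if x: "x \<in> M" for x
  proof -
    have "osum (\<lambda>b. b) B (cinner x) \<in> M"
      by (rule osum_in_subspace[OF M]) (use B Bessel[OF B(2)] in auto)
    then have "x - osum (\<lambda>b. b) B (cinner x) = 0"
      using osum_coeff_orthogonal[OF B(2)] max csubspace_minus[OF M(1) x] by blast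
    then show ?thesis by simp
  qed
  then show ?thesis using B unfolding basis_of_def by blast
qed

lemma csubspace_UNIV [simp]: "csubspace UNIV" by (simp add: csubspace_def)

section \<open>Bounded operators and adjoints\<close>

lemma bclinearI:
  assumes "\<And>x y. f (x + y) = f x + f y" "\<And>c x. f (c *C x) = c *C f x" "\<And>x. norm (f x) \<le> K * norm x"
  shows "bclinear f"
  unfolding bounded_clinear_def
proof (intro conjI allI bounded_linear_intro)
  show "norm (f x) \<le> norm x * K" for x using assms(3)[of x] by (simp add: mult.commute)
qed (simp_all add: assms scaleR_eq_scaleC)

lemma bclinearD:
  assumes "bclinear f"
  shows "bounded_linear f" "f (c *C x) = c *C f x" "f (x + y) = f x + f y" "f (x - y) = f x - f y"
    "f 0 = 0" "f (- x) = - f x" "norm (f x) \<le> onorm f * norm x"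
proof -
  show b: "bounded_linear f" and "f (c *C x) = c *C f x"
    using assms unfolding bounded_clinear_def by simp_all
  note l = bounded_linear.linear[OF b]
  show "f (x + y) = f x + f y" "f (x - y) = f x - f y" "f 0 = 0" "f (- x) = - f x"
    using linear_add[OF l] linear_diff[OF l] linear_0[OF l] linear_neg[OF l] by simp_all
  show "norm (f x) \<le> onorm f * norm x" by (rule onorm[OF b])
qed

lemma bclinear_sum: "bclinear f ==> f (sum g A) = (\<Sum>i\<in>A. f (g i))"
  using linear_sum bounded_linear.linear bclinearD(1) by blast

lemma bclinear_id [simp]: "bclinear id" "bclinear (\<lambda>x. x)"
  by (simp_all add: bounded_clinear_def id_def)

lemma bclinear_zero [simp]: "bclinear (\<lambda>_. 0)"
  by (simp add: bounded_clinear_def)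

lemma bclinear_add:
  "bclinear f ==> bclinear g ==> bclinear (\<lambda>x. f x + g x)"
  by (simp add: bounded_clinear_def bounded_linear_add scaleC_add_right)

lemma bclinear_diff:
  "bclinear f ==> bclinear g ==> bclinear (\<lambda>x. f x - g x)"
  by (simp add: bounded_clinear_def bounded_linear_sub scaleC_diff_right)

lemma bclinear_scaleC: "bclinear f ==> bclinear (\<lambda>x. c *C f x)"
  by (simp add: bounded_clinear_def bounded_linear_compose[OF scaleC_right_linear] scaleC_scaleC
      mult.commute)

lemma bclinear_compose: "bclinear f ==> bclinear g ==> bclinear (f \<circ> g)"
  using bounded_linear_compose[of f g] by (simp add: bounded_clinear_def o_def)

lemmas bclinear_intros = bclinear_id bclinear_zero bclinear_add
  bclinear_diff bclinear_scaleC bclinear_compose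

definition adjoint_pair ::
  "('a::complex_hilbert_space => 'b::complex_hilbert_space) => ('b => 'a) => bool" where
  "adjoint_pair f g \<longleftrightarrow> (\<forall>x y. cinner (f x) y = cinner x (g y))"

text \<open>The adjoint has the coordinates that the identity \<open>\<langle>f e, y\<rangle> = \<langle>e, g y\<rangle>\<close> prescribes in an
  orthonormal basis.\<close>

lemma ex_adjoint:
  fixes f :: "'a::complex_hilbert_space => 'b::complex_hilbert_space"
  assumes f: "bclinear f"
  shows "\<exists>g. bclinear g \<and> adjoint_pair f g"
proof -
  obtain E :: "'a set" where E: "basis_of E UNIV" using ex_basis[of UNIV] by auto
  then have on: "orthonormal_on (\<lambda>b. b) E" and rep: "osum (\<lambda>b. b) E (cinner x) = x" for x
    by (auto simp: basis_of_def)
  define K where "K = onorm f"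
  have K: "norm (f x) \<le> K * norm x" for x unfolding K_def by (rule bclinearD(7)[OF f])
  have K0: "0 \<le> K" unfolding K_def using onorm_pos_le[OF bclinearD(1)[OF f]] .
  have sum: "(\<lambda>e. (cmod (cnj (cinner (f e) y)))^2) summable_on E" for y
  proof (rule nonneg_bdd_above_summable_on)
    have "(\<Sum>e\<in>F. (cmod (cnj (cinner (f e) y)))^2) \<le> (K * norm y)^2" if F: "F \<subseteq> E" "finite F" for F
    proof -
      define S where "S = (\<Sum>e\<in>F. (cmod (cinner (f e) y))^2)"
      define z where "z = (\<Sum>e\<in>F. cnj (cinner (f e) y) *C e)"
      have S0: "0 \<le> S" by (simp add: S_def sum_nonneg)
      have nz: "(norm z)^2 = S"
	unfolding z_def S_def
	using norm_finite_sum[OF orthonormal_on_subset[OF on F(1)] F(2)] by simp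
      have "cinner (f z) y = (\<Sum>e\<in>F. cnj (cinner (f e) y) * cinner (f e) y)"
	by (simp add: z_def bclinear_sum[OF f] bclinearD(2)[OF f] cinner_sum_left
	    cinner_scaleC_left)
      also have "\<dots> = complex_of_real S"
	by (simp add: S_def complex_norm_square mult.commute del: of_real_power)
      finally have "S = cmod (cinner (f z) y)" using S0 by simp
      also have "\<dots> \<le> norm (f z) * norm y" by (rule Cauchy_Schwarz_cinner)
      also have "\<dots> \<le> K * norm z * norm y" by (rule mult_right_mono[OF K]) simp
      finally have le: "(norm z)^2 \<le> K * norm y * norm z" using nz by (simp add: mult_ac)
      have "norm z \<le> K * norm y"
      proof (cases "norm z = 0")
	case False
	then show ?thesis using le by (simp add: power2_eq_square)
      qed (use K0 in simp)
      then have "(norm z)^2 \<le> (K * norm y)^2" by (simp add: power_mono)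
      then show ?thesis using nz by (simp add: S_def)
    qed
    then show "bdd_above (sum (\<lambda>e. (cmod (cnj (cinner (f e) y)))^2) ` {F. F \<subseteq> E \<and> finite F})"
      by (intro bdd_aboveI2[of _ _ "(K * norm y)^2"]) auto
  qed simp
  define g where "g y = osum (\<lambda>b. b) E (\<lambda>e. cnj (cinner (f e) y))" for y
  have ge: "cinner e (g y) = cinner (f e) y" if "e \<in> E" for e y
    using cinner_osum_coeff[OF on sum that, of y] cinner_commute[of e "g y"] by (simp add: g_def)
  have ad: "cinner (f x) y = cinner x (g y)" for x y
  proof -
    have hs: "((\<lambda>e. cinner x e *C e) has_sum x) E"
      using osum_has_sum[OF on Bessel[OF on], of x] rep[of x] by simp
    have 1: "((\<lambda>e. cinner (cinner x e *C e) (g y)) has_sum cinner x (g y)) E"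
      using has_sum_bounded_linear[OF bounded_linear_cinner_left hs] .
    have 2: "((\<lambda>e. cinner (f (cinner x e *C e)) y) has_sum cinner (f x) y) E"
      using has_sum_bounded_linear[OF bounded_linear_cinner_left
	  has_sum_bounded_linear[OF bclinearD(1)[OF f] hs]] .
    have eq: "cinner (f (cinner x e *C e)) y = cinner (cinner x e *C e) (g y)" if "e \<in> E" for e
      using ge[OF that] by (simp add: bclinearD(2)[OF f] cinner_scaleC_left)
    have "((\<lambda>e. cinner (cinner x e *C e) (g y)) has_sum cinner (f x) y) E"
      by (rule has_sum_cong[THEN iffD1, OF eq 2])
    then show ?thesis by (rule has_sum_unique[OF _ 1])
  qed
  have "bclinear g"
  proof (rule bclinearI)
    show "g (x + y) = g x + g y" for x y
      by (rule cinner_eqI) (simp add: ad[symmetric] cinner_add_right)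
    show "g (c *C x) = c *C g x" for c x
      by (rule cinner_eqI) (simp add: ad[symmetric] cinner_scaleC_right)
    show "norm (g y) \<le> K * norm y" for y
    proof (cases "g y = 0")
      case False
      have "complex_of_real ((norm (g y))^2) = cinner (f (g y)) y"
	unfolding ad by (simp add: cinner_self)
      then have "(norm (g y))^2 = cmod (cinner (f (g y)) y)"
	by (metis norm_of_real abs_of_nonneg zero_le_power2)
      also have "\<dots> \<le> norm (f (g y)) * norm y" by (rule Cauchy_Schwarz_cinner)
      also have "\<dots> \<le> K * norm (g y) * norm y" by (rule mult_right_mono[OF K]) simp
      finally show ?thesis using False by (simp add: power2_eq_square mult_ac)
    qed (use K0 in simp)
  qed
  then show ?thesis using ad unfolding adjoint_pair_def by blast
qed

lemma adjoint_pair_unique: "adjoint_pair f g ==> adjoint_pair f h ==> g = h"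
  unfolding adjoint_pair_def by (intro ext cinner_eqI) metis

lemma adj:
  assumes "bclinear f"
  shows "bclinear (adj f)" "adjoint_pair f (adj f)"
proof -
  have "\<exists>!g. bclinear g \<and> (\<forall>x y. cinner (f x) y = cinner x (g y))"
    using ex_adjoint[OF assms] adjoint_pair_unique unfolding adjoint_pair_def by metis
  from theI'[OF this] show "bclinear (adj f)" "adjoint_pair f (adj f)"
    unfolding hilbert_adjoint_def adjoint_pair_def by blast+
qed

lemma adj_eqI:
  assumes "bclinear f" "adjoint_pair f g" shows "adj f = g"
  using adjoint_pair_unique[OF adj(2)[OF assms(1)] assms(2)] .

lemma cinner_adjoint:
  assumes "bclinear f"
  shows "cinner (f x) y = cinner x (adj f y)"
    and "cinner y (f x) = cinner (adj f y) x"
proof -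
  show *: "cinner (f x) y = cinner x (adj f y)"
    using adj(2)[OF assms] unfolding adjoint_pair_def by simp
  show "cinner y (f x) = cinner (adj f y) x"
    by (subst (1 2) cinner_commute) (simp add: *)
qed

lemma adjoint_adjoint: "bclinear f ==> adj (adj f) = f"
  by (rule adj_eqI) (auto simp: adj adjoint_pair_def cinner_adjoint)

lemma adjoint_compose:
  "bclinear f ==> bclinear g ==>
    adj (f \<circ> g) = adj g \<circ> adj f"
  by (rule adj_eqI) (auto simp: bclinear_compose adjoint_pair_def cinner_adjoint)

lemma adjoint_diff:
  "bclinear f ==> bclinear g ==>
    adj (\<lambda>x. f x - g x) = (\<lambda>x. adj f x - adj g x)"
  by (rule adj_eqI) (auto simp: bclinear_diff adjoint_pair_def cinner_adjoint cinner_linear)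

lemma onorm_adjoint_le:
  assumes f: "bclinear f" shows "onorm (adj f) \<le> onorm f"
proof (rule onorm_bound)
  show "0 \<le> onorm f" using onorm_pos_le[OF bclinearD(1)[OF f]] .
  fix y
  let ?g = "adj f"
  show "norm (?g y) \<le> onorm f * norm y"
  proof (cases "?g y = 0")
    case False
    have "complex_of_real ((norm (?g y))^2) = cinner (f (?g y)) y"
      using cinner_adjoint(1)[OF f] by (simp add: cinner_self)
    then have "(norm (?g y))^2 = cmod (cinner (f (?g y)) y)"
      by (metis norm_of_real abs_of_nonneg zero_le_power2)
    also have "\<dots> \<le> norm (f (?g y)) * norm y" by (rule Cauchy_Schwarz_cinner)
    also have "\<dots> \<le> onorm f * norm (?g y) * norm y"
      by (rule mult_right_mono[OF bclinearD(7)[OF f]]) simp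
    finally show ?thesis using False by (simp add: power2_eq_square mult_ac)
  qed (use onorm_pos_le[OF bclinearD(1)[OF f]] in simp)
qed

definition oproj :: "('a::complex_hilbert_space => 'a) => bool" where
  "oproj P \<longleftrightarrow> bclinear P \<and> P \<circ> P = P \<and> adjoint_pair P P"

lemma oprojD:
  assumes "oproj P"
  shows "bclinear P" "P (P x) = P x" "cinner (P x) y = cinner x (P y)"
    "cinner (x - P x) (P y) = 0" "norm (P x) \<le> norm x"
proof -
  show b: "bclinear P" and i: "\<And>x. P (P x) = P x" and a: "\<And>x y. cinner (P x) y = cinner x (P y)"
    using assms unfolding oproj_def adjoint_pair_def by (auto simp: fun_eq_iff)
  show o: "cinner (x - P x) (P y) = 0" for x y
    by (simp add: cinner_diff_left a i)
  have "(norm x)^2 = (norm (x - P x))^2 + (norm (P x))^2"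
    using pythagoras[OF o[of x x]] by simp
  then show "norm (P x) \<le> norm x" by (intro power2_le_imp_le[of "norm (P x)"]) auto
qed

lemma adj_oproj: "oproj P ==> adj P = P"
  by (rule adj_eqI) (auto simp: oproj_def)

lemma oproj_complement: "oproj P ==> oproj (\<lambda>x. x - P x)"
  unfolding oproj_def adjoint_pair_def
  by (auto simp: fun_eq_iff cinner_linear bclinear_intros bclinearD(4))

text \<open>The partial isometry that maps the first of two orthonormal families to the second.\<close>

definition partial_isometry ::
  "('i => 'a::complex_hilbert_space) => ('i => 'b::complex_hilbert_space) => 'i set => 'a => 'b" where
  "partial_isometry u v I x = osum v I (\<lambda>i. cinner x (u i))"

lemma osum_eqI:
  assumes v: "orthonormal_on v I" and c: "(\<lambda>i. (cmod (c i))^2) summable_on I"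
    and co: "\<And>i. i \<in> I ==> cinner y (v i) = c i"
    and z: "\<And>z. (\<forall>i\<in>I. cinner (v i) z = 0) ==> cinner y z = 0"
  shows "osum v I c = y"
proof -
  let ?P = "osum v I c"
  have o: "cinner (v i) (y - ?P) = 0" if "i \<in> I" for i
    using co[OF that] cinner_osum_coeff[OF v c that]
    by (simp add: cinner_eq_0_commute[of "v i"] cinner_diff_left)
  then have "cinner y (y - ?P) = 0" "cinner ?P (y - ?P) = 0"
    using z cinner_osum_orthogonal[OF v c] by blast+
  then have "cinner (y - ?P) (y - ?P) = 0" by (simp add: cinner_diff_left)
  then show ?thesis by simp
qed

lemma partial_isometry:
  fixes u :: "'i => 'a::complex_hilbert_space" and v :: "'i => 'b::complex_hilbert_space"
  assumes u: "orthonormal_on u I" and v: "orthonormal_on v I"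
  shows "bclinear (partial_isometry u v I)"
    and "norm (partial_isometry u v I x) \<le> norm x"
    and "adjoint_pair (partial_isometry u v I) (partial_isometry v u I)"
    and "i \<in> I ==> cinner (partial_isometry u v I x) (v i) = cinner x (u i)"
    and "i \<in> I ==> partial_isometry u v I (u i) = v i"
    and "(\<forall>i\<in>I. cinner (v i) z = 0) ==> cinner (partial_isometry u v I x) z = 0"
    and "partial_isometry v u I (partial_isometry u v I x) = partial_isometry u u I x"
proof -
  note B = Bessel[OF u]
  have pi: "partial_isometry u v I x = osum v I (\<lambda>i. cinner x (u i))" for x
    by (simp add: partial_isometry_def)
  show coeff: "cinner (partial_isometry u v I x) (v i) = cinner x (u i)" if "i \<in> I" for x i
    unfolding pi using cinner_osum_coeff[OF v B that] .
  show ortho: "cinner (partial_isometry u v I x) z = 0" if "\<forall>i\<in>I. cinner (v i) z = 0" for x z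
    unfolding pi using cinner_osum_orthogonal[OF v B] that by blast
  show bound: "norm (partial_isometry u v I x) \<le> norm x" for x
  proof -
    have "(norm (partial_isometry u v I x))^2 \<le> (norm x)^2"
    proof (rule has_sum_le_finite_sums)
      show "((\<lambda>i. (cmod (cinner x (u i)))^2) has_sum (norm (partial_isometry u v I x))^2) I"
	unfolding pi by (rule norm_osum[OF v B])
      show "(\<Sum>i\<in>F. (cmod (cinner x (u i)))^2) \<le> (norm x)^2" if "finite F" "F \<subseteq> I" for F
	by (rule Bessel_finite[OF orthonormal_on_subset[OF u that(2)] that(1)])
    qed
    then show ?thesis using power2_le_imp_le by simp
  qed
  show "bclinear (partial_isometry u v I)"
  proof (rule bclinearI)
    show "partial_isometry u v I (x + y) = partial_isometry u v I x + partial_isometry u v I y" for x y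
      unfolding pi[of "x + y"]
      by (rule osum_eqI[OF v B]) (simp_all add: cinner_add_left coeff ortho)
    show "partial_isometry u v I (c *C x) = c *C partial_isometry u v I x" for c x
      unfolding pi[of "c *C x"]
      by (rule osum_eqI[OF v B]) (simp_all add: cinner_scaleC_left coeff ortho)
    show "norm (partial_isometry u v I x) \<le> 1 * norm x" for x using bound by simp
  qed
  show "adjoint_pair (partial_isometry u v I) (partial_isometry v u I)"
    unfolding adjoint_pair_def
  proof (intro allI)
    fix x y
    have "((\<lambda>i. cinner x (u i) * cinner (v i) y) has_sum cinner (partial_isometry u v I x) y) I"
      unfolding pi by (rule cinner_osum[OF v B])
    moreover have "((\<lambda>i. cnj (cinner y (v i) * cinner (u i) x)) has_sum
	cnj (cinner (partial_isometry v u I y) x)) I"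
      unfolding partial_isometry_def
      using has_sum_bounded_linear[OF bounded_linear_cnj cinner_osum[OF u Bessel[OF v]]] .
    moreover have "cnj (cinner y (v i) * cinner (u i) x) = cinner x (u i) * cinner (v i) y" for i
      using cinner_commute[of "v i" y] cinner_commute[of x "u i"] by simp
    ultimately have "cinner (partial_isometry u v I x) y = cnj (cinner (partial_isometry v u I y) x)"
      using has_sum_unique by simp
    then show "cinner (partial_isometry u v I x) y = cinner x (partial_isometry v u I y)"
      by (metis cinner_commute)
  qed
  show "partial_isometry u v I (u i) = v i" if "i \<in> I"
    unfolding pi
  proof (rule osum_eqI[OF v B])
    show "cinner (v i) (v j) = cinner (u i) (u j)" if "j \<in> I" for j
      using u v that \<open>i \<in> I\<close> unfolding orthonormal_on_def by simp
  qed (use that in blast)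
  show "partial_isometry v u I (partial_isometry u v I x) = partial_isometry u u I x"
    unfolding partial_isometry_def[of v u] partial_isometry_def[of u u] osum_def
    using coeff by (intro infsum_cong) simp
qed

lemma adjoint_partial_isometry:
  assumes "orthonormal_on u I" "orthonormal_on v I"
  shows "adj (partial_isometry u v I) = partial_isometry v u I"
  by (rule adj_eqI[OF partial_isometry(1,3)[OF assms]])

lemma oproj_span: "orthonormal_on u I ==> oproj (partial_isometry u u I)"
  unfolding oproj_def using partial_isometry(1,3,7) by (auto simp: fun_eq_iff)

lemma ex_oproj:
  assumes M: "csubspace M" "closed M"
  obtains P where "oproj P" "\<And>x. x \<in> M \<longleftrightarrow> P x = x" "\<And>x. P x \<in> M"
proof -
  obtain B where B: "basis_of B M" using ex_basis[OF M] by blast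
  then have on: "orthonormal_on (\<lambda>b. b) B" and BM: "B \<subseteq> M"
    and rep: "\<And>x. x \<in> M ==> osum (\<lambda>b. b) B (cinner x) = x"
    by (auto simp: basis_of_def)
  have inM: "osum (\<lambda>b. b) B (cinner x) \<in> M" for x
    by (rule osum_in_subspace[OF M]) (use BM on Bessel[OF on] in auto)
  show ?thesis
  proof (rule that[of "\<lambda>x. osum (\<lambda>b. b) B (cinner x)"])
    show "oproj (\<lambda>x. osum (\<lambda>b. b) B (cinner x))" using oproj_span[OF on] by (simp add: partial_isometry_def[abs_def])
    show "x \<in> M \<longleftrightarrow> osum (\<lambda>b. b) B (cinner x) = x" for x using inM[of x] rep by metis
  qed (rule inM)
qed

lemma oproj_range:
  assumes P: "oproj P"
  shows "csubspace {x. P x = x}" "closed {x. P x = x}"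
proof -
  note D = bclinearD[OF oprojD(1)[OF P]]
  show "csubspace {x. P x = x}" by (simp add: csubspace_def D(2,3,5))
  have "continuous_on UNIV P" using D(1) linear_continuous_on by blast
  then show "closed {x. P x = x}" by (intro closed_Collect_eq continuous_on_id)
qed

text \<open>Every projection is the sum of the rank one projections of an orthonormal basis.\<close>

lemma oproj_basis:
  assumes P: "oproj P"
  obtains B where "orthonormal_on (\<lambda>b. b) B" "P = partial_isometry (\<lambda>b. b) (\<lambda>b. b) B"
    "\<And>b. b \<in> B ==> P b = b"
proof -
  obtain B where B: "basis_of B {x. P x = x}" using ex_basis[OF oproj_range[OF P]] by blast
  then have on: "orthonormal_on (\<lambda>b. b) B" and PB: "\<And>b. b \<in> B ==> P b = b"
    and rep: "\<And>x. P x = x ==> osum (\<lambda>b. b) B (cinner x) = x"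
    by (auto simp: basis_of_def)
  have "P x = osum (\<lambda>b. b) B (cinner x)" for x
  proof -
    have "osum (\<lambda>b. b) B (cinner x) = osum (\<lambda>b. b) B (cinner (P x))"
      unfolding osum_def using PB oprojD(3)[OF P] by (intro infsum_cong) simp
    then show ?thesis using rep[of "P x"] oprojD(2)[OF P] by simp
  qed
  then have "P = partial_isometry (\<lambda>b. b) (\<lambda>b. b) B" by (simp add: partial_isometry_def fun_eq_iff)
  then show ?thesis using that on PB by blast
qed

section \<open>Compact operators\<close>

lemma bclinear_ball_bound:
  fixes f :: "'a::complex_hilbert_space => 'b::complex_hilbert_space"
  assumes f: "bclinear f" and ball: "\<And>x. norm x \<le> 1 ==> norm (f x) \<le> e"
  shows "norm (f x) \<le> e * norm x"
proof (cases "x = 0")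
  case True
  then show ?thesis using bclinearD(5)[OF f] by simp
next
  case False
  let ?c = "complex_of_real (1 / norm x)"
  have "norm (f (?c *C x)) \<le> e" by (rule ball) (use False in \<open>simp add: norm_divide\<close>)
  then have "norm (f x) / norm x \<le> e" by (simp add: bclinearD(2)[OF f] norm_divide)
  then show ?thesis using False by (simp add: divide_le_eq)
qed

text \<open>Compactness in the form of finite nets, which is what all estimates use.\<close>

lemma compact_operator_iff:
  "compact_operator f \<longleftrightarrow> bclinear f \<and>
     (\<forall>e>0. \<exists>k. finite k \<and> (\<forall>x. norm x \<le> 1 --> (\<exists>y\<in>k. norm (f x - y) < e)))"
proof -
  let ?S = "f ` cball 0 1"
  have "compact (closure ?S) \<longleftrightarrow> (\<forall>e>0. \<exists>k. finite k \<and> ?S \<subseteq> (\<Union>y\<in>k. ball y e))"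
  proof
    assume "compact (closure ?S)"
    then show "\<forall>e>0. \<exists>k. finite k \<and> ?S \<subseteq> (\<Union>y\<in>k. ball y e)"
      unfolding compact_eq_totally_bounded using closure_subset by (meson order_trans)
  next
    assume net: "\<forall>e>0. \<exists>k. finite k \<and> ?S \<subseteq> (\<Union>y\<in>k. ball y e)"
    show "compact (closure ?S)"
      unfolding compact_eq_totally_bounded
    proof (intro conjI allI impI)
      show "complete (closure ?S)" by (simp add: complete_eq_closed)
      fix e :: real assume "e > 0"
      then obtain k where k: "finite k" "?S \<subseteq> (\<Union>y\<in>k. ball y (e/2))" using net half_gt_zero by blast
      have "closure ?S \<subseteq> (\<Union>y\<in>k. cball y (e/2))"
      proof (rule closure_minimal)
	show "?S \<subseteq> (\<Union>y\<in>k. cball y (e/2))" using k(2) ball_subset_cball by blast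
	show "closed (\<Union>y\<in>k. cball y (e/2))" using k(1) by (intro closed_UN) auto
      qed
      also have "\<dots> \<subseteq> (\<Union>y\<in>k. ball y e)" using \<open>e > 0\<close> by (intro UN_mono) auto
      finally show "\<exists>k. finite k \<and> closure ?S \<subseteq> (\<Union>x\<in>k. ball x e)" using k(1) by blast
    qed
  qed
  moreover have "?S \<subseteq> (\<Union>y\<in>k. ball y e) \<longleftrightarrow> (\<forall>x. norm x \<le> 1 --> (\<exists>y\<in>k. norm (f x - y) < e))" for k e
    by (auto simp: image_subset_iff dist_norm norm_minus_commute)
  ultimately show ?thesis unfolding compact_operator_def by simp
qed

lemma compact_operatorI:
  assumes "bclinear f"
    and "\<And>e. e > 0 ==> \<exists>k. finite k \<and> (\<forall>x. norm x \<le> 1 --> (\<exists>y\<in>k. norm (f x - y) < e))"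
  shows "compact_operator f"
  using assms unfolding compact_operator_iff by blast

lemma compact_operatorD:
  assumes "compact_operator f"
  shows "bclinear f"
    and "e > 0 ==> \<exists>k. finite k \<and> (\<forall>x. norm x \<le> 1 --> (\<exists>y\<in>k. norm (f x - y) < e))"
  using assms unfolding compact_operator_iff by blast+

lemma compact_zero [simp]: "compact_operator (\<lambda>_. 0)"
  by (rule compact_operatorI) (auto intro: exI[of _ "{0}"])

lemma compact_add:
  assumes f: "compact_operator f" and g: "compact_operator g"
  shows "compact_operator (\<lambda>x. f x + g x)"
proof (rule compact_operatorI)
  show "bclinear (\<lambda>x. f x + g x)"
    using compact_operatorD(1) f g by (intro bclinear_add)
  fix e :: real assume "e > 0"
  then have e: "e/2 > 0" by simp
  obtain k where k: "finite k" "\<forall>x. norm x \<le> 1 --> (\<exists>y\<in>k. norm (f x - y) < e/2)"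
    using compact_operatorD(2)[OF f e] by blast
  obtain l where l: "finite l" "\<forall>x. norm x \<le> 1 --> (\<exists>y\<in>l. norm (g x - y) < e/2)"
    using compact_operatorD(2)[OF g e] by blast
  have "\<exists>y\<in>(\<lambda>(a, b). a + b) ` (k \<times> l). norm (f x + g x - y) < e" if x: "norm x \<le> 1" for x
  proof -
    obtain a b where ab: "a \<in> k" "b \<in> l" "norm (f x - a) < e/2" "norm (g x - b) < e/2"
      using k(2) l(2) x by blast
    have "norm (f x + g x - (a + b)) \<le> norm (f x - a) + norm (g x - b)"
      using norm_triangle_ineq[of "f x - a" "g x - b"] by (simp add: algebra_simps)
    then have "norm (f x + g x - (a + b)) < e" using ab by simp
    then show ?thesis using ab by force
  qed
  then show "\<exists>k. finite k \<and> (\<forall>x. norm x \<le> 1 --> (\<exists>y\<in>k. norm (f x + g x - y) < e))"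
    using k(1) l(1) by (intro exI[of _ "(\<lambda>(a, b). a + b) ` (k \<times> l)"]) blast
qed

lemma compact_compose_left:
  assumes a: "bclinear a" and f: "compact_operator f"
  shows "compact_operator (a \<circ> f)"
proof (rule compact_operatorI)
  show "bclinear (a \<circ> f)" using a compact_operatorD(1)[OF f] by (rule bclinear_compose)
  fix e :: real assume "e > 0"
  define d where "d = onorm a + 1"
  have d: "d > 0" unfolding d_def using onorm_pos_le[OF bclinearD(1)[OF a]] by simp
  then obtain k where k: "finite k" "\<forall>x. norm x \<le> 1 --> (\<exists>y\<in>k. norm (f x - y) < e / d)"
    using compact_operatorD(2)[OF f, of "e / d"] \<open>e > 0\<close> by auto
  have "\<exists>y\<in>a ` k. norm ((a \<circ> f) x - y) < e" if x: "norm x \<le> 1" for x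
  proof -
    obtain y where y: "y \<in> k" "norm (f x - y) < e / d" using k(2) x by blast
    have "norm (a (f x) - a y) \<le> onorm a * norm (f x - y)"
      using bclinearD(7)[OF a, of "f x - y"] by (simp add: bclinearD(4)[OF a])
    also have "\<dots> \<le> d * norm (f x - y)" unfolding d_def by (rule mult_right_mono) auto
    also have "\<dots> < e" using y(2) d by (simp add: pos_less_divide_eq mult.commute)
    finally show ?thesis using y(1) by auto
  qed
  then show "\<exists>k. finite k \<and> (\<forall>x. norm x \<le> 1 --> (\<exists>y\<in>k. norm ((a \<circ> f) x - y) < e))"
    using k(1) by (intro exI[of _ "a ` k"]) blast
qed

lemma compact_scaleC: "compact_operator f ==> compact_operator (\<lambda>x. c *C f x)"
  using compact_compose_left[OF bclinear_scaleC[OF bclinear_id(2), of c], of f]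
  by (simp add: o_def)

lemma compact_uminus: "compact_operator f ==> compact_operator (\<lambda>x. - f x)"
  using compact_scaleC[of f "-1"] by simp

lemma compact_diff: "compact_operator f ==> compact_operator g ==> compact_operator (\<lambda>x. f x - g x)"
  using compact_add[OF _ compact_uminus, of f g] by simp

lemma compact_compose_right:
  assumes a: "bclinear a" and f: "compact_operator f"
  shows "compact_operator (f \<circ> a)"
proof (rule compact_operatorI)
  show "bclinear (f \<circ> a)" using compact_operatorD(1)[OF f] a by (rule bclinear_compose)
  note F = compact_operatorD(1)[OF f]
  fix e :: real assume "e > 0"
  define d where "d = onorm a + 1"
  have d: "d > 0" unfolding d_def using onorm_pos_le[OF bclinearD(1)[OF a]] by simp
  then obtain k where k: "finite k" "\<forall>x. norm x \<le> 1 --> (\<exists>y\<in>k. norm (f x - y) < e / d)"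
    using compact_operatorD(2)[OF f, of "e / d"] \<open>e > 0\<close> by auto
  have "\<exists>y\<in>(\<lambda>y. complex_of_real d *C y) ` k. norm ((f \<circ> a) x - y) < e" if x: "norm x \<le> 1" for x
  proof -
    define z where "z = complex_of_real (1 / d) *C a x"
    have "norm (a x) \<le> onorm a * norm x" by (rule bclinearD(7)[OF a])
    also have "\<dots> \<le> onorm a * 1"
      by (rule mult_left_mono[OF x onorm_pos_le[OF bclinearD(1)[OF a]]])
    also have "\<dots> \<le> d" by (simp add: d_def)
    finally have "norm z \<le> 1" using d by (simp add: z_def norm_divide divide_le_eq)
    then obtain y where y: "y \<in> k" "norm (f z - y) < e / d" using k(2) by blast
    have "f (a x) = complex_of_real d *C f z"
      using d by (simp add: z_def bclinearD(2)[OF F] scaleC_scaleC)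
    then have "norm (f (a x) - complex_of_real d *C y) = d * norm (f z - y)"
      using d by (simp add: scaleC_diff_right[symmetric])
    also have "\<dots> < e" using y(2) d by (simp add: pos_less_divide_eq mult.commute)
    finally show ?thesis using y(1) by auto
  qed
  then show "\<exists>k. finite k \<and> (\<forall>x. norm x \<le> 1 --> (\<exists>y\<in>k. norm ((f \<circ> a) x - y) < e))"
    using k(1) by (intro exI[of _ "(\<lambda>y. complex_of_real d *C y) ` k"]) blast
qed

lemma compact_limit:
  fixes f :: "'a::complex_hilbert_space => 'b::complex_hilbert_space"
  assumes f: "bclinear f"
    and lim: "\<And>e. e > 0 ==> \<exists>g :: 'a => 'b. compact_operator g \<and> (\<forall>x. norm x \<le> 1 --> norm (f x - g x) \<le> e)"
  shows "compact_operator f"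
proof (rule compact_operatorI[OF f])
  fix e :: real assume "e > 0"
  then obtain g :: "'a => 'b" where g: "compact_operator g" "\<forall>x. norm x \<le> 1 --> norm (f x - g x) \<le> e/2"
    using lim[of "e/2"] by auto
  obtain k where k: "finite k" "\<forall>x. norm x \<le> 1 --> (\<exists>y\<in>k. norm (g x - y) < e/2)"
    using compact_operatorD(2)[OF g(1), of "e/2"] \<open>e > 0\<close> by auto
  have "\<exists>y\<in>k. norm (f x - y) < e" if x: "norm x \<le> 1" for x
  proof -
    obtain y where y: "y \<in> k" "norm (g x - y) < e/2" using k(2) x by blast
    have "norm (f x - y) \<le> norm (f x - g x) + norm (g x - y)"
      using norm_triangle_ineq[of "f x - g x" "g x - y"] by simp
    moreover have "norm (f x - g x) \<le> e/2" using g(2) x by blast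
    ultimately show ?thesis using y by (intro bexI[of _ y]) auto
  qed
  then show "\<exists>k. finite k \<and> (\<forall>x. norm x \<le> 1 --> (\<exists>y\<in>k. norm (f x - y) < e))" using k(1) by blast
qed

lemma compact_rank_one: "compact_operator (\<lambda>x. cinner x b *C y)"
proof (rule compact_operatorI)
  show "bclinear (\<lambda>x. cinner x b *C y)"
  proof (rule bclinearI)
    show "norm (cinner x b *C y) \<le> (norm b * norm y) * norm x" for x
      using mult_right_mono[OF Cauchy_Schwarz_cinner[of x b], of "norm y"] by (simp add: mult_ac)
  qed (simp_all add: cinner_add_left scaleC_add_left cinner_scaleC_left scaleC_scaleC)
  have lin: "bounded_linear (\<lambda>c. c *C y)"
    by (rule bounded_linear_intro[of _ "norm y"])
      (simp_all add: scaleC_add_left scaleR_eq_scaleC scaleC_scaleC scaleR_conv_of_real)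
  have "compact ((\<lambda>c. c *C y) ` cball 0 (norm b))"
    by (intro compact_continuous_image linear_continuous_on[OF lin]) simp
  then have net: "\<forall>e>0. \<exists>k. finite k \<and> (\<lambda>c. c *C y) ` cball 0 (norm b) \<subseteq> (\<Union>x\<in>k. ball x e)"
    unfolding compact_eq_totally_bounded by blast
  fix e :: real assume "e > 0"
  then obtain k where k: "finite k" "(\<lambda>c. c *C y) ` cball 0 (norm b) \<subseteq> (\<Union>x\<in>k. ball x e)"
    using net by blast
  have "\<exists>z\<in>k. norm (cinner x b *C y - z) < e" if x: "norm x \<le> 1" for x
  proof -
    have "cmod (cinner x b) \<le> norm x * norm b" by (rule Cauchy_Schwarz_cinner)
    also have "\<dots> \<le> norm b" using x by (simp add: mult_left_le_one_le)
    finally have "cinner x b *C y \<in> (\<Union>x\<in>k. ball x e)" using k(2) by (auto simp: image_subset_iff)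
    then show ?thesis by (auto simp: dist_norm norm_minus_commute)
  qed
  then show "\<exists>k. finite k \<and> (\<forall>x. norm x \<le> 1 --> (\<exists>z\<in>k. norm (cinner x b *C y - z) < e))"
    using k(1) by blast
qed

lemma compact_sum:
  "finite F ==> (\<And>i. i \<in> F ==> compact_operator (f i)) ==> compact_operator (\<lambda>x. \<Sum>i\<in>F. f i x)"
  by (induction F rule: finite_induct) (auto intro: compact_add)

lemma partial_isometry_finite:
  "finite I ==> partial_isometry u v I x = (\<Sum>i\<in>I. cinner x (u i) *C v i)"
  by (simp add: partial_isometry_def osum_def)

lemma compact_finite_partial_isometry:
  assumes "finite I" shows "compact_operator (partial_isometry u v I)"
proof -
  have "partial_isometry u v I = (\<lambda>x. \<Sum>i\<in>I. cinner x (u i) *C v i)"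
    using partial_isometry_finite[OF assms] by blast
  then show ?thesis using compact_sum[OF assms compact_rank_one] by simp
qed

lemma Gram_Schmidt:
  assumes "finite S"
  shows "\<exists>B. finite B \<and> orthonormal_on (\<lambda>b. b) B \<and>
    (\<forall>s\<in>S. partial_isometry (\<lambda>b. b) (\<lambda>b. b) B s = (s :: 'a::complex_hilbert_space))"
  using assms
proof (induction S)
  case empty
  show ?case by (rule exI[of _ "{}"]) (simp add: orthonormal_on_def)
next
  case (insert s S)
  then obtain B where B: "finite B" "orthonormal_on (\<lambda>b. b) B"
    "\<And>t. t \<in> S ==> partial_isometry (\<lambda>b. b) (\<lambda>b. b) B t = t" by blast
  let ?P = "partial_isometry (\<lambda>b. b) (\<lambda>b. b) B :: 'a => 'a"
  note P = oproj_span[OF B(2)]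
  define r where "r = s - ?P s"
  show ?case
  proof (cases "r = 0")
    case True
    then show ?thesis using B unfolding r_def by (intro exI[of _ B]) auto
  next
    case False
    define c where "c = complex_of_real (1 / norm r) *C r"
    have rb: "cinner r b = 0" if "b \<in> B" for b
      using oprojD(4)[OF P, of s b] partial_isometry(5)[OF B(2) B(2) that] by (simp add: r_def)
    then have cb: "cinner c b = 0" "cinner b c = 0" if "b \<in> B" for b
      using that by (simp_all add: c_def cinner_scaleC_left cinner_eq_0_commute[of b])
    have "norm c = 1" using False by (simp add: c_def norm_divide)
    then have cc: "cinner c c = 1" by (simp add: cinner_self)
    then have "c \<notin> B" using cb by auto
    have on: "orthonormal_on (\<lambda>b. b) (insert c B)"
      unfolding orthonormal_on_def
    proof (intro ballI)
      fix a b assume "a \<in> insert c B" "b \<in> insert c B"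
      then show "cinner a b = (if a = b then 1 else 0)"
	using cb cc B(2) \<open>c \<notin> B\<close> unfolding orthonormal_on_def by auto
    qed
    have split: "partial_isometry (\<lambda>b. b) (\<lambda>b. b) (insert c B) x = cinner x c *C c + ?P x" for x
      using B(1) \<open>c \<notin> B\<close> by (simp add: partial_isometry_finite)
    have "partial_isometry (\<lambda>b. b) (\<lambda>b. b) (insert c B) t = t" if t: "t \<in> S" for t
    proof -
      have "cinner (?P t) c = 0" using partial_isometry(6)[OF B(2) B(2)] cb by blast
      then show ?thesis using split B(3)[OF t] by simp
    qed
    moreover have "partial_isometry (\<lambda>b. b) (\<lambda>b. b) (insert c B) s = s"
    proof -
      have "cinner (?P s) c = 0" using partial_isometry(6)[OF B(2) B(2)] cb by blast
      then have "cinner s c = cinner r c" by (simp add: r_def cinner_diff_left)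
      also have "\<dots> = complex_of_real (norm r)"
	using False by (simp add: c_def cinner_scaleC_right cinner_self power2_eq_square)
      finally have "cinner s c *C c = r" using False by (simp add: c_def scaleC_scaleC)
      then show ?thesis using split by (simp add: r_def)
    qed
    ultimately show ?thesis using B(1) on by (intro exI[of _ "insert c B"]) auto
  qed
qed

lemma compact_finite_rank_approx:
  fixes f :: "'a::complex_hilbert_space => 'b::complex_hilbert_space"
  assumes f: "compact_operator f" and e: "e > 0"
  shows "\<exists>B :: 'b set. finite B \<and> orthonormal_on (\<lambda>b. b) B \<and>
    (\<forall>x. norm (f x - partial_isometry (\<lambda>b. b) (\<lambda>b. b) B (f x)) \<le> e * norm x)"
proof -
  obtain k where k: "finite k" "\<forall>x. norm x \<le> 1 --> (\<exists>y\<in>k. norm (f x - y) < e)"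
    using compact_operatorD(2)[OF f e] by blast
  obtain B :: "'b set" where B: "finite B" "orthonormal_on (\<lambda>b. b) B"
    "\<And>s. s \<in> k ==> partial_isometry (\<lambda>b. b) (\<lambda>b. b) B s = s"
    using Gram_Schmidt[OF k(1)] by blast
  let ?P = "partial_isometry (\<lambda>b. b) (\<lambda>b. b) B"
  have Q: "oproj (\<lambda>x. x - ?P x)" using oproj_complement[OF oproj_span[OF B(2)]] .
  note F = compact_operatorD(1)[OF f] and P = oprojD(1)[OF oproj_span[OF B(2)]]
  have "norm (f x - ?P (f x)) \<le> e * norm x" for x
  proof (rule bclinear_ball_bound[of "\<lambda>x. f x - ?P (f x)"])
    show "bclinear (\<lambda>x. f x - ?P (f x))"
      using bclinear_diff[OF F bclinear_compose[OF P F]] by (simp add: o_def)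
    fix x :: 'a assume "norm x \<le> 1"
    then obtain y where y: "y \<in> k" "norm (f x - y) < e" using k(2) by blast
    have "norm ((f x - y) - ?P (f x - y)) \<le> norm (f x - y)" by (rule oprojD(5)[OF Q])
    then show "norm (f x - ?P (f x)) \<le> e"
      using y B(3)[OF y(1)] by (simp add: bclinearD(4)[OF P])
  qed
  then show ?thesis using B by blast
qed

lemma onorm_le_iff:
  assumes "bclinear f" "0 \<le> e" shows "onorm f \<le> e \<longleftrightarrow> (\<forall>x. norm (f x) \<le> e * norm x)"
  using bclinearD(7)[OF assms(1)] onorm_bound[OF assms(2)]
  by (meson mult_right_mono norm_ge_zero order_trans)

lemma adjoint_bound:
  assumes f: "bclinear f" and e: "0 \<le> e" and b: "\<And>x. norm (f x) \<le> e * norm x"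
  shows "norm (adj f y) \<le> e * norm y"
proof -
  have "onorm (adj f) \<le> e" using onorm_adjoint_le[OF f] onorm_bound[OF e b] by simp
  then show ?thesis using onorm_le_iff[OF adj(1)[OF f] e] by blast
qed

lemma compact_adjoint:
  assumes f: "compact_operator f" shows "compact_operator (adj f)"
proof (rule compact_limit)
  note F = compact_operatorD(1)[OF f]
  show "bclinear (adj f)" by (rule adj(1)[OF F])
  fix e :: real assume e: "e > 0"
  obtain B where B: "finite B" "orthonormal_on (\<lambda>b. b) B"
    "\<And>x. norm (f x - partial_isometry (\<lambda>b. b) (\<lambda>b. b) B (f x)) \<le> e * norm x"
    using compact_finite_rank_approx[OF f e] by blast
  let ?P = "partial_isometry (\<lambda>b. b) (\<lambda>b. b) B"
  note P = oprojD(1)[OF oproj_span[OF B(2)]]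
  have PF: "bclinear (?P \<circ> f)" by (rule bclinear_compose[OF P F])
  have eq: "adj (\<lambda>x. f x - (?P \<circ> f) x) =
      (\<lambda>x. adj f x - (adj f \<circ> ?P) x)"
    using adjoint_diff[OF F PF] adjoint_compose[OF P F] adjoint_partial_isometry[OF B(2) B(2)] by simp
  have "norm (adj f y - (adj f \<circ> ?P) y) \<le> e" if y: "norm y \<le> 1" for y
  proof -
    have "norm (adj (\<lambda>x. f x - (?P \<circ> f) x) y) \<le> e * norm y"
      by (rule adjoint_bound[OF bclinear_diff[OF F PF]]) (use e B(3) in auto)
    also have "\<dots> \<le> e" using y e by simp
    finally show ?thesis unfolding eq .
  qed
  moreover have "compact_operator (adj f \<circ> ?P)"
    by (rule compact_compose_left[OF adj(1)[OF F] compact_finite_partial_isometry[OF B(1)]])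
  ultimately show "\<exists>g. compact_operator g \<and> (\<forall>x. norm x \<le> 1 --> norm (adj f x - g x) \<le> e)"
    by blast
qed

lemma finite_large_coeffs:
  assumes u: "orthonormal_on u I" and d: "d > 0"
  shows "finite {i\<in>I. cmod (cinner x (u i)) \<ge> d}"
proof (rule ccontr)
  assume inf: "infinite {i\<in>I. cmod (cinner x (u i)) \<ge> d}"
  obtain n :: nat where n: "(norm x)^2 / d^2 < real n" using reals_Archimedean2 by blast
  obtain F where F: "F \<subseteq> {i\<in>I. cmod (cinner x (u i)) \<ge> d}" "finite F" "card F = n"
    using infinite_arbitrarily_large[OF inf] by blast
  have "real n * d^2 = (\<Sum>i\<in>F. d^2)" using F(3) by simp
  also have "\<dots> \<le> (\<Sum>i\<in>F. (cmod (cinner x (u i)))^2)"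
    by (rule sum_mono) (use F(1) d in \<open>auto intro!: power_mono\<close>)
  also have "\<dots> \<le> (norm x)^2"
    by (rule Bessel_finite[OF orthonormal_on_subset[OF u] F(2)]) (use F(1) in auto)
  finally show False using n d by (simp add: divide_less_eq)
qed

text \<open>If \<open>f (u i)\<close> is large and close to a point \<open>y\<close> of a finite net, then \<open>u i\<close> has a large
  coefficient in \<open>f\<^sup>* y\<close>, which by Bessel's inequality happens for finitely many \<open>i\<close> only.\<close>

lemma compact_finite_large:
  assumes f: "compact_operator f" and u: "orthonormal_on u I" and e: "e > 0"
  shows "finite {i\<in>I. norm (f (u i)) \<ge> e}"
proof -
  note F = compact_operatorD(1)[OF f]
  obtain k where k: "finite k" "\<forall>x. norm x \<le> 1 --> (\<exists>y\<in>k. norm (f x - y) < e/2)"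
    using compact_operatorD(2)[OF f, of "e/2"] e by auto
  have "{i\<in>I. norm (f (u i)) \<ge> e} \<subseteq> (\<Union>y\<in>k. {i\<in>I. cmod (cinner (adj f y) (u i)) \<ge> e^2 / 2})"
  proof
    fix i assume "i \<in> {i\<in>I. norm (f (u i)) \<ge> e}"
    then have i: "i \<in> I" "norm (f (u i)) \<ge> e" by auto
    let ?z = "f (u i)"
    obtain y where y: "y \<in> k" "norm (?z - y) < e/2"
      using k(2) orthonormal_onD(2)[OF u i(1)] by (metis order_refl)
    have "(norm ?z)^2 = cmod (cinner ?z ?z)" by (simp add: cinner_self norm_power)
    also have "cinner ?z ?z = cinner y ?z + cinner (?z - y) ?z" by (simp add: cinner_diff_left)
    also have "cmod \<dots> \<le> cmod (cinner y ?z) + norm (?z - y) * norm ?z"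
      using norm_triangle_ineq[of "cinner y ?z" "cinner (?z - y) ?z"]
	Cauchy_Schwarz_cinner[of "?z - y" ?z] by simp
    also have "norm (?z - y) * norm ?z \<le> e/2 * norm ?z"
      using y(2) by (intro mult_right_mono) auto
    finally have "norm ?z * (norm ?z - e/2) \<le> cmod (cinner y ?z)"
      by (simp add: power2_eq_square algebra_simps)
    moreover have "e * (e/2) \<le> norm ?z * (norm ?z - e/2)"
      using i(2) e by (intro mult_mono) auto
    ultimately have "e^2 / 2 \<le> cmod (cinner (adj f y) (u i))"
      using cinner_adjoint(2)[OF F, of y "u i"] by (simp add: power2_eq_square)
    then show "i \<in> (\<Union>y\<in>k. {i\<in>I. cmod (cinner (adj f y) (u i)) \<ge> e^2 / 2})"
      using y(1) i(1) by blast
  qed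
  moreover have "finite (\<Union>y\<in>k. {i\<in>I. cmod (cinner (adj f y) (u i)) \<ge> e^2 / 2})"
    using k(1) finite_large_coeffs[OF u, of "e^2 / 2"] e by simp
  ultimately show ?thesis by (rule finite_subset)
qed

section \<open>Operators of small rank\<close>

text \<open>\<open>S\<close> covers \<open>f\<close> when the range of \<open>f\<close> lies in the closed subspace spanned by \<open>S\<close>.\<close>

definition covers :: "'a::complex_hilbert_space set => ('b => 'a) => bool" where
  "covers S f \<longleftrightarrow> (\<forall>y. (\<forall>s\<in>S. cinner s y = 0) --> (\<forall>x. cinner (f x) y = 0))"

lemma covers_mono: "covers S f ==> S \<subseteq> T ==> covers T f"
  unfolding covers_def by blast

lemma covers_add: "covers S f ==> covers T g ==> covers (S \<union> T) (\<lambda>x. f x + g x)"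
  unfolding covers_def by (simp add: cinner_add_left)

lemma covers_compose_right: "covers S f ==> covers S (f \<circ> g)"
  unfolding covers_def by simp

lemma covers_compose_left:
  assumes "bclinear a" "covers S f" shows "covers (a ` S) (a \<circ> f)"
  using assms(2) cinner_adjoint(1)[OF assms(1)] unfolding covers_def by simp

text \<open>Finite nets of the image of the unit ball, for a sequence of errors that tends to 0, span a
  subspace whose closure contains the range.\<close>

lemma compact_countable_cover:
  fixes f :: "'b::complex_hilbert_space => 'a::complex_hilbert_space"
  assumes f: "compact_operator f"
  shows "\<exists>S. countable S \<and> covers S f"
proof -
  have "\<exists>k. finite k \<and> (\<forall>x. norm x \<le> 1 --> (\<exists>y\<in>k. norm (f x - y) < 1 / Suc n))" for n
    by (rule compact_operatorD(2)[OF f]) simp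
  then obtain k where k: "\<And>n. finite (k n)"
    "\<And>n x. norm x \<le> 1 ==> \<exists>y\<in>k n. norm (f x - y) < 1 / Suc n" by metis
  have "covers (\<Union>n. k n) f"
    unfolding covers_def
  proof (intro allI impI)
    fix y x assume y: "\<forall>s\<in>(\<Union>n. k n). cinner s y = 0"
    define g where "g = (\<lambda>x. cinner x y *C y) \<circ> f"
    have g: "bclinear g" unfolding g_def
      by (rule bclinear_compose[OF compact_operatorD(1)[OF compact_rank_one]
	    compact_operatorD(1)[OF f]])
    have "norm (g x) \<le> (norm y * norm y) * inverse (real (Suc n)) * norm x" for n
    proof (rule bclinear_ball_bound[OF g])
      fix x :: 'b assume "norm x \<le> 1"
      then obtain s where s: "s \<in> k n" "norm (f x - s) < 1 / Suc n" using k(2) by blast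
      have "cinner (f x) y = cinner (f x - s) y" using y s(1) by (auto simp: cinner_diff_left)
      then have "cmod (cinner (f x) y) \<le> norm (f x - s) * norm y"
	using Cauchy_Schwarz_cinner by metis
      also have "\<dots> \<le> 1 / Suc n * norm y" using s(2) by (intro mult_right_mono) auto
      finally have "cmod (cinner (f x) y) * norm y \<le> 1 / Suc n * norm y * norm y"
	by (rule mult_right_mono) simp
      then show "norm (g x) \<le> (norm y * norm y) * inverse (real (Suc n))"
	by (simp add: g_def divide_inverse mult_ac)
    qed
    then have "norm (g x) \<le> (norm y * norm y * norm x) * inverse (real (Suc n))" for n
      by (simp add: mult_ac)
    moreover have "(\<lambda>n. (norm y * norm y * norm x) * inverse (real (Suc n))) \<longlonglongrightarrow> 0"
      by (rule tendsto_mult_right_zero[OF LIMSEQ_inverse_real_of_nat])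
    ultimately have "norm (g x) \<le> 0" by (intro LIMSEQ_le_const) auto
    then have "cinner (f x) y = 0 \<or> norm y = 0" by (auto simp: g_def mult_le_0_iff)
    then show "cinner (f x) y = 0" by auto
  qed
  moreover have "countable (\<Union>n. k n)" using k(1) by (simp add: countable_finite)
  ultimately show ?thesis by blast
qed

lemma countable_ordLeq_infinite: "countable A ==> infinite B ==> |A| \<le>o |B|"
proof -
  assume "countable A" "infinite B"
  then obtain f :: "'a => nat" where f: "inj_on f A" by (auto simp: countable_def)
  obtain g :: "nat => 'b" where g: "inj g" "range g \<subseteq> B" using infinite_countable_subset[OF \<open>infinite B\<close>] by blast
  have "inj_on (g \<circ> f) A" "(g \<circ> f) ` A \<subseteq> B"
    using f g by (auto intro!: comp_inj_on inj_on_subset[OF g(1)])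
  then show ?thesis using card_of_ordLeq by blast
qed

text \<open>Each vector of \<open>S\<close> is orthogonal to all but countably many elements of \<open>C\<close>.\<close>

lemma orthonormal_card_le:
  assumes C: "orthonormal_on (\<lambda>c. c) C" and S: "infinite S"
    and cov: "\<And>c. c \<in> C ==> \<exists>s\<in>S. cinner s c \<noteq> 0"
  shows "|C| \<le>o |S|"
proof -
  have "|\<Union>s\<in>S. {c\<in>C. cinner s c \<noteq> 0}| \<le>o |S|"
  proof (rule card_of_UNION_ordLeq_infinite[OF S])
    show "|S| \<le>o |S|" by (rule card_of_mono1) simp
    show "\<forall>s\<in>S. |{c\<in>C. cinner s c \<noteq> 0}| \<le>o |S|"
      using countable_nonorthogonal[OF C] countable_ordLeq_infinite[OF _ S] by blast
  qed
  moreover have "C \<subseteq> (\<Union>s\<in>S. {c\<in>C. cinner s c \<noteq> 0})" using cov by blast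
  ultimately show ?thesis using card_of_mono1 ordLeq_transitive by blast
qed

text \<open>The operators of rank less than \<open>|L|\<close>. The compact operators take the place of the
  finite rank operators for the first infinite cardinal.\<close>

definition small :: "'l set => ('a::complex_hilbert_space => 'a) => bool" where
  "small L f \<longleftrightarrow> bclinear f \<and>
     (compact_operator f \<or> (\<exists>S. infinite S \<and> |S| <o |L| \<and> covers S f))"

lemma small_bounded: "small L f ==> bclinear f"
  by (simp add: small_def)

lemma small_compact: "compact_operator f ==> small L f"
  using compact_operatorD(1) by (auto simp: small_def)

lemma small_cover:
  "bclinear f ==> infinite S ==> |S| <o |L| ==> covers S f ==> small L f"
  by (auto simp: small_def)

lemma small_add:
  fixes f g :: "'a::complex_hilbert_space => 'a" and L :: "'l set"
  assumes L: "infinite L" and f: "small L f" and g: "small L g"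
  shows "small L (\<lambda>x. f x + g x)"
proof -
  have b: "bclinear (\<lambda>x. f x + g x)"
    using f g by (simp add: small_def bclinear_add)
  have mixed: "\<exists>S. infinite S \<and> |S| <o |L| \<and> covers S (\<lambda>x. p x + q x)"
    if p: "compact_operator p" and T: "infinite T" "|T| <o |L|" "covers T q" for p q :: "'a => 'a" and T
  proof -
    obtain S where S: "countable S" "covers S p" using compact_countable_cover[OF p] by blast
    have "|S| \<le>o |T|" by (rule countable_ordLeq_infinite[OF S(1) T(1)])
    then have "|S| <o |L|" using T(2) by (rule ordLeq_ordLess_trans)
    then have "|S \<union> T| <o |L|" by (rule card_of_Un_ordLess_infinite[OF L _ T(2)])
    then show ?thesis using covers_add[OF S(2) T(3)] T(1) by blast
  qed
  consider "compact_operator f" "compact_operator g"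
    | T where "compact_operator f" "infinite T" "|T| <o |L|" "covers T g"
    | T where "compact_operator g" "infinite T" "|T| <o |L|" "covers T f"
    | S T where "infinite S" "|S| <o |L|" "covers S f" "infinite T" "|T| <o |L|" "covers T g"
    using f g unfolding small_def by blast
  then show ?thesis
  proof cases
    case 1
    then show ?thesis using compact_add small_compact by blast
  next
    case 2
    then show ?thesis using mixed b unfolding small_def by blast
  next
    case 3
    then have "\<exists>S. infinite S \<and> |S| <o |L| \<and> covers S (\<lambda>x. g x + f x)" using mixed by blast
    then show ?thesis using b unfolding small_def by (simp add: add.commute)
  next
    case 4
    have "|S \<union> T| <o |L|" by (rule card_of_Un_ordLess_infinite[OF L 4(2,5)])
    then show ?thesis using covers_add[OF 4(3,6)] 4(1) b unfolding small_def by blast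
  qed
qed

lemma small_compose_right:
  assumes f: "small L f" and a: "bclinear a" shows "small L (f \<circ> a)"
  using f covers_compose_right compact_compose_right[OF a] bclinear_compose[OF _ a]
  unfolding small_def by blast

lemma small_compose_left:
  assumes f: "small L f" and a: "bclinear a" shows "small L (a \<circ> f)"
proof -
  have b: "bclinear (a \<circ> f)" using small_bounded[OF f] bclinear_compose[OF a] by blast
  consider "compact_operator f" | S where "infinite S" "|S| <o |L|" "covers S f"
    using f unfolding small_def by blast
  then show ?thesis
  proof cases
    case 1
    then show ?thesis using compact_compose_left[OF a] small_compact by blast
  next
    case 2
    have "covers (a ` S \<union> S) (a \<circ> f)"
      using covers_mono[OF covers_compose_left[OF a 2(3)]] by blast
    moreover have "|a ` S \<union> S| <o |L|"
    proof (rule card_of_Un_ordLess_infinite)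
      show "infinite L" using 2(1,2) card_of_ordLeq_infinite ordLess_imp_ordLeq by blast
      show "|a ` S| <o |L|" using card_of_image 2(2) by (rule ordLeq_ordLess_trans)
    qed (rule 2(2))
    ultimately show ?thesis using 2(1) b by (intro small_cover[of _ "a ` S \<union> S"]) auto
  qed
qed

lemma small_nearly_orthogonal:
  assumes f: "small L f" and C: "orthonormal_on (\<lambda>c. c) C" and L: "infinite L" "|L| \<le>o |C|"
    and e: "e > 0"
  shows "\<exists>c\<in>C. cmod (cinner (f c) c) < e"
proof -
  have infC: "infinite C" using L card_of_ordLeq_infinite by blast
  consider "compact_operator f" | S where "infinite S" "|S| <o |L|" "covers S f"
    using f unfolding small_def by blast
  then show ?thesis
  proof cases
    case 1
    have "finite {c\<in>C. norm (f c) \<ge> e}" using compact_finite_large[OF 1 C e] by simp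
    then have "C - {c\<in>C. norm (f c) \<ge> e} \<noteq> {}" using infC by (metis finite.emptyI finite_Diff2)
    then obtain c where c: "c \<in> C" "norm (f c) < e" by force
    have "cmod (cinner (f c) c) \<le> norm (f c) * norm c" by (rule Cauchy_Schwarz_cinner)
    then show ?thesis using c orthonormal_onD(2)[OF C c(1)] by (intro bexI[of _ c]) auto
  next
    case 2
    have "\<exists>c\<in>C. \<forall>s\<in>S. cinner s c = 0"
    proof (rule ccontr)
      assume "\<not> (\<exists>c\<in>C. \<forall>s\<in>S. cinner s c = 0)"
      then have "|C| \<le>o |S|" by (intro orthonormal_card_le[OF C 2(1)]) blast
      then have "|C| <o |C|" using 2(2) L(2) ordLeq_ordLess_trans ordLess_ordLeq_trans by blast
      then show False using ordLess_irreflexive by blast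
    qed
    then obtain c where c: "c \<in> C" "\<forall>s\<in>S. cinner s c = 0" by blast
    then have "cinner (f c) c = 0" using 2(3) unfolding covers_def by blast
    then show ?thesis using c(1) e by (intro bexI[of _ c]) simp_all
  qed
qed

text \<open>The projection onto the closed span of \<open>Z\<close>, obtained as the complement of the projection onto
  the vectors orthogonal to \<open>Z\<close>.\<close>

lemma small_projection_containing:
  assumes Z: "|Z| <o |L|" and L: "infinite L"
  shows "\<exists>P. oproj P \<and> small L P \<and> (\<forall>z\<in>Z. P z = (z :: 'a::complex_hilbert_space))"
proof (cases "finite Z")
  case True
  then obtain B where "finite B" "orthonormal_on (\<lambda>b. b) B"
    "\<forall>s\<in>Z. partial_isometry (\<lambda>b. b) (\<lambda>b. b) B s = s" using Gram_Schmidt by blast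
  then show ?thesis using oproj_span small_compact compact_finite_partial_isometry by blast
next
  case False
  define M where "M = {x. \<forall>z\<in>Z. cinner x z = 0}"
  have M: "csubspace M" by (auto simp: csubspace_def M_def cinner_add_left cinner_scaleC_left)
  have "closed {x. cinner x z = 0}" for z :: 'a
    by (intro closed_Collect_eq linear_continuous_on bounded_linear_cinner_left continuous_on_const)
  then have "closed (\<Inter>z\<in>Z. {x. cinner x z = 0})" by (intro closed_INT) auto
  moreover have "M = (\<Inter>z\<in>Z. {x. cinner x z = 0})" by (auto simp: M_def)
  ultimately have clM: "closed M" by simp
  obtain Q where Q: "oproj Q" "\<And>x. x \<in> M \<longleftrightarrow> Q x = x" "\<And>x. Q x \<in> M"
    by (rule ex_oproj[OF M clM]) blast
  let ?P = "\<lambda>x. x - Q x"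
  have P: "oproj ?P" by (rule oproj_complement[OF Q(1)])
  have "?P z = z" if "z \<in> Z" for z
  proof -
    have "cinner (Q z) (Q z) = cinner (Q (Q z)) z" using oprojD(3)[OF Q(1), of "Q z" z] by simp
    also have "\<dots> = 0" using Q(3) that by (simp add: M_def oprojD(2)[OF Q(1)])
    finally show ?thesis by simp
  qed
  moreover have "covers Z ?P"
    unfolding covers_def
  proof (intro allI impI)
    fix y x assume "\<forall>s\<in>Z. cinner s y = 0"
    then have "y \<in> M" by (simp add: M_def cinner_eq_0_commute[of y])
    then have "?P y = 0" using Q(2) by simp
    then show "cinner (x - Q x) y = 0" using oprojD(3)[OF P, of x y] by simp
  qed
  ultimately show ?thesis using P False Z oprojD(1)[OF P] small_cover by blast
qed

section \<open>Bounded below compact perturbations of operators near the identity are onto\<close>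

lemma closed_range_bounded_below:
  fixes f :: "'a::complex_hilbert_space => 'b::complex_hilbert_space"
  assumes f: "bclinear f" and c: "c > 0" "\<And>x. c * norm x \<le> norm (f x)"
  shows "csubspace (range f)" "closed (range f)"
proof -
  show "csubspace (range f)"
    unfolding csubspace_def using bclinearD(2,3,5)[OF f] by (auto simp: image_iff) metis+
  have "complete (f ` UNIV)"
    by (rule complete_isometric_image[OF c(1) _ bclinearD(1)[OF f]])
      (use c(2) in \<open>auto simp: complete_UNIV\<close>)
  then show "closed (range f)" by (rule complete_imp_closed)
qed

text \<open>Otherwise the ranges of the powers of \<open>u\<close> decrease strictly, and unit vectors of each
  range that are orthogonal to the next one are mapped by \<open>k\<close> to a uniformly separated
  sequence.\<close>

lemma bounded_below_surj:
  fixes u g k :: "'a::complex_hilbert_space => 'a"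
  assumes k: "compact_operator k" and u: "\<And>x. u x = g x + k x" and bu: "bclinear u"
    and g: "\<And>x. norm (g x - x) \<le> d * norm x" and d: "d < 1/2"
    and c: "c > 0" "\<And>x. c * norm x \<le> norm (u x)"
  shows "surj u"
proof (rule ccontr)
  assume "\<not> surj u"
  then obtain t where t: "t \<notin> range u" by blast
  have inj: "x = y" if "u x = u y" for x y
    using c(2)[of "x - y"] c(1) that by (simp add: bclinearD(4)[OF bu] mult_le_0_iff)
  have bpow: "bclinear (u ^^ n)" for n
    by (induction n) (use bclinear_compose[OF bu] in \<open>simp_all add: o_def id_def\<close>)
  have below: "c ^ n * norm x \<le> norm ((u ^^ n) x)" for n x
  proof (induction n)
    case (Suc n)
    have "c ^ Suc n * norm x \<le> c * norm ((u ^^ n) x)"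
      using mult_left_mono[OF Suc, of c] c(1) by (simp add: mult_ac)
    also have "\<dots> \<le> norm ((u ^^ Suc n) x)" using c(2) by simp
    finally show ?case .
  qed simp
  have injn: "x = y" if "(u ^^ n) x = (u ^^ n) y" for n x y
    using that inj by (induction n) auto
  have mono: "(u ^^ m) x \<in> range (u ^^ n)" if "n \<le> m" for n m x
  proof -
    have "(u ^^ m) x = (u ^^ n) ((u ^^ (m - n)) x)"
      using that funpow_add[of n "m - n" u] by simp
    then show ?thesis by simp
  qed
  have "\<exists>e. e \<in> range (u ^^ n) \<and> norm e = 1 \<and> (\<forall>y\<in>range (u ^^ Suc n). cinner y e = 0)" for n
  proof -
    note R = closed_range_bounded_below[OF bpow _ below]
    have cn: "c ^ Suc n > 0" "c ^ n > 0" using c(1) by simp_all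
    obtain P where P: "oproj P" "\<And>x. x \<in> range (u ^^ Suc n) \<longleftrightarrow> P x = x" "\<And>x. P x \<in> range (u ^^ Suc n)"
      by (rule ex_oproj[OF R[OF cn(1)]]) blast
    define r where "r = (u ^^ n) t - P ((u ^^ n) t)"
    have "r \<noteq> 0"
    proof
      assume "r = 0"
      then have "(u ^^ n) t \<in> range (u ^^ Suc n)" using P(3)[of "(u ^^ n) t"] by (simp add: r_def)
      then obtain s where "(u ^^ n) t = (u ^^ n) (u s)" by (auto simp: funpow_swap1)
      then have "t = u s" by (rule injn)
      then show False using t by blast
    qed
    have "P ((u ^^ n) t) \<in> range (u ^^ n)"
      using P(3)[of "(u ^^ n) t"] mono[of n "Suc n"] by auto
    then have rn: "r \<in> range (u ^^ n)"
      unfolding r_def using csubspace_minus[OF R(1)[OF cn(2)]] by blast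
    have orth: "cinner y r = 0" if "y \<in> range (u ^^ Suc n)" for y
      using oprojD(4)[OF P(1), of "(u ^^ n) t" y] that P(2)
      by (simp add: r_def cinner_eq_0_commute[of y])
    define e where "e = complex_of_real (1 / norm r) *C r"
    have "e \<in> range (u ^^ n)" using rn R(1)[OF cn(2)] unfolding e_def csubspace_def by blast
    moreover have "norm e = 1" using \<open>r \<noteq> 0\<close> by (simp add: e_def norm_divide)
    moreover have "cinner y e = 0" if "y \<in> range (u ^^ Suc n)" for y
      using orth[OF that] by (simp add: e_def cinner_scaleC_right)
    ultimately show ?thesis by blast
  qed
  then obtain e where e: "\<And>n. e n \<in> range (u ^^ n)" "\<And>n. norm (e n) = 1"
    "\<And>n y. y \<in> range (u ^^ Suc n) ==> cinner y (e n) = 0" by metis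
  have sep: "1 - 2 * d \<le> norm (k (e n) - k (e m))" if nm: "n < m" for n m
  proof -
    define h where "h x = g x - x" for x
    have kk: "k x = u x - x - h x" for x by (simp add: u h_def)
    obtain p q where p: "e n = (u ^^ n) p" and q: "e m = (u ^^ m) q" using e(1) by (meson imageE)
    have z: "cinner (u (e n)) (e n) = 0" "cinner (u (e m)) (e n) = 0" "cinner (e m) (e n) = 0"
    proof -
      have "u (e n) \<in> range (u ^^ Suc n)" using mono[of "Suc n" "Suc n" p] by (simp add: p)
      then show "cinner (u (e n)) (e n) = 0" by (rule e(3))
      have "u (e m) \<in> range (u ^^ Suc n)" using mono[of "Suc n" "Suc m" q] nm by (simp add: q)
      then show "cinner (u (e m)) (e n) = 0" by (rule e(3))
      have "e m \<in> range (u ^^ Suc n)" using mono[of "Suc n" m q] nm by (simp add: q)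
      then show "cinner (e m) (e n) = 0" by (rule e(3))
    qed
    have one: "cinner (e n) (e n) = 1" using e(2) by (simp add: cinner_self)
    have "cinner (k (e n) - k (e m)) (e n) = - 1 - cinner (h (e n)) (e n) + cinner (h (e m)) (e n)"
      by (simp add: kk cinner_diff_left z one)
    then have eq: "1 = - cinner (k (e n) - k (e m)) (e n) - cinner (h (e n)) (e n)
	+ cinner (h (e m)) (e n)" by (simp add: algebra_simps)
    have hb: "cmod (cinner (h (e i)) (e n)) \<le> d" for i
      using Cauchy_Schwarz_cinner[of "h (e i)" "e n"] g[of "e i"] e(2) by (simp add: h_def)
    have kb: "cmod (cinner (k (e n) - k (e m)) (e n)) \<le> norm (k (e n) - k (e m))"
      using Cauchy_Schwarz_cinner[of "k (e n) - k (e m)" "e n"] e(2) by simp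
    have "1 = cmod (- cinner (k (e n) - k (e m)) (e n) - cinner (h (e n)) (e n)
	+ cinner (h (e m)) (e n))" by (simp add: eq[symmetric])
    also have "\<dots> \<le> cmod (cinner (k (e n) - k (e m)) (e n)) + cmod (cinner (h (e n)) (e n))
	+ cmod (cinner (h (e m)) (e n))"
      by (rule order_trans[OF norm_triangle_ineq add_right_mono[OF order_trans[OF norm_triangle_ineq4]]])
	simp
    finally show ?thesis using hb[of n] hb[of m] kb by simp
  qed
  obtain N where N: "finite N" "\<And>x. norm x \<le> 1 ==> \<exists>y\<in>N. norm (k x - y) < (1 - 2 * d) / 2"
    using compact_operatorD(2)[OF k, of "(1 - 2 * d) / 2"] d by auto
  have "\<exists>y. y \<in> N \<and> norm (k (e n) - y) < (1 - 2 * d) / 2" for n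
    using N(2)[of "e n"] e(2)[of n] by auto
  then obtain y where y: "\<And>n. y n \<in> N \<and> norm (k (e n) - y n) < (1 - 2 * d) / 2" by metis
  have "\<not> inj y" using N(1) y finite_imageD[of y UNIV] finite_subset[of "range y" N] by auto
  then obtain n m where "n < m" "y n = y m" by (metis injI linorder_neqE_nat)
  then have "norm (k (e n) - k (e m)) < 1 - 2 * d"
    using norm_triangle_ineq4[of "k (e n) - y n" "k (e m) - y m"] y[of n] y[of m] by simp
  then show False using sep[OF \<open>n < m\<close>] by simp
qed

section \<open>Projections modulo the compact operators lift to projections\<close>

definition compact_equal ::
  "('a::complex_hilbert_space => 'b::complex_hilbert_space) => ('a => 'b) => bool" where
  "compact_equal f g \<longleftrightarrow> compact_operator (\<lambda>x. f x - g x)"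

lemma compact_equal_refl [simp]: "compact_equal f f"
  by (simp add: compact_equal_def)

lemma compact_equal_sym: "compact_equal f g ==> compact_equal g f"
  unfolding compact_equal_def using compact_uminus[of "\<lambda>x. f x - g x"] by simp

lemma compact_equal_trans [trans]: "compact_equal f g ==> compact_equal g h ==> compact_equal f h"
  unfolding compact_equal_def using compact_add[of "\<lambda>x. f x - g x" "\<lambda>x. g x - h x"] by simp

lemma compact_equal_add:
  "compact_equal f f' ==> compact_equal g g' ==> compact_equal (\<lambda>x. f x + g x) (\<lambda>x. f' x + g' x)"
  unfolding compact_equal_def using compact_add[of "\<lambda>x. f x - f' x" "\<lambda>x. g x - g' x"]
  by (simp add: algebra_simps)

lemma compact_equal_scaleC: "compact_equal f g ==> compact_equal (\<lambda>x. c *C f x) (\<lambda>x. c *C g x)"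
  unfolding compact_equal_def using compact_scaleC[of "\<lambda>x. f x - g x" c] by (simp add: scaleC_diff_right)

lemma compact_equal_diff:
  "compact_equal f f' ==> compact_equal g g' ==> compact_equal (\<lambda>x. f x - g x) (\<lambda>x. f' x - g' x)"
  using compact_equal_add[OF _ compact_equal_scaleC[of g g' "-1"], of f f'] by simp

lemma compact_equal_compose:
  assumes f: "compact_equal f f'" and g: "compact_equal g g'"
    and b: "bclinear f" "bclinear g'"
  shows "compact_equal (f \<circ> g) (f' \<circ> g')"
proof -
  have "compact_operator (\<lambda>x. (f \<circ> (\<lambda>x. g x - g' x)) x + ((\<lambda>x. f x - f' x) \<circ> g') x)"
    using compact_compose_left[OF b(1) g[unfolded compact_equal_def]]
      compact_compose_right[OF b(2) f[unfolded compact_equal_def]] by (rule compact_add)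
  then show ?thesis unfolding compact_equal_def by (simp add: bclinearD(4)[OF b(1)])
qed

lemma compact_equal_adjoint:
  assumes "bclinear f" "bclinear g" "compact_equal f g"
  shows "compact_equal (adj f) (adj g)"
  using compact_adjoint[OF assms(3)[unfolded compact_equal_def]] adjoint_diff[OF assms(1,2)]
  unfolding compact_equal_def by simp

lemma compact_equal_zero: "compact_equal f (\<lambda>_. 0) \<longleftrightarrow> compact_operator f"
  by (simp add: compact_equal_def)

lemma adjoint_pair_self: "adjoint_pair f f ==> cinner (f x) y = cinner x (f y)"
  by (simp add: adjoint_pair_def)

text \<open>The Cauchy--Schwarz inequality for the positive form of \<open>T\<close>, in its simplest instance.\<close>

lemma positive_operator_bound:
  assumes T: "bclinear T" "adjoint_pair T T"
    and pos: "\<And>x. 0 \<le> Re (cinner (T x) x)" and m: "\<And>x. Re (cinner (T x) x) \<le> m * (norm x)^2"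
    and m0: "m > 0"
  shows "norm (T x) \<le> m * norm x"
proof -
  define t where "t = complex_of_real (1 / m)"
  note D = bclinearD[OF T(1)]
  have tt: "cnj t = t" "t * t = complex_of_real (1 / m^2)" by (simp_all add: t_def power2_eq_square)
  have cc: "cinner (T x) (T x) = complex_of_real ((norm (T x))^2)" by (rule cinner_self)
  have "cinner (T (x - t *C T x)) (x - t *C T x) =
      cinner (T x) x - t * cinner (T x) (T x) - t * cinner (T (T x)) x + t * t * cinner (T (T x)) (T x)"
    by (simp add: D(2,4) cinner_linear tt(1) algebra_simps)
  also have "cinner (T (T x)) x = cinner (T x) (T x)" using adjoint_pair_self[OF T(2)] .
  finally have "Re (cinner (T (x - t *C T x)) (x - t *C T x)) =
      Re (cinner (T x) x) - 2 * (norm (T x))^2 / m + Re (cinner (T (T x)) (T x)) / m^2"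
    unfolding tt cc by (simp add: t_def del: of_real_power)
  then have "0 \<le> Re (cinner (T x) x) - 2 * (norm (T x))^2 / m + Re (cinner (T (T x)) (T x)) / m^2"
    using pos[of "x - t *C T x"] by simp
  also have "\<dots> \<le> m * (norm x)^2 - 2 * (norm (T x))^2 / m + (m * (norm (T x))^2) / m^2"
    using m[of x] m[of "T x"] m0 by (intro add_mono diff_mono divide_right_mono) auto
  also have "\<dots> = m * (norm x)^2 - (norm (T x))^2 / m"
    using m0 by (simp add: power2_eq_square field_simps)
  finally have "(norm (T x))^2 \<le> (m * norm x)^2"
    using m0 by (simp add: divide_le_eq power_mult_distrib power2_eq_square mult_ac)
  then show ?thesis by (rule power2_le_imp_le) (use m0 in simp)
qed

text \<open>Newton's iteration for the sign of a self-adjoint operator. With \<open>e = 1 - y^2\<close> one step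
  replaces \<open>e\<close> by \<open>(3 e^2 + e\<^sup>3) / 4\<close>.\<close>

definition sign_step :: "('a::complex_hilbert_space => 'a) => 'a => 'a" where
  "sign_step y x = (3/2) *C y x - (1/2) *C y (y (y x))"

lemma bclinear_sign_step: "bclinear y ==> bclinear (sign_step y)"
proof -
  assume y: "bclinear y"
  have "sign_step y = (\<lambda>x. (3/2) *C y x - (1/2) *C (y \<circ> (y \<circ> y)) x)"
    by (simp add: sign_step_def fun_eq_iff)
  then show ?thesis using y by (simp add: bclinear_intros del: comp_apply)
qed

lemma adjoint_pair_sign_step:
  assumes y: "adjoint_pair y y" shows "adjoint_pair (sign_step y) (sign_step y)"
  unfolding adjoint_pair_def sign_step_def
  using adjoint_pair_self[OF y] by (simp add: cinner_linear)

lemma sign_step_defect: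
  assumes y: "bclinear y" and q: "\<And>x. norm (x - y (y x)) \<le> q * norm x" "0 \<le> q" "q \<le> 1"
  shows "norm (x - sign_step y (sign_step y x)) \<le> q^2 * norm x"
proof -
  note D = bclinearD[OF y]
  define e where "e x = x - y (y x)" for x
  have cs: "(a + b) *C z = a *C z + b *C z" for a b and z :: 'a by (rule scaleC_add_left)
  have "4 *C (x - sign_step y (sign_step y x)) = 3 *C e (e x) + e (e (e x))"
  proof -
    define y2 y4 y6 where "y2 = y (y x)" and "y4 = y (y y2)" and "y6 = y (y y4)"
    have 1: "4 *C (x - sign_step y (sign_step y x)) = 4 *C x - 9 *C y2 + 6 *C y4 - y6"
      unfolding sign_step_def y2_def y4_def y6_def
      by (simp add: D(2,3,4) scaleC_diff_right scaleC_add_right scaleC_scaleC)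
	(simp add: scaleC_add_left[symmetric] algebra_simps)
    have e1: "e x = x - y2" by (simp add: e_def y2_def)
    have e2: "e (e x) = x - y2 - y2 + y4"
      unfolding e1 by (simp add: e_def D(4) y2_def[symmetric] y4_def[symmetric])
    have e3: "e (e (e x)) = x - y2 - y2 - y2 + y4 + y4 + y4 - y6"
      unfolding e2 by (simp add: e_def D(3,4) y2_def[symmetric] y4_def[symmetric] y6_def[symmetric])
    have num: "2 *C z = z + z" "3 *C z = z + z + z" "4 *C z = z + z + z + z"
      "6 *C z = z + z + z + z + z + z" "9 *C z = z + z + z + z + z + z + z + z + z" for z :: 'a
      using cs[of 1 1 z] cs[of 2 1 z] cs[of 3 1 z] cs[of 3 3 z] cs[of 6 3 z] by simp_all
    show ?thesis unfolding 1 e3 unfolding e2 num by (simp add: algebra_simps)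
  qed
  then have "4 * norm (x - sign_step y (sign_step y x)) = norm (3 *C e (e x) + e (e (e x)))"
    using norm_scaleC[of 4 "x - sign_step y (sign_step y x)"] by simp
  also have "\<dots> \<le> 3 * norm (e (e x)) + norm (e (e (e x)))"
    using norm_triangle_ineq[of "3 *C e (e x)" "e (e (e x))"] by simp
  also have "norm (e (e (e x))) \<le> 1 * norm (e (e x))"
    using q(1)[of "e (e x)"] mult_right_mono[OF q(3), of "norm (e (e x))"] by (simp add: e_def)
  finally have "norm (x - sign_step y (sign_step y x)) \<le> norm (e (e x))" by simp
  also have "\<dots> \<le> q * norm (e x)" using q(1)[of "e x"] by (simp add: e_def)
  also have "\<dots> \<le> q * (q * norm x)" using q(1)[of x] q(2) by (intro mult_left_mono) (auto simp: e_def)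
  finally show ?thesis by (simp add: power2_eq_square)
qed

lemma bclinear_pointwise_limit:
  assumes y: "\<And>n. bclinear (y n)" and K: "\<And>n x. norm (y n x) \<le> K * norm x"
    and lim: "\<And>x. (\<lambda>n. y n x) \<longlonglongrightarrow> s x"
  shows "bclinear s"
proof (rule bclinearI)
  show "s (x + z) = s x + s z" for x z
    using LIMSEQ_unique[OF lim[of "x + z"]] tendsto_add[OF lim[of x] lim[of z]]
    by (simp add: bclinearD(3)[OF y])
  show "s (c *C x) = c *C s x" for c x
    using LIMSEQ_unique[OF lim[of "c *C x"]] bounded_linear.tendsto[OF scaleC_right_linear lim[of x], of c]
    by (simp add: bclinearD(2)[OF y])
  show "norm (s x) \<le> K * norm x" for x
    by (rule LIMSEQ_le_const2[OF tendsto_norm[OF lim]]) (use K in blast)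
qed

text \<open>A bound for the defect \<open>1 - y^2\<close> is squared in every step, so the iteration converges uniformly, to a
  symmetry.\<close>

lemma sign_iteration_converges:
  fixes y :: "nat => 'a::complex_hilbert_space => 'a"
  assumes y0: "bclinear (y 0)" "adjoint_pair (y 0) (y 0)"
    and step: "\<And>n. y (Suc n) = sign_step (y n)"
    and q: "\<And>x. norm (x - y 0 (y 0 x)) \<le> q * norm x" "0 \<le> q" "q < 1"
  shows "\<exists>s. bclinear s \<and> adjoint_pair s s \<and> (\<forall>x. s (s x) = x) \<and>
    (\<forall>n x. norm (s x - y n x) \<le> q ^ Suc n / (1 - q) * norm x)"
proof -
  have b: "bclinear (y n)" and a: "adjoint_pair (y n) (y n)" for n
    using y0 by (induction n) (simp_all add: step bclinear_sign_step adjoint_pair_sign_step)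
  have defect: "norm (x - y n (y n x)) \<le> q ^ Suc n * norm x" for n x
  proof (induction n arbitrary: x)
    case 0
    then show ?case using q by simp
  next
    case (Suc n)
    have le1: "q ^ Suc n \<le> 1" using q by (intro power_le_one) auto
    have "norm (x - y (Suc n) (y (Suc n) x)) \<le> (q ^ Suc n)^2 * norm x"
      unfolding step by (rule sign_step_defect[OF b Suc]) (use q le1 in auto)
    also have "(q ^ Suc n)^2 \<le> q ^ Suc (Suc n)"
      unfolding power_mult[symmetric] using q by (intro power_decreasing) auto
    finally show ?case by (simp add: mult_right_mono)
  qed
  have bound: "norm (y n x) \<le> 2 * norm x" for n x
  proof -
    have le1: "q ^ Suc n \<le> 1" using q by (intro power_le_one) auto
    have "complex_of_real ((norm (y n x))^2) = cinner (y n (y n x)) x"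
      using adjoint_pair_self[OF a, of n "y n x" x] by (simp add: cinner_self)
    then have "(norm (y n x))^2 = cmod (cinner (y n (y n x)) x)"
      by (metis norm_of_real abs_of_nonneg zero_le_power2)
    also have "\<dots> \<le> norm (y n (y n x)) * norm x" by (rule Cauchy_Schwarz_cinner)
    also have "norm (y n (y n x)) \<le> norm x + norm (x - y n (y n x))"
      using norm_triangle_ineq4[of x "x - y n (y n x)"] by simp
    also have "\<dots> \<le> norm x + 1 * norm x"
      using defect[of x n] mult_right_mono[OF le1, of "norm x"] by simp
    finally have "(norm (y n x))^2 \<le> 2 * (norm x)^2" by (simp add: power2_eq_square mult_right_mono)
    also have "\<dots> \<le> (2 * norm x)^2" by (simp add: power_mult_distrib)
    finally show ?thesis by (rule power2_le_imp_le) simp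
  qed
  have diff: "norm (y (Suc n) x - y n x) \<le> q ^ Suc n * norm x" for n x
  proof -
    have "y (Suc n) x - y n x = (1/2) *C y n (x - y n (y n x))"
    proof -
      have "(3/2) *C z = z + (1/2) *C z" for z :: 'a
	using scaleC_add_left[of 1 "1/2" z] by simp
      then show ?thesis
	by (simp add: step sign_step_def bclinearD(4)[OF b] scaleC_diff_right)
    qed
    then have "norm (y (Suc n) x - y n x) = norm (y n (x - y n (y n x))) / 2" by simp
    also have "\<dots> \<le> norm (x - y n (y n x))" using bound[of n "x - y n (y n x)"] by simp
    finally show ?thesis using defect[of x n] by simp
  qed
  have far: "norm (y m x - y n x) \<le> (q ^ Suc n - q ^ Suc m) / (1 - q) * norm x" if "n \<le> m" for n m x
    using that
  proof (induction m rule: dec_induct)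
    case (step m)
    have "norm (y (Suc m) x - y n x) \<le> norm (y (Suc m) x - y m x) + norm (y m x - y n x)"
      using norm_triangle_ineq[of "y (Suc m) x - y m x" "y m x - y n x"] by simp
    also have "\<dots> \<le> q ^ Suc m * norm x + (q ^ Suc n - q ^ Suc m) / (1 - q) * norm x"
      using diff step.IH by (intro add_mono) auto
    also have "\<dots> = (q ^ Suc n - q ^ Suc (Suc m)) / (1 - q) * norm x"
      using q(3) by (simp add: field_simps)
    finally show ?case .
  qed simp
  have far': "norm (y m x - y n x) \<le> q ^ Suc n / (1 - q) * norm x" if "n \<le> m" for n m x
  proof -
    have "(q ^ Suc n - q ^ Suc m) / (1 - q) \<le> q ^ Suc n / (1 - q)"
      using q by (intro divide_right_mono) auto
    then show ?thesis using far[OF that, of x] mult_right_mono[of _ _ "norm x"]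
      by (meson norm_ge_zero order_trans)
  qed
  have small: "(\<lambda>n. q ^ Suc n / (1 - q) * norm x) \<longlonglongrightarrow> 0" for x :: 'a
    by (intro tendsto_mult_left_zero tendsto_divide_zero LIMSEQ_Suc LIMSEQ_power_zero)
      (use q in simp)
  have "Cauchy (\<lambda>n. y n x)" for x
  proof (rule CauchyI)
    fix r :: real assume "r > 0"
    then have "\<forall>\<^sub>F n in sequentially. q ^ Suc n / (1 - q) * norm x < r / 2"
      using small by (intro order_tendstoD(2)) auto
    then obtain N where N: "q ^ Suc N / (1 - q) * norm x < r / 2"
      unfolding eventually_sequentially by blast
    have "norm (y m x - y n x) < r" if "N \<le> m" "N \<le> n" for m n
      using far'[OF that(1), of x] far'[OF that(2), of x] N
	norm_triangle_ineq4[of "y m x - y N x" "y n x - y N x"]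
      unfolding diff_diff_eq2 diff_add_cancel by linarith
    then show "\<exists>M. \<forall>m\<ge>M. \<forall>n\<ge>M. norm (y m x - y n x) < r" by blast
  qed
  then have "\<exists>l. (\<lambda>n. y n x) \<longlonglongrightarrow> l" for x using Cauchy_convergent by (auto simp: convergent_def)
  then obtain s where s: "\<And>x. (\<lambda>n. y n x) \<longlonglongrightarrow> s x" by metis
  have bs: "bclinear s" by (rule bclinear_pointwise_limit[OF b bound s])
  have lim1: "(\<lambda>n. cinner (y n x) z) \<longlonglongrightarrow> cinner (s x) z" for x z
    by (rule bounded_linear.tendsto[OF bounded_linear_cinner_left s])
  have lim2: "(\<lambda>n. cinner x (y n z)) \<longlonglongrightarrow> cinner x (s z)" for x z
    by (rule bounded_linear.tendsto[OF bounded_linear_cinner_right s])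
  have as: "adjoint_pair s s"
    unfolding adjoint_pair_def
    using LIMSEQ_unique[OF lim1] lim2 adjoint_pair_self[OF a] by simp
  have "s (s x) = x" for x
  proof -
    have "y n (s x) = s (y n x)" for n x
    proof -
      have com: "y n (y m x) = y m (y n x)" for m x
      proof (induction m arbitrary: x)
	case 0
	show ?case
	proof (induction n arbitrary: x)
	  case (Suc n)
	  then show ?case
	    by (simp add: step sign_step_def bclinearD(2,4)[OF b])
	qed simp
      next
	case (Suc m)
	then show ?case
	  by (simp add: step sign_step_def bclinearD(2,4)[OF b])
      qed
      have "(\<lambda>m. y n (y m x)) \<longlonglongrightarrow> y n (s x)"
	by (rule bounded_linear.tendsto[OF bclinearD(1)[OF b] s])
      then show ?thesis using LIMSEQ_unique s[of "y n x"] by (simp add: com)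
    qed
    then have "(\<lambda>n. y n (s x)) \<longlonglongrightarrow> s (s x)"
      using s[of "s x"] by simp
    have "(\<lambda>n. s (y n x) - y n (y n x)) \<longlonglongrightarrow> 0"
    proof (rule Lim_null_comparison)
      show "\<forall>\<^sub>F n in sequentially. norm (s (y n x) - y n (y n x)) \<le> q ^ Suc n / (1 - q) * (2 * norm x)"
      proof (rule always_eventually, rule allI)
	fix n
	have "norm (s (y n x) - y n (y n x)) \<le> q ^ Suc n / (1 - q) * norm (y n x)"
	  by (rule LIMSEQ_le_const2[OF tendsto_norm[OF tendsto_diff[OF s tendsto_const]]])
	    (use far' in blast)
	also have "\<dots> \<le> q ^ Suc n / (1 - q) * (2 * norm x)"
	  using q bound by (intro mult_left_mono) auto
	finally show "norm (s (y n x) - y n (y n x)) \<le> q ^ Suc n / (1 - q) * (2 * norm x)" .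
      qed
      show "(\<lambda>n. q ^ Suc n / (1 - q) * (2 * norm x)) \<longlonglongrightarrow> 0"
	using tendsto_mult_right_zero[OF small[of x], of 2] by (simp add: mult_ac)
    qed
    moreover have "(\<lambda>n. s (y n x)) \<longlonglongrightarrow> s (s x)"
      by (rule bounded_linear.tendsto[OF bclinearD(1)[OF bs] s])
    ultimately have 1: "(\<lambda>n. y n (y n x)) \<longlonglongrightarrow> s (s x)"
      using tendsto_diff[of "\<lambda>n. s (y n x)" "s (s x)" sequentially "\<lambda>n. s (y n x) - y n (y n x)" 0] by simp
    have "(\<lambda>n. x - y n (y n x)) \<longlonglongrightarrow> 0"
    proof (rule Lim_null_comparison)
      show "\<forall>\<^sub>F n in sequentially. norm (x - y n (y n x)) \<le> q ^ Suc n * norm x"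
	using defect by (intro always_eventually) blast
      show "(\<lambda>n. q ^ Suc n * norm x) \<longlonglongrightarrow> 0"
	by (intro tendsto_mult_left_zero LIMSEQ_Suc LIMSEQ_power_zero) (use q in simp)
    qed
    then have "(\<lambda>n. y n (y n x)) \<longlonglongrightarrow> x"
      using tendsto_diff[OF tendsto_const[of x], of "\<lambda>n. x - y n (y n x)" 0 sequentially] by simp
    then show ?thesis using 1 LIMSEQ_unique by blast
  qed
  moreover have "norm (s x - y n x) \<le> q ^ Suc n / (1 - q) * norm x" for n x
    by (rule LIMSEQ_le_const2[OF tendsto_norm[OF tendsto_diff[OF s tendsto_const]]])
      (use far' in blast)
  ultimately show ?thesis using bs as by blast
qed

text \<open>Otherwise there are unit vectors whose images tend to 0. Since \<open>b^2 - 1\<close> is compact, a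
  subsequence of them converges, and its limit is a unit vector in the kernel of \<open>b\<close>.\<close>

lemma bounded_below_of_compact_equal_id:
  fixes b :: "'a::complex_hilbert_space => 'a"
  assumes b: "bclinear b" and bb: "compact_equal (b \<circ> b) id" and inj: "\<And>x. b x = 0 ==> x = 0"
  shows "\<exists>c>0. \<forall>x. c * norm x \<le> norm (b x)"
proof (rule ccontr)
  assume neg: "\<not> (\<exists>c>0. \<forall>x. c * norm x \<le> norm (b x))"
  note D = bclinearD[OF b]
  have "\<exists>x. norm x = 1 \<and> norm (b x) < inverse (real (Suc n))" for n
  proof -
    have "inverse (real (Suc n)) > 0" by simp
    then obtain x where x: "norm (b x) < inverse (real (Suc n)) * norm x"
      using neg by (meson not_le)
    then have "x \<noteq> 0" using D(5) by auto
    let ?z = "complex_of_real (1 / norm x) *C x"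
    have "norm (b ?z) = norm (b x) / norm x" by (simp add: D(2) norm_divide)
    also have "\<dots> < inverse (real (Suc n))" using x \<open>x \<noteq> 0\<close> by (simp add: divide_less_eq)
    finally show ?thesis using \<open>x \<noteq> 0\<close> by (intro exI[of _ ?z]) (simp add: norm_divide)
  qed
  then obtain x where x: "\<And>n. norm (x n) = 1" "\<And>n. norm (b (x n)) < inverse (real (Suc n))" by metis
  define k where "k z = b (b z) - z" for z
  have "compact_operator k" using bb unfolding compact_equal_def k_def by simp
  then have "compact (closure (k ` cball 0 1))" by (simp add: compact_operator_def)
  then have "seq_compact (closure (k ` cball 0 1))" by (rule compact_imp_seq_compact)
  moreover have "\<forall>n. k (x n) \<in> closure (k ` cball 0 1)"
    using x(1) closure_subset[of "k ` cball 0 1"] by auto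
  ultimately obtain l r where r: "strict_mono (r :: nat => nat)" "((\<lambda>n. k (x n)) \<circ> r) \<longlonglongrightarrow> l"
    unfolding seq_compact_def by metis
  have b0: "(\<lambda>n. b (x n)) \<longlonglongrightarrow> 0"
    by (rule Lim_null_comparison[OF _ LIMSEQ_inverse_real_of_nat])
      (use x(2) in \<open>auto intro!: always_eventually less_imp_le\<close>)
  then have b0r: "(\<lambda>n. b (x (r n))) \<longlonglongrightarrow> 0" using LIMSEQ_subseq_LIMSEQ[OF _ r(1)] by (force simp: o_def)
  then have "(\<lambda>n. b (b (x (r n)))) \<longlonglongrightarrow> b 0" by (rule bounded_linear.tendsto[OF D(1)])
  then have "(\<lambda>n. b (b (x (r n))) - k (x (r n))) \<longlonglongrightarrow> 0 - l"
    using r(2) D(5) by (intro tendsto_diff) (simp_all add: o_def)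
  then have xl: "(\<lambda>n. x (r n)) \<longlonglongrightarrow> - l" by (simp add: k_def)
  then have "(\<lambda>n. b (x (r n))) \<longlonglongrightarrow> b (- l)" by (rule bounded_linear.tendsto[OF D(1)])
  then have "b (- l) = 0" using b0r LIMSEQ_unique by blast
  then have "- l = 0" by (rule inj)
  moreover have "norm (- l) = 1"
    using LIMSEQ_unique[OF tendsto_norm[OF xl]] x(1) by simp
  ultimately show False by simp
qed

text \<open>With \<open>b = 2 a - 1\<close> one has \<open>b^2 = 1\<close> modulo compact operators. Adding the projection onto the
  kernel of \<open>b\<close>, which has finite dimension, makes \<open>b\<close> bounded below, so that it has a sign \<open>s\<close>:
  a symmetry that equals \<open>b\<close> modulo compact operators. Then \<open>(1 + s) / 2\<close> is a projection with the
  class of \<open>a\<close>.\<close>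

theorem projection_lifting:
  fixes a :: "'a::complex_hilbert_space => 'a"
  assumes a: "bclinear a" "adjoint_pair a a" and aa: "compact_equal (a \<circ> a) a"
  shows "\<exists>p. oproj p \<and> compact_equal p a"
proof -
  note A = bclinearD[OF a(1)]
  define b where "b x = 2 *C a x - x" for x
  have b: "bclinear b" unfolding b_def using a(1) by (intro bclinear_intros)
  note B = bclinearD[OF b]
  have bsa: "adjoint_pair b b"
    using adjoint_pair_self[OF a(2)] by (simp add: adjoint_pair_def b_def cinner_linear)
  have bb: "compact_equal (b \<circ> b) id"
  proof -
    have "(b \<circ> b) x - id x = 4 *C ((a \<circ> a) x - a x)" for x
      using scaleC_add_left[of 2 2 "a x"]
      by (simp add: b_def A(2,4) scaleC_diff_right scaleC_scaleC)
    then show ?thesis using compact_scaleC[OF aa[unfolded compact_equal_def], of 4]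
      unfolding compact_equal_def by simp
  qed
  \<comment> \<open>The kernel of \<open>b\<close> is finite dimensional, and the projection onto it makes \<open>b\<close> injective.\<close>
  have M: "csubspace {x. b x = 0}" by (simp add: csubspace_def B(2,3,5))
  have clM: "closed {x. b x = 0}"
    using linear_continuous_on[OF B(1)] by (intro closed_Collect_eq continuous_on_const)
  obtain f where f: "oproj f" "\<And>x. x \<in> {x. b x = 0} \<longleftrightarrow> f x = x" "\<And>x. f x \<in> {x. b x = 0}"
    by (rule ex_oproj[OF M clM]) blast
  obtain E where E: "orthonormal_on (\<lambda>e. e) E" "f = partial_isometry (\<lambda>e. e) (\<lambda>e. e) E"
    "\<And>e. e \<in> E ==> f e = e" using oproj_basis[OF f(1)] by blast
  have "finite {e\<in>E. norm ((\<lambda>x. (b \<circ> b) x - id x) e) \<ge> 1}"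
    using compact_finite_large[OF bb[unfolded compact_equal_def] E(1), of 1] by simp
  moreover have "norm ((\<lambda>x. (b \<circ> b) x - id x) e) \<ge> 1" if "e \<in> E" for e
  proof -
    have "b e = 0" using f(3)[of e] E(3)[OF that] by simp
    then show ?thesis using orthonormal_onD(2)[OF E(1) that] by (simp add: B(5))
  qed
  ultimately have "finite E" by (metis (mono_tags, lifting) Collect_cong Collect_mem_eq)
  then have cf: "compact_operator f" using compact_finite_partial_isometry E(2) by blast
  define c where "c x = b x + f x" for x
  have c: "bclinear c"
    unfolding c_def using b oprojD(1)[OF f(1)] by (intro bclinear_intros)
  note C = bclinearD[OF c]
  have csa: "adjoint_pair c c"
    using adjoint_pair_self[OF bsa] oprojD(3)[OF f(1)] by (simp add: adjoint_pair_def c_def cinner_linear)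
  have cb: "compact_equal c b" using cf by (simp add: compact_equal_def c_def)
  have "compact_equal (c \<circ> c) (b \<circ> b)" by (rule compact_equal_compose[OF cb cb c b])
  then have cc: "compact_equal (c \<circ> c) id" using bb compact_equal_trans by blast
  have inj: "x = 0" if "c x = 0" for x
  proof -
    have "f (b x) = 0"
      by (rule cinner_eqI) (use f(3) oprojD(3)[OF f(1)] adjoint_pair_self[OF bsa] in \<open>metis (mono_tags, lifting)
	cinner_zero(2) mem_Collect_eq\<close>)
    then have "f x = 0"
      using that bclinearD(3,5)[OF oprojD(1)[OF f(1)]] oprojD(2)[OF f(1)]
      by (metis add.left_neutral c_def)
    then have "b x = 0" using that by (simp add: c_def)
    then have "f x = x" using f(2) by simp
    then show ?thesis using \<open>f x = 0\<close> by simp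
  qed
  obtain d where d: "d > 0" "\<And>x. d * norm x \<le> norm (c x)"
    using bounded_below_of_compact_equal_id[OF c cc inj] by blast
  define K where "K = onorm c + d + 1"
  have K: "K > 0" "K \<ge> 1" "d < K" "\<And>x. norm (c x) \<le> K * norm x"
  proof -
    have "0 \<le> onorm c" using onorm_pos_le[OF C(1)] .
    then show "K > 0" "K \<ge> 1" "d < K" using d(1) by (simp_all add: K_def)
    show "norm (c x) \<le> K * norm x" for x
      using C(7)[of x] d(1) by (simp add: K_def distrib_right add_increasing2)
  qed
  define t0 where "t0 = 1 / K"
  define y where "y n = (sign_step ^^ n) (\<lambda>x. complex_of_real t0 *C c x)" for n
  have y0: "y 0 = (\<lambda>x. complex_of_real t0 *C c x)" and step: "y (Suc n) = sign_step (y n)" for n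
    by (simp_all add: y_def)
  have by0: "bclinear (y 0)" unfolding y0 using c by (rule bclinear_scaleC)
  have ay0: "adjoint_pair (y 0) (y 0)"
    using adjoint_pair_self[OF csa] by (simp add: y0 adjoint_pair_def cinner_linear)
  define q where "q = 1 - (d / K)^2"
  have dK: "0 < d / K" "d / K < 1" using d K by simp_all
  then have q: "0 < q" "q < 1" using d(1) K(1) unfolding q_def
    by (simp_all add: power_less_one_iff abs_square_less_1)
  have T: "bclinear (\<lambda>x. x - y 0 (y 0 x))"
    using bclinear_diff[OF bclinear_id(2) bclinear_compose[OF by0 by0]]
    by (simp add: o_def)
  have form: "Re (cinner (x - y 0 (y 0 x)) x) = (norm x)^2 - (norm (y 0 x))^2" for x
    using adjoint_pair_self[OF ay0, of "y 0 x" x] by (simp add: cinner_diff_left Re_cinner_self)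
  have ny: "norm (y 0 x) = norm (c x) / K" for x using K(1) by (simp add: y0 t0_def norm_divide)
  have "norm (x - y 0 (y 0 x)) \<le> q * norm x" for x
  proof (rule positive_operator_bound[OF T])
    show "adjoint_pair (\<lambda>x. x - y 0 (y 0 x)) (\<lambda>x. x - y 0 (y 0 x))"
      using adjoint_pair_self[OF ay0] by (simp add: adjoint_pair_def cinner_linear)
    show "0 \<le> Re (cinner (x - y 0 (y 0 x)) x)" for x
    proof -
      have "norm (y 0 x) \<le> norm x" unfolding ny using K by (simp add: divide_le_eq mult.commute)
      then show ?thesis unfolding form by (simp add: power_mono)
    qed
    show "Re (cinner (x - y 0 (y 0 x)) x) \<le> q * (norm x)^2" for x
    proof -
      have "d / K * norm x \<le> norm (y 0 x)" unfolding ny using d(2)[of x] K(1) by (simp add: divide_right_mono)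
      then have "(d / K * norm x)^2 \<le> (norm (y 0 x))^2" using d(1) K(1) by (intro power_mono) auto
      then show ?thesis unfolding form q_def by (simp add: power_mult_distrib power_divide algebra_simps)
    qed
  qed (rule q(1))
  then obtain s where s: "bclinear s" "adjoint_pair s s" "\<And>x. s (s x) = x"
    "\<And>n x. norm (s x - y n x) \<le> q ^ Suc n / (1 - q) * norm x"
    using sign_iteration_converges[of y q, OF by0 ay0 step] q by auto
  \<comment> \<open>Modulo compact operators the iteration multiplies \<open>b\<close> by scalars \<open>t n\<close>, which it drives to 1.\<close>
  define t where "t n = ((\<lambda>r. 3/2 * r - 1/2 * r^3) ^^ n) t0" for n :: nat
  have t_0: "t 0 = t0" and t_Suc: "t (Suc n) = 3/2 * t n - 1/2 * (t n)^3" for n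
    by (simp_all add: t_def)
  have t0: "0 < t0" "t0 \<le> 1" using K by (simp_all add: t0_def)
  define w where "w = 1 - t0^2"
  have w: "0 \<le> w" "w < 1" using t0 by (simp_all add: w_def power_le_one)
  have tb: "0 < t n \<and> t n \<le> 1 \<and> 1 - (t n)^2 \<le> w ^ Suc n" for n
  proof (induction n)
    case 0
    then show ?case using t0 by (simp add: t_0 w_def)
  next
    case (Suc n)
    define v where "v = 1 - (t n)^2"
    have v: "0 \<le> v" "v \<le> w ^ Suc n" "v < 1" using Suc by (simp_all add: v_def power_le_one)
    have eq: "t (Suc n) = t n * (2 + v) / 2"
      by (simp add: t_Suc v_def power3_eq_cube power2_eq_square field_simps)
    have sq: "1 - (t (Suc n))^2 = v^2 * (3 + v) / 4"
    proof -
      have "(t (Suc n))^2 = (1 - v) * (2 + v)^2 / 4"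
	unfolding eq by (simp add: power_mult_distrib power_divide v_def)
      then show ?thesis by (simp add: power2_eq_square power3_eq_cube field_simps)
    qed
    have pos: "0 < t (Suc n)" unfolding eq using Suc v by simp
    have "0 \<le> v^2 * (3 + v) / 4" using v by simp
    then have "(t (Suc n))^2 \<le> 1^2" using sq by simp
    then have le: "t (Suc n) \<le> 1" by (rule power2_le_imp_le) simp
    have "v^2 * (3 + v) / 4 \<le> v^2"
      using v mult_left_mono[of "3 + v" 4 "v^2"] by simp
    also have "\<dots> \<le> (w ^ Suc n)^2" using v by (intro power_mono) auto
    also have "\<dots> \<le> w ^ Suc (Suc n)"
      unfolding power_mult[symmetric] using w by (intro power_decreasing) auto
    finally show ?case using sq pos le by simp
  qed
  have t1: "\<bar>t n - 1\<bar> \<le> w ^ Suc n" for n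
  proof -
    have "1 - t n \<le> 1 - (t n)^2" using tb[of n] by (simp add: power2_eq_square mult_left_le)
    then show ?thesis using tb[of n] by simp
  qed
  have byn: "bclinear (y n)" for n
    using by0 by (induction n) (simp_all add: step bclinear_sign_step)
  have yt: "compact_equal (y n) (\<lambda>x. complex_of_real (t n) *C b x)" for n
  proof (induction n)
    case 0
    show ?case unfolding y0 t_0 by (rule compact_equal_scaleC[OF cb])
  next
    case (Suc n)
    let ?tb = "\<lambda>x. complex_of_real (t n) *C b x"
    have btb: "bclinear ?tb" using b by (rule bclinear_scaleC)
    have "compact_equal (y n \<circ> (y n \<circ> y n)) (?tb \<circ> (?tb \<circ> ?tb))"
      by (intro compact_equal_compose Suc byn btb bclinear_compose)
    also have "?tb \<circ> (?tb \<circ> ?tb) = (\<lambda>x. complex_of_real ((t n)^3) *C (b \<circ> (b \<circ> b)) x)"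
      by (simp add: fun_eq_iff B(2) scaleC_scaleC power3_eq_cube mult_ac)
    also have "compact_equal \<dots> (\<lambda>x. complex_of_real ((t n)^3) *C (b \<circ> id) x)"
      by (intro compact_equal_scaleC compact_equal_compose bb b bclinear_id compact_equal_refl)
    finally have y3: "compact_equal (y n \<circ> (y n \<circ> y n)) (\<lambda>x. complex_of_real ((t n)^3) *C b x)" by (simp add: o_def)
    have "compact_equal (\<lambda>x. (3/2) *C y n x - (1/2) *C (y n \<circ> (y n \<circ> y n)) x)
	(\<lambda>x. (3/2) *C ?tb x - (1/2) *C (complex_of_real ((t n)^3) *C b x))"
      by (intro compact_equal_diff compact_equal_scaleC Suc y3)
    moreover have "(3/2) *C ?tb x - (1/2) *C (complex_of_real ((t n)^3) *C b x) =
	complex_of_real (t (Suc n)) *C b x" for x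
    proof -
      have "complex_of_real (t (Suc n)) = 3/2 * complex_of_real (t n) - 1/2 * complex_of_real ((t n)^3)"
	by (simp add: t_Suc)
      then show ?thesis by (simp add: scaleC_scaleC scaleC_diff_left)
    qed
    ultimately show ?case by (simp add: step sign_step_def[abs_def])
  qed
  have sb: "compact_equal s b"
    unfolding compact_equal_def
  proof (rule compact_limit)
    show "bclinear (\<lambda>x. s x - b x)" using s(1) b by (rule bclinear_diff)
    fix e :: real assume "e > 0"
    have "(\<lambda>n. q ^ Suc n / (1 - q) + w ^ Suc n * onorm b) \<longlonglongrightarrow> 0 / (1 - q) + 0 * onorm b"
      by (intro tendsto_intros LIMSEQ_Suc LIMSEQ_power_zero) (use q w in auto)
    then have "\<forall>\<^sub>F n in sequentially. q ^ Suc n / (1 - q) + w ^ Suc n * onorm b < e"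
      using \<open>e > 0\<close> by (intro order_tendstoD(2)) auto
    then obtain n where n: "q ^ Suc n / (1 - q) + w ^ Suc n * onorm b < e"
      unfolding eventually_sequentially by blast
    let ?g = "\<lambda>x. y n x - complex_of_real (t n) *C b x"
    have "norm ((s x - b x) - ?g x) \<le> e" if x: "norm x \<le> 1" for x
    proof -
      have eq: "(s x - b x) - ?g x = (s x - y n x) + complex_of_real (t n - 1) *C b x"
	using scaleC_add_left[of "complex_of_real (t n)" "-1" "b x"] by simp
      have "norm ((s x - b x) - ?g x) \<le> norm (s x - y n x) + norm (complex_of_real (t n - 1) *C b x)"
	unfolding eq by (rule norm_triangle_ineq)
      also have "norm (complex_of_real (t n - 1) *C b x) = \<bar>t n - 1\<bar> * norm (b x)"
	by (simp only: norm_scaleC norm_of_real)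
      also have "\<bar>t n - 1\<bar> * norm (b x) \<le> w ^ Suc n * onorm b"
      proof (rule mult_mono[OF t1])
	show "norm (b x) \<le> onorm b"
	  using B(7)[of x] mult_left_mono[OF x onorm_pos_le[OF B(1)]] by simp
      qed (use w in auto)
      also have "norm (s x - y n x) \<le> q ^ Suc n / (1 - q)"
	using s(4)[of x n] mult_left_mono[OF x, of "q ^ Suc n / (1 - q)"] q by simp
      finally show ?thesis using n by simp
    qed
    then show "\<exists>g. compact_operator g \<and> (\<forall>x. norm x \<le> 1 --> norm (s x - b x - g x) \<le> e)"
      using yt[of n] unfolding compact_equal_def by blast
  qed
  define p where "p x = (1/2) *C (x + s x)" for x
  note S = bclinearD[OF s(1)]
  have half: "(1/2) *C z + (1/2) *C z = z" for z :: 'a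
    using scaleC_add_left[of "1/2" "1/2" z] by simp
  have "oproj p"
    unfolding oproj_def
  proof (intro conjI)
    show "bclinear p" unfolding p_def using s(1) by (intro bclinear_intros)
    show "p \<circ> p = p"
    proof
      fix x
      have "(p \<circ> p) x = (1/2) *C ((1/2) *C (x + s x) + (1/2) *C (x + s x))"
	by (simp add: p_def S(2,3) s(3) add.commute)
      then show "(p \<circ> p) x = p x" unfolding half by (simp add: p_def)
    qed
    show "adjoint_pair p p"
      using adjoint_pair_self[OF s(2)] by (simp add: adjoint_pair_def p_def cinner_linear)
  qed
  moreover have "compact_equal p a"
  proof -
    have "compact_equal p (\<lambda>x. (1/2) *C (x + b x))"
      unfolding p_def by (intro compact_equal_scaleC compact_equal_add sb compact_equal_refl)
    moreover have "(1/2) *C (x + b x) = a x" for x by (simp add: b_def scaleC_scaleC)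
    ultimately show ?thesis by simp
  qed
  ultimately show ?thesis by blast
qed

section \<open>Bounded operators and the Calkin algebra as algebras of classes of operators\<close>

text \<open>Both algebras consist of classes \<open>\<pi> f\<close> of bounded operators modulo an ideal \<open>I\<close> of compact
  operators, which is zero for the algebra of all bounded operators. The assumption \<open>lift\<close> holds for the
  Calkin algebra by \<open>projection_lifting\<close>.\<close>

locale operator_algebra =
  fixes A :: "'x cstar_algebra" and \<pi> :: "('h::complex_hilbert_space => 'h) => 'x"
    and I :: "('h => 'h) set"
  assumes carrier: "carrier A = \<pi> ` {f. bclinear f}"
    and class_eq: "bclinear f ==> bclinear g ==> \<pi> f = \<pi> g \<longleftrightarrow> (\<lambda>x. f x - g x) \<in> I"
    and mult: "bclinear f ==> bclinear g ==> \<pi> f \<otimes>\<^bsub>A\<^esub> \<pi> g = \<pi> (f \<circ> g)"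
    and add: "bclinear f ==> bclinear g ==> \<pi> f \<oplus>\<^bsub>A\<^esub> \<pi> g = \<pi> (\<lambda>x. f x + g x)"
    and one: "\<one>\<^bsub>A\<^esub> = \<pi> id"
    and scale: "bclinear f ==> cscale A c (\<pi> f) = \<pi> (\<lambda>x. c *C f x)"
    and star: "bclinear f ==> cstar A (\<pi> f) = \<pi> (adj f)"
    and norm_le: "bclinear f ==> k \<in> I ==> cnorm A (\<pi> f) \<le> onorm (\<lambda>x. f x - k x)"
    and norm_less: "bclinear f ==> cnorm A (\<pi> f) < r ==> \<exists>k\<in>I. onorm (\<lambda>x. f x - k x) < r"
    and I_compact: "k \<in> I ==> compact_operator k" and I_zero: "(\<lambda>_. 0) \<in> I"
    and lift: "X \<in> projections A ==> \<exists>p. oproj p \<and> X = \<pi> p"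
begin

lemma class_in_carrier: "bclinear f ==> \<pi> f \<in> carrier A"
  by (simp add: carrier)

lemma carrierE:
  assumes "X \<in> carrier A" obtains f where "bclinear f" "X = \<pi> f"
  using assms unfolding carrier by blast

lemma class_eq_compact:
  "bclinear f ==> bclinear g ==> \<pi> f = \<pi> g ==> compact_equal f g"
  using class_eq I_compact by (auto simp: compact_equal_def)

lemma norm_nonneg: "bclinear f ==> 0 \<le> cnorm A (\<pi> f)"
proof (rule ccontr)
  assume f: "bclinear f" and "\<not> 0 \<le> cnorm A (\<pi> f)"
  then obtain k where k: "k \<in> I" "onorm (\<lambda>x. f x - k x) < 0" using norm_less[OF f, of 0] by auto
  have "bclinear (\<lambda>x. f x - k x)"
    by (rule bclinear_diff[OF f compact_operatorD(1)[OF I_compact[OF k(1)]]])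
  then show False using onorm_pos_le[OF bclinearD(1)] k(2) by fastforce
qed

lemma norm_le_onorm: "bclinear f ==> cnorm A (\<pi> f) \<le> onorm f"
  using norm_le[OF _ I_zero, of f] by simp

lemma class_projection: "oproj p ==> \<pi> p \<in> projections A"
  using oprojD(1)[of p] adj_oproj[of p]
  by (simp add: projections_def class_in_carrier mult star oproj_def)

end

definition calkin_class :: "('h::complex_hilbert_space => 'h) => ('h => 'h) set" where
  "calkin_class f = {g. compact_equal g f}"

lemma in_calkin_class_iff: "g \<in> calkin_class f \<longleftrightarrow> compact_equal g f"
  by (simp add: calkin_class_def)

lemma calkin_class_eq: "calkin_class f = calkin_class g \<longleftrightarrow> compact_equal f g"
proof
  assume "calkin_class f = calkin_class g"
  then show "compact_equal f g" using in_calkin_class_iff compact_equal_refl by blast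
next
  assume fg: "compact_equal f g"
  show "calkin_class f = calkin_class g"
  proof (rule Set.set_eqI)
    show "h \<in> calkin_class f \<longleftrightarrow> h \<in> calkin_class g" for h
      using fg compact_equal_trans[of h f g] compact_equal_trans[of h g f] compact_equal_sym[of f g]
      unfolding in_calkin_class_iff by blast
  qed
qed

lemma calkin_class_self: "f \<in> calkin_class f"
  by (simp add: in_calkin_class_iff)

lemma calkin_class_nonempty: "calkin_class f \<noteq> {}"
  using calkin_class_self by blast

lemma compact_equal_bounded:
  assumes "compact_equal g f" "bclinear f" shows "bclinear g"
  using bclinear_add[OF compact_operatorD(1)[OF assms(1)[unfolded compact_equal_def]] assms(2)]
  by simp

lemma UN_calkin_class:
  assumes "S \<noteq> {}" "\<And>x. x \<in> S ==> compact_equal (F x) f"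
  shows "(\<Union>x\<in>S. calkin_class (F x)) = calkin_class f"
  using assms calkin_class_eq by blast

lemma calkin_fields:
  fixes H :: "'h::complex_hilbert_space itself"
  shows "carrier (calkin_algebra H) = calkin_class ` {f. bclinear f}"
    and "bclinear f ==> bclinear g ==>
      calkin_class f \<otimes>\<^bsub>calkin_algebra H\<^esub> calkin_class g = calkin_class (f \<circ> g)"
    and "bclinear f ==> bclinear g ==>
      calkin_class f \<oplus>\<^bsub>calkin_algebra H\<^esub> calkin_class g = calkin_class (\<lambda>x. f x + g x)"
    and "\<one>\<^bsub>calkin_algebra H\<^esub> = calkin_class id"
    and "bclinear f ==> cscale (calkin_algebra H) c (calkin_class f) = calkin_class (\<lambda>x. c *C f x)"
    and "bclinear f ==> cstar (calkin_algebra H) (calkin_class f) = calkin_class (adj f)"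
    and "cnorm (calkin_algebra H) X = Inf (onorm ` X)"
proof -
  let ?B = "bounded_operators H" and ?I = "{f :: 'h => 'h. compact_operator f}"
  have coset: "?I +>\<^bsub>?B\<^esub> f = calkin_class f" for f
  proof -
    have "?I +>\<^bsub>?B\<^esub> f = (\<lambda>k x. k x + f x) ` ?I"
      by (auto simp: a_r_coset_def r_coset_def bounded_operators_def)
    also have "\<dots> = calkin_class f"
    proof (intro Set.set_eqI iffI)
      fix g assume "g \<in> (\<lambda>k x. k x + f x) ` ?I"
      then show "g \<in> calkin_class f" by (auto simp: in_calkin_class_iff compact_equal_def)
    next
      fix g assume "g \<in> calkin_class f"
      then show "g \<in> (\<lambda>k x. k x + f x) ` ?I"
	by (intro image_eqI[of _ _ "\<lambda>x. g x - f x"]) (simp_all add: in_calkin_class_iff compact_equal_def)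
    qed
    finally show ?thesis .
  qed
  have cB: "carrier ?B = {f. bclinear f}" by (simp add: bounded_operators_def)
  note defs = calkin_algebra_def cstar_quotient_def FactRing_def ring.defs cstar_algebra.defs
  show "carrier (calkin_algebra H) = calkin_class ` {f. bclinear f}"
    by (auto simp: defs A_RCOSETS_def' coset cB)
  show "\<one>\<^bsub>calkin_algebra H\<^esub> = calkin_class id"
    by (simp add: defs coset) (simp add: bounded_operators_def)
  show "cnorm (calkin_algebra H) X = Inf (onorm ` X)"
    by (simp add: defs) (simp add: bounded_operators_def)
  {
    assume f: "bclinear f" and g: "bclinear g"
    have "calkin_class f \<otimes>\<^bsub>calkin_algebra H\<^esub> calkin_class g =
	(\<Union>a\<in>calkin_class f. \<Union>b\<in>calkin_class g. calkin_class (a \<circ> b))"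
      by (simp add: defs rcoset_mult_def coset) (simp add: bounded_operators_def)
    also have "\<dots> = (\<Union>a\<in>calkin_class f. calkin_class (f \<circ> g))"
    proof (rule SUP_cong[OF refl], rule UN_calkin_class)
      fix a b assume "a \<in> calkin_class f" "b \<in> calkin_class g"
      then have ab: "compact_equal a f" "compact_equal b g" by (simp_all add: in_calkin_class_iff)
      show "compact_equal (a \<circ> b) (f \<circ> g)"
	by (rule compact_equal_compose[OF ab compact_equal_bounded[OF ab(1) f] g])
    qed (use calkin_class_self in blast)
    also have "\<dots> = calkin_class (f \<circ> g)" using calkin_class_self by blast
    finally show "calkin_class f \<otimes>\<^bsub>calkin_algebra H\<^esub> calkin_class g = calkin_class (f \<circ> g)" .
    have "calkin_class f \<oplus>\<^bsub>calkin_algebra H\<^esub> calkin_class g =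
	{(\<lambda>x. a x + b x) | a b. a \<in> calkin_class f \<and> b \<in> calkin_class g}"
      by (auto simp: defs set_add_def set_mult_def bounded_operators_def)
    also have "\<dots> = calkin_class (\<lambda>x. f x + g x)"
    proof (intro Set.set_eqI iffI)
      fix h assume "h \<in> {(\<lambda>x. a x + b x) | a b. a \<in> calkin_class f \<and> b \<in> calkin_class g}"
      then show "h \<in> calkin_class (\<lambda>x. f x + g x)"
	using compact_equal_add by (auto simp: in_calkin_class_iff)
    next
      fix h assume "h \<in> calkin_class (\<lambda>x. f x + g x)"
      then have "compact_equal (\<lambda>x. h x - g x) f"
	by (simp add: in_calkin_class_iff compact_equal_def algebra_simps)
      moreover have "h = (\<lambda>x. (h x - g x) + g x)" by simp
      ultimately show "h \<in> {(\<lambda>x. a x + b x) | a b. a \<in> calkin_class f \<and> b \<in> calkin_class g}"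
	using calkin_class_self[of g] unfolding in_calkin_class_iff[symmetric]
	by - (rule CollectI, rule exI[of _ "\<lambda>x. h x - g x"], rule exI[of _ g], simp)
    qed
    finally show "calkin_class f \<oplus>\<^bsub>calkin_algebra H\<^esub> calkin_class g = calkin_class (\<lambda>x. f x + g x)" .
  }
  {
    assume f: "bclinear f"
    have "cscale (calkin_algebra H) c (calkin_class f) =
	(\<Union>a\<in>calkin_class f. calkin_class (\<lambda>x. c *C a x))"
      by (simp add: defs coset) (simp add: bounded_operators_def)
    also have "\<dots> = calkin_class (\<lambda>x. c *C f x)"
      by (rule UN_calkin_class)
	(use calkin_class_nonempty compact_equal_scaleC in \<open>auto simp: in_calkin_class_iff\<close>)
    finally show "cscale (calkin_algebra H) c (calkin_class f) = calkin_class (\<lambda>x. c *C f x)" .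
    have "cstar (calkin_algebra H) (calkin_class f) =
	(\<Union>a\<in>calkin_class f. calkin_class (adj a))"
      by (simp add: defs coset) (simp add: bounded_operators_def)
    also have "\<dots> = calkin_class (adj f)"
    proof (rule UN_calkin_class[OF calkin_class_nonempty])
      fix a assume "a \<in> calkin_class f"
      then have "compact_equal a f" by (simp add: in_calkin_class_iff)
      then show "compact_equal (adj a) (adj f)"
	by (intro compact_equal_adjoint compact_equal_bounded[of a f] f)
    qed
    finally show "cstar (calkin_algebra H) (calkin_class f) = calkin_class (adj f)" .
  }
qed

lemma operator_algebra_bounded:
  "operator_algebra (bounded_operators TYPE('h::complex_hilbert_space)) (\<lambda>f. f) {\<lambda>_. 0}"
proof
  let ?B = "bounded_operators TYPE('h)"
  note B = bounded_operators_def
  show "f = g \<longleftrightarrow> (\<lambda>x. f x - g x) \<in> {\<lambda>_. 0}" for f g :: "'h => 'h" by (auto simp: fun_eq_iff)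
  show "cnorm ?B f \<le> onorm (\<lambda>x. f x - k x)" if "k \<in> {\<lambda>_. 0}" for f k
    using that by (simp add: B)
  show "\<exists>k\<in>{\<lambda>_. 0}. onorm (\<lambda>x. f x - k x) < r" if "cnorm ?B f < r" for f r
    using that by (simp add: B)
  show "\<exists>p. oproj p \<and> X = p" if X: "X \<in> projections ?B" for X
  proof -
    have x: "bclinear X" "X \<circ> X = X" "adj X = X"
      using X by (simp_all add: projections_def B)
    then have "adjoint_pair X X" using adj(2)[OF x(1)] by simp
    then show ?thesis using x by (auto simp: oproj_def)
  qed
qed (simp_all add: bounded_operators_def)

lemma operator_algebra_calkin:
  "operator_algebra (calkin_algebra TYPE('h::complex_hilbert_space)) calkin_class {k. compact_operator k}"
proof
  let ?C = "calkin_algebra TYPE('h)"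
  note C = calkin_fields[where H = "TYPE('h)"]
  show "carrier ?C = calkin_class ` {f. bclinear f}" by (rule C)
  show "\<one>\<^bsub>?C\<^esub> = calkin_class id" by (rule C)
  fix f g :: "'h => 'h" assume f: "bclinear f"
  show "cscale ?C c (calkin_class f) = calkin_class (\<lambda>x. c *C f x)" for c by (rule C(5)[OF f])
  show "cstar ?C (calkin_class f) = calkin_class (adj f)" by (rule C(6)[OF f])
  have mem: "(\<lambda>x. f x - k x) \<in> calkin_class f" if "compact_operator k" for k
    using compact_uminus[OF that] by (simp add: in_calkin_class_iff compact_equal_def)
  have bdd: "bdd_below (onorm ` calkin_class f)"
  proof (rule bdd_belowI2)
    show "0 \<le> onorm a" if "a \<in> calkin_class f" for a
      using onorm_pos_le[OF bclinearD(1)[OF compact_equal_bounded[OF _ f]], of a] that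
      by (simp add: in_calkin_class_iff)
  qed
  show "cnorm ?C (calkin_class f) \<le> onorm (\<lambda>x. f x - k x)" if "k \<in> {k. compact_operator k}" for k
    unfolding C(7) using mem that by (intro cInf_lower[OF _ bdd]) auto
  show "\<exists>k\<in>{k. compact_operator k}. onorm (\<lambda>x. f x - k x) < r" if less: "cnorm ?C (calkin_class f) < r" for r
  proof -
    have "onorm ` calkin_class f \<noteq> {}" using calkin_class_self by blast
    then obtain z where "z \<in> onorm ` calkin_class f" "z < r"
      using cInf_lessD[of "onorm ` calkin_class f" r] less unfolding C(7) by blast
    then obtain a where a: "a \<in> calkin_class f" "onorm a < r" by (elim imageE) simp
    have "compact_operator (\<lambda>x. f x - a x)"
      using compact_equal_sym[OF a(1)[unfolded in_calkin_class_iff]] by (simp add: compact_equal_def)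
    then show ?thesis using a(2) by (intro bexI[of _ "\<lambda>x. f x - a x"]) simp_all
  qed
  assume g: "bclinear g"
  show "calkin_class f = calkin_class g \<longleftrightarrow> (\<lambda>x. f x - g x) \<in> {k. compact_operator k}"
    by (simp add: calkin_class_eq compact_equal_def)
  show "calkin_class f \<otimes>\<^bsub>?C\<^esub> calkin_class g = calkin_class (f \<circ> g)" by (rule C(2)[OF f g])
  show "calkin_class f \<oplus>\<^bsub>?C\<^esub> calkin_class g = calkin_class (\<lambda>x. f x + g x)" by (rule C(3)[OF f g])
next
  let ?C = "calkin_algebra TYPE('h)"
  note C = calkin_fields[where H = "TYPE('h)"]
  fix X assume X: "X \<in> projections ?C"
  then obtain f :: "'h => 'h" where f: "bclinear f" "X = calkin_class f"
    unfolding projections_def C(1) by blast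
  have ff: "compact_equal (f \<circ> f) f" "compact_equal (adj f) f"
    using X unfolding projections_def f(2) by (simp_all add: C(2,6) f(1) calkin_class_eq)
  note fs = adj(1)[OF f(1)]
  define a where "a x = (1/2) *C (f x + adj f x)" for x
  have a: "bclinear a" unfolding a_def using f(1) fs by (intro bclinear_intros)
  have sa: "adjoint_pair a a"
    using cinner_adjoint[OF f(1)] by (simp add: adjoint_pair_def a_def cinner_linear)
  have "compact_equal a (\<lambda>x. (1/2) *C (f x + f x))"
    unfolding a_def by (intro compact_equal_scaleC compact_equal_add ff compact_equal_refl)
  moreover have "(1/2) *C (f x + f x) = f x" for x
    using scaleC_add_left[of "1/2" "1/2" "f x"] by (simp add: scaleC_add_right)
  ultimately have af: "compact_equal a f" by simp
  have "compact_equal (a \<circ> a) (f \<circ> f)" by (rule compact_equal_compose[OF af af a f(1)])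
  then have "compact_equal (a \<circ> a) a"
    using ff(1) compact_equal_sym[OF af] compact_equal_trans by blast
  then obtain p where "oproj p" "compact_equal p a" using projection_lifting[OF a sa] by blast
  then show "\<exists>p. oproj p \<and> X = calkin_class p"
    using f(2) af compact_equal_trans compact_equal_sym calkin_class_eq by metis
qed (simp_all add: compact_zero)

section \<open>The Murray--von Neumann order compares ranks\<close>

definition has_rank :: "('h::complex_hilbert_space => 'h) => 'h set => bool" where
  "has_rank p B \<longleftrightarrow> orthonormal_on (\<lambda>b. b) B \<and> p = partial_isometry (\<lambda>b. b) (\<lambda>b. b) B"

lemma ex_rank: "oproj p ==> \<exists>B. has_rank p B"
  using oproj_basis unfolding has_rank_def by metis

lemma has_rank_oproj: "has_rank p B ==> oproj p"
  unfolding has_rank_def using oproj_span by blast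

lemma has_rank_fixes: "has_rank p B ==> b \<in> B ==> p b = b"
  unfolding has_rank_def using partial_isometry(5)[of "\<lambda>b. b" B "\<lambda>b. b" b] by simp

lemma has_rank_covers: "has_rank p B ==> covers B p"
  unfolding has_rank_def covers_def using partial_isometry(6) by blast

lemma has_rank_finite_compact: "has_rank p B ==> finite B ==> compact_operator p"
  unfolding has_rank_def using compact_finite_partial_isometry by blast

lemma rank_not_small:
  assumes p: "has_rank p B" and B: "infinite B" "|L| \<le>o |B|" "infinite L"
  shows "\<not> small L p"
proof
  assume "small L p"
  have on: "orthonormal_on (\<lambda>b. b) B" using p by (simp add: has_rank_def)
  obtain b where b: "b \<in> B" "cmod (cinner (p b) b) < 1"
    using small_nearly_orthogonal[OF \<open>small L p\<close> on B(3,2), of 1] by auto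
  then show False using has_rank_fixes[OF p b(1)] orthonormal_onD(1)[OF on b(1)] by simp
qed

lemma rank_small:
  assumes q: "has_rank q C" and L: "\<not> (infinite C \<and> |L| \<le>o |C| )"
  shows "small L q"
proof (cases "finite C")
  case True
  then show ?thesis using has_rank_finite_compact[OF q] small_compact by blast
next
  case False
  then have "|C| <o |L|" using L not_ordLeq_iff_ordLess[OF card_of_Well_order card_of_Well_order] by blast
  then show ?thesis
    using small_cover[OF oprojD(1)[OF has_rank_oproj[OF q]] False _ has_rank_covers[OF q]] by blast
qed

lemma partial_isometry_reindex:
  assumes "bij_betw \<phi> B C" shows "partial_isometry \<phi> \<phi> B = partial_isometry (\<lambda>b. b) (\<lambda>b. b) C"
  unfolding partial_isometry_def osum_def
  using infsum_reindex_bij_betw[OF assms, of "\<lambda>c. cinner _ c *C c"] by (intro ext) simp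

lemma orthonormal_image:
  assumes "orthonormal_on (\<lambda>b. b) C" "inj_on \<phi> B" "\<phi> ` B \<subseteq> C" shows "orthonormal_on \<phi> B"
  using assms unfolding orthonormal_on_def inj_on_def by (auto simp: image_subset_iff)

lemma projection_fixes_partial_isometry:
  assumes q: "oproj q" and on: "orthonormal_on \<phi> B" "orthonormal_on u B"
    and q\<phi>: "\<And>b. b \<in> B ==> q (\<phi> b) = \<phi> b"
  shows "q (partial_isometry u \<phi> B x) = partial_isometry u \<phi> B x"
  using osum_in_subspace[OF oproj_range[OF q], where u = \<phi> and I = B and c = "\<lambda>i. cinner x (u i)"]
    q\<phi> on(1) Bessel[OF on(2)]
  unfolding partial_isometry_def by simp

context operator_algebra
begin

lemma mvn_equiv_iff:
  assumes p: "oproj p" and q: "oproj q"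
  shows "mvn_equiv A (\<pi> p) (\<pi> q) \<longleftrightarrow> (\<exists>V. bclinear V \<and> \<pi> (adj V \<circ> V) = \<pi> p \<and>
    \<pi> (V \<circ> adj V) = \<pi> q)"
  unfolding mvn_equiv_def using class_projection[OF p] class_projection[OF q]
  by (auto simp: carrier star mult adj)

lemma mvn_equiv_sym:
  assumes "oproj p" "oproj q" "mvn_equiv A (\<pi> p) (\<pi> q)" shows "mvn_equiv A (\<pi> q) (\<pi> p)"
  using assms(3) unfolding mvn_equiv_iff[OF assms(1,2)] mvn_equiv_iff[OF assms(2,1)]
  using adjoint_adjoint adj(1) by metis

lemma mvn_equiv_imp_le:
  assumes "oproj p" "oproj q" "mvn_equiv A (\<pi> p) (\<pi> q)" shows "mvn_le A (\<pi> p) (\<pi> q)"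
  unfolding mvn_le_def subprojection_def
  using assms(3) class_projection[OF assms(2)] oprojD(1)[OF assms(2)] assms(2)
  by (intro exI[of _ "\<pi> q"]) (simp add: mult oproj_def)

text \<open>From \<open>v\<^sup>* v = p\<close> and \<open>v v\<^sup>* \<le> q\<close> modulo compact operators one gets
  \<open>p = v\<^sup>* v v\<^sup>* v = v\<^sup>* q v v\<^sup>* v\<close>, which is small when \<open>q\<close> is.\<close>

lemma small_of_mvn_le:
  assumes p: "oproj p" and q: "small L q" "oproj q" and L: "infinite L"
    and le: "mvn_le A (\<pi> p) (\<pi> q)"
  shows "small L p"
proof -
  obtain r where r: "r \<in> projections A" "\<pi> q \<otimes>\<^bsub>A\<^esub> r = r" "mvn_equiv A (\<pi> p) r"
    using le unfolding mvn_le_def subprojection_def by blast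
  obtain v where v: "v \<in> carrier A" "cstar A v \<otimes>\<^bsub>A\<^esub> v = \<pi> p" "v \<otimes>\<^bsub>A\<^esub> cstar A v = r"
    using r(3) unfolding mvn_equiv_def by blast
  obtain V where V: "bclinear V" "v = \<pi> V" using carrierE[OF v(1)] .
  note Vs = adj(1)[OF V(1)] and qb = oprojD(1)[OF q(2)] and pb = oprojD(1)[OF p]
  let ?W = "adj V"
  have VW: "bclinear (V \<circ> ?W)" "bclinear (?W \<circ> V)"
    using V(1) Vs by (simp_all add: bclinear_compose)
  have e1: "compact_equal (?W \<circ> V) p"
    using v(2) unfolding V(2) by (simp add: star mult V(1) Vs class_eq_compact[OF VW(2) pb])
  have e2: "compact_equal (q \<circ> (V \<circ> ?W)) (V \<circ> ?W)"
    using r(2) unfolding v(3)[symmetric] V(2)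
    by (simp add: star mult V(1) Vs VW qb class_eq_compact[OF bclinear_compose[OF qb VW(1)] VW(1)])
  have "compact_equal ((?W \<circ> V) \<circ> (?W \<circ> V)) (p \<circ> p)" by (rule compact_equal_compose[OF e1 e1 VW(2) pb])
  then have e3: "compact_equal (?W \<circ> (V \<circ> ?W) \<circ> V) p" using p by (simp add: oproj_def o_assoc)
  have "compact_equal (?W \<circ> (q \<circ> (V \<circ> ?W))) (?W \<circ> (V \<circ> ?W))"
    by (rule compact_equal_compose[OF compact_equal_refl e2 Vs VW(1)])
  then have "compact_equal (?W \<circ> (q \<circ> (V \<circ> ?W)) \<circ> V) (?W \<circ> (V \<circ> ?W) \<circ> V)"
    by (rule compact_equal_compose[OF _ compact_equal_refl _ V(1)])
      (intro bclinear_compose Vs qb VW(1))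
  then have "compact_equal (?W \<circ> (q \<circ> (V \<circ> ?W)) \<circ> V) p" using e3 by (rule compact_equal_trans)
  then have k: "small L (\<lambda>x. p x - (?W \<circ> (q \<circ> (V \<circ> ?W)) \<circ> V) x)"
    using compact_equal_sym small_compact unfolding compact_equal_def by blast
  have "small L (?W \<circ> (q \<circ> (V \<circ> ?W)) \<circ> V)"
    by (intro small_compose_right small_compose_left q(1) Vs V(1) VW(1))
  from small_add[OF L k this] show ?thesis by simp
qed

lemma rank_le_of_mvn_le:
  assumes p: "has_rank p B" "infinite B" and q: "has_rank q C" and le: "mvn_le A (\<pi> p) (\<pi> q)"
  shows "infinite C \<and> |B| \<le>o |C|"
proof (rule ccontr)
  assume "\<not> (infinite C \<and> |B| \<le>o |C| )"
  then have "small B q" by (rule rank_small[OF q])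
  then have "small B p" using small_of_mvn_le has_rank_oproj p q le by blast
  then show False using rank_not_small[OF p card_of_mono1[OF subset_refl] p(2)] by blast
qed

text \<open>An injection between bases of the ranges extends to a partial isometry.\<close>

lemma mvn_le_of_rank_le:
  assumes p: "has_rank p B" and q: "has_rank q C" and le: "|B| \<le>o |C|"
  shows "mvn_le A (\<pi> p) (\<pi> q)"
proof -
  obtain \<phi> where \<phi>: "inj_on \<phi> B" "\<phi> ` B \<subseteq> C" using le card_of_ordLeq by metis
  have on: "orthonormal_on (\<lambda>b. b) B" "orthonormal_on \<phi> B"
    using p q orthonormal_image[OF _ \<phi>] by (auto simp: has_rank_def)
  let ?V = "partial_isometry (\<lambda>b. b) \<phi> B" and ?r = "partial_isometry \<phi> \<phi> B"
  have V: "bclinear ?V" "adj ?V = partial_isometry \<phi> (\<lambda>b. b) B"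
    using partial_isometry(1) adjoint_partial_isometry on by blast+
  have r: "oproj ?r" by (rule oproj_span[OF on(2)])
  have qr: "q \<circ> ?r = ?r"
    using projection_fixes_partial_isometry[OF has_rank_oproj[OF q] on(2,2)] has_rank_fixes[OF q] \<phi>(2)
    by (auto simp: fun_eq_iff)
  have "mvn_equiv A (\<pi> p) (\<pi> ?r)"
    unfolding mvn_equiv_iff[OF has_rank_oproj[OF p] r]
  proof (intro exI conjI)
    have "adj ?V \<circ> ?V = p"
      using partial_isometry(7)[OF on] p by (auto simp: fun_eq_iff V(2) has_rank_def)
    then show "\<pi> (adj ?V \<circ> ?V) = \<pi> p" by simp
    have "?V \<circ> adj ?V = ?r"
      using partial_isometry(7)[OF on(2,1)] by (auto simp: fun_eq_iff V(2))
    then show "\<pi> (?V \<circ> adj ?V) = \<pi> ?r" by simp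
  qed (rule V(1))
  moreover have "subprojection A (\<pi> ?r) (\<pi> q)"
    unfolding subprojection_def
    using class_projection[OF r] class_projection[OF has_rank_oproj[OF q]]
      mult[OF oprojD(1)[OF has_rank_oproj[OF q]] oprojD(1)[OF r]] qr by simp
  ultimately show ?thesis unfolding mvn_le_def by blast
qed

lemma mvn_equiv_of_rank_eq:
  assumes p: "has_rank p B" and q: "has_rank q C" and eq: "|B| =o |C|"
  shows "mvn_equiv A (\<pi> p) (\<pi> q)"
proof -
  obtain \<phi> where \<phi>: "bij_betw \<phi> B C" using eq card_of_ordIso by metis
  have on: "orthonormal_on (\<lambda>b. b) B" "orthonormal_on \<phi> B"
    using p q orthonormal_image[of C \<phi> B] \<phi> by (auto simp: has_rank_def bij_betw_def)
  let ?V = "partial_isometry (\<lambda>b. b) \<phi> B"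
  have V: "bclinear ?V" "adj ?V = partial_isometry \<phi> (\<lambda>b. b) B"
    using partial_isometry(1) adjoint_partial_isometry on by blast+
  show ?thesis
    unfolding mvn_equiv_iff[OF has_rank_oproj[OF p] has_rank_oproj[OF q]]
  proof (intro exI conjI)
    have "adj ?V \<circ> ?V = p"
      using partial_isometry(7)[OF on] p by (auto simp: fun_eq_iff V(2) has_rank_def)
    then show "\<pi> (adj ?V \<circ> ?V) = \<pi> p" by simp
    have "?V \<circ> adj ?V = q"
      using partial_isometry(7)[OF on(2,1)] partial_isometry_reindex[OF \<phi>] q
      by (auto simp: fun_eq_iff V(2) has_rank_def)
    then show "\<pi> (?V \<circ> adj ?V) = \<pi> q" by simp
  qed (rule V(1))
qed

lemma mvn_le_rank_iff:
  assumes "has_rank p B" "has_rank q C" "infinite B"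
  shows "mvn_le A (\<pi> p) (\<pi> q) \<longleftrightarrow> |B| \<le>o |C|"
  using rank_le_of_mvn_le[OF assms(1,3,2)] mvn_le_of_rank_le[OF assms(1,2)] by blast

lemma mvn_equiv_rank_iff:
  assumes "has_rank p B" "has_rank q C" "infinite B" "infinite C"
  shows "mvn_equiv A (\<pi> p) (\<pi> q) \<longleftrightarrow> |B| =o |C|"
proof
  assume e: "mvn_equiv A (\<pi> p) (\<pi> q)"
  note P = has_rank_oproj[OF assms(1)] has_rank_oproj[OF assms(2)]
  have "|B| \<le>o |C|" "|C| \<le>o |B|"
    using mvn_le_rank_iff[OF assms(1-3)] mvn_le_rank_iff[OF assms(2,1,4)]
      mvn_equiv_imp_le[OF P e] mvn_equiv_imp_le[OF P(2,1) mvn_equiv_sym[OF P e]] by blast+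
  then show "|B| =o |C|" using ordIso_iff_ordLeq by blast
qed (rule mvn_equiv_of_rank_eq[OF assms(1,2)])

end

section \<open>Infinite projections are the projections of infinite rank\<close>

text \<open>\<open>V\<close> is an isometry of the range of \<open>p\<close> into itself. On the whole space, \<open>V + (1 - p)\<close> is an
  isometry that differs from 1 by a compact operator, hence it is onto.\<close>

lemma finite_rank_not_infinite:
  fixes p :: "'h::complex_hilbert_space => 'h"
  assumes p: "has_rank p B" "finite B" and q: "oproj q" "p \<circ> q = q"
    and V: "bclinear V" "adj V \<circ> V = p" "V \<circ> adj V = q"
  shows "q = p"
proof -
  note P = has_rank_oproj[OF p(1)]
  note PD = oprojD[OF P] and VD = bclinearD[OF V(1)]
  have VV: "adj V (V x) = p x" "V (adj V x) = q x" "p (q x) = q x" for x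
    using V(2,3) q(2) by (auto simp: fun_eq_iff)
  have nV: "(norm (V x))^2 = (norm (p x))^2" for x
  proof -
    have "cinner (V x) (V x) = cinner (p x) (p x)"
      using cinner_adjoint(1)[OF V(1), of x "V x"] VV(1) PD(2,3)[of x] by (metis PD(2) PD(3))
    then show ?thesis using Re_cinner_self by metis
  qed
  have Vp: "V (p x) = V x" for x
  proof -
    have "(norm (V (x - p x)))^2 = 0"
      unfolding nV by (simp add: bclinearD(4)[OF PD(1)] PD(2))
    then show ?thesis by (simp add: VD(4))
  qed
  have pV: "p (V x) = V x" for x
  proof -
    have "V x = q (V x)" using VV(1)[of x] VV(2)[of "V x"] Vp[of x] by simp
    then show ?thesis using VV(3)[of "V x"] by simp
  qed
  define u where "u x = V x + (x - p x)" for x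
  have bu: "bclinear u" unfolding u_def using V(1) PD(1) by (intro bclinear_intros)
  have "surj u"
  proof (rule bounded_below_surj[where g = "\<lambda>x. x" and k = "\<lambda>x. V x - p x" and d = 0 and c = 1])
    have cp: "compact_operator p" by (rule has_rank_finite_compact[OF p])
    have "V = V \<circ> p" by (simp add: fun_eq_iff Vp)
    then have "compact_operator V" using compact_compose_left[OF V(1) cp] by simp
    then show "compact_operator (\<lambda>x. V x - p x)" using cp by (rule compact_diff)
    show "1 * norm x \<le> norm (u x)" for x
    proof -
      have "cinner (V x) (x - p x) = 0"
	using PD(4)[of x "V x"] pV by (simp add: cinner_eq_0_commute[of "V x"])
      then have "(norm (u x))^2 = (norm (p x))^2 + (norm (x - p x))^2"
	unfolding u_def using pythagoras nV by metis
      also have "\<dots> = (norm (p x + (x - p x)))^2"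
	using pythagoras[of "p x" "x - p x"] PD(4)[of x x] by (simp add: cinner_eq_0_commute[of "p x"])
      finally show ?thesis by simp
    qed
  qed (simp_all add: u_def bu)
  have qp: "q (p y) = p y" for y
  proof -
    obtain x where x: "p y = u x" using \<open>surj u\<close> by (metis surjD)
    then have "p y = p (u x)" using PD(2)[of y] by simp
    then have "p y = V x"
      by (simp add: u_def bclinearD(3,4)[OF PD(1)] pV PD(2))
    then show ?thesis using VV(1)[of x] VV(2)[of "V x"] Vp by simp
  qed
  show "q = p"
  proof
    fix x
    show "q x = p x"
    proof (rule cinner_eqI)
      fix z
      have "cinner z (q x) = cinner z (p (q x))" by (simp add: VV(3))
      also have "\<dots> = cinner (q (p z)) x" using PD(3) oprojD(3)[OF q(1)] by metis
      also have "\<dots> = cinner z (p x)" by (simp add: qp PD(3))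
      finally show "cinner z (q x) = cinner z (p x)" .
    qed
  qed
qed

text \<open>If \<open>B\<close> is infinite, a bijection of \<open>B\<close> with a proper subset of \<open>B\<close> gives a proper
  subprojection of \<open>p\<close> that is equivalent to \<open>p\<close>.\<close>

lemma infinite_projections_iff:
  fixes p :: "'h::complex_hilbert_space => 'h"
  assumes p: "has_rank p B"
  shows "p \<in> infinite_projections (bounded_operators TYPE('h)) \<longleftrightarrow> infinite B"
proof -
  interpret operator_algebra "bounded_operators TYPE('h)" "\<lambda>f. f" "{\<lambda>_. 0}"
    by (rule operator_algebra_bounded)
  let ?A = "bounded_operators TYPE('h)"
  note P = has_rank_oproj[OF p]
  show ?thesis
  proof
    assume "p \<in> infinite_projections ?A"
    then obtain q where q: "subprojection ?A q p" "q \<noteq> p" "mvn_equiv ?A p q"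
      unfolding infinite_projections_def by blast
    have qP: "oproj q" using lift q(1) unfolding subprojection_def by blast
    have pq: "p \<circ> q = q"
      using q(1) mult[OF oprojD(1)[OF P] oprojD(1)[OF qP]] unfolding subprojection_def by simp
    obtain V where "bclinear V" "adj V \<circ> V = p" "V \<circ> adj V = q"
      using q(3) unfolding mvn_equiv_iff[OF P qP] by blast
    then show "infinite B" using finite_rank_not_infinite[OF p _ qP pq] q(2) by blast
  next
    assume inf: "infinite B"
    then obtain b where b: "b \<in> B" by fastforce
    let ?C = "B - {b}"
    have on: "orthonormal_on (\<lambda>b. b) B" using p by (simp add: has_rank_def)
    define q where "q = partial_isometry (\<lambda>b. b) (\<lambda>b. b) ?C"
    have onC: "orthonormal_on (\<lambda>b. b) ?C" by (rule orthonormal_on_subset[OF on]) blast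
    have qr: "has_rank q ?C" using onC by (simp add: has_rank_def q_def)
    have "|B| =o |?C|"
      using infinite_imp_bij_betw[OF inf, of b] card_of_ordIso by blast
    then have "mvn_equiv ?A p q" by (rule mvn_equiv_of_rank_eq[OF p qr])
    moreover have "p \<circ> q = q"
      using projection_fixes_partial_isometry[OF P onC onC] has_rank_fixes[OF p]
      by (auto simp: fun_eq_iff q_def)
    then have "subprojection ?A q p"
      unfolding subprojection_def
      using class_projection[OF P] class_projection[OF has_rank_oproj[OF qr]]
	mult[OF oprojD(1)[OF P] oprojD(1)[OF has_rank_oproj[OF qr]]] by simp
    moreover have "q \<noteq> p"
    proof
      assume "q = p"
      then have "q b = b" using has_rank_fixes[OF p b] by simp
      moreover have "cinner (q b) b = 0"
	unfolding q_def using on b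
	by (intro partial_isometry(6)[OF onC onC, rule_format]) (auto simp: orthonormal_on_def)
      ultimately show False using orthonormal_onD(1)[OF on b] by simp
    qed
    ultimately show "p \<in> infinite_projections ?A"
      unfolding infinite_projections_def using class_projection[OF P] by blast
  qed
qed

section \<open>The posets of projections are the orders of infinite ranks\<close>

text \<open>\<open>T\<close>, ordered by \<open>r\<close>, indexes the infinite cardinals up to the dimension \<open>|E|\<close>.\<close>

definition rank_index :: "'t set => 't rel => ('t => 'c set) => 'h set => bool" where
  "rank_index T r crd E \<longleftrightarrow>
     (\<forall>t\<in>T. infinite (crd t) \<and> |crd t| \<le>o |E| ) \<and>
     (\<forall>B :: 'h set. infinite B --> |B| \<le>o |E| --> (\<exists>t\<in>T. |B| =o |crd t| )) \<and>
     (\<forall>s\<in>T. \<forall>t\<in>T. ((s, t) \<in> r \<longleftrightarrow> |crd s| \<le>o |crd t| ) \<and> ( |crd s| =o |crd t| --> s = t))"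

lemma rank_indexD:
  assumes "rank_index T r crd (E :: 'h set)"
  shows "t \<in> T ==> infinite (crd t)" "t \<in> T ==> |crd t| \<le>o |E|"
    and "infinite B ==> |B| \<le>o |E| ==> \<exists>t\<in>T. |B :: 'h set| =o |crd t|"
    and "s \<in> T ==> t \<in> T ==> (s, t) \<in> r \<longleftrightarrow> |crd s| \<le>o |crd t|"
    and "s \<in> T ==> t \<in> T ==> |crd s| =o |crd t| ==> s = t"
  using assms unfolding rank_index_def by simp_all

lemma mvn_poset_fo_equiv:
  assumes rk: "rk ` P = U"
    and eq: "\<And>p q. p \<in> P ==> q \<in> P ==> mvn_equiv A p q \<longleftrightarrow> rk p = rk q"
    and le: "\<And>p q. p \<in> P ==> q \<in> P ==> mvn_le A p q \<longleftrightarrow> (rk p, rk q) \<in> r"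
  shows "fo_equiv (U, r) (mvn_poset A P)"
proof -
  define g where "g u = {p \<in> P. rk p = u}" for u
  let ?R = "{(p, q). p \<in> P \<and> q \<in> P \<and> mvn_equiv A p q}"
  have cls: "?R `` {p} = g (rk p)" if "p \<in> P" for p
    using eq that by (auto simp: g_def)
  have Q: "P // ?R = g ` U"
  proof -
    have "P // ?R = (\<lambda>p. g (rk p)) ` P" unfolding quotient_def using cls by auto
    then show ?thesis using rk by (auto simp: image_image)
  qed
  have mem: "p \<in> g (rk p)" if "p \<in> P" for p using that by (simp add: g_def)
  have ne: "\<exists>p\<in>P. rk p = u \<and> p \<in> g u" if "u \<in> U" for u
    using that rk mem by auto
  have fst: "fst (mvn_poset A P) = g ` U"
    by (simp add: mvn_poset_def Let_def Q)
  have snd: "(X, Y) \<in> snd (mvn_poset A P) \<longleftrightarrow> X \<in> g ` U \<and> Y \<in> g ` U \<and> (\<exists>p\<in>X. \<exists>q\<in>Y. mvn_le A p q)" for X Y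
    by (simp add: mvn_poset_def Let_def Q)
  have inj: "u = v" if "u \<in> U" "g u = g v" for u v
    using ne[OF that(1)] that(2) by (auto simp: g_def)
  show ?thesis
  proof (rule fo_equiv_iso[where h = g])
    show "bij_betw g (fst (U, r)) (fst (mvn_poset A P))"
      unfolding fst bij_betw_def using inj by (auto intro: inj_onI)
    show "\<forall>x\<in>fst (U, r). \<forall>y\<in>fst (U, r).
	(x, y) \<in> snd (U, r) \<longleftrightarrow> (g x, g y) \<in> snd (mvn_poset A P)"
    proof (intro ballI)
      fix x y assume "x \<in> fst (U, r)" "y \<in> fst (U, r)"
      then have xy: "x \<in> U" "y \<in> U" by simp_all
      show "(x, y) \<in> snd (U, r) \<longleftrightarrow> (g x, g y) \<in> snd (mvn_poset A P)"
	unfolding snd using xy ne[OF xy(1)] ne[OF xy(2)] le by (auto simp: g_def)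
    qed
  qed
qed

definition rank_of ::
  "(('h::complex_hilbert_space => 'h) => 'x) => 't set => ('t => 'c set) => 'x => 't" where
  "rank_of \<pi> T crd X = (SOME t. t \<in> T \<and>
     (\<exists>p B. has_rank p B \<and> X = \<pi> p \<and> infinite B \<and> |B| =o |crd t| ))"

context operator_algebra
begin

context
  fixes T :: "'t set" and r :: "'t rel" and crd :: "'t => 'c set" and E :: "'h set"
  assumes T: "rank_index T r crd E" and E: "basis_of E UNIV"
begin

private lemmas index = rank_indexD[OF T]

private lemma rank_bound:
  fixes p :: "'h => 'h"
  assumes "has_rank p B" "infinite B" shows "|B| \<le>o |E|"
proof -
  have on: "orthonormal_on (\<lambda>b. b) B" "orthonormal_on (\<lambda>b. b) E" and rep: "\<And>x. osum (\<lambda>b. b) E (cinner x) = x"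
    using assms(1) E by (auto simp: has_rank_def basis_of_def)
  have id: "has_rank id E"
    using on(2) rep by (auto simp: has_rank_def partial_isometry_def fun_eq_iff)
  have "oproj (id :: 'h => 'h)" using has_rank_oproj[OF id] .
  then have "mvn_le A (\<pi> p) (\<pi> id)"
    unfolding mvn_le_def subprojection_def mvn_equiv_def
    using class_projection[of p] class_projection[of id] has_rank_oproj[OF assms(1)]
      oprojD(1)[OF has_rank_oproj[OF assms(1)]] adj_oproj[OF has_rank_oproj[OF assms(1)]]
    by (intro exI[of _ "\<pi> p"]) (auto simp: mult class_in_carrier star oproj_def intro!: bexI[of _ "\<pi> p"])
  then show ?thesis using rank_le_of_mvn_le[OF assms id] by blast
qed

lemma rank_of:
  assumes p: "has_rank p B" "infinite B"
  shows "rank_of \<pi> T crd (\<pi> p) \<in> T" "|B| =o |crd (rank_of \<pi> T crd (\<pi> p))|"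
proof -
  obtain t where "t \<in> T" "|B| =o |crd t|" using index(3)[OF p(2) rank_bound[OF p]] by blast
  then have "\<exists>t. t \<in> T \<and> (\<exists>q C. has_rank q C \<and> \<pi> p = \<pi> q \<and> infinite C \<and> |C| =o |crd t| )"
    using p by blast
  from someI_ex[OF this] obtain q C where t: "rank_of \<pi> T crd (\<pi> p) \<in> T"
    and q: "has_rank q C" "\<pi> p = \<pi> q" "infinite C" "|C| =o |crd (rank_of \<pi> T crd (\<pi> p))|"
    unfolding rank_of_def by blast
  have "mvn_equiv A (\<pi> p) (\<pi> p)" by (rule mvn_equiv_of_rank_eq[OF p(1,1) card_of_refl])
  then have "|B| =o |C|" using mvn_equiv_rank_iff[OF p(1) q(1) p(2) q(3)] q(2) by simp
  then show "|B| =o |crd (rank_of \<pi> T crd (\<pi> p))|" using q(4) by (rule ordIso_transitive)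
  show "rank_of \<pi> T crd (\<pi> p) \<in> T" by (rule t)
qed

lemma rank_of_surj:
  assumes "t \<in> T"
  shows "\<exists>p B. has_rank p B \<and> infinite B \<and> rank_of \<pi> T crd (\<pi> p) = t"
proof -
  obtain \<phi> where \<phi>: "inj_on \<phi> (crd t)" "\<phi> ` crd t \<subseteq> E"
    using index(2)[OF assms] card_of_ordLeq by metis
  let ?B = "\<phi> ` crd t"
  have "orthonormal_on (\<lambda>b. b) E" using E by (simp add: basis_of_def)
  then have "orthonormal_on (\<lambda>b. b) ?B" using \<phi>(2) by (rule orthonormal_on_subset)
  then have p: "has_rank (partial_isometry (\<lambda>b. b) (\<lambda>b. b) ?B) ?B" by (simp add: has_rank_def)
  have inf: "infinite ?B" using index(1)[OF assms] \<phi>(1) finite_imageD by blast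
  note R = rank_of[OF p inf]
  have "|crd t| =o |?B|" using \<phi>(1) card_of_ordIso by (metis bij_betw_def)
  then have "|crd t| =o |crd (rank_of \<pi> T crd (\<pi> (partial_isometry (\<lambda>b. b) (\<lambda>b. b) ?B)))|"
    using R(2) by (rule ordIso_transitive)
  then have "t = rank_of \<pi> T crd (\<pi> (partial_isometry (\<lambda>b. b) (\<lambda>b. b) ?B))" by (rule index(5)[OF assms R(1)])
  then have t: "rank_of \<pi> T crd (\<pi> (partial_isometry (\<lambda>b. b) (\<lambda>b. b) ?B)) = t" by (rule sym)
  show ?thesis by (intro exI conjI, rule p, rule inf, rule t)
qed

lemma rank_of_order:
  assumes p: "has_rank p B" "infinite B" and q: "has_rank q C" "infinite C"
  shows "mvn_equiv A (\<pi> p) (\<pi> q) \<longleftrightarrow> rank_of \<pi> T crd (\<pi> p) = rank_of \<pi> T crd (\<pi> q)"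
    and "mvn_le A (\<pi> p) (\<pi> q) \<longleftrightarrow> (rank_of \<pi> T crd (\<pi> p), rank_of \<pi> T crd (\<pi> q)) \<in> r"
proof -
  note P = rank_of[OF p] and Q = rank_of[OF q]
  have "|B| =o |C| \<longleftrightarrow> |crd (rank_of \<pi> T crd (\<pi> p))| =o |crd (rank_of \<pi> T crd (\<pi> q))|"
    using P(2) Q(2) ordIso_transitive ordIso_symmetric by metis
  then show "mvn_equiv A (\<pi> p) (\<pi> q) \<longleftrightarrow> rank_of \<pi> T crd (\<pi> p) = rank_of \<pi> T crd (\<pi> q)"
    unfolding mvn_equiv_rank_iff[OF p(1) q(1) p(2) q(2)]
    using index(5)[OF P(1) Q(1)] card_of_refl by metis
  have "|B| \<le>o |C| \<longleftrightarrow> |crd (rank_of \<pi> T crd (\<pi> p))| \<le>o |crd (rank_of \<pi> T crd (\<pi> q))|"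
    using P(2) Q(2) ordIso_ordLeq_trans ordLeq_ordIso_trans ordIso_symmetric by metis
  then show "mvn_le A (\<pi> p) (\<pi> q) \<longleftrightarrow> (rank_of \<pi> T crd (\<pi> p), rank_of \<pi> T crd (\<pi> q)) \<in> r"
    unfolding mvn_le_rank_iff[OF p(1) q(1) p(2)] index(4)[OF P(1) Q(1)] .
qed

end

end

theorem infinite_projections_poset:
  assumes T: "rank_index T r crd (E :: 'h::complex_hilbert_space set)" and E: "basis_of E UNIV"
  shows "fo_equiv (T, r) (mvn_poset (bounded_operators TYPE('h))
    (infinite_projections (bounded_operators TYPE('h))))"
proof -
  let ?A = "bounded_operators TYPE('h)"
  interpret operator_algebra ?A "\<lambda>f. f" "{\<lambda>_. 0}" by (rule operator_algebra_bounded)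
  have ex: "\<exists>B. has_rank p B \<and> infinite B" if p: "p \<in> infinite_projections ?A" for p
  proof -
    have "\<exists>q. oproj q \<and> p = q" using lift p unfolding infinite_projections_def by blast
    then obtain B where B: "has_rank p B" using ex_rank by blast
    then show ?thesis using infinite_projections_iff[OF B] p by blast
  qed
  show ?thesis
  proof (rule mvn_poset_fo_equiv[where rk = "rank_of (\<lambda>f. f) T crd"])
    show "rank_of (\<lambda>f. f) T crd ` infinite_projections ?A = T"
    proof (intro Set.set_eqI iffI)
      fix t assume "t \<in> rank_of (\<lambda>f. f) T crd ` infinite_projections ?A"
      then show "t \<in> T" using ex rank_of(1)[OF T E] by blast
    next
      fix t assume "t \<in> T"
      then obtain p :: "'h => 'h" and B where "has_rank p B" "infinite B" "rank_of (\<lambda>f. f) T crd p = t"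
	using rank_of_surj[OF T E] by blast
      then show "t \<in> rank_of (\<lambda>f. f) T crd ` infinite_projections ?A"
	using infinite_projections_iff by blast
    qed
    show "mvn_equiv ?A p q \<longleftrightarrow> rank_of (\<lambda>f. f) T crd p = rank_of (\<lambda>f. f) T crd q"
      if "p \<in> infinite_projections ?A" "q \<in> infinite_projections ?A" for p q
      using ex[OF that(1)] ex[OF that(2)] rank_of_order(1)[OF T E] by blast
    show "mvn_le ?A p q \<longleftrightarrow> (rank_of (\<lambda>f. f) T crd p, rank_of (\<lambda>f. f) T crd q) \<in> r"
      if "p \<in> infinite_projections ?A" "q \<in> infinite_projections ?A" for p q
      using ex[OF that(1)] ex[OF that(2)] rank_of_order(2)[OF T E] by blast
  qed
qed

text \<open>In the Calkin algebra the projections of finite rank form one more class, the class of 0.\<close>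

definition add_bottom :: "'t set => 't rel => 't option fo_struct" where
  "add_bottom T r = (insert None (Some ` T),
     {(None, x) | x. True} \<union> {(Some s, Some t) | s t. (s, t) \<in> r})"

theorem calkin_projections_poset:
  assumes T: "rank_index T r crd (E :: 'h::complex_hilbert_space set)" and E: "basis_of E UNIV"
  shows "fo_equiv (add_bottom T r) (mvn_poset (calkin_algebra TYPE('h))
    (projections (calkin_algebra TYPE('h))))"
proof -
  let ?A = "calkin_algebra TYPE('h)"
  interpret operator_algebra ?A calkin_class "{k. compact_operator k}" by (rule operator_algebra_calkin)
  define z where "z = calkin_class (\<lambda>_. 0 :: 'h)"
  have z0: "has_rank (\<lambda>_. 0 :: 'h) {}"
    by (simp add: has_rank_def orthonormal_on_def partial_isometry_def osum_def fun_eq_iff)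
  have z_iff: "calkin_class p = z \<longleftrightarrow> compact_operator p" for p
    unfolding z_def calkin_class_eq by (rule compact_equal_zero)
  have fin: "calkin_class p = z \<longleftrightarrow> finite B" if p: "has_rank p B" for p B
  proof
    assume "calkin_class p = z"
    then have "small B p" using z_iff small_compact by blast
    then show "finite B" using rank_not_small[OF p _ card_of_mono1[OF subset_refl]] by blast
  qed (use has_rank_finite_compact[OF p] z_iff in blast)
  define rk where "rk X = (if X = z then None else Some (rank_of calkin_class T crd X))" for X
  have ex: "\<exists>p B. has_rank p B \<and> X = calkin_class p \<and> (X = z \<longleftrightarrow> finite B)"
    if "X \<in> projections ?A" for X
    using lift[OF that] ex_rank fin by metis
  have zP: "z \<in> projections ?A"
    unfolding z_def using class_projection has_rank_oproj[OF z0] by blast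
  show ?thesis
    unfolding add_bottom_def
  proof (rule mvn_poset_fo_equiv[where rk = rk])
    show "rk ` projections ?A = insert None (Some ` T)"
    proof (intro Set.set_eqI iffI)
      fix t assume "t \<in> rk ` projections ?A"
      then obtain X where X: "X \<in> projections ?A" "t = rk X" by blast
      obtain p B where "has_rank p B" "X = calkin_class p" "X = z \<longleftrightarrow> finite B" using ex[OF X(1)] by blast
      then show "t \<in> insert None (Some ` T)"
	using rank_of(1)[OF T E, of p B] X(2) by (auto simp: rk_def)
    next
      fix t assume "t \<in> insert None (Some ` T)"
      then consider "t = None" | s where "s \<in> T" "t = Some s" by blast
      then show "t \<in> rk ` projections ?A"
      proof cases
	case 1
	then show ?thesis using zP by (intro image_eqI[of _ _ z]) (simp_all add: rk_def)
      next
	case 2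
	then obtain p :: "'h => 'h" and B where p: "has_rank p B" "infinite B"
	  "rank_of calkin_class T crd (calkin_class p) = s"
	  using rank_of_surj[OF T E 2(1)] by blast
	then show ?thesis using fin[OF p(1)] 2(2) class_projection[OF has_rank_oproj[OF p(1)]]
	  by (intro image_eqI[of _ _ "calkin_class p"]) (simp_all add: rk_def)
      qed
    qed
    fix X Y assume XY: "X \<in> projections ?A" "Y \<in> projections ?A"
    obtain p B where p: "has_rank p B" "X = calkin_class p" "X = z \<longleftrightarrow> finite B" using ex[OF XY(1)] by blast
    obtain q C where q: "has_rank q C" "Y = calkin_class q" "Y = z \<longleftrightarrow> finite C" using ex[OF XY(2)] by blast
    have le_z: "X = z" if "mvn_le ?A X Y" "Y = z"
      using rank_le_of_mvn_le[OF p(1) _ q(1)] that p(2,3) q(2,3) by blast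
    have z_le: "mvn_le ?A X Y" if "X = z"
      using mvn_le_of_rank_le[OF z0 q(1)] card_of_empty that q(2) unfolding z_def by blast
    have zz: "mvn_equiv ?A z z"
      unfolding z_def by (rule mvn_equiv_of_rank_eq[OF z0 z0 card_of_refl])
    note P = has_rank_oproj[OF p(1)] has_rank_oproj[OF q(1)]
    have eq_z: "X = z \<longleftrightarrow> Y = z" if e: "mvn_equiv ?A X Y"
    proof
      assume "Y = z"
      then show "X = z" using le_z mvn_equiv_imp_le[OF P] e p(2) q(2) by simp
    next
      assume "X = z"
      have "mvn_le ?A Y X"
	using mvn_equiv_imp_le[OF P(2,1)] mvn_equiv_sym[OF P] e p(2) q(2) by simp
      then show "Y = z"
	using rank_le_of_mvn_le[OF q(1) _ p(1)] p(2,3) q(2,3) \<open>X = z\<close> by blast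
    qed
    show "mvn_equiv ?A X Y \<longleftrightarrow> rk X = rk Y"
    proof (cases "X = z \<or> Y = z")
      case True
      then show ?thesis using eq_z zz by (auto simp: rk_def)
    next
      case False
      then show ?thesis
	using rank_of_order(1)[OF T E p(1) _ q(1)] p(2,3) q(2,3) by (simp add: rk_def)
    qed
    show "mvn_le ?A X Y \<longleftrightarrow> (rk X, rk Y) \<in> {(None, x) | x. True} \<union> {(Some s, Some t) | s t. (s, t) \<in> r}"
    proof (cases "X = z \<or> Y = z")
      case True
      then show ?thesis using le_z z_le by (auto simp: rk_def)
    next
      case False
      then show ?thesis
	using rank_of_order(2)[OF T E p(1) _ q(1)] p(2,3) q(2,3) by (simp add: rk_def)
    qed
  qed
qed

section \<open>Distance to the operators of small rank\<close>

text \<open>Formulas of continuous logic see operators only up to small errors. Ranks are therefore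
  measured by the distance to the operators of small rank.\<close>

definition near :: "real => 'l set => ('h::complex_hilbert_space => 'h) => bool" where
  "near c L f \<longleftrightarrow> (\<exists>s. small L s \<and> (\<forall>x. norm (f x - s x) \<le> c * norm x))"

lemma nearI: "small L s ==> (\<And>x. norm (f x - s x) \<le> c * norm x) ==> near c L f"
  unfolding near_def by blast

lemma near_mono: "near c L f ==> c \<le> d ==> near d L f"
  unfolding near_def by (meson mult_right_mono norm_ge_zero order_trans)

lemma near_perturb:
  assumes L: "infinite L" and g: "near c L g" and d: "\<And>x. norm (f x - g x - k x) \<le> d * norm x"
    and k: "compact_operator k"
  shows "near (c + d) L f"
proof -
  obtain s where s: "small L s" "\<And>x. norm (g x - s x) \<le> c * norm x" using g unfolding near_def by blast
  show ?thesis
  proof (rule nearI[OF small_add[OF L s(1) small_compact[OF k]]])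
    fix x
    have "norm (f x - (s x + k x)) \<le> norm (g x - s x) + norm (f x - g x - k x)"
      using norm_triangle_ineq[of "g x - s x" "f x - g x - k x"] by (simp add: algebra_simps)
    then show "norm (f x - (s x + k x)) \<le> (c + d) * norm x"
      using s(2)[of x] d[of x] by (simp add: distrib_right)
  qed
qed

lemma onorm_bounds:
  assumes "bclinear f" "onorm f \<le> c" shows "norm (f x) \<le> c * norm x"
  using bclinearD(7)[OF assms(1), of x] assms(2) by (meson mult_right_mono norm_ge_zero order_trans)

lemma near_sandwich:
  fixes v g w :: "'h::complex_hilbert_space => 'h"
  assumes L: "infinite L" and g: "near c L g" and v: "bclinear v" "onorm v \<le> a"
    and w: "bclinear w" "onorm w \<le> b" and c: "0 \<le> c"
  shows "near (a * c * b) L (v \<circ> g \<circ> w)"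
proof -
  obtain s where s: "small L s" "\<And>x. norm (g x - s x) \<le> c * norm x" using g unfolding near_def by blast
  have a0: "0 \<le> a" using onorm_pos_le[OF bclinearD(1)[OF v(1)]] v(2) by simp
  show ?thesis
  proof (rule nearI[OF small_compose_right[OF small_compose_left[OF s(1) v(1)] w(1)]])
    fix x
    have "norm ((v \<circ> g \<circ> w) x - (v \<circ> s \<circ> w) x) = norm (v (g (w x) - s (w x)))"
      by (simp add: bclinearD(4)[OF v(1)])
    also have "\<dots> \<le> a * norm (g (w x) - s (w x))" by (rule onorm_bounds[OF v])
    also have "\<dots> \<le> a * (c * norm (w x))" by (rule mult_left_mono[OF s(2) a0])
    also have "\<dots> \<le> a * (c * (b * norm x))"
      by (intro mult_left_mono onorm_bounds[OF w] a0 c)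
    finally show "norm ((v \<circ> g \<circ> w) x - (v \<circ> s \<circ> w) x) \<le> a * c * b * norm x" by (simp add: mult_ac)
  qed
qed

text \<open>If \<open>f\<close> is close to \<open>f v f\<close> then its distance \<open>c\<close> to the operators of small rank is,
  up to the error, at most \<open>c^2\<close>; so \<open>c\<close> is close to 0 or not much below 1.\<close>

lemma near_square:
  assumes L: "infinite L" and f: "bclinear f" and v: "bclinear v" "onorm v \<le> a"
    and k: "compact_operator k" and d: "\<And>x. norm (f x - f (v (f x)) - k x) \<le> d * norm x"
    and n: "near c L f" and c: "0 \<le> c"
  shows "near (c * a * c + d) L f"
proof -
  obtain s where s: "small L s" "\<And>x. norm (f x - s x) \<le> c * norm x" using n unfolding near_def by blast
  note S = small_bounded[OF s(1)]
  define y where "y x = f x - s x" for x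
  have y: "bclinear y" unfolding y_def using f S by (rule bclinear_diff)
  have yc: "onorm y \<le> c" by (rule onorm_bound[OF c]) (simp add: y_def s(2))
  have a0: "0 \<le> a" using onorm_pos_le[OF bclinearD(1)[OF v(1)]] v(2) by simp
  let ?s = "\<lambda>x. (s \<circ> (v \<circ> f)) x + ((y \<circ> v) \<circ> s) x"
  have "near (c * a * c) L (\<lambda>x. f (v (f x)))"
  proof (rule nearI)
    show "small L ?s"
      by (intro small_add[OF L] small_compose_right[OF s(1)] small_compose_left[OF s(1)]
	  bclinear_compose f v(1) y)
    fix x
    have "f (v (f x)) - ?s x = y (v (y x))"
      by (simp add: y_def bclinearD(4)[OF v(1)] bclinearD(4)[OF f] bclinearD(4)[OF S])
    also have "norm \<dots> \<le> c * norm (v (y x))" by (rule onorm_bounds[OF y yc])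
    also have "\<dots> \<le> c * (a * (c * norm x))"
      by (intro mult_left_mono order_trans[OF onorm_bounds[OF v]] onorm_bounds[OF y yc] a0 c)
    finally show "norm (f (v (f x)) - ?s x) \<le> c * a * c * norm x" by (simp add: mult_ac)
  qed
  then show ?thesis using near_perturb[OF L _ d k] by blast
qed

text \<open>The distance of \<open>f\<close> to the operators of small rank does not lie between \<open>1/16\<close> and \<open>9/10\<close>;
  two applications of the estimate lead from the upper to the lower bound.\<close>

lemma near_gap:
  assumes L: "infinite L" and f: "bclinear f" and v: "bclinear v" "onorm v \<le> 101/100"
    and k: "compact_operator k" and d: "\<And>x. norm (f x - f (v (f x)) - k x) \<le> 1/100 * norm x"
  shows "near (1/2) L f ==> near (1/16) L f" and "near (9/10) L f ==> near (1/2) L f"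
proof -
  note sq = near_square[OF L f v k d]
  have step: "near e L f" if "near c L f" "0 \<le> c" "c * (101/100) * c + 1/100 \<le> e" for c e
    using near_mono[OF sq[OF that(1,2)] that(3)] .
  show "near (1/16) L f" if n: "near (1/2) L f"
  proof -
    have "near (27/100) L f" by (rule step[OF n]) simp_all
    then have "near (9/100) L f" by (rule step) simp_all
    then show ?thesis by (rule step) simp_all
  qed
  show "near (1/2) L f" if n: "near (9/10) L f"
  proof -
    have "near (83/100) L f" by (rule step[OF n]) simp_all
    then have "near (71/100) L f" by (rule step) simp_all
    then have "near (53/100) L f" by (rule step) simp_all
    then show ?thesis by (rule step) simp_all
  qed
qed

text \<open>An operator that is not close to small rank is bounded below on a large orthonormal set
  which it keeps orthogonal: a maximal such set that is too small leaves room for one more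
  vector.\<close>

lemma large_orthogonal_set:
  fixes g :: "'h::complex_hilbert_space => 'h"
  assumes L: "infinite L" and g: "bclinear g" and n: "\<not> near \<theta> L g" and \<theta>: "0 \<le> \<theta>"
  shows "\<exists>C. orthonormal_on (\<lambda>c. c) C \<and> |L| \<le>o |C| \<and> (\<forall>c\<in>C. \<theta> < norm (g c)) \<and>
    (\<forall>c\<in>C. \<forall>d\<in>C. c \<noteq> d --> cinner (g c) (g d) = 0)"
proof -
  let ?ok = "\<lambda>C. orthonormal_on (\<lambda>c. c) C \<and> (\<forall>c\<in>C. \<theta> < norm (g c)) \<and>
    (\<forall>c\<in>C. \<forall>d\<in>C. c \<noteq> d --> cinner (g c) (g d) = 0)"
  have "\<exists>C\<in>Collect ?ok. \<forall>X\<in>Collect ?ok. C \<subseteq> X --> X = C"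
  proof (rule subset_Zorn')
    fix K assume K: "subset.chain (Collect ?ok) K"
    have two: "\<exists>X\<in>K. a \<in> X \<and> b \<in> X" if ab: "a \<in> \<Union>K" "b \<in> \<Union>K" for a b
    proof -
      obtain X Y where XY: "X \<in> K" "Y \<in> K" "a \<in> X" "b \<in> Y" using ab by blast
      then have "X \<subseteq> Y \<or> Y \<subseteq> X" using K unfolding subset_chain_def by blast
      then show ?thesis using XY by blast
    qed
    have okX: "?ok X" if "X \<in> K" for X using K that unfolding subset_chain_def by blast
    have "orthonormal_on (\<lambda>c. c) (\<Union>K)"
      unfolding orthonormal_on_def
    proof (intro ballI)
      fix a b assume "a \<in> \<Union>K" "b \<in> \<Union>K"
      then obtain X where X: "X \<in> K" "a \<in> X" "b \<in> X" using two by blast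
      have "orthonormal_on (\<lambda>c. c) X" by (rule conjunct1[OF okX[OF X(1)]])
      then show "cinner a b = (if a = b then 1 else 0)"
	using X(2,3) unfolding orthonormal_on_def by simp
    qed
    moreover have "\<forall>c\<in>\<Union>K. \<theta> < norm (g c)"
    proof
      fix a assume "a \<in> \<Union>K"
      then obtain X where X: "X \<in> K" "a \<in> X" by blast
      show "\<theta> < norm (g a)" using conjunct1[OF conjunct2[OF okX[OF X(1)]]] X(2) by (rule bspec)
    qed
    moreover have "\<forall>c\<in>\<Union>K. \<forall>d\<in>\<Union>K. c \<noteq> d --> cinner (g c) (g d) = 0"
    proof (intro ballI impI)
      fix a b assume ab: "a \<in> \<Union>K" "b \<in> \<Union>K" "a \<noteq> b"
      then obtain X where X: "X \<in> K" "a \<in> X" "b \<in> X" using two by blast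
      from conjunct2[OF conjunct2[OF okX[OF X(1)]]] X(2,3) ab(3)
      show "cinner (g a) (g b) = 0" by blast
    qed
    ultimately show "\<Union>K \<in> Collect ?ok" by simp
  qed
  then obtain C where "C \<in> Collect ?ok" and Cmax: "\<forall>X\<in>Collect ?ok. C \<subseteq> X --> X = C" by (rule bexE)
  then have C: "orthonormal_on (\<lambda>c. c) C" "\<forall>c\<in>C. \<theta> < norm (g c)"
    "\<forall>c\<in>C. \<forall>d\<in>C. c \<noteq> d --> cinner (g c) (g d) = 0" by simp_all
  have "|L| \<le>o |C|"
  proof (rule ccontr)
    assume "\<not> |L| \<le>o |C|"
    then have CL: "|C| <o |L|" using not_ordLeq_iff_ordLess[OF card_of_Well_order card_of_Well_order] by blast
    \<comment> \<open>Every vector orthogonal to \<open>C\<close> and \<open>g\<^sup>* g C\<close> on which \<open>g\<close> is large could be added to \<open>C\<close>.\<close>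
    let ?h = "\<lambda>x. adj g (g x)"
    have "|?h ` C| <o |L|" using card_of_image CL by (rule ordLeq_ordLess_trans)
    then have "|C \<union> ?h ` C| <o |L|" by (rule card_of_Un_ordLess_infinite[OF L CL])
    then obtain P where P: "oproj P" "small L P" "\<forall>z\<in>C \<union> ?h ` C. P z = z"
      using small_projection_containing[OF _ L] by blast
    note PD = oprojD[OF P(1)]
    have "norm (g x - (g \<circ> P) x) \<le> \<theta> * norm x" for x
    proof (rule ccontr)
      assume "\<not> norm (g x - (g \<circ> P) x) \<le> \<theta> * norm x"
      then have big: "\<theta> * norm x < norm (g (x - P x))" by (simp add: bclinearD(4)[OF g])
      define r where "r = x - P x"
      have "r \<noteq> 0"
      proof
	assume "r = 0"
	then have "\<theta> * norm x < 0" using big bclinearD(5)[OF g] by (simp add: r_def)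
	then show False using \<theta> by (simp add: mult_less_0_iff)
      qed
      have "norm r \<le> norm x" unfolding r_def by (rule oprojD(5)[OF oproj_complement[OF P(1)]])
      then have big': "\<theta> * norm r < norm (g r)" using big \<theta> unfolding r_def
	by (meson le_less_trans mult_left_mono)
      define \<xi> where "\<xi> = complex_of_real (1 / norm r) *C r"
      have \<xi>1: "norm \<xi> = 1" using \<open>r \<noteq> 0\<close> by (simp add: \<xi>_def norm_divide)
      then have \<xi>\<xi>: "cinner \<xi> \<xi> = 1" by (simp add: cinner_self)
      have "norm (g \<xi>) = norm (g r) / norm r" by (simp add: \<xi>_def bclinearD(2)[OF g] norm_divide)
      then have \<xi>\<theta>: "\<theta> < norm (g \<xi>)" using big' \<open>r \<noteq> 0\<close> by (simp add: less_divide_eq)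
      have orth: "cinner \<xi> z = 0" if "z \<in> C \<union> ?h ` C" for z
      proof -
	have "P z = z" using P(3) that by blast
	then have "cinner r z = 0" using PD(4)[of x z] by (simp add: r_def)
	then show ?thesis by (simp add: \<xi>_def cinner_scaleC_left)
      qed
      have oc: "cinner \<xi> c = 0" "cinner c \<xi> = 0" if "c \<in> C" for c
	using orth[of c] that cinner_eq_0_commute by auto
      have gc: "cinner (g \<xi>) (g c) = 0" "cinner (g c) (g \<xi>) = 0" if "c \<in> C" for c
	using orth[of "?h c"] that cinner_adjoint(1)[OF g, of \<xi> "g c"] cinner_eq_0_commute by auto
      have on: "orthonormal_on (\<lambda>c. c) (insert \<xi> C)"
	unfolding orthonormal_on_def
      proof (intro ballI)
	fix a b assume ab: "a \<in> insert \<xi> C" "b \<in> insert \<xi> C"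
	have "\<xi> \<notin> C" using oc \<xi>\<xi> by auto
	then show "cinner a b = (if a = b then 1 else 0)"
	  using ab oc \<xi>\<xi> C(1)[unfolded orthonormal_on_def] by auto
      qed
      have "\<forall>c\<in>insert \<xi> C. \<forall>d\<in>insert \<xi> C. c \<noteq> d --> cinner (g c) (g d) = 0"
	using gc C(3) by blast
      moreover have "\<forall>c\<in>insert \<xi> C. \<theta> < norm (g c)" using \<xi>\<theta> C(2) by blast
      ultimately have "insert \<xi> C \<in> Collect ?ok" using on by simp
      then have "insert \<xi> C = C" using bspec[OF Cmax, of "insert \<xi> C"] by blast
      then have "\<xi> \<in> C" by blast
      then show False using oc \<xi>\<xi> by simp
    qed
    then have "near \<theta> L g" by (rule nearI[OF small_compose_left[OF P(2) g]])
    then show False using n by blast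
  qed
  then show ?thesis using C by blast
qed

lemma rank_not_near:
  assumes p: "has_rank p B" and L: "infinite L" "|L| \<le>o |B|" and c: "c < 1"
  shows "\<not> near c L p"
proof
  assume "near c L p"
  then obtain s where s: "small L s" "\<And>x. norm (p x - s x) \<le> c * norm x" unfolding near_def by blast
  have on: "orthonormal_on (\<lambda>b. b) B" using p by (simp add: has_rank_def)
  obtain b where b: "b \<in> B" "cmod (cinner (s b) b) < 1 - c"
    using small_nearly_orthogonal[OF s(1) on L, of "1 - c"] c by auto
  note B = orthonormal_onD(1,2)[OF on b(1)]
  have "cinner (p b - s b) b = 1 - cinner (s b) b"
    using has_rank_fixes[OF p b(1)] B by (simp add: cinner_diff_left)
  moreover have "cmod (cinner (p b - s b) b) \<le> c"
    using Cauchy_Schwarz_cinner[of "p b - s b" b] s(2)[of b] B(2) by simp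
  ultimately have "cmod (1 - cinner (s b) b) \<le> c" by simp
  then have "1 - cmod (cinner (s b) b) \<le> c"
    using norm_triangle_ineq2[of 1 "cinner (s b) b"] by simp
  then show False using b(2) by simp
qed

lemma covers_fixed:
  assumes e: "oproj e" and S: "covers S s" "\<And>z. z \<in> S ==> e z = z"
  shows "e (s x) = s x"
proof -
  have "cinner (s x) (y - e y) = 0" for y
  proof -
    have "cinner z (y - e y) = 0" if "z \<in> S" for z
      using oprojD(4)[OF e, of y z] S(2)[OF that] by (simp add: cinner_eq_0_commute[of z])
    then show ?thesis using S(1) unfolding covers_def by blast
  qed
  then have "cinner y (e (s x)) = cinner y (s x)" for y
    using oprojD(3)[OF e, of y "s x"]
    by (metis cinner_commute cinner_diff_right right_minus_eq)
  then show ?thesis by (rule cinner_eqI)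
qed

text \<open>The factorization \<open>f \<approx> v g w\<close> with contractions \<open>v\<close> and \<open>w\<close>: \<open>w\<close> applies \<open>f\<close> and moves the range
  of \<open>e\<close>, which almost contains the range of \<open>f\<close>, into the span of \<open>C\<close>, where \<open>g\<close> is diagonal with
  entries between \<open>9/10\<close> and \<open>101/100\<close>; \<open>v\<close> moves the result back. The factor \<open>100/101\<close> makes \<open>w\<close>
  a contraction.\<close>

lemma factor_through:
  fixes f g :: "'h::complex_hilbert_space => 'h"
  assumes f: "bclinear f" "onorm f \<le> 101/100" and g: "bclinear g" "onorm g \<le> 101/100"
    and e: "has_rank e B" and fe: "\<And>x. norm (f x - e (f x)) \<le> 1/16 * norm x"
    and C: "orthonormal_on (\<lambda>c. c) C" "\<forall>c\<in>C. 9/10 < norm (g c)"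
      "\<forall>c\<in>C. \<forall>d\<in>C. c \<noteq> d --> cinner (g c) (g d) = 0" and BC: "|B| \<le>o |C|"
  shows "\<exists>v w. bclinear v \<and> bclinear w \<and> onorm v \<le> 1 \<and> onorm w \<le> 1 \<and>
    (\<forall>x. norm (f x - v (g (w x))) \<le> 1/5 * norm x)"
proof -
  obtain \<phi> where \<phi>: "inj_on \<phi> B" "\<phi> ` B \<subseteq> C" using BC card_of_ordLeq by metis
  have onB: "orthonormal_on (\<lambda>b. b) B" and eB: "e = partial_isometry (\<lambda>b. b) (\<lambda>b. b) B"
    using e by (simp_all add: has_rank_def)
  have on\<phi>: "orthonormal_on \<phi> B" by (rule orthonormal_image[OF C(1) \<phi>])
  define d where "d b = norm (g (\<phi> b))" for b
  have \<phi>C: "\<phi> b \<in> C" if "b \<in> B" for b using \<phi>(2) that by blast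
  have d: "9/10 < d b" "d b \<le> 101/100" if "b \<in> B" for b
    using C(2) \<phi>C[OF that] onorm_bounds[OF g, of "\<phi> b"] orthonormal_onD(2)[OF C(1) \<phi>C[OF that]]
    by (auto simp: d_def)
  define \<psi> where "\<psi> b = complex_of_real (1 / d b) *C g (\<phi> b)" for b
  have on\<psi>: "orthonormal_on \<psi> B"
    unfolding orthonormal_on_def
  proof (intro ballI)
    fix a b assume ab: "a \<in> B" "b \<in> B"
    show "cinner (\<psi> a) (\<psi> b) = (if a = b then 1 else 0)"
    proof (cases "a = b")
      case True
      have "d b > 0" using d(1)[OF ab(2)] by simp
      then have "norm (\<psi> b) = 1" by (simp add: \<psi>_def norm_divide d_def)
      then show ?thesis using True by (simp add: cinner_self)
    next
      case False
      then have "\<phi> a \<noteq> \<phi> b" using \<phi>(1) ab by (auto simp: inj_on_def)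
      then show ?thesis using C(3) \<phi>C ab False by (simp add: \<psi>_def cinner_linear)
    qed
  qed
  let ?U = "partial_isometry (\<lambda>b. b) \<phi> B" and ?v = "partial_isometry \<psi> (\<lambda>b. b) B"
  define c where "c = complex_of_real (100/101)"
  define w where "w x = c *C ?U (e (f x))" for x
  note ep = has_rank_oproj[OF e]
  have bU: "bclinear ?U" and bv: "bclinear ?v"
    using partial_isometry(1) onB on\<phi> on\<psi> by blast+
  have bw: "bclinear w"
    using bclinear_scaleC[OF bclinear_compose[OF bU bclinear_compose[OF oprojD(1)[OF ep] f(1)]], of c]
    by (simp add: w_def[abs_def] o_def)
  have nef: "norm (e (f x)) \<le> 101/100 * norm x" for x
    using oprojD(5)[OF ep, of "f x"] onorm_bounds[OF f, of x] by simp
  have "norm (w x) \<le> 1 * norm x" for x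
    using partial_isometry(2)[OF onB on\<phi>, of "e (f x)"] nef[of x] by (simp add: w_def c_def norm_divide)
  then have nw: "onorm w \<le> 1" by (intro onorm_bound) auto
  have "norm (?v x) \<le> 1 * norm x" for x using partial_isometry(2)[OF on\<psi> onB, of x] by simp
  then have nv: "onorm ?v \<le> 1" by (intro onorm_bound) auto
  have coeff: "cinner (?v (g (?U z))) b = complex_of_real (d b) * cinner z b" if b: "b \<in> B" for z b
  proof -
    have hs: "((\<lambda>i. cinner z i *C \<phi> i) has_sum ?U z) B"
      unfolding partial_isometry_def by (rule osum_has_sum[OF on\<phi> Bessel[OF onB]])
    have "((\<lambda>i. cinner (g (cinner z i *C \<phi> i)) (\<psi> b)) has_sum cinner (g (?U z)) (\<psi> b)) B"
      using has_sum_bounded_linear[OF bounded_linear_cinner_left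
	  has_sum_bounded_linear[OF bclinearD(1)[OF g(1)] hs]] .
    moreover have "((\<lambda>i. cinner (g (cinner z i *C \<phi> i)) (\<psi> b)) has_sum complex_of_real (d b) * cinner z b) B"
    proof (rule has_sum_finite_neutralI[of "{b}"])
      have g\<psi>: "g (\<phi> i) = complex_of_real (d i) *C \<psi> i" if "i \<in> B" for i
	using d(1)[OF that] by (simp add: \<psi>_def scaleC_scaleC)
      then show "cinner (g (cinner z i *C \<phi> i)) (\<psi> b) = 0" if "i \<in> B - {b}" for i
	using that b on\<psi> by (simp add: bclinearD(2)[OF g(1)] cinner_scaleC_left orthonormal_on_def)
      show "complex_of_real (d b) * cinner z b = (\<Sum>i\<in>{b}. cinner (g (cinner z i *C \<phi> i)) (\<psi> b))"
	using g\<psi>[OF b] orthonormal_onD(1)[OF on\<psi> b]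
	by (simp add: bclinearD(2)[OF g(1)] cinner_scaleC_left)
    qed (use b in auto)
    ultimately have "cinner (g (?U z)) (\<psi> b) = complex_of_real (d b) * cinner z b"
      by (rule has_sum_unique)
    then show ?thesis using partial_isometry(4)[OF on\<psi> onB b] by simp
  qed
  have close: "norm (z - c *C ?v (g (?U z))) \<le> 11/100 * norm z" if z: "e z = z" for z
  proof -
    define y where "y = z - c *C ?v (g (?U z))"
    have yc: "cinner y b = complex_of_real (1 - 100/101 * d b) * cinner z b" if "b \<in> B" for b
      using coeff[OF that, of z] by (simp add: y_def c_def cinner_linear algebra_simps)
    have ev: "e (?v x) = ?v x" for x
      by (rule projection_fixes_partial_isometry[OF ep onB on\<psi> has_rank_fixes[OF e]])
    have ey: "e y = y"
      using z ev bclinearD(2,4)[OF oprojD(1)[OF ep]] by (simp add: y_def)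
    have hs: "((\<lambda>b. (cmod (cinner y b))^2) has_sum (norm y)^2) B"
      using norm_osum[OF onB Bessel[OF onB], of y] ey unfolding eB partial_isometry_def by simp
    have "(norm y)^2 \<le> (11/100 * norm z)^2"
    proof (rule has_sum_le_finite_sums[OF hs])
      fix F assume F: "finite F" "F \<subseteq> B"
      have "(\<Sum>b\<in>F. (cmod (cinner y b))^2) \<le> (\<Sum>b\<in>F. (11/100)^2 * (cmod (cinner z b))^2)"
      proof (rule sum_mono)
	fix b assume "b \<in> F"
	then have b: "b \<in> B" using F by blast
	have "cmod (cinner y b) = \<bar>1 - 100/101 * d b\<bar> * cmod (cinner z b)"
	  unfolding yc[OF b] by (simp only: norm_mult norm_of_real)
	also have "\<dots> \<le> 11/100 * cmod (cinner z b)"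
	  using d[OF b] by (intro mult_right_mono) (auto simp: abs_if)
	finally have "(cmod (cinner y b))^2 \<le> (11/100 * cmod (cinner z b))^2" by (intro power_mono) auto
	then show "(cmod (cinner y b))^2 \<le> (11/100)^2 * (cmod (cinner z b))^2"
	  by (simp only: power_mult_distrib)
      qed
      also have "\<dots> = (11/100)^2 * (\<Sum>b\<in>F. (cmod (cinner z b))^2)" by (simp add: sum_distrib_left)
      also have "\<dots> \<le> (11/100)^2 * (norm z)^2"
	by (intro mult_left_mono Bessel_finite[OF orthonormal_on_subset[OF onB F(2)] F(1)]) simp
      finally show "(\<Sum>b\<in>F. (cmod (cinner y b))^2) \<le> (11/100 * norm z)^2"
	by (simp only: power_mult_distrib)
    qed
    then show ?thesis unfolding y_def[symmetric] by (rule power2_le_imp_le) simp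
  qed
  have "norm (f x - ?v (g (w x))) \<le> 1/5 * norm x" for x
  proof -
    let ?z = "e (f x)"
    have "?v (g (w x)) = c *C ?v (g (?U ?z))"
      by (simp add: w_def bclinearD(2)[OF g(1)] bclinearD(2)[OF bv])
    then have "norm (?z - ?v (g (w x))) \<le> 11/100 * norm ?z"
      using close[of ?z] oprojD(2)[OF ep] by simp
    also have "\<dots> \<le> 11/100 * (101/100 * norm x)" using nef by (intro mult_left_mono) auto
    finally have "norm (?z - ?v (g (w x))) \<le> 1111/10000 * norm x" by simp
    moreover have "norm (f x - ?v (g (w x))) \<le> norm (f x - ?z) + norm (?z - ?v (g (w x)))"
      using norm_triangle_ineq[of "f x - ?z" "?z - ?v (g (w x))"] by simp
    ultimately show ?thesis using fe[of x] norm_ge_zero[of x] by linarith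
  qed
  then show ?thesis using bv bw nv nw by blast
qed

section \<open>The order of infinite ranks in continuous logic\<close>

definition CMax :: "cl_formula => cl_formula => cl_formula" where
  "CMax \<phi> \<psi> = CConn (\<lambda>s. max (s 0) (s 1)) [\<phi>, \<psi>]"

definition COneMinus :: "cl_formula => cl_formula" where
  "COneMinus \<phi> = CConn (\<lambda>s. 1 - s 0) [\<phi>]"

text \<open>This rescales the interval from \<open>l\<close> to \<open>h\<close> to the unit interval and truncates.\<close>

definition CClamp :: "real => real => cl_formula => cl_formula" where
  "CClamp l h \<phi> = CConn (\<lambda>s. max 0 (min 1 ((s 0 - l) / (h - l)))) [\<phi>]"

lemma connective_eval [simp]:
  "cl_eval A (CMax \<phi> \<psi>) e = max (cl_eval A \<phi> e) (cl_eval A \<psi> e)"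
  "cl_eval A (COneMinus \<phi>) e = 1 - cl_eval A \<phi> e"
  "cl_eval A (CClamp l h \<phi>) e = max 0 (min 1 ((cl_eval A \<phi> e - l) / (h - l)))"
  by (simp_all add: CMax_def COneMinus_def CClamp_def)

lemma connective_free [simp]:
  "cl_free (CMax \<phi> \<psi>) = cl_free \<phi> \<union> cl_free \<psi>"
  "cl_free (COneMinus \<phi>) = cl_free \<phi>"
  "cl_free (CClamp l h \<phi>) = cl_free \<phi>"
  by (simp_all add: CMax_def COneMinus_def CClamp_def)

lemma continuous_coordinate: "continuous_on UNIV (\<lambda>s :: nat => real. s i)"
  by (rule continuous_on_product_coordinates)

lemma connective_wf [simp]:
  "cl_wf (CMax \<phi> \<psi>) \<longleftrightarrow> cl_wf \<phi> \<and> cl_wf \<psi>"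
  "cl_wf (COneMinus \<phi>) \<longleftrightarrow> cl_wf \<phi>"
  "l < h ==> cl_wf (CClamp l h \<phi>) \<longleftrightarrow> cl_wf \<phi>"
proof -
  have "continuous_on UNIV (\<lambda>s :: nat => real. max (s 0) (s 1))"
    by (intro continuous_on_max continuous_coordinate)
  then show "cl_wf (CMax \<phi> \<psi>) \<longleftrightarrow> cl_wf \<phi> \<and> cl_wf \<psi>" by (simp add: CMax_def)
  have "continuous_on UNIV (\<lambda>s :: nat => real. 1 - s 0)"
    by (intro continuous_on_diff continuous_on_const continuous_coordinate)
  then show "cl_wf (COneMinus \<phi>) \<longleftrightarrow> cl_wf \<phi>" by (simp add: COneMinus_def)
  assume "l < h"
  then have "continuous_on UNIV (\<lambda>s :: nat => real. max 0 (min 1 ((s 0 - l) / (h - l))))"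
    by (intro continuous_on_max continuous_on_min continuous_on_divide continuous_on_diff
	continuous_on_const continuous_coordinate) auto
  then show "cl_wf (CClamp l h \<phi>) \<longleftrightarrow> cl_wf \<phi>" by (simp add: CClamp_def)
qed

lemma clamp_eq_0: "l < h ==> x \<le> l ==> max 0 (min 1 ((x - l) / (h - l))) = (0 :: real)"
  using divide_nonpos_pos[of "x - l" "h - l"] by simp

lemma clamp_eq_1: "l < h ==> h \<le> x ==> max 0 (min 1 ((x - l) / (h - l))) = (1 :: real)"
  by (simp add: le_divide_eq max_def min_def)

lemma clamp_less_1: "l < h ==> max 0 (min 1 ((x - l) / (h - l))) < (1 :: real) ==> x < h"
  using clamp_eq_1[of l h x] by linarith

text \<open>A structure \<open>(T, r)\<close> is interpreted in \<open>A\<close> by a formula \<open>P\<close> for the universe and a formula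
  \<open>L\<close> for the order when every element on which \<open>P\<close> is less than 1 represents a member of
  \<open>T\<close>, every member is represented by an element on which \<open>P\<close> is 0, and \<open>L\<close> takes only the values
  0 and 1 on representatives. The infimum of the maximum of \<open>P\<close> and a formula that is two-valued on
  representatives is then two-valued, too.\<close>

definition interprets ::
  "'x cstar_algebra => 't fo_struct => ('x => 't => bool) => (nat => cl_formula) =>
    (nat => nat => cl_formula) => bool" where
  "interprets A M G P L \<longleftrightarrow> unit_ball A \<noteq> {} \<and>
     (\<forall>i e. 0 \<le> cl_eval A (P i) e \<and> cl_eval A (P i) e \<le> 1) \<and>
     (\<forall>i j e. 0 \<le> cl_eval A (L i j) e \<and> cl_eval A (L i j) e \<le> 1) \<and>
     (\<forall>i e. e i \<in> unit_ball A --> cl_eval A (P i) e < 1 --> (\<exists>t\<in>fst M. G (e i) t)) \<and>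
     (\<forall>t\<in>fst M. \<exists>X\<in>unit_ball A. G X t \<and> (\<forall>i e. e i = X --> cl_eval A (P i) e = 0)) \<and>
     (\<forall>i j e s t. G (e i) s --> G (e j) t -->
	cl_eval A (L i j) e = (if (s, t) \<in> snd M then 0 else 1)) \<and>
     (\<forall>X s Y t. G X s --> G Y t --> (s = t \<longleftrightarrow> (s, t) \<in> snd M \<and> (t, s) \<in> snd M))"

lemma interpretsD:
  assumes "interprets A M G P L"
  shows "unit_ball A \<noteq> {}"
    and "0 \<le> cl_eval A (P i) e" "cl_eval A (P i) e \<le> 1"
    and "0 \<le> cl_eval A (L i j) e" "cl_eval A (L i j) e \<le> 1"
    and "e i \<in> unit_ball A ==> cl_eval A (P i) e < 1 ==> \<exists>t\<in>fst M. G (e i) t"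
    and "t \<in> fst M ==> \<exists>X\<in>unit_ball A. G X t \<and> (\<forall>i e. e i = X --> cl_eval A (P i) e = 0)"
    and "G (e i) s ==> G (e j) t ==> cl_eval A (L i j) e = (if (s, t) \<in> snd M then 0 else 1)"
    and "G X s ==> G Y t ==> s = t \<longleftrightarrow> (s, t) \<in> snd M \<and> (t, s) \<in> snd M"
  using assms unfolding interprets_def by simp_all

primrec translate :: "(nat => cl_formula) => (nat => nat => cl_formula) => fo_formula => cl_formula" where
  "translate P L (FEq i j) = CMax (L i j) (L j i)"
| "translate P L (FRel i j) = L i j"
| "translate P L (FNot \<phi>) = COneMinus (translate P L \<phi>)"
| "translate P L (FAnd \<phi> \<psi>) = CMax (translate P L \<phi>) (translate P L \<psi>)"
| "translate P L (FEx i \<phi>) = CInf i (CMax (P i) (translate P L \<phi>))"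

lemma cInf_unit_interval:
  fixes f :: "'x => real"
  assumes "B \<noteq> {}" "\<And>x. x \<in> B ==> 0 \<le> f x \<and> f x \<le> 1"
  shows "0 \<le> (INF x\<in>B. f x) \<and> (INF x\<in>B. f x) \<le> 1"
proof
  show "0 \<le> (INF x\<in>B. f x)" using assms by (intro cINF_greatest) auto
  obtain x where "x \<in> B" using assms(1) by blast
  moreover have "bdd_below (f ` B)" using assms(2) by (intro bdd_belowI2[of _ 0]) auto
  ultimately show "(INF x\<in>B. f x) \<le> 1" using assms(2) cINF_lower2[of f B x 1] by blast
qed

lemma translate_range:
  assumes "interprets A M G P L"
  shows "0 \<le> cl_eval A (translate P L \<phi>) e \<and> cl_eval A (translate P L \<phi>) e \<le> 1"
proof (induction \<phi> arbitrary: e)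
  case (FEx i \<phi>)
  have "0 \<le> max (cl_eval A (P i) (e(i := X))) (cl_eval A (translate P L \<phi>) (e(i := X))) \<and>
      max (cl_eval A (P i) (e(i := X))) (cl_eval A (translate P L \<phi>) (e(i := X))) \<le> 1" for X
    using interpretsD(2,3)[OF assms] FEx.IH by (simp add: le_max_iff_disj)
  then show ?case using cInf_unit_interval[OF interpretsD(1)[OF assms]] by simp
next
  case (FEq i j)
  then show ?case using interpretsD(4,5)[OF assms] by (simp add: le_max_iff_disj)
next
  case (FAnd \<phi> \<psi>)
  then show ?case by (auto simp: le_max_iff_disj)
qed (use interpretsD(4,5)[OF assms] in auto)

lemma translate_eval:
  assumes int: "interprets A M G P L" and G: "\<forall>i\<in>fo_free \<phi>. G (e i) (e' i)"
  shows "cl_eval A (translate P L \<phi>) e = (if fo_sat M \<phi> e' then 0 else 1)"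
  using G
proof (induction \<phi> arbitrary: e e')
  case (FEq i j)
  then have G: "G (e i) (e' i)" "G (e j) (e' j)" by auto
  have "cl_eval A (L i j) e = (if (e' i, e' j) \<in> snd M then 0 else 1)"
    "cl_eval A (L j i) e = (if (e' j, e' i) \<in> snd M then 0 else 1)"
    "e' i = e' j \<longleftrightarrow> (e' i, e' j) \<in> snd M \<and> (e' j, e' i) \<in> snd M"
    using interpretsD(8)[OF int G] interpretsD(8)[OF int G(2,1)] interpretsD(9)[OF int G] by simp_all
  then show ?case by auto
next
  case (FRel i j)
  then have G: "G (e i) (e' i)" "G (e j) (e' j)" by auto
  then show ?case using interpretsD(8)[OF int G] by simp
next
  case (FAnd \<phi> \<psi>)
  then have "cl_eval A (translate P L \<phi>) e = (if fo_sat M \<phi> e' then 0 else 1)"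
    "cl_eval A (translate P L \<psi>) e = (if fo_sat M \<psi> e' then 0 else 1)" by simp_all
  then show ?case by simp
next
  case (FEx i \<phi>)
  let ?f = "\<lambda>X. max (cl_eval A (P i) (e(i := X))) (cl_eval A (translate P L \<phi>) (e(i := X)))"
  have IH: "cl_eval A (translate P L \<phi>) (e(i := X)) = (if fo_sat M \<phi> (e'(i := t)) then 0 else 1)"
    if "G X t" for X t
    by (rule FEx.IH) (use FEx.prems that in auto)
  have P01: "0 \<le> cl_eval A (P i) e" "cl_eval A (P i) e \<le> 1" for e
    by (rule interpretsD(2,3)[OF int])+
  have bdd: "bdd_below (?f ` unit_ball A)" using P01 by (intro bdd_belowI2[of _ 0]) (simp add: le_max_iff_disj)
  note ne = interpretsD(1)[OF int]
  have ev: "cl_eval A (translate P L (FEx i \<phi>)) e = (INF X\<in>unit_ball A. ?f X)" by simp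
  show ?case
  proof (cases "fo_sat M (FEx i \<phi>) e'")
    case True
    then obtain t where t: "t \<in> fst M" "fo_sat M \<phi> (e'(i := t))" by auto
    obtain X where X: "X \<in> unit_ball A" "G X t" "\<forall>i e. e i = X --> cl_eval A (P i) e = 0"
      using interpretsD(7)[OF int t(1)] by blast
    have "?f X = 0" using X(3) IH[OF X(2)] t(2) by simp
    then have "(INF X\<in>unit_ball A. ?f X) \<le> 0" using cINF_lower[OF bdd X(1)] by simp
    moreover have "0 \<le> (INF X\<in>unit_ball A. ?f X)"
      using P01 by (intro cINF_greatest[OF ne]) (simp add: le_max_iff_disj)
    ultimately show ?thesis using True ev by simp
  next
    case False
    have "?f X = 1" if X: "X \<in> unit_ball A" for X
    proof (cases "cl_eval A (P i) (e(i := X)) < 1")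
      case True
      have "\<exists>t\<in>fst M. G ((e(i := X)) i) t"
	using interpretsD(6)[OF int, where e = "e(i := X)" and i = i] True X by simp
      then obtain t where t: "t \<in> fst M" "G X t" by auto
      have "\<not> fo_sat M \<phi> (e'(i := t))" using False t(1) by auto
      then show ?thesis using IH[OF t(2)] P01 by (simp add: max_def)
    next
      case False
      then have "cl_eval A (P i) (e(i := X)) = 1" using P01[of "e(i := X)"] by linarith
      then show ?thesis using translate_range[OF int, of \<phi> "e(i := X)"] by (simp add: max_def)
    qed
    then have "(INF X\<in>unit_ball A. ?f X) = (INF X\<in>unit_ball A. 1)" by (intro INF_cong) auto
    then show ?thesis using False ev ne by simp
  qed
qed simp

theorem interprets_fo_equiv:
  assumes A: "interprets A M G P L" and B: "interprets B N H P L"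
    and wf: "\<And>i. cl_wf (P i)" "\<And>i j. cl_wf (L i j)"
    and free: "\<And>i. cl_free (P i) \<subseteq> {i}" "\<And>i j. cl_free (L i j) \<subseteq> {i, j}"
    and eq: "cstar_equiv A B"
  shows "fo_equiv M N"
  unfolding fo_equiv_def
proof (intro allI impI)
  fix \<phi> assume closed: "fo_free \<phi> = {}"
  have W: "cl_wf (translate P L \<psi>)" for \<psi> by (induction \<psi>) (simp_all add: wf)
  have "cl_free (translate P L \<psi>) \<subseteq> fo_free \<psi>" for \<psi>
  proof (induction \<psi>)
    case (FEq i j)
    then show ?case using free(2)[of i j] free(2)[of j i] by auto
  next
    case (FEx i \<psi>)
    then show ?case using free(1)[of i] by auto
  qed (use free(2) in auto)
  then have F: "cl_free (translate P L \<phi>) = {}" using closed by blast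
  have "cl_eval A (translate P L \<phi>) (\<lambda>_. undefined) = (if fo_sat M \<phi> (\<lambda>_. undefined) then 0 else 1)"
    by (rule translate_eval[OF A]) (simp add: closed)
  moreover have "cl_eval B (translate P L \<phi>) (\<lambda>_. undefined) = (if fo_sat N \<phi> (\<lambda>_. undefined) then 0 else 1)"
    by (rule translate_eval[OF B]) (simp add: closed)
  ultimately show "fo_sat M \<phi> (\<lambda>_. undefined) = fo_sat N \<phi> (\<lambda>_. undefined)"
    using eq F W unfolding cstar_equiv_def by (smt (verit))
qed

section \<open>The formulas\<close>

text \<open>The universe consists of elements \<open>x\<close> for which \<open>x v x\<close> is close to \<open>x\<close> for some
  contraction \<open>v\<close>, and \<open>x\<close> is below \<open>y\<close> when \<open>v y w\<close> is close to \<open>x\<close> for contractions \<open>v\<close> and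
  \<open>w\<close>. If \<open>x\<close> has at most the rank of \<open>y\<close>, an error of \<open>1/5\<close> can be achieved, and if an error
  below \<open>3/10\<close> can be achieved, then \<open>x\<close> has at most the rank of \<open>y\<close>.\<close>

definition SMinus :: "star_poly => star_poly => star_poly" where
  "SMinus s t = SAdd s (SScale (-1) t)"

definition regular_fm :: "nat => cl_formula" where
  "regular_fm i = CClamp 0 (1/100) (CInf (Suc i)
     (CNorm (SMinus (SVar i) (SMult (SMult (SVar i) (SVar (Suc i))) (SVar i)))))"

definition below_fm :: "nat => nat => cl_formula" where
  "below_fm i j = CClamp (1/5) (3/10) (CInf (Suc (i + j)) (CInf (Suc (Suc (i + j)))
     (CNorm (SMinus (SVar i) (SMult (SMult (SVar (Suc (i + j))) (SVar j)) (SVar (Suc (Suc (i + j)))))))))"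

definition nonzero_fm :: "nat => cl_formula" where
  "nonzero_fm i = COneMinus (CClamp (1/2) 1 (CNorm (SVar i)))"

text \<open>\<open>x\<close> is infinite when some \<open>u = 1 + 2 v x w\<close> is close to an isometry that is not unitary;
  for \<open>x\<close> near a compact operator this would contradict that \<open>u\<close> has index 0.\<close>

definition shift_poly :: "nat => star_poly" where
  "shift_poly i = SAdd SOne (SScale 2 (SMult (SMult (SVar (i + 1)) (SVar i)) (SVar (i + 2))))"

definition infinite_fm :: "nat => cl_formula" where
  "infinite_fm i = CClamp 0 (1/10) (CInf (i + 1) (CInf (i + 2) (CInf (i + 3)
     (CMax (CNorm (SMinus (SMult (SStar (shift_poly i)) (shift_poly i)) SOne))
       (CMax (CNorm (SMult (SStar (shift_poly i)) (SVar (i + 3))))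
	 (COneMinus (CNorm (SVar (i + 3)))))))))"

lemma formulas_wf:
  "cl_wf (regular_fm i)" "cl_wf (below_fm i j)" "cl_wf (nonzero_fm i)" "cl_wf (infinite_fm i)"
  by (simp_all add: regular_fm_def below_fm_def nonzero_fm_def infinite_fm_def)

lemma formulas_free:
  "cl_free (regular_fm i) \<subseteq> {i}" "cl_free (below_fm i j) \<subseteq> {i, j}"
  "cl_free (nonzero_fm i) \<subseteq> {i}" "cl_free (infinite_fm i) \<subseteq> {i}"
  by (auto simp: regular_fm_def below_fm_def nonzero_fm_def infinite_fm_def SMinus_def shift_poly_def)

lemma formulas_range:
  "0 \<le> cl_eval A (regular_fm i) e \<and> cl_eval A (regular_fm i) e \<le> 1"
  "0 \<le> cl_eval A (below_fm i j) e \<and> cl_eval A (below_fm i j) e \<le> 1"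
  "0 \<le> cl_eval A (nonzero_fm i) e \<and> cl_eval A (nonzero_fm i) e \<le> 1"
  "0 \<le> cl_eval A (infinite_fm i) e \<and> cl_eval A (infinite_fm i) e \<le> 1"
  by (simp_all add: regular_fm_def below_fm_def nonzero_fm_def infinite_fm_def)

context operator_algebra
begin

lemma unit_ballE:
  assumes "X \<in> unit_ball A" "1 < r"
  obtains f where "bclinear f" "X = \<pi> f" "onorm f < r"
proof -
  obtain f where f: "bclinear f" "X = \<pi> f" using assms(1) carrierE by (auto simp: unit_ball_def)
  have "cnorm A (\<pi> f) < r" using assms f by (simp add: unit_ball_def)
  then obtain k where k: "k \<in> I" "onorm (\<lambda>x. f x - k x) < r" using norm_less[OF f(1)] by blast
  have b: "bclinear (\<lambda>x. f x - k x)"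
    using f(1) compact_operatorD(1)[OF I_compact[OF k(1)]] by (rule bclinear_diff)
  have "\<pi> f = \<pi> (\<lambda>x. f x - k x)" using class_eq[OF f(1) b] k(1) by simp
  then show ?thesis using that b k(2) f(2) by simp
qed

lemma unit_ballI: "bclinear f ==> onorm f \<le> 1 ==> \<pi> f \<in> unit_ball A"
  using norm_le_onorm[of f] by (simp add: unit_ball_def class_in_carrier)

lemma zero_in_unit_ball: "\<pi> (\<lambda>_. 0) \<in> unit_ball A"
  by (rule unit_ballI) (simp_all add: onorm_zero)

lemma norm_lessE:
  assumes "bclinear f" "cnorm A (\<pi> f) < r"
  obtains k where "compact_operator k" "\<And>x. norm (f x - k x) \<le> r * norm x"
proof -
  obtain k where k: "k \<in> I" "onorm (\<lambda>x. f x - k x) < r" using norm_less[OF assms] by blast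
  have "bclinear (\<lambda>x. f x - k x)"
    using assms(1) compact_operatorD(1)[OF I_compact[OF k(1)]] by (rule bclinear_diff)
  then show ?thesis using that I_compact[OF k(1)] onorm_bounds k(2) by (meson less_imp_le)
qed

lemma norm_boundI:
  assumes "bclinear f" "0 \<le> c" "\<And>x. norm (f x) \<le> c * norm x"
  shows "cnorm A (\<pi> f) \<le> c"
  using norm_le_onorm[OF assms(1)] onorm_bound[OF assms(2,3)] by simp

lemma eval_minus:
  assumes "star_poly_eval A s e = \<pi> f" "star_poly_eval A t e = \<pi> g" "bclinear f" "bclinear g"
  shows "star_poly_eval A (SMinus s t) e = \<pi> (\<lambda>x. f x - g x)"
proof -
  have "bclinear (\<lambda>x. - g x)" using bclinear_scaleC[OF assms(4), of "-1"] by simp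
  then show ?thesis using assms by (simp add: SMinus_def scale add)
qed

lemma cInf_ball_less:
  assumes "\<And>X. X \<in> unit_ball A ==> 0 \<le> F X" "(INF X\<in>unit_ball A. F X) < (r :: real)"
  shows "\<exists>X\<in>unit_ball A. F X < r"
proof -
  have "bdd_below (F ` unit_ball A)" using assms(1) by (intro bdd_belowI2[of _ 0]) auto
  then show ?thesis using assms(2) zero_in_unit_ball cINF_less_iff[of "unit_ball A" F r] by blast
qed

lemma cInf_ball_le:
  assumes "\<And>X. X \<in> unit_ball A ==> 0 \<le> F X" "X \<in> unit_ball A" "F X \<le> (r :: real)"
  shows "(INF X\<in>unit_ball A. F X) \<le> r"
proof -
  have "bdd_below (F ` unit_ball A)" using assms(1) by (intro bdd_belowI2[of _ 0]) auto
  then show ?thesis using cINF_lower[of F "unit_ball A" X] assms(2,3) by simp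
qed

lemma cInf_ball_nonneg:
  "(\<And>X. X \<in> unit_ball A ==> 0 \<le> F X) ==> 0 \<le> (INF X\<in>unit_ball A. F X :: real)"
  using zero_in_unit_ball by (intro cINF_greatest) auto

lemma regular_formula:
  assumes "e i = \<pi> f" "bclinear f"
  shows "cl_eval A (regular_fm i) e < 1 ==>
      \<exists>v k. bclinear v \<and> onorm v \<le> 101/100 \<and> compact_operator k \<and>
	(\<forall>x. norm (f x - f (v (f x)) - k x) \<le> 1/100 * norm x)" (is "_ ==> ?factor")
    and "f \<circ> f = f ==> cl_eval A (regular_fm i) e = 0"
proof -
  let ?F = "\<lambda>V. cl_eval A (CNorm (SMinus (SVar i) (SMult (SMult (SVar i) (SVar (Suc i))) (SVar i)))) (e(Suc i := V))"
  have F: "?F (\<pi> v) = cnorm A (\<pi> (\<lambda>x. f x - (f \<circ> v \<circ> f) x))" if v: "bclinear v" for v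
  proof -
    have "star_poly_eval A (SMult (SMult (SVar i) (SVar (Suc i))) (SVar i)) (e(Suc i := \<pi> v)) = \<pi> (f \<circ> v \<circ> f)"
      using assms v by (simp add: mult bclinear_compose)
    moreover have "star_poly_eval A (SVar i) (e(Suc i := \<pi> v)) = \<pi> f" using assms by simp
    ultimately show ?thesis
      using eval_minus assms(2) v by (simp add: bclinear_compose)
  qed
  have bv: "bclinear (\<lambda>x. f x - (f \<circ> v \<circ> f) x)" if "bclinear v" for v
    using assms(2) that by (intro bclinear_diff bclinear_compose)
  have nonneg: "0 \<le> ?F V" if V: "V \<in> unit_ball A" for V
  proof -
    obtain v where v: "bclinear v" "V = \<pi> v" using unit_ballE[OF V, of 2] by auto
    show ?thesis unfolding v(2) F[OF v(1)] by (rule norm_nonneg[OF bv[OF v(1)]])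
  qed
  have ev: "cl_eval A (regular_fm i) e = max 0 (min 1 (((INF V\<in>unit_ball A. ?F V) - 0) / (1/100 - 0)))"
    by (simp add: regular_fm_def)
  show ?factor if "cl_eval A (regular_fm i) e < 1"
  proof -
    have "(INF V\<in>unit_ball A. ?F V) < 1/100" by (rule clamp_less_1[of 0]) (use that ev in simp_all)
    then obtain V where V: "V \<in> unit_ball A" "?F V < 1/100" using cInf_ball_less[of ?F, OF nonneg] by blast
    obtain v where v: "bclinear v" "V = \<pi> v" "onorm v < 101/100" using unit_ballE[OF V(1), of "101/100"] by auto
    have "cnorm A (\<pi> (\<lambda>x. f x - (f \<circ> v \<circ> f) x)) < 1/100" using V(2) F[OF v(1)] v(2) by simp
    then obtain k where "compact_operator k" "\<And>x. norm (f x - (f \<circ> v \<circ> f) x - k x) \<le> 1/100 * norm x"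
      using norm_lessE[OF bv[OF v(1)]] by blast
    then show ?thesis using v by (intro exI[of _ v] exI[of _ k]) auto
  qed
  show "cl_eval A (regular_fm i) e = 0" if ff: "f \<circ> f = f"
  proof -
    have "?F (\<pi> id) = 0"
    proof -
      have "?F (\<pi> id) = cnorm A (\<pi> (\<lambda>_. 0))" unfolding F[OF bclinear_id(1)] using ff by (simp add: fun_eq_iff)
      moreover have "cnorm A (\<pi> (\<lambda>_. 0)) \<le> 0" by (rule norm_boundI) simp_all
      ultimately show ?thesis using norm_nonneg[OF bclinear_zero] by simp
    qed
    moreover have "\<pi> id \<in> unit_ball A" by (rule unit_ballI) (simp_all add: onorm_id_le id_def)
    ultimately have "(INF V\<in>unit_ball A. ?F V) \<le> 0" using cInf_ball_le[of ?F, OF nonneg, of "\<pi> id" 0] by simp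
    then show ?thesis unfolding ev by (intro clamp_eq_0) simp_all
  qed
qed

lemma below_formula:
  assumes e: "e i = \<pi> f" "e j = \<pi> g" and f: "bclinear f" and g: "bclinear g"
  shows "cl_eval A (below_fm i j) e < 1 ==>
      \<exists>v w k. bclinear v \<and> bclinear w \<and> onorm v \<le> 101/100 \<and> onorm w \<le> 101/100 \<and>
	compact_operator k \<and> (\<forall>x. norm (f x - v (g (w x)) - k x) \<le> 3/10 * norm x)" (is "_ ==> ?factor")
    and "bclinear v ==> bclinear w ==> onorm v \<le> 1 ==> onorm w \<le> 1 ==>
      (\<And>x. norm (f x - v (g (w x))) \<le> 1/5 * norm x) ==> cl_eval A (below_fm i j) e = 0"
proof -
  let ?n = "Suc (i + j)"
  let ?F = "\<lambda>V W. cl_eval A (CNorm (SMinus (SVar i) (SMult (SMult (SVar ?n) (SVar j)) (SVar (Suc ?n)))))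
    (e(?n := V, Suc ?n := W))"
  have F: "?F (\<pi> v) (\<pi> w) = cnorm A (\<pi> (\<lambda>x. f x - (v \<circ> g \<circ> w) x))"
    if v: "bclinear v" and w: "bclinear w" for v w
  proof -
    have "star_poly_eval A (SMult (SMult (SVar ?n) (SVar j)) (SVar (Suc ?n))) (e(?n := \<pi> v, Suc ?n := \<pi> w))
	= \<pi> (v \<circ> g \<circ> w)"
      using e v w g by (simp add: mult bclinear_compose)
    moreover have "star_poly_eval A (SVar i) (e(?n := \<pi> v, Suc ?n := \<pi> w)) = \<pi> f" using e by simp
    ultimately show ?thesis using eval_minus f g v w by (simp add: bclinear_compose)
  qed
  have bv: "bclinear (\<lambda>x. f x - (v \<circ> g \<circ> w) x)" if "bclinear v" "bclinear w" for v w
    using f g that by (intro bclinear_diff bclinear_compose)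
  have nonneg: "0 \<le> ?F V W" if VW: "V \<in> unit_ball A" "W \<in> unit_ball A" for V W
  proof -
    obtain v where v: "bclinear v" "V = \<pi> v" using unit_ballE[OF VW(1), of 2] by auto
    obtain w where w: "bclinear w" "W = \<pi> w" using unit_ballE[OF VW(2), of 2] by auto
    show ?thesis unfolding v(2) w(2) F[OF v(1) w(1)] by (rule norm_nonneg[OF bv[OF v(1) w(1)]])
  qed
  let ?G = "\<lambda>V. INF W\<in>unit_ball A. ?F V W"
  have nonneg': "0 \<le> ?G V" if "V \<in> unit_ball A" for V by (rule cInf_ball_nonneg) (rule nonneg[OF that])
  have ev: "cl_eval A (below_fm i j) e = max 0 (min 1 (((INF V\<in>unit_ball A. ?G V) - 1/5) / (3/10 - 1/5)))"
    by (simp add: below_fm_def)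
  show ?factor if "cl_eval A (below_fm i j) e < 1"
  proof -
    have "(INF V\<in>unit_ball A. ?G V) < 3/10" by (rule clamp_less_1[of "1/5"]) (use that ev in simp_all)
    then obtain V where V: "V \<in> unit_ball A" "?G V < 3/10" using cInf_ball_less[of ?G, OF nonneg'] by blast
    obtain W where W: "W \<in> unit_ball A" "?F V W < 3/10" using cInf_ball_less[of "?F V", OF nonneg[OF V(1)] V(2)] by blast
    obtain v where v: "bclinear v" "V = \<pi> v" "onorm v < 101/100" using unit_ballE[OF V(1), of "101/100"] by auto
    obtain w where w: "bclinear w" "W = \<pi> w" "onorm w < 101/100" using unit_ballE[OF W(1), of "101/100"] by auto
    have "cnorm A (\<pi> (\<lambda>x. f x - (v \<circ> g \<circ> w) x)) < 3/10" using W(2) F[OF v(1) w(1)] v(2) w(2) by simp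
    then obtain k where "compact_operator k" "\<And>x. norm (f x - (v \<circ> g \<circ> w) x - k x) \<le> 3/10 * norm x"
      using norm_lessE[OF bv[OF v(1) w(1)]] by blast
    then show ?thesis using v w by (intro exI[of _ v] exI[of _ w] exI[of _ k]) auto
  qed
  assume v: "bclinear v" "onorm v \<le> 1" and w: "bclinear w" "onorm w \<le> 1"
    and close: "\<And>x. norm (f x - v (g (w x))) \<le> 1/5 * norm x"
  have "?F (\<pi> v) (\<pi> w) \<le> 1/5"
    unfolding F[OF v(1) w(1)] by (rule norm_boundI[OF bv[OF v(1) w(1)]]) (use close in auto)
  then have "?G (\<pi> v) \<le> 1/5"
    using cInf_ball_le[of "?F (\<pi> v)", OF nonneg[OF unit_ballI[OF v]] unit_ballI[OF w]] by blast
  then have "(INF V\<in>unit_ball A. ?G V) \<le> 1/5" using cInf_ball_le[of ?G, OF nonneg' unit_ballI[OF v]] by blast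
  then show "cl_eval A (below_fm i j) e = 0" unfolding ev by (intro clamp_eq_0) simp_all
qed

end

section \<open>Both algebras interpret the order of infinite ranks\<close>

text \<open>A set whose cardinality is the successor of that of \<open>L\<close>; rank at most \<open>|L|\<close> is rank less than
  \<open>|suc_set L|\<close>.\<close>

definition suc_set :: "'c set => 'c set set" where
  "suc_set L = Field (cardSuc |L| )"

lemma less_suc_set_iff: "|S| <o |suc_set L| \<longleftrightarrow> |S| \<le>o |L|"
proof -
  have c: "|suc_set L| =o cardSuc |L|"
    unfolding suc_set_def by (rule card_of_Field_ordIso[OF cardSuc_Card_order[OF card_of_Card_order]])
  have "|S| <o |suc_set L| \<longleftrightarrow> |S| <o cardSuc |L|"
    using ordLess_ordIso_trans[OF _ c] ordLess_ordIso_trans[OF _ ordIso_symmetric[OF c]] by blast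
  then show ?thesis using cardSuc_ordLeq_ordLess[OF card_of_Card_order card_of_Card_order] by blast
qed

lemma suc_set_le_iff: "|suc_set L| \<le>o |M| \<longleftrightarrow> |L| <o |M|"
proof -
  have c: "|suc_set L| =o cardSuc |L|"
    unfolding suc_set_def by (rule card_of_Field_ordIso[OF cardSuc_Card_order[OF card_of_Card_order]])
  have "|suc_set L| \<le>o |M| \<longleftrightarrow> cardSuc |L| \<le>o |M|"
    using ordIso_ordLeq_trans[OF c] ordIso_ordLeq_trans[OF ordIso_symmetric[OF c]] by blast
  then show ?thesis using cardSuc_ordLess_ordLeq[OF card_of_Card_order card_of_Card_order] by blast
qed

lemma infinite_suc_set: "infinite L ==> infinite (suc_set L)"
proof -
  assume L: "infinite L"
  have "|L| <o |suc_set L|" unfolding less_suc_set_iff by (rule card_of_mono1) simp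
  then show ?thesis using L card_of_ordLeq_infinite ordLess_imp_ordLeq by blast
qed

lemma not_card_le_iff: "\<not> |A| \<le>o |B| \<longleftrightarrow> |B| <o |A|"
  by (rule not_ordLeq_iff_ordLess[OF card_of_Well_order card_of_Well_order])

lemma card_le_refl: "|A| \<le>o |A|"
  by (rule card_of_mono1) simp

lemma small_UNIV_nat: "small (UNIV :: nat set) f \<longleftrightarrow> compact_operator f"
proof
  assume "small (UNIV :: nat set) f"
  moreover have "\<not> |S| <o |UNIV :: nat set|" if "infinite S" for S :: "'a set"
    using countable_ordLeq_infinite[OF _ that, of "UNIV :: nat set"] not_card_le_iff by auto
  ultimately show "compact_operator f" unfolding small_def by blast
qed (rule small_compact)

lemma basis_has_rank:
  assumes "basis_of E UNIV" shows "has_rank id E"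
  using assms by (auto simp: basis_of_def has_rank_def partial_isometry_def fun_eq_iff)

lemma basis_covers:
  assumes E: "basis_of E UNIV" shows "covers E f"
  unfolding covers_def
proof (intro allI impI)
  fix y x assume "\<forall>s\<in>E. cinner s y = 0"
  then have "cinner (id y) y = 0"
    using has_rank_covers[OF basis_has_rank[OF E]] unfolding covers_def by blast
  then show "cinner (f x) y = 0" by simp
qed

text \<open>An operator gets the rank \<open>t\<close> when it is close to operators of rank at most \<open>t\<close> and to no
  operators of smaller infinite rank.\<close>

definition rank_class :: "'t set => ('t => 'c set) => ('h::complex_hilbert_space => 'h) => 't => bool" where
  "rank_class T crd f t \<longleftrightarrow> t \<in> T \<and> near (1/2) (suc_set (crd t)) f \<and>
     (\<forall>s\<in>T. near (1/2) (suc_set (crd s)) f --> |crd t| \<le>o |crd s| ) \<and>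
     \<not> near (1/2) (UNIV :: nat set) f"

definition regular :: "('h::complex_hilbert_space => 'h) => bool" where
  "regular f \<longleftrightarrow> bclinear f \<and> onorm f \<le> 101/100 \<and>
     (\<exists>v k. bclinear v \<and> onorm v \<le> 101/100 \<and> compact_operator k \<and>
	(\<forall>x. norm (f x - f (v (f x)) - k x) \<le> 1/100 * norm x))"

lemma regular_gap:
  assumes "regular f" "infinite L"
  shows "near (1/2) L f ==> near (1/16) L f" and "near (9/10) L f ==> near (1/2) L f"
  using assms near_gap[OF assms(2)] unfolding regular_def by blast+

context
  fixes T :: "'t set" and r :: "'t rel" and crd :: "'t => 'c set"
    and E :: "'h::complex_hilbert_space set"
  assumes T: "rank_index T r crd E" and E: "basis_of E UNIV"
begin

private lemmas index = rank_indexD[OF T]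

lemma rank_class_exists:
  fixes f :: "'h => 'h"
  assumes f: "bclinear f" and n: "\<not> near (1/2) (UNIV :: nat set) f"
  shows "\<exists>t. rank_class T crd f t"
proof -
  have infE: "infinite E"
  proof
    assume "finite E"
    then have "compact_operator (id :: 'h => 'h)"
      using has_rank_finite_compact[OF basis_has_rank[OF E]] by blast
    then have "compact_operator f" using compact_compose_left[OF f, of id] by simp
    then have "near (1/2) (UNIV :: nat set) f"
      by (intro nearI[of _ f]) (simp_all add: small_UNIV_nat)
    then show False using n by blast
  qed
  obtain t0 where t0: "t0 \<in> T" "|E| =o |crd t0|" using index(3)[OF infE card_le_refl] by blast
  have "|E| <o |suc_set (crd t0)|" unfolding less_suc_set_iff using t0(2) ordIso_imp_ordLeq by blast
  then have "small (suc_set (crd t0)) f" using small_cover[OF f infE _ basis_covers[OF E]] by blast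
  then have n0: "near (1/2) (suc_set (crd t0)) f" by (intro nearI[of _ f]) simp_all
  define N where "N = {t \<in> T. near (1/2) (suc_set (crd t)) f}"
  have "\<exists>q\<in>(\<lambda>t. |crd t| ) ` N. \<forall>q'\<in>(\<lambda>t. |crd t| ) ` N. q \<le>o q'"
    by (rule exists_minim_Card_order) (use t0(1) n0 in \<open>auto simp: N_def card_of_Card_order\<close>)
  then obtain t where "t \<in> N" "\<forall>s\<in>N. |crd t| \<le>o |crd s|" by auto
  then show ?thesis using n by (auto simp: rank_class_def N_def)
qed

text \<open>Otherwise \<open>g\<close> would be close to an operator of smaller rank, and this rank is the cardinality
  of some smaller member of the index set, because the ranks are all the infinite cardinals up to
  the dimension.\<close>

lemma not_near_own_rank:
  fixes g :: "'h => 'h"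
  assumes g: "rank_class T crd g t" shows "\<not> near (1/2) (crd t) g"
proof
  assume "near (1/2) (crd t) g"
  then obtain s where s: "small (crd t) s" "\<forall>x. norm (g x - s x) \<le> 1/2 * norm x"
    unfolding near_def by blast
  have tT: "t \<in> T" using g by (simp add: rank_class_def)
  consider "compact_operator s" | S where "infinite S" "|S| <o |crd t|" "covers S s"
    using s(1) unfolding small_def by blast
  then show False
  proof cases
    case 1
    then have "near (1/2) (UNIV :: nat set) g" using s(2) small_UNIV_nat unfolding near_def by blast
    then show False using g by (simp add: rank_class_def)
  next
    case 2
    have "|S| \<le>o |E|"
      using ordLess_imp_ordLeq[OF 2(2)] index(2)[OF tT] by (rule ordLeq_transitive)
    then obtain u where u: "u \<in> T" "|S| =o |crd u|" using index(3)[OF 2(1)] by blast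
    have "|S| <o |suc_set (crd u)|" unfolding less_suc_set_iff using u(2) ordIso_imp_ordLeq by blast
    then have "small (suc_set (crd u)) s" by (rule small_cover[OF small_bounded[OF s(1)] 2(1) _ 2(3)])
    then have "near (1/2) (suc_set (crd u)) g" using s(2) unfolding near_def by blast
    then have "|crd t| \<le>o |crd u|" using g u(1) by (simp add: rank_class_def)
    then have "|crd t| \<le>o |S|" using ordIso_symmetric[OF u(2)] by (rule ordLeq_ordIso_trans)
    then show False using 2(2) not_ordLess_ordLeq by blast
  qed
qed

lemma rank_class_projection:
  assumes t: "t \<in> T"
  shows "\<exists>p B. has_rank (p :: 'h => 'h) B \<and> infinite B \<and> rank_class T crd p t"
proof -
  obtain \<phi> where \<phi>: "inj_on \<phi> (crd t)" "\<phi> ` crd t \<subseteq> E"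
    using index(2)[OF t] card_of_ordLeq by metis
  let ?B = "\<phi> ` crd t" and ?p = "partial_isometry (\<lambda>b. b) (\<lambda>b. b) (\<phi> ` crd t) :: 'h => 'h"
  have "orthonormal_on (\<lambda>b. b) E" using E by (simp add: basis_of_def)
  then have "orthonormal_on (\<lambda>b. b) ?B" using \<phi>(2) by (rule orthonormal_on_subset)
  then have p: "has_rank ?p ?B" by (simp add: has_rank_def)
  have inf: "infinite ?B" using index(1)[OF t] \<phi>(1) finite_imageD by blast
  have B: "|crd t| =o |?B|" using \<phi>(1) card_of_ordIso by (metis bij_betw_def)
  have pb: "bclinear ?p" using oprojD(1)[OF has_rank_oproj[OF p]] .
  have "rank_class T crd ?p t"
    unfolding rank_class_def
  proof (intro conjI ballI impI)
    have "|?B| <o |suc_set (crd t)|"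
      unfolding less_suc_set_iff using ordIso_imp_ordLeq[OF ordIso_symmetric[OF B]] .
    then have "small (suc_set (crd t)) ?p" using small_cover[OF pb inf _ has_rank_covers[OF p]] by blast
    then show "near (1/2) (suc_set (crd t)) ?p" by (intro nearI[of _ ?p]) simp_all
    have "|UNIV :: nat set| \<le>o |?B|" by (rule countable_ordLeq_infinite[OF _ inf]) simp
    then show "\<not> near (1/2) (UNIV :: nat set) ?p" using rank_not_near[OF p infinite_UNIV_nat, of "1/2"] by simp
    fix s assume s: "s \<in> T" "near (1/2) (suc_set (crd s)) ?p"
    show "|crd t| \<le>o |crd s|"
    proof (rule ccontr)
      assume "\<not> |crd t| \<le>o |crd s|"
      then have "|suc_set (crd s)| \<le>o |crd t|" by (simp add: suc_set_le_iff not_card_le_iff)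
      then have "|suc_set (crd s)| \<le>o |?B|" using B by (rule ordLeq_ordIso_trans)
      then show False
	using rank_not_near[OF p infinite_suc_set[OF index(1)[OF s(1)]], of "1/2"] s(2) by simp
    qed
  qed (rule t)
  then show ?thesis using p inf by blast
qed

text \<open>Since \<open>f\<close> is close to rank at most \<open>|crd s|\<close>, its range is almost contained in that of a
  projection of this rank; since \<open>g\<close> is far from rank less than \<open>|crd t|\<close>, it is large on an
  orthonormal set of cardinality \<open>|crd t|\<close>.\<close>

lemma rank_class_factor:
  fixes f g :: "'h => 'h"
  assumes f: "regular f" "rank_class T crd f s" and g: "regular g" "rank_class T crd g t"
    and le: "|crd s| \<le>o |crd t|"
  shows "\<exists>v w. bclinear v \<and> bclinear w \<and> onorm v \<le> 1 \<and> onorm w \<le> 1 \<and>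
    (\<forall>x. norm (f x - v (g (w x))) \<le> 1/5 * norm x)"
proof -
  have sT: "s \<in> T" and tT: "t \<in> T" using f(2) g(2) by (auto simp: rank_class_def)
  note infs = index(1)[OF sT] and inft = index(1)[OF tT]
  let ?L = "suc_set (crd s)"
  note infL = infinite_suc_set[OF infs]
  have "near (1/2) ?L f" using f(2) by (simp add: rank_class_def)
  then have "near (1/16) ?L f" by (rule regular_gap(1)[OF f(1) infL])
  then obtain q where q: "small ?L q" "\<And>x. norm (f x - q x) \<le> 1/16 * norm x" unfolding near_def by blast
  have "\<exists>S. |S| <o |?L| \<and> covers S q"
  proof -
    consider "compact_operator q" | S where "|S| <o |?L|" "covers S q"
      using q(1) unfolding small_def by blast
    then show ?thesis
    proof cases
      case 1
      then obtain S where S: "countable S" "covers S q" using compact_countable_cover by blast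
      have "|S| <o |?L|" unfolding less_suc_set_iff by (rule countable_ordLeq_infinite[OF S(1) infs])
      then show ?thesis using S(2) by blast
    qed blast
  qed
  then obtain S where S: "|S| <o |?L|" "covers S q" by blast
  obtain e where e: "oproj e" "small ?L e" "\<forall>z\<in>S. e z = z"
    using small_projection_containing[OF S(1) infL] by blast
  have eq: "e (q x) = q x" for x by (rule covers_fixed[OF e(1) S(2)]) (use e(3) in blast)
  obtain B where B: "has_rank e B" using ex_rank[OF e(1)] by blast
  have "|B| \<le>o |crd s|"
  proof (cases "finite B")
    case True
    then show ?thesis using countable_ordLeq_infinite[OF countable_finite infs] by blast
  next
    case False
    then have "\<not> |?L| \<le>o |B|" using rank_not_small[OF B False _ infL] e(2) by blast
    then show ?thesis unfolding not_card_le_iff less_suc_set_iff .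
  qed
  then have Bt: "|B| \<le>o |crd t|" using le by (rule ordLeq_transitive)
  have fe: "norm (f x - e (f x)) \<le> 1/16 * norm x" for x
  proof -
    have "f x - e (f x) = (f x - q x) - e (f x - q x)"
      by (simp add: bclinearD(4)[OF oprojD(1)[OF e(1)]] eq)
    also have "norm \<dots> \<le> norm (f x - q x)" by (rule oprojD(5)[OF oproj_complement[OF e(1)]])
    finally show ?thesis using q(2)[of x] by simp
  qed
  have gb: "bclinear g" "onorm g \<le> 101/100" and fb: "bclinear f" "onorm f \<le> 101/100"
    using f(1) g(1) by (auto simp: regular_def)
  have "\<not> near (9/10) (crd t) g" using not_near_own_rank[OF g(2)] regular_gap(2)[OF g(1) inft] by blast
  then obtain C where C: "orthonormal_on (\<lambda>c. c) C" "|crd t| \<le>o |C|" "\<forall>c\<in>C. 9/10 < norm (g c)"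
    "\<forall>c\<in>C. \<forall>d\<in>C. c \<noteq> d --> cinner (g c) (g d) = 0"
    using large_orthogonal_set[OF inft gb(1), of "9/10"] by auto
  show ?thesis
    by (rule factor_through[OF fb gb B fe C(1,3,4) ordLeq_transitive[OF Bt C(2)]])
qed

text \<open>\<open>v g w\<close> is close to operators of rank at most \<open>|crd t|\<close>, as \<open>g\<close> is.\<close>

lemma rank_class_le:
  fixes f g :: "'h => 'h"
  assumes f: "rank_class T crd f s" and g: "regular g" "rank_class T crd g t"
    and v: "bclinear v" "onorm v \<le> 101/100" and w: "bclinear w" "onorm w \<le> 101/100"
    and k: "compact_operator k" and d: "\<And>x. norm (f x - v (g (w x)) - k x) \<le> 3/10 * norm x"
  shows "|crd s| \<le>o |crd t|"
proof -
  have tT: "t \<in> T" using g(2) by (auto simp: rank_class_def)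
  note infL = infinite_suc_set[OF index(1)[OF tT]]
  have "near (1/2) (suc_set (crd t)) g" using g(2) by (simp add: rank_class_def)
  then have "near (1/16) (suc_set (crd t)) g" by (rule regular_gap(1)[OF g(1) infL])
  then have n: "near (101/100 * (1/16) * (101/100)) (suc_set (crd t)) (v \<circ> g \<circ> w)"
    by (rule near_sandwich[OF infL _ v w]) simp
  have "near (101/100 * (1/16) * (101/100) + 3/10) (suc_set (crd t)) f"
    by (rule near_perturb[OF infL n _ k]) (use d in simp)
  then have "near (1/2) (suc_set (crd t)) f" by (rule near_mono) simp
  then show ?thesis using f tT by (simp add: rank_class_def)
qed

end

context operator_algebra
begin

definition represents_rank :: "'t set => ('t => 'c set) => 'x => 't => bool" where
  "represents_rank T crd X t \<longleftrightarrow> (\<exists>f. X = \<pi> f \<and> regular f \<and> rank_class T crd f t)"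

text \<open>The formula \<open>Q\<close> excludes the operators that are close to compact ones. It is the only part of the
  interpretation that depends on the algebra.\<close>

theorem interprets_ranks:
  assumes T: "rank_index T r crd (E :: 'h set)" and E: "basis_of E UNIV"
    and range: "\<And>i e. 0 \<le> cl_eval A (Q i) e \<and> cl_eval A (Q i) e \<le> 1"
    and sound: "\<And>i e f. e i = \<pi> f ==> regular f ==> cl_eval A (Q i) e < 1 ==>
      \<not> near (1/2) (UNIV :: nat set) f"
    and complete: "\<And>i e p B. e i = \<pi> p ==> has_rank p B ==> infinite B ==> cl_eval A (Q i) e = 0"
  shows "interprets A (T, r) (represents_rank T crd) (\<lambda>i. CMax (regular_fm i) (Q i)) below_fm"
  unfolding interprets_def
proof (intro conjI allI impI ballI)
  show "unit_ball A \<noteq> {}" using zero_in_unit_ball by blast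
  show "0 \<le> cl_eval A (CMax (regular_fm i) (Q i)) e" "cl_eval A (CMax (regular_fm i) (Q i)) e \<le> 1" for i e
    using range[of i e] formulas_range(1)[of A i e] by (simp_all add: le_max_iff_disj)
  show "0 \<le> cl_eval A (below_fm i j) e" "cl_eval A (below_fm i j) e \<le> 1" for i j e
    using formulas_range(2)[of A i j e] by simp_all
next
  fix i e assume X: "e i \<in> unit_ball A" and less: "cl_eval A (CMax (regular_fm i) (Q i)) e < 1"
  obtain f where f: "bclinear f" "e i = \<pi> f" "onorm f < 101/100"
    using unit_ballE[OF X, of "101/100"] by auto
  have "cl_eval A (regular_fm i) e < 1" using less by simp
  then have reg: "regular f" using regular_formula(1)[of e i f, OF f(2,1)] f unfolding regular_def by auto
  have "\<not> near (1/2) (UNIV :: nat set) f" using sound[of e i f, OF f(2) reg] less by simp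
  then obtain t where t: "rank_class T crd f t" using rank_class_exists[OF T E f(1)] by blast
  then have "represents_rank T crd (e i) t" unfolding represents_rank_def using f(2) reg by blast
  then show "\<exists>t\<in>fst (T, r). represents_rank T crd (e i) t" using t by (auto simp: rank_class_def)
next
  fix t assume "t \<in> fst (T, r)"
  then obtain p :: "'h => 'h" and B where p: "has_rank p B" "infinite B" "rank_class T crd p t"
    using rank_class_projection[OF T E, of t] by auto
  note P = has_rank_oproj[OF p(1)]
  have np: "onorm p \<le> 1" by (rule onorm_bound) (use oprojD(5)[OF P] in simp_all)
  have pp: "p \<circ> p = p" using P by (simp add: oproj_def)
  have "regular p"
    unfolding regular_def
  proof (intro conjI exI)
    show "bclinear p" by (rule oprojD(1)[OF P])
    show "onorm p \<le> 101/100" using np by simp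
    show "bclinear (\<lambda>x :: 'h. x)" "compact_operator (\<lambda>_. 0 :: 'h)" by simp_all
    show "onorm (\<lambda>x :: 'h. x) \<le> 101/100" by (rule order_trans[OF onorm_id_le]) simp
    show "\<forall>x. norm (p x - p (p x) - 0) \<le> 1/100 * norm x" by (simp add: oprojD(2)[OF P])
  qed
  then have "represents_rank T crd (\<pi> p) t" unfolding represents_rank_def using p(3) by blast
  moreover have "cl_eval A (CMax (regular_fm i) (Q i)) e = 0" if "e i = \<pi> p" for i e
    using regular_formula(2)[of e i p, OF that oprojD(1)[OF P] pp] complete[of e i p B, OF that p(1,2)] by simp
  ultimately show "\<exists>X\<in>unit_ball A. represents_rank T crd X t \<and>
      (\<forall>i e. e i = X --> cl_eval A (CMax (regular_fm i) (Q i)) e = 0)"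
    using unit_ballI[OF oprojD(1)[OF P] np] by blast
next
  fix i j :: nat and e s t assume "represents_rank T crd (e i) s" "represents_rank T crd (e j) t"
  then obtain f g where f: "e i = \<pi> f" "regular f" "rank_class T crd f s"
    and g: "e j = \<pi> g" "regular g" "rank_class T crd g t" unfolding represents_rank_def by blast
  have st: "s \<in> T" "t \<in> T" and b: "bclinear f" "bclinear g"
    using f g by (auto simp: rank_class_def regular_def)
  show "cl_eval A (below_fm i j) e = (if (s, t) \<in> snd (T, r) then 0 else 1)"
  proof (cases "|crd s| \<le>o |crd t|")
    case True
    then have "cl_eval A (below_fm i j) e = 0"
      using rank_class_factor[OF T E f(2,3) g(2,3)] below_formula(2)[of e i f j g, OF f(1) g(1) b] by blast
    then show ?thesis using rank_indexD(4)[OF T st] True by simp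
  next
    case False
    have "\<not> cl_eval A (below_fm i j) e < 1"
    proof
      assume "cl_eval A (below_fm i j) e < 1"
      then obtain v w k where "bclinear v" "bclinear w" "onorm v \<le> 101/100"
	"onorm w \<le> 101/100" "compact_operator k" "\<forall>x. norm (f x - v (g (w x)) - k x) \<le> 3/10 * norm x"
	using below_formula(1)[of e i f j g, OF f(1) g(1) b] by blast
      then show False using rank_class_le[OF T E f(3) g(2,3)] False by blast
    qed
    then have "cl_eval A (below_fm i j) e = 1" using formulas_range(2)[of A i j e] by simp
    then show ?thesis using rank_indexD(4)[OF T st] False by simp
  qed
next
  fix X s Y t assume "represents_rank T crd X s" "represents_rank T crd Y t"
  then have st: "s \<in> T" "t \<in> T" by (auto simp: represents_rank_def rank_class_def)
  show "s = t \<longleftrightarrow> (s, t) \<in> snd (T, r) \<and> (t, s) \<in> snd (T, r)"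
    using rank_indexD(4)[OF T st] rank_indexD(4)[OF T st(2,1)] rank_indexD(5)[OF T st]
      card_le_refl ordIso_iff_ordLeq by auto
qed

lemma shift_poly_eval:
  assumes "e i = \<pi> f" "e (i + 1) = \<pi> v" "e (i + 2) = \<pi> w"
    and "bclinear f" "bclinear v" "bclinear w"
  shows "star_poly_eval A (shift_poly i) e = \<pi> (\<lambda>x. x + 2 *C v (f (w x)))"
proof -
  have "star_poly_eval A (SMult (SMult (SVar (i + 1)) (SVar i)) (SVar (i + 2))) e = \<pi> (v \<circ> f \<circ> w)"
    using assms by (simp add: mult bclinear_compose)
  then have "star_poly_eval A (shift_poly i) e = \<pi> id \<oplus>\<^bsub>A\<^esub> cscale A 2 (\<pi> (v \<circ> f \<circ> w))"
    by (simp add: shift_poly_def one)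
  also have "\<dots> = \<pi> (\<lambda>x. id x + 2 *C (v \<circ> f \<circ> w) x)"
    using assms by (simp only: scale add bclinear_scaleC bclinear_compose bclinear_id)
  finally show ?thesis by simp
qed

lemma infinite_formula:
  assumes e: "e i = \<pi> f" and f: "bclinear f"
  defines "U \<equiv> \<lambda>v w x. x + 2 *C v (f (w x))"
  shows "cl_eval A (infinite_fm i) e < 1 ==>
      \<exists>v w t. bclinear v \<and> bclinear w \<and> bclinear t \<and>
	onorm v \<le> 101/100 \<and> onorm w \<le> 101/100 \<and>
	cnorm A (\<pi> (\<lambda>x. adj (U v w) (U v w x) - x)) < 1/10 \<and>
	cnorm A (\<pi> (adj (U v w) \<circ> t)) < 1/10 \<and> 9/10 < cnorm A (\<pi> t)" (is "_ ==> ?shift")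
    and "bclinear v ==> bclinear w ==> bclinear t ==>
      onorm v \<le> 1 ==> onorm w \<le> 1 ==> onorm t \<le> 1 ==>
      (\<And>x. adj (U v w) (U v w x) = x) ==> (\<And>x. adj (U v w) (t x) = 0) ==>
      1 \<le> cnorm A (\<pi> t) ==> cl_eval A (infinite_fm i) e = 0"
proof -
  let ?\<phi> = "CMax (CNorm (SMinus (SMult (SStar (shift_poly i)) (shift_poly i)) SOne))
       (CMax (CNorm (SMult (SStar (shift_poly i)) (SVar (i + 3))))
	 (COneMinus (CNorm (SVar (i + 3)))))"
  let ?F = "\<lambda>V W Z. cl_eval A ?\<phi> (e(i + 1 := V, i + 2 := W, i + 3 := Z))"
  have bU: "bclinear (U v w)" if "bclinear v" "bclinear w" for v w
    using bclinear_add[OF bclinear_id(2) bclinear_scaleC[OF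
	  bclinear_compose[OF that(1) bclinear_compose[OF f that(2)]]], of 2]
    by (simp add: U_def o_def)
  have b1: "bclinear (\<lambda>x. adj (U v w) (U v w x) - x)"
    if vw: "bclinear v" "bclinear w" for v w
    using bclinear_diff[OF bclinear_compose[OF adj(1)[OF bU[OF vw]] bU[OF vw]]
	bclinear_id(2)] by (simp add: o_def)
  have b2: "bclinear (adj (U v w) \<circ> t)"
    if vw: "bclinear v" "bclinear w" and t: "bclinear t" for v w t
    by (rule bclinear_compose[OF adj(1)[OF bU[OF vw]] t])
  have F: "?F (\<pi> v) (\<pi> w) (\<pi> t) = max (cnorm A (\<pi> (\<lambda>x. adj (U v w) (U v w x) - x)))
      (max (cnorm A (\<pi> (adj (U v w) \<circ> t))) (1 - cnorm A (\<pi> t)))"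
    if v: "bclinear v" and w: "bclinear w" and t: "bclinear t" for v w t
  proof -
    let ?e = "e(i + 1 := \<pi> v, i + 2 := \<pi> w, i + 3 := \<pi> t)"
    note u = bU[OF v w] and us = adj(1)[OF bU[OF v w]]
    have S: "star_poly_eval A (shift_poly i) ?e = \<pi> (U v w)"
      unfolding U_def by (rule shift_poly_eval) (use e f v w in simp_all)
    have 1: "star_poly_eval A (SMult (SStar (shift_poly i)) (shift_poly i)) ?e =
	\<pi> (adj (U v w) \<circ> U v w)" using S u us by (simp add: star mult)
    have "star_poly_eval A SOne ?e = \<pi> id" by (simp add: one)
    then have 2: "star_poly_eval A (SMinus (SMult (SStar (shift_poly i)) (shift_poly i)) SOne) ?e =
	\<pi> (\<lambda>x. (adj (U v w) \<circ> U v w) x - id x)"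
      by (rule eval_minus[OF 1 _ bclinear_compose[OF us u] bclinear_id(1)])
    have 3: "star_poly_eval A (SMult (SStar (shift_poly i)) (SVar (i + 3))) ?e =
	\<pi> (adj (U v w) \<circ> t)" using S u us t by (simp add: star mult)
    show ?thesis unfolding connective_eval cl_eval.simps 2 3 by simp
  qed
  have nonneg: "0 \<le> ?F V W Z" if VWZ: "V \<in> unit_ball A" "W \<in> unit_ball A" "Z \<in> unit_ball A" for V W Z
  proof -
    obtain v where v: "bclinear v" "V = \<pi> v" using unit_ballE[OF VWZ(1), of 2] by auto
    obtain w where w: "bclinear w" "W = \<pi> w" using unit_ballE[OF VWZ(2), of 2] by auto
    obtain t where t: "bclinear t" "Z = \<pi> t" using unit_ballE[OF VWZ(3), of 2] by auto
    show ?thesis unfolding v(2) w(2) t(2) F[OF v(1) w(1) t(1)]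
      using norm_nonneg[OF b1[OF v(1) w(1)]] by (simp add: le_max_iff_disj)
  qed
  let ?H = "\<lambda>V W. INF Z\<in>unit_ball A. ?F V W Z"
  have nonneg2: "0 \<le> ?H V W" if "V \<in> unit_ball A" "W \<in> unit_ball A" for V W
    by (rule cInf_ball_nonneg) (rule nonneg[OF that])
  let ?G = "\<lambda>V. INF W\<in>unit_ball A. ?H V W"
  have nonneg1: "0 \<le> ?G V" if "V \<in> unit_ball A" for V
    by (rule cInf_ball_nonneg) (rule nonneg2[OF that])
  have ev: "cl_eval A (infinite_fm i) e = max 0 (min 1 (((INF V\<in>unit_ball A. ?G V) - 0) / (1/10 - 0)))"
    unfolding infinite_fm_def connective_eval(3) cl_eval.simps(4) by (rule refl)
  show ?shift if less: "cl_eval A (infinite_fm i) e < 1"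
  proof -
    have "(INF V\<in>unit_ball A. ?G V) < 1/10"
      using clamp_less_1[of 0 "1/10", OF _ less[unfolded ev]] by simp
    then obtain V where V: "V \<in> unit_ball A" "?G V < 1/10" using cInf_ball_less[of ?G, OF nonneg1] by blast
    obtain W where W: "W \<in> unit_ball A" "?H V W < 1/10"
      using cInf_ball_less[of "?H V", OF nonneg2[OF V(1)] V(2)] by blast
    obtain Z where Z: "Z \<in> unit_ball A" "?F V W Z < 1/10"
      using cInf_ball_less[of "?F V W", OF nonneg[OF V(1) W(1)] W(2)] by blast
    obtain v where v: "bclinear v" "V = \<pi> v" "onorm v < 101/100" using unit_ballE[OF V(1), of "101/100"] by auto
    obtain w where w: "bclinear w" "W = \<pi> w" "onorm w < 101/100" using unit_ballE[OF W(1), of "101/100"] by auto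
    obtain t where t: "bclinear t" "Z = \<pi> t" using unit_ballE[OF Z(1), of 2] by auto
    show ?thesis
      using Z(2) v(1,3) w(1,3) t(1) unfolding v(2) w(2) t(2) F[OF v(1) w(1) t(1)] max_less_iff_conj
      by (intro exI[of _ v] exI[of _ w] exI[of _ t]) simp
  qed
  assume v: "bclinear v" "onorm v \<le> 1" and w: "bclinear w" "onorm w \<le> 1"
    and t: "bclinear t" "onorm t \<le> 1" and uu: "\<And>x. adj (U v w) (U v w x) = x"
    and ut: "\<And>x. adj (U v w) (t x) = 0" and nt: "1 \<le> cnorm A (\<pi> t)"
  have z: "cnorm A (\<pi> (\<lambda>_. 0)) \<le> 0" by (rule norm_boundI) simp_all
  have "adj (U v w) \<circ> t = (\<lambda>_. 0)" using ut by auto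
  then have "?F (\<pi> v) (\<pi> w) (\<pi> t) \<le> 0"
    unfolding F[OF v(1) w(1) t(1)] using uu nt z by simp
  then have "?H (\<pi> v) (\<pi> w) \<le> 0"
    using cInf_ball_le[of "?F (\<pi> v) (\<pi> w)", OF nonneg[OF unit_ballI[OF v] unit_ballI[OF w]] unit_ballI[OF t]] by blast
  then have "?G (\<pi> v) \<le> 0"
    using cInf_ball_le[of "?H (\<pi> v)", OF nonneg2[OF unit_ballI[OF v]] unit_ballI[OF w]] by blast
  then have "(INF V\<in>unit_ball A. ?G V) \<le> 0" using cInf_ball_le[of ?G, OF nonneg1 unit_ballI[OF v]] by blast
  then show "cl_eval A (infinite_fm i) e = 0" unfolding ev by (intro clamp_eq_0) simp_all
qed

end

definition bounded_universe :: "nat => cl_formula" where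
  "bounded_universe i = CMax (regular_fm i) (infinite_fm i)"

definition calkin_universe :: "nat => cl_formula" where
  "calkin_universe i = CMax (regular_fm i) (nonzero_fm i)"

text \<open>The operator \<open>u\<close> is close to an isometry, hence bounded below, and it is a compact perturbation
  of an operator near the identity, so it is onto. Then \<open>u\<^sup>*\<close> is bounded below, and \<open>t\<close> is small
  because \<open>u\<^sup>* t\<close> is.\<close>

lemma near_compact_not_shift:
  fixes f v w t :: "'h::complex_hilbert_space => 'h"
  assumes f: "near (1/16) (UNIV :: nat set) f" and fb: "bclinear f"
    and v: "bclinear v" "onorm v \<le> 101/100" and w: "bclinear w" "onorm w \<le> 101/100"
    and t: "bclinear t"
  defines "u \<equiv> \<lambda>x. x + 2 *C v (f (w x))"
  assumes uu: "onorm (\<lambda>x. adj u (u x) - x) < 1/10"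
    and ut: "onorm (adj u \<circ> t) < 1/10"
  shows "onorm t < 9/10"
proof -
  have "near (101/100 * (1/16) * (101/100)) (UNIV :: nat set) (v \<circ> f \<circ> w)"
    by (rule near_sandwich[OF _ f v w]) simp_all
  then obtain k where k: "compact_operator k"
    "\<And>x. norm (v (f (w x)) - k x) \<le> 101/100 * (1/16) * (101/100) * norm x"
    unfolding near_def small_UNIV_nat by auto
  have bu: "bclinear u"
    using bclinear_add[OF bclinear_id(2) bclinear_scaleC[OF
	  bclinear_compose[OF v(1) bclinear_compose[OF fb w(1)]]], of 2]
    by (simp add: u_def o_def)
  note us = adj(1)[OF bu]
  have b1: "bclinear (\<lambda>x. adj u (u x) - x)"
    using bclinear_diff[OF bclinear_compose[OF us bu] bclinear_id(2)] by (simp add: o_def)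
  have below: "9/10 * norm x \<le> norm (u x)" for x
  proof -
    have "complex_of_real ((norm (u x))^2) = cinner x (adj u (u x))"
      using cinner_adjoint(1)[OF bu, of x "u x"] by (simp add: cinner_self)
    also have "\<dots> = complex_of_real ((norm x)^2) + cinner x (adj u (u x) - x)"
      by (simp add: cinner_diff_right cinner_self)
    finally have "(norm (u x))^2 = (norm x)^2 + Re (cinner x (adj u (u x) - x))"
      by (metis Re_complex_of_real plus_complex.simps(1))
    moreover have "cmod (cinner x (adj u (u x) - x)) \<le> norm x * (1/10 * norm x)"
      using Cauchy_Schwarz_cinner[of x "adj u (u x) - x"]
	mult_left_mono[OF onorm_bounds[OF b1 less_imp_le[OF uu], of x], of "norm x"] by simp
    ultimately have "(norm x)^2 - norm x * (1/10 * norm x) \<le> (norm (u x))^2"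
      using abs_Re_le_cmod[of "cinner x (adj u (u x) - x)"] by linarith
    moreover have "(9/10 * norm x)^2 \<le> (norm x)^2 - norm x * (1/10 * norm x)"
      using zero_le_square[of "norm x"] by (simp add: power2_eq_square)
    ultimately have "(9/10 * norm x)^2 \<le> (norm (u x))^2" by linarith
    then show ?thesis by (rule power2_le_imp_le) simp
  qed
  have "surj u"
  proof (rule bounded_below_surj[where g = "\<lambda>x. x + 2 *C (v (f (w x)) - k x)" and k = "\<lambda>x. 2 *C k x"
	and d = "1/5" and c = "9/10"])
    show "compact_operator (\<lambda>x. 2 *C k x)" by (rule compact_scaleC[OF k(1)])
    show "u x = x + 2 *C (v (f (w x)) - k x) + 2 *C k x" for x
      by (simp add: u_def scaleC_diff_right)
    show "norm (x + 2 *C (v (f (w x)) - k x) - x) \<le> 1/5 * norm x" for x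
    proof -
      have "x + 2 *C (v (f (w x)) - k x) - x = 2 *C (v (f (w x)) - k x)" by simp
      then have "norm (x + 2 *C (v (f (w x)) - k x) - x) = 2 * norm (v (f (w x)) - k x)" by simp
      also have "\<dots> \<le> 2 * (101/100 * (1/16) * (101/100) * norm x)"
	using k(2)[of x] by (rule mult_left_mono) simp
      also have "\<dots> \<le> 1/5 * norm x" using norm_ge_zero[of x] by simp
      finally show ?thesis .
    qed
  qed (use bu below in simp_all)
  have ad: "9/10 * norm y \<le> norm (adj u y)" for y
  proof (cases "y = 0")
    case False
    obtain x where x: "y = u x" using \<open>surj u\<close> by (metis surjD)
    have "(norm y)^2 = cmod (cinner (u x) y)" using x by (simp add: cinner_self norm_power)
    also have "\<dots> = cmod (cinner x (adj u y))" by (simp add: cinner_adjoint(1)[OF bu])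
    also have "\<dots> \<le> norm x * norm (adj u y)" by (rule Cauchy_Schwarz_cinner)
    also have "\<dots> \<le> (10/9 * norm y) * norm (adj u y)"
      using below[of x] x by (intro mult_right_mono) auto
    finally show ?thesis using False by (simp add: power2_eq_square)
  qed simp
  have "norm (t x) \<le> 1/9 * norm x" for x
    using ad[of "t x"] onorm_bounds[OF bclinear_compose[OF us t] less_imp_le[OF ut], of x] by simp
  then have "onorm t \<le> 1/9" by (intro onorm_bound) simp_all
  then show ?thesis by simp
qed

text \<open>On the range of a projection of infinite rank there is a shift, whose range misses one
  basis vector.\<close>

lemma infinite_rank_shift:
  fixes p :: "'h::complex_hilbert_space => 'h"
  assumes p: "has_rank p B" "infinite B"
  shows "\<exists>v (t :: 'h => 'h). bclinear v \<and> onorm v \<le> 1 \<and> bclinear t \<and> onorm t \<le> 1 \<and> 1 \<le> onorm t \<and>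
    (\<forall>x. adj (\<lambda>x. x + 2 *C v (p x)) (x + 2 *C v (p x)) = x) \<and>
    (\<forall>x. adj (\<lambda>x. x + 2 *C v (p x)) (t x) = 0)"
proof -
  note P = has_rank_oproj[OF p(1)]
  note PD = oprojD[OF P]
  have on: "orthonormal_on (\<lambda>b. b) B" and pB: "p = partial_isometry (\<lambda>b. b) (\<lambda>b. b) B"
    using p(1) by (simp_all add: has_rank_def)
  obtain b where b: "b \<in> B" using p(2) by fastforce
  obtain h where h: "bij_betw h B (B - {b})" using infinite_imp_bij_betw[OF p(2), of b] by blast
  have onh: "orthonormal_on h B"
    by (rule orthonormal_image[OF on]) (use h in \<open>auto simp: bij_betw_def\<close>)
  let ?V = "partial_isometry (\<lambda>b. b) h B" and ?W = "partial_isometry h (\<lambda>b. b) B"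
  have bV: "bclinear ?V" and bW: "bclinear ?W"
    using partial_isometry(1) on onh by blast+
  note VD = bclinearD[OF bV] and WD = bclinearD[OF bW]
  have WV: "?W (?V x) = p x" for x using partial_isometry(7)[OF on onh] by (simp add: pB)
  have ph: "p (h b') = h b'" if b': "b' \<in> B" for b'
  proof -
    have "h b' \<in> B" using h b' by (auto simp: bij_betw_def)
    then show ?thesis by (rule has_rank_fixes[OF p(1)])
  qed
  have pV: "p (?V x) = ?V x" for x by (rule projection_fixes_partial_isometry[OF P onh on ph])
  have pW: "p (?W x) = ?W x" for x
    by (rule projection_fixes_partial_isometry[OF P on onh has_rank_fixes[OF p(1)]])
  have Vp: "?V (p x) = ?V x" for x
    unfolding partial_isometry_def[of "\<lambda>b. b" h] osum_def
    using PD(3) has_rank_fixes[OF p(1)] by (intro infsum_cong) simp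
  have Wp: "?W (p x) = ?W x" for x
  proof -
    have "cinner (p x) (h i) = cinner x (h i)" if "i \<in> B" for i
      using PD(3)[of x "h i"] ph[OF that] by simp
    then show ?thesis unfolding partial_isometry_def[of h] osum_def by (intro infsum_cong) simp
  qed
  define u where "u x = ?V x + (x - p x)" for x
  have bu: "bclinear u" unfolding u_def using bV PD(1) by (intro bclinear_intros)
  have us: "adj u = (\<lambda>x. ?W x + (x - p x))"
  proof (rule adj_eqI[OF bu])
    show "adjoint_pair u (\<lambda>x. ?W x + (x - p x))"
      using partial_isometry(3)[OF on onh] PD(3)
      by (simp add: adjoint_pair_def u_def cinner_add_left cinner_add_right cinner_diff_left cinner_diff_right)
  qed
  have uu: "adj u (u x) = x" for x
  proof -
    have "?W (x - p x) = 0" using Wp by (simp add: WD(4))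
    then show ?thesis unfolding us u_def
      by (simp add: WD(3) bclinearD(3,4)[OF PD(1)] WV pV PD(2))
  qed
  have nu: "norm (u x) = norm x" for x
  proof -
    have "cinner (u x) (u x) = cinner x x" using cinner_adjoint(1)[OF bu, of x "u x"] uu by simp
    then have "(norm (u x))^2 = (norm x)^2" using Re_cinner_self by metis
    then show ?thesis by simp
  qed
  \<comment> \<open>The factor 2 in the formula makes \<open>v\<close> a contraction.\<close>
  define v where "v x = (1/2) *C (u x - x)" for x
  have bv: "bclinear v" unfolding v_def using bu by (intro bclinear_intros)
  have "norm (v x) \<le> 1 * norm x" for x
    using norm_triangle_ineq4[of "u x" x] nu[of x] by (simp add: v_def norm_divide)
  then have nv: "onorm v \<le> 1" by (intro onorm_bound) simp_all
  have U: "x + 2 *C v (p x) = u x" for x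
    by (simp add: v_def scaleC_scaleC u_def Vp PD(2))
  define t where "t = partial_isometry (\<lambda>b. b) (\<lambda>b. b) {b}"
  have onb: "orthonormal_on (\<lambda>b. b) {b}" by (rule orthonormal_on_subset[OF on]) (use b in simp)
  have bt: "bclinear t" unfolding t_def by (rule partial_isometry(1)[OF onb onb])
  have "norm (t x) \<le> 1 * norm x" for x unfolding t_def using partial_isometry(2)[OF onb onb] by simp
  then have nt: "onorm t \<le> 1" by (intro onorm_bound) simp_all
  have nb: "norm b = 1" by (rule orthonormal_onD(2)[OF on b])
  have "t b = b" unfolding t_def using partial_isometry(5)[OF onb onb, of b] by simp
  then have nt': "1 \<le> onorm t" using bclinearD(7)[OF bt, of b] nb by simp
  have "?W b = 0"
  proof -
    have "cinner b (h i) = 0" if "i \<in> B" for i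
    proof -
      have "h i \<in> B - {b}" using h that by (auto simp: bij_betw_def)
      then show ?thesis using on b unfolding orthonormal_on_def by auto
    qed
    then show ?thesis unfolding partial_isometry_def osum_def by (intro infsum_0) simp
  qed
  then have "adj u b = 0" using has_rank_fixes[OF p(1) b] by (simp add: us)
  then have ut: "adj u (t x) = 0" for x
    by (simp add: t_def partial_isometry_finite bclinearD(2)[OF adj(1)[OF bu]])
  have "bclinear v \<and> onorm v \<le> 1 \<and> bclinear t \<and> onorm t \<le> 1 \<and> 1 \<le> onorm t \<and>
    (\<forall>x. adj (\<lambda>x. x + 2 *C v (p x)) (x + 2 *C v (p x)) = x) \<and>
    (\<forall>x. adj (\<lambda>x. x + 2 *C v (p x)) (t x) = 0)"
    using bv nv bt nt nt' uu ut by (simp add: U)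
  then show ?thesis by (intro exI)
qed

theorem bounded_interprets:
  assumes T: "rank_index T r crd (E :: 'h::complex_hilbert_space set)" and E: "basis_of E UNIV"
  shows "\<exists>G. interprets (bounded_operators TYPE('h)) (T, r) G bounded_universe below_fm"
proof -
  let ?A = "bounded_operators TYPE('h)"
  interpret operator_algebra ?A "\<lambda>f. f" "{\<lambda>_. 0}" by (rule operator_algebra_bounded)
  have cn: "cnorm ?A f = onorm f" for f by (simp add: bounded_operators_def)
  show ?thesis
    unfolding bounded_universe_def[abs_def]
  proof (rule exI, rule interprets_ranks[OF T E formulas_range(4)])
    fix i and e :: "nat => 'h => 'h" and f
    assume f: "e i = f" "regular f" and less: "cl_eval ?A (infinite_fm i) e < 1"
    have fb: "bclinear f" using f(2) by (simp add: regular_def)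
    show "\<not> near (1/2) (UNIV :: nat set) f"
    proof
      assume "near (1/2) (UNIV :: nat set) f"
      then have n: "near (1/16) (UNIV :: nat set) f" using regular_gap(1)[OF f(2) infinite_UNIV_nat] by simp
      from infinite_formula(1)[of e i f, OF f(1) fb less] show False
	unfolding cn
      proof (elim exE conjE)
	fix v w t :: "'h => 'h"
	assume "bclinear v" "bclinear w" "bclinear t"
	  "onorm v \<le> 101/100" "onorm w \<le> 101/100" "9/10 < onorm t"
	  "onorm (\<lambda>x. adj (\<lambda>x. x + 2 *C v (f (w x))) (x + 2 *C v (f (w x))) - x) < 1/10"
	  "onorm (adj (\<lambda>x. x + 2 *C v (f (w x))) \<circ> t) < 1/10"
	then show False using near_compact_not_shift[OF n fb, of v w t] by simp
      qed
    qed
  next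
    fix i and e :: "nat => 'h => 'h" and p B
    assume p: "e i = p" "has_rank p B" "infinite B"
    obtain v t :: "'h => 'h" where vt: "bclinear v" "onorm v \<le> 1" "bclinear t" "onorm t \<le> 1" "1 \<le> onorm t"
      "\<forall>x. adj (\<lambda>x. x + 2 *C v (p x)) (x + 2 *C v (p x)) = x"
      "\<forall>x. adj (\<lambda>x. x + 2 *C v (p x)) (t x) = 0"
      using infinite_rank_shift[OF p(2,3)] by blast
    show "cl_eval ?A (infinite_fm i) e = 0"
      by (rule infinite_formula(2)[of e i p v "\<lambda>x. x" t])
	(use p(1) oprojD(1)[OF has_rank_oproj[OF p(2)]] vt onorm_id_le in \<open>simp_all add: cn\<close>)
  qed
qed

theorem calkin_interprets:
  assumes T: "rank_index T r crd (E :: 'h::complex_hilbert_space set)" and E: "basis_of E UNIV"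
  shows "\<exists>G. interprets (calkin_algebra TYPE('h)) (T, r) G calkin_universe below_fm"
proof -
  let ?A = "calkin_algebra TYPE('h)"
  interpret operator_algebra ?A calkin_class "{k. compact_operator k}" by (rule operator_algebra_calkin)
  have ev: "cl_eval ?A (nonzero_fm i) e = 1 - max 0 (min 1 ((cnorm ?A (e i) - 1/2) / (1 - 1/2)))"
    for i :: nat and e :: "nat => ('h => 'h) set"
    by (simp add: nonzero_fm_def)
  show ?thesis
    unfolding calkin_universe_def[abs_def]
  proof (rule exI, rule interprets_ranks[OF T E formulas_range(3)])
    fix i :: nat and e and f :: "'h => 'h"
    assume f: "e i = calkin_class f" "regular f" and less: "cl_eval ?A (nonzero_fm i) e < 1"
    have fb: "bclinear f" using f(2) by (simp add: regular_def)
    show "\<not> near (1/2) (UNIV :: nat set) f"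
    proof
      assume "near (1/2) (UNIV :: nat set) f"
      then have "near (1/16) (UNIV :: nat set) f" using regular_gap(1)[OF f(2) infinite_UNIV_nat] by simp
      then obtain s where s: "compact_operator s" "\<And>x. norm (f x - s x) \<le> 1/16 * norm x"
	unfolding near_def small_UNIV_nat by blast
      have "cnorm ?A (calkin_class f) \<le> onorm (\<lambda>x. f x - s x)" by (rule norm_le[OF fb]) (simp add: s(1))
      also have "\<dots> \<le> 1/16" by (rule onorm_bound) (use s(2) in simp_all)
      finally have "max 0 (min 1 ((cnorm ?A (e i) - 1/2) / (1 - 1/2))) = 0"
	using f(1) by (intro clamp_eq_0) simp_all
      then show False using less ev by simp
    qed
  next
    fix i :: nat and e and p :: "'h => 'h" and B
    assume p: "e i = calkin_class p" "has_rank p B" "infinite B"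
    note pb = oprojD(1)[OF has_rank_oproj[OF p(2)]]
    have "1 \<le> cnorm ?A (calkin_class p)"
    proof (rule ccontr)
      assume neg: "\<not> 1 \<le> cnorm ?A (calkin_class p)"
      define c where "c = (1 + cnorm ?A (calkin_class p)) / 2"
      have c: "cnorm ?A (calkin_class p) < c" "c < 1" using neg by (simp_all add: c_def)
      obtain k where k: "compact_operator k" "\<And>x. norm (p x - k x) \<le> c * norm x"
	using norm_lessE[OF pb c(1)] by blast
      have "near c (UNIV :: nat set) p" by (rule nearI[OF small_compact[OF k(1)] k(2)])
      moreover have "|UNIV :: nat set| \<le>o |B|" by (rule countable_ordLeq_infinite[OF _ p(3)]) simp
      ultimately show False using rank_not_near[OF p(2) _ _ c(2)] by auto
    qed
    then have "max 0 (min 1 ((cnorm ?A (e i) - 1/2) / (1 - 1/2))) = 1"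
      using p(1) by (intro clamp_eq_1) simp_all
    then show "cl_eval ?A (nonzero_fm i) e = 0" unfolding ev by simp
  qed
qed

section \<open>The density character and the dimension\<close>

text \<open>A point at distance less than 1 from a basis vector is not orthogonal to it, and each point is
  orthogonal to all but countably many basis vectors.\<close>

lemma dense_card_ge:
  assumes E: "basis_of E (UNIV :: 'h::complex_hilbert_space set)" "infinite E" and D: "closure D = (UNIV :: 'h set)"
  shows "|E| \<le>o |D|"
proof (rule orthonormal_card_le)
  show on: "orthonormal_on (\<lambda>e. e) E" using E(1) by (simp add: basis_of_def)
  show "infinite D"
  proof
    assume "finite D"
    then have "D = UNIV" using D closure_closed[OF finite_imp_closed] by blast
    then show False using E(2) \<open>finite D\<close> finite_subset[OF subset_UNIV] by metis
  qed
  fix c assume c: "c \<in> E"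
  have "c \<in> closure D" using D by simp
  then obtain d where d: "d \<in> D" "dist d c < 1" unfolding closure_approachable by (metis zero_less_one)
  have "cinner d c \<noteq> 0"
  proof
    assume "cinner d c = 0"
    then have "cinner (d - c) c = - 1" by (simp add: cinner_diff_left orthonormal_onD(1)[OF on c])
    then have "1 \<le> norm (d - c) * norm c" using Cauchy_Schwarz_cinner[of "d - c" c] by simp
    then show False using d(2) orthonormal_onD(2)[OF on c] by (simp add: dist_norm)
  qed
  then show "\<exists>s\<in>D. cinner s c \<noteq> 0" using d(1) by blast
qed

text \<open>Finite combinations of the basis with coefficients from a countable dense set are dense.\<close>

lemma ex_dense_card_le:
  fixes E :: "'h::complex_hilbert_space set"
  assumes E: "basis_of E UNIV" and K: "infinite K" "|E| \<le>o |K|"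
  shows "\<exists>D :: 'h set. closure D = UNIV \<and> |D| \<le>o |K|"
proof -
  obtain Q :: "complex set" where Q: "countable Q" "\<And>X. open X ==> X \<noteq> {} ==> \<exists>q\<in>Q. q \<in> X"
    using countable_dense_exists by metis
  define G where "G X = (\<lambda>((q, e), d). q *C e + d) ` ((Q \<times> E) \<times> X)" for X :: "'h set"
  define D where "D n = (G ^^ n) {0}" for n
  have DSuc: "q *C e + d \<in> D (Suc n)" if "q \<in> Q" "e \<in> E" "d \<in> D n" for q e d n
    using that by (force simp: D_def G_def)
  have times: "|A \<times> B| \<le>o |K|" if "|A| \<le>o |K|" "|B| \<le>o |K|" for A :: "'x set" and B :: "'y set"
    by (rule card_of_Times_ordLeq_infinite_Field[OF _ that card_of_Card_order]) (simp add: Field_card_of K(1))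
  have QE: "|Q \<times> E| \<le>o |K|"
    by (rule times[OF countable_ordLeq_infinite[OF Q(1) K(1)] K(2)])
  have "|D n| \<le>o |K|" for n
  proof (induction n)
    case 0
    show ?case unfolding D_def by (rule countable_ordLeq_infinite[OF _ K(1)]) simp
  next
    case (Suc n)
    have "|(Q \<times> E) \<times> D n| \<le>o |K|" by (rule times[OF QE Suc])
    then have "|G (D n)| \<le>o |K|" unfolding G_def using card_of_image ordLeq_transitive by blast
    then show ?case by (simp add: D_def)
  qed
  then have card: "|\<Union>n. D n| \<le>o |K|"
    by (intro card_of_UNION_ordLeq_infinite[OF K(1)] countable_ordLeq_infinite[OF _ K(1)]) auto
  have approx: "\<exists>n. \<exists>d\<in>D n. norm (d - (\<Sum>e\<in>F. c e *C e)) < \<epsilon>" if "finite F" "F \<subseteq> E" "0 < \<epsilon>"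
    for F :: "'h set" and c \<epsilon>
    using that
  proof (induction F arbitrary: \<epsilon>)
    case empty
    then show ?case by (intro exI[of _ 0]) (simp add: D_def)
  next
    case (insert b F)
    obtain n d where d: "d \<in> D n" "norm (d - (\<Sum>e\<in>F. c e *C e)) < \<epsilon>/2"
      using insert.IH[of "\<epsilon>/2"] insert.prems by auto
    obtain q where q: "q \<in> Q" "q \<in> ball (c b) (\<epsilon>/2)"
      using Q(2)[of "ball (c b) (\<epsilon>/2)"] insert.prems by auto
    have nb: "norm b = 1"
      using E insert.prems orthonormal_onD(2)[of "\<lambda>e. e" E b] by (simp add: basis_of_def)
    have "(q *C b + d) - (\<Sum>e\<in>insert b F. c e *C e) = (q - c b) *C b + (d - (\<Sum>e\<in>F. c e *C e))"
      using insert.hyps by (simp add: scaleC_diff_left)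
    also have "norm \<dots> \<le> norm ((q - c b) *C b) + norm (d - (\<Sum>e\<in>F. c e *C e))" by (rule norm_triangle_ineq)
    also have "\<dots> < \<epsilon>"
      using q(2) d(2) nb by (simp add: dist_norm norm_minus_commute)
    finally have "norm ((q *C b + d) - (\<Sum>e\<in>insert b F. c e *C e)) < \<epsilon>" .
    moreover have "q *C b + d \<in> D (Suc n)" using q(1) d(1) insert.prems by (intro DSuc) auto
    ultimately show ?case by blast
  qed
  have "x \<in> closure (\<Union>n. D n)" for x
    unfolding closure_approachable
  proof (intro allI impI)
    fix \<epsilon> :: real assume \<epsilon>: "0 < \<epsilon>"
    have on: "orthonormal_on (\<lambda>e. e) E" and x: "osum (\<lambda>e. e) E (cinner x) = x"
      using E by (simp_all add: basis_of_def)
    have sum: "((\<lambda>e. cinner x e *C e) has_sum x) E"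
      using osum_has_sum[OF on Bessel[OF on, of x]] x by simp
    then obtain F where F: "finite F" "F \<subseteq> E" "dist (\<Sum>e\<in>F. cinner x e *C e) x \<le> \<epsilon>/2"
      using has_sum_finite_approximation[OF sum, of "\<epsilon>/2"] \<epsilon> by auto
    obtain n d where d: "d \<in> D n" "norm (d - (\<Sum>e\<in>F. cinner x e *C e)) < \<epsilon>/2"
      using approx[OF F(1,2), of "\<epsilon>/2" "cinner x"] \<epsilon> by auto
    have "dist d x < \<epsilon>"
      using dist_triangle[of d x "\<Sum>e\<in>F. cinner x e *C e"] F(3) d(2) by (simp add: dist_norm)
    then show "\<exists>y\<in>\<Union>n. D n. dist y x < \<epsilon>" using d(1) by blast
  qed
  then have "closure (\<Union>n. D n) = UNIV" by blast
  then show ?thesis using card by blast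
qed

section \<open>The infinite cardinals up to the dimension\<close>

definition alephs_below :: "'k rel => 'k set" where
  "alephs_below \<kappa> = {x \<in> Field \<kappa>. infinite (underS \<kappa> x) \<and> Card_order (Restr \<kappa> (underS \<kappa> x))}"

text \<open>The index set has an element for every infinite cardinal below \<open>\<kappa>\<close> and one, on top, for
  \<open>\<kappa>\<close> itself.\<close>

definition aleph_set :: "'k rel => 'k option => 'k set" where
  "aleph_set \<kappa> t = (case t of None => Field \<kappa> | Some x => underS \<kappa> x)"

lemma underS_less:
  assumes \<kappa>: "Card_order \<kappa>" and x: "Card_order (Restr \<kappa> (underS \<kappa> x))" and y: "y \<in> underS \<kappa> x"
  shows "|underS \<kappa> y| <o |underS \<kappa> x|"
proof -
  have W: "Well_order \<kappa>" using \<kappa> by (rule card_order_on_well_order_on)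
  note WF = Well_order_facts[OF W]
  let ?c = "Restr \<kappa> (underS \<kappa> x)"
  have F: "Field ?c = underS \<kappa> x" by (rule Field_Restr_underS[OF W])
  have "underS ?c y = underS \<kappa> y"
    using y WF(2,3) unfolding underS_def by blast
  moreover have "|underS ?c y| <o ?c" using card_of_underS[OF x] y F by simp
  moreover have "?c =o |underS \<kappa> x|" using ordIso_symmetric[OF card_of_Field_ordIso[OF x]] F by simp
  ultimately show ?thesis using ordLess_ordIso_trans by metis
qed

lemma Field_Restr_alephs: 
  assumes "Well_order \<kappa>" shows "Field (Restr \<kappa> (alephs_below \<kappa>)) = alephs_below \<kappa>"
proof -
  have "Refl \<kappa>" using assms by (simp add: order_on_defs)
  then show ?thesis by (rule Refl_Field_Restr2) (auto simp: alephs_below_def)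
qed

text \<open>Every cardinal below \<open>\<kappa>\<close> is the order type of an initial segment of \<open>\<kappa>\<close>, and initial segments of
  different cardinality are comparable.\<close>

lemma rank_index_alephs:
  fixes \<kappa> :: "'k rel" and E :: "'h set"
  assumes \<kappa>: "Card_order \<kappa>" and E: "infinite E" "|E| =o \<kappa>"
  defines "q \<equiv> Restr \<kappa> (alephs_below \<kappa>)"
  shows "rank_index (Field (add_top q)) (add_top q) (aleph_set \<kappa>) E"
proof -
  have W: "Well_order \<kappa>" using \<kappa> by (rule card_order_on_well_order_on)
  note WF = Well_order_facts[OF W]
  note Fq = Field_Restr_alephs[OF W, folded q_def]
  note \<kappa>F = card_of_Field_ordIso[OF \<kappa>]
  have EF: "|E| =o |Field \<kappa>|" using E(2) ordIso_symmetric[OF \<kappa>F] by (rule ordIso_transitive)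
  have inf\<kappa>: "infinite (Field \<kappa>)" using card_of_ordIso_finite[OF EF] E(1) by simp
  have Wq: "Well_order (add_top q)" unfolding q_def by (intro Well_order_add_top Well_order_Restr W)
  have sub: "aleph_set \<kappa> t \<subseteq> Field \<kappa>" for t
    by (auto simp: aleph_set_def dest: underS_Field[THEN subsetD] split: option.splits)
  have order: "(s, t) \<in> add_top q \<longleftrightarrow> |aleph_set \<kappa> s| \<le>o |aleph_set \<kappa> t|"
    if s: "s \<in> Field (add_top q)" and t: "t \<in> Field (add_top q)" for s t
  proof (cases t)
    case None
    have "|aleph_set \<kappa> s| \<le>o |aleph_set \<kappa> t|"
      using card_of_mono1[OF sub[of s]] None by (simp add: aleph_set_def)
    moreover have "(s, t) \<in> add_top q" using s None by (cases s) (auto simp: Field_add_top)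
    ultimately show ?thesis by simp
  next
    case (Some y)
    then have y: "y \<in> Field \<kappa>" "Card_order (Restr \<kappa> (underS \<kappa> y))" "y \<in> alephs_below \<kappa>"
      using t by (auto simp: Field_add_top Fq alephs_below_def)
    show ?thesis
    proof (cases s)
      case None
      have "|underS \<kappa> y| <o |Field \<kappa>|"
	using card_of_underS[OF \<kappa> y(1)] ordIso_symmetric[OF \<kappa>F] by (rule ordLess_ordIso_trans)
      then show ?thesis using None Some not_ordLess_ordLeq by (auto simp: aleph_set_def)
    next
      case (Some x)
      then have x: "x \<in> Field \<kappa>" "Card_order (Restr \<kappa> (underS \<kappa> x))" "x \<in> alephs_below \<kappa>"
	using s by (auto simp: Field_add_top Fq alephs_below_def)
      have "(x, y) \<in> \<kappa> \<longleftrightarrow> |underS \<kappa> x| \<le>o |underS \<kappa> y|"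
      proof
	assume "(x, y) \<in> \<kappa>"
	then have "underS \<kappa> x \<subseteq> underS \<kappa> y" using WF(2,3) unfolding underS_def by blast
	then show "|underS \<kappa> x| \<le>o |underS \<kappa> y|" by (rule card_of_mono1)
      next
	assume le: "|underS \<kappa> x| \<le>o |underS \<kappa> y|"
	show "(x, y) \<in> \<kappa>"
	proof (rule ccontr)
	  assume "(x, y) \<notin> \<kappa>"
	  then have "y \<in> underS \<kappa> x" using WF(1,4) x(1) y(1) unfolding underS_def by blast
	  then show False using underS_less[OF \<kappa> x(2)] le not_ordLess_ordLeq by blast
	qed
      qed
      then show ?thesis using Some \<open>t = Some y\<close> x(3) y(3) by (simp add: aleph_set_def q_def)
    qed
  qed
  show ?thesis
    unfolding rank_index_def
  proof (intro conjI ballI allI impI)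
    fix t assume t: "t \<in> Field (add_top q)"
    show "infinite (aleph_set \<kappa> t)"
      using t inf\<kappa> by (auto simp: Field_add_top Fq alephs_below_def aleph_set_def)
    show "|aleph_set \<kappa> t| \<le>o |E|"
      using card_of_mono1[OF sub] ordIso_symmetric[OF EF] by (rule ordLeq_ordIso_trans)
  next
    fix B :: "'h set" assume B: "infinite B" "|B| \<le>o |E|"
    have le: "|B| \<le>o \<kappa>" using B(2) E(2) by (rule ordLeq_ordIso_trans)
    show "\<exists>t\<in>Field (add_top q). |B| =o |aleph_set \<kappa> t|"
    proof (cases "|B| =o \<kappa>")
      case True
      then have "|B| =o |aleph_set \<kappa> None|"
	using ordIso_transitive[OF _ ordIso_symmetric[OF \<kappa>F]] by (simp add: aleph_set_def)
      then show ?thesis by (auto simp: Field_add_top)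
    next
      case False
      then have "|B| <o \<kappa>" using le ordLeq_iff_ordLess_or_ordIso by blast
      then obtain x where x: "x \<in> Field \<kappa>" "|B| =o Restr \<kappa> (underS \<kappa> x)"
	using ordLess_iff_ordIso_Restr[OF W card_of_Well_order] by blast
      have c: "Card_order (Restr \<kappa> (underS \<kappa> x))" by (rule Card_order_ordIso2[OF card_of_Card_order x(2)])
      have Bx: "|B| =o |underS \<kappa> x|"
	using ordIso_transitive[OF x(2) ordIso_symmetric[OF card_of_Field_ordIso[OF c]]]
	by (simp add: Field_Restr_underS[OF W])
      then have "infinite (underS \<kappa> x)" using card_of_ordIso_finite[OF Bx] B(1) by simp
      then have "Some x \<in> Field (add_top q)" using x(1) c by (simp add: Field_add_top Fq alephs_below_def)
      then show ?thesis using Bx by (intro bexI[of _ "Some x"]) (simp_all add: aleph_set_def)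
    qed
  next
    fix s t assume st: "s \<in> Field (add_top q)" "t \<in> Field (add_top q)"
    show "(s, t) \<in> add_top q \<longleftrightarrow> |aleph_set \<kappa> s| \<le>o |aleph_set \<kappa> t|" by (rule order[OF st])
    assume "|aleph_set \<kappa> s| =o |aleph_set \<kappa> t|"
    then have "(s, t) \<in> add_top q" "(t, s) \<in> add_top q"
      using order[OF st] order[OF st(2,1)] ordIso_iff_ordLeq by blast+
    then show "s = t" by (rule Well_order_facts(3)[OF Wq])
  qed
qed

text \<open>The first case is that of the nonzero spaces of finite dimension: they have density character
  \<open>\<aleph>\<^sub>0\<close> but no infinite ranks.\<close>

definition ranks_of :: "'a rel => 'k option set => 'k option rel => bool" where
  "ranks_of \<alpha> T r \<longleftrightarrow> \<alpha> = {} \<and> T = {} \<or>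
     (\<exists>q. Well_order q \<and> q =o \<alpha> \<and> T = Field (add_top q) \<and> r = add_top q)"

lemma ex_ranks:
  fixes \<alpha> :: "'a rel" and \<kappa> :: "'k rel"
  assumes \<alpha>: "is_aleph \<alpha> \<kappa>" and \<kappa>: "has_density_character TYPE('h::complex_hilbert_space) \<kappa>"
  shows "\<exists>(E :: 'h set) T r (crd :: 'k option => 'k set). basis_of E UNIV \<and> rank_index T r crd E \<and> ranks_of \<alpha> T r"
proof -
  have C: "Card_order \<kappa>" and iso: "Restr \<kappa> (alephs_below \<kappa>) =o \<alpha>"
    using \<alpha> by (simp_all add: is_aleph_def alephs_below_def)
  have W: "Well_order \<kappa>" using C by (rule card_order_on_well_order_on)
  obtain E :: "'h set" where E: "basis_of E UNIV" using ex_basis[OF csubspace_UNIV closed_UNIV] by blast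
  have upper: "\<kappa> \<le>o |K|" if K: "infinite K" "|E| \<le>o |K|" for K :: "'x set"
  proof -
    obtain D :: "'h set" where D: "closure D = UNIV" "|D| \<le>o |K|" using ex_dense_card_le[OF E K] by blast
    have "\<kappa> \<le>o |D|" using \<kappa> D(1) by (simp add: has_density_character_def)
    then show ?thesis using D(2) by (rule ordLeq_transitive)
  qed
  show ?thesis
  proof (cases "finite E")
    case True
    have le: "\<kappa> \<le>o |UNIV :: nat set|"
      by (rule upper[OF infinite_UNIV_nat countable_ordLeq_infinite[OF countable_finite[OF True] infinite_UNIV_nat]])
    have "alephs_below \<kappa> = {}"
    proof (rule ccontr)
      assume "alephs_below \<kappa> \<noteq> {}"
      then obtain x where x: "x \<in> Field \<kappa>" "infinite (underS \<kappa> x)" by (auto simp: alephs_below_def)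
      have "|underS \<kappa> x| <o |UNIV :: nat set|" using card_of_underS[OF C x(1)] le by (rule ordLess_ordLeq_trans)
      moreover have "|UNIV :: nat set| \<le>o |underS \<kappa> x|" by (rule countable_ordLeq_infinite[OF _ x(2)]) simp
      ultimately show False using not_ordLess_ordLeq by blast
    qed
    then have "\<alpha> = {}" using ordIso_empty[OF iso] by simp
    then have "ranks_of \<alpha> ({} :: 'k option set) {}" by (simp add: ranks_of_def)
    moreover have "rank_index {} {} crd E" for crd :: "'k option => 'k set"
      using True card_of_ordLeq_infinite by (auto simp: rank_index_def)
    ultimately show ?thesis using E by blast
  next
    case False
    obtain D :: "'h set" where D: "closure D = UNIV" "|D| =o \<kappa>" using \<kappa> by (auto simp: has_density_character_def)
    have "|E| \<le>o \<kappa>" using dense_card_ge[OF E False D(1)] D(2) by (rule ordLeq_ordIso_trans)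
    moreover have "\<kappa> \<le>o |E|" by (rule upper[OF False]) (rule card_of_mono1, simp)
    ultimately have E\<kappa>: "|E| =o \<kappa>" using ordIso_iff_ordLeq by blast
    let ?q = "Restr \<kappa> (alephs_below \<kappa>)"
    have "ranks_of \<alpha> (Field (add_top ?q)) (add_top ?q)"
      unfolding ranks_of_def using iso Well_order_Restr[OF W] by blast
    then show ?thesis using E rank_index_alephs[OF C False E\<kappa>] by blast
  qed
qed

section \<open>Comparing the posets of ranks\<close>

lemma segment_simps:
  assumes "Well_order R"
  shows "x \<in> fst (segment True R t) \<longleftrightarrow> (x, t) \<in> omega_times R"
    and "x \<in> fst (segment False R t) \<longleftrightarrow> x \<in> underS (omega_times R) t"
    and "snd (segment True R t) = omega_times R" and "snd (segment False R t) = omega_times R - Id"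
  by (auto simp: segment_def underS_def)

lemma ord_struct_segment:
  fixes \<alpha> :: "'a rel" and R :: "'r rel"
  assumes R: "Well_order R" and iso: "\<alpha> =o Restr (omega_times R) (underS (omega_times R) t)"
  shows "fo_equiv (ord_struct \<alpha>) (segment False R t)"
proof -
  let ?W = "omega_times R"
  note F = Field_Restr_underS[OF Well_order_omega_times[OF R]]
  obtain h where h: "bij_betw h (Field \<alpha>) (Field (Restr ?W (underS ?W t)))"
    "\<And>a b. a \<in> Field \<alpha> ==> b \<in> Field \<alpha> ==> (a, b) \<in> \<alpha> \<longleftrightarrow> (h a, h b) \<in> Restr ?W (underS ?W t)"
    using ordIso_bij[OF iso] by blast
  have U: "fst (segment False R t) = underS ?W t" using segment_simps(2)[OF R] by blast
  note h1 = h(1)[unfolded F]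
  show ?thesis
  proof (rule fo_equiv_iso[of h])
    show "bij_betw h (fst (ord_struct \<alpha>)) (fst (segment False R t))"
      unfolding U using h1 by (simp add: ord_struct_def)
    show "\<forall>x\<in>fst (ord_struct \<alpha>). \<forall>y\<in>fst (ord_struct \<alpha>).
      (x, y) \<in> snd (ord_struct \<alpha>) \<longleftrightarrow> (h x, h y) \<in> snd (segment False R t)"
    proof (intro ballI)
      fix x y assume "x \<in> fst (ord_struct \<alpha>)" "y \<in> fst (ord_struct \<alpha>)"
      then have xy: "x \<in> Field \<alpha>" "y \<in> Field \<alpha>" by (simp_all add: ord_struct_def)
      have "h x = h y \<longleftrightarrow> x = y" using h1 xy by (auto simp: bij_betw_def inj_on_def)
      moreover have "h x \<in> underS ?W t" "h y \<in> underS ?W t" using h1 xy by (auto simp: bij_betw_def)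
      ultimately show "(x, y) \<in> snd (ord_struct \<alpha>) \<longleftrightarrow> (h x, h y) \<in> snd (segment False R t)"
	using h(2)[OF xy] by (simp add: ord_struct_def segment_simps(4)[OF R])
    qed
  qed
qed

text \<open>With a top element added, the order type \<open>t\<close> becomes \<open>t + 1\<close>, the closed segment up to \<open>t\<close>.\<close>

lemma add_top_segment:
  fixes q :: "'q rel" and R :: "'r rel"
  assumes R: "Well_order R" and t: "t \<in> Field (omega_times R)"
    and iso: "q =o Restr (omega_times R) (underS (omega_times R) t)"
  shows "\<exists>k. bij_betw k (Field (add_top q)) {x. (x, t) \<in> omega_times R} \<and>
    (\<forall>x\<in>Field (add_top q). \<forall>y\<in>Field (add_top q). (x, y) \<in> add_top q \<longleftrightarrow> (k x, k y) \<in> omega_times R)"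
proof -
  let ?W = "omega_times R"
  have W: "Well_order ?W" by (rule Well_order_omega_times[OF R])
  note WF = Well_order_facts[OF W] and F = Field_Restr_underS[OF W]
  obtain h where h: "bij_betw h (Field q) (Field (Restr ?W (underS ?W t)))"
    "\<And>a b. a \<in> Field q ==> b \<in> Field q ==> (a, b) \<in> q \<longleftrightarrow> (h a, h b) \<in> Restr ?W (underS ?W t)"
    using ordIso_bij[OF iso] by blast
  note h1 = h(1)[unfolded F]
  have below: "h a \<in> underS ?W t" if "a \<in> Field q" for a using h1 that by (auto simp: bij_betw_def)
  define k where "k x = (case x of None => t | Some a => h a)" for x
  have kSome: "k (Some a) = h a" and kNone: "k None = t" for a by (simp_all add: k_def)
  have "inj_on k (Field (add_top q))"
  proof (rule inj_onI)
    fix x y assume xy: "x \<in> Field (add_top q)" "y \<in> Field (add_top q)" "k x = k y"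
    show "x = y"
      using xy below h1 by (cases x; cases y) (auto simp: Field_add_top kSome kNone bij_betw_def inj_on_def underS_def)
  qed
  moreover have "k ` Field (add_top q) = {x. (x, t) \<in> ?W}"
  proof -
    have "k ` Field (add_top q) = insert t (h ` Field q)"
      by (simp add: Field_add_top image_image kSome kNone)
    also have "h ` Field q = underS ?W t" using h1 by (simp add: bij_betw_def)
    also have "insert t (underS ?W t) = {x. (x, t) \<in> ?W}" using WF(1)[OF t] by (auto simp: underS_def)
    finally show ?thesis .
  qed
  moreover have "(x, y) \<in> add_top q \<longleftrightarrow> (k x, k y) \<in> ?W"
    if "x \<in> Field (add_top q)" "y \<in> Field (add_top q)" for x y
  proof (cases x)
    case None
    show ?thesis
    proof (cases y)
      case None
      then show ?thesis using \<open>x = None\<close> WF(1)[OF t] by (simp add: kNone)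
    next
      case (Some b)
      then have "h b \<in> underS ?W t" using below that by (auto simp: Field_add_top)
      then have "(t, h b) \<notin> ?W" using WF(3) unfolding underS_def by blast
      then show ?thesis using None Some by (simp add: kNone kSome)
    qed
  next
    case (Some a)
    then have a: "a \<in> Field q" using that by (auto simp: Field_add_top)
    show ?thesis
    proof (cases y)
      case None
      then show ?thesis using Some a below[OF a] by (simp add: kNone kSome underS_def)
    next
      case (Some b)
      then have b: "b \<in> Field q" using that by (auto simp: Field_add_top)
      show ?thesis using h(2)[OF a b] below[OF a] below[OF b] Some \<open>x = Some a\<close> by (simp add: kSome)
    qed
  qed
  ultimately show ?thesis unfolding bij_betw_def by blast
qed

text \<open>The new least element goes to the least element of \<open>\<omega>\<^sup>\<omega> \<cdot> R\<close>, and the others are moved by the map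
  \<open>x \<mapsto> 1 + x\<close>, which adds 1 to the finite ordinals and fixes the others.\<close>

lemma add_bottom_segment:
  fixes R :: "'r rel" and T :: "'t set"
  assumes R: "Well_order R" and j: "j \<in> Field R" and f: "fin_supp f"
    and k: "bij_betw k T {x. (x, (f, j)) \<in> omega_times R}"
    and iff: "\<forall>x\<in>T. \<forall>y\<in>T. (x, y) \<in> r \<longleftrightarrow> (k x, k y) \<in> omega_times R"
  shows "fo_equiv (add_bottom T r) (segment True R (bump (underS R j = {}) f, j))"
proof -
  let ?W = "omega_times R" and ?t = "(f, j)"
  have W: "Well_order ?W" by (rule Well_order_omega_times[OF R])
  note WF = Well_order_facts[OF W]
  have t: "?t \<in> Field ?W" using j f by (simp add: Field_omega_times[OF R])
  have t': "(bump (underS R j = {}) f, j) = one_plus R ?t" by (simp add: one_plus_def)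
  obtain z where z: "z \<in> Field R" "\<forall>x\<in>Field R. (z, x) \<in> R" by (rule Well_order_bottom[OF R j])
  let ?o = "((\<lambda>_. 0 :: nat), z)"
  have kF: "k x \<in> Field ?W" and kt: "(k x, ?t) \<in> ?W" if "x \<in> T" for x
    using k that by (auto simp: bij_betw_def intro: FieldI1)
  note order = one_plus_order(1)[OF R] and inF = one_plus_order(2)[OF R _ t]
  have bot: "(?o, x) \<in> ?W" if "x \<in> Field ?W" for x by (rule omega_times_bottom[OF R z that])
  have inF: "one_plus R x \<in> Field ?W" if "x \<in> Field ?W" for x
    by (rule one_plus_order(2)[OF R that t])
  have inj: "x = y" if "x \<in> Field ?W" "y \<in> Field ?W" "one_plus R x = one_plus R y" for x y
  proof (rule WF(3))
    show "(x, y) \<in> ?W" using order[OF that(1,2)] WF(1)[OF inF[OF that(2)]] that(3) by simp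
    show "(y, x) \<in> ?W" using order[OF that(2,1)] WF(1)[OF inF[OF that(2)]] that(3) by simp
  qed
  define l where "l x = (case x of None => ?o | Some s => one_plus R (k s))" for x
  have lSome: "l (Some s) = one_plus R (k s)" and lNone: "l None = ?o" for s by (simp_all add: l_def)
  have ne: "one_plus R (k s) \<noteq> ?o" if "s \<in> T" for s by (rule one_plus_range(1)[OF R z kF[OF that]])
  show ?thesis
    unfolding t'
  proof (rule fo_equiv_iso[of l])
    have "inj_on l (insert None (Some ` T))"
    proof (rule inj_onI)
      fix x y assume xy: "x \<in> insert None (Some ` T)" "y \<in> insert None (Some ` T)" "l x = l y"
      show "x = y"
      proof (cases x)
	case None
	then show ?thesis using xy by (cases y) (auto simp: lSome lNone ne[symmetric])
      next
	case (Some s)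
	then have s: "s \<in> T" using xy by auto
	show ?thesis
	proof (cases y)
	  case None
	  then show ?thesis using Some xy(3) ne[OF s] by (simp add: lSome lNone)
	next
	  case (Some s')
	  then have s': "s' \<in> T" using xy by auto
	  have "k s = k s'" using inj[OF kF[OF s] kF[OF s']] xy(3) Some \<open>x = Some s\<close> by (simp add: lSome)
	  then show ?thesis using k s s' Some \<open>x = Some s\<close> by (simp add: bij_betw_def inj_on_def)
	qed
      qed
    qed
    moreover have "l ` insert None (Some ` T) = {x. (x, one_plus R ?t) \<in> ?W}"
    proof (intro Set.set_eqI iffI)
      fix x assume "x \<in> l ` insert None (Some ` T)"
      then consider "x = ?o" | s where "s \<in> T" "x = one_plus R (k s)" by (auto simp: lSome lNone)
      then show "x \<in> {x. (x, one_plus R ?t) \<in> ?W}"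
      proof cases
	case 1
	then show ?thesis using bot[OF inF[OF t]] by simp
      next
	case 2
	then show ?thesis using order[OF kF[OF 2(1)] t] kt[OF 2(1)] by simp
      qed
    next
      fix x assume "x \<in> {x. (x, one_plus R ?t) \<in> ?W}"
      then have x: "(x, one_plus R ?t) \<in> ?W" by simp
      show "x \<in> l ` insert None (Some ` T)"
      proof (cases "x = ?o")
	case True
	then show ?thesis using lNone by (intro image_eqI[of _ _ None]) simp_all
      next
	case False
	then obtain y where y: "y \<in> Field ?W" "one_plus R y = x"
	  using one_plus_range(2)[OF R z FieldI1[OF x]] by blast
	then have "(y, ?t) \<in> ?W" using order[OF y(1) t] x by simp
	then obtain s where "s \<in> T" "y = k s" using k by (auto simp: bij_betw_def)
	then show ?thesis using y(2) lSome by (intro image_eqI[of _ _ "Some s"]) simp_all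
      qed
    qed
    ultimately show "bij_betw l (fst (add_bottom T r)) (fst (segment True R (one_plus R ?t)))"
      by (simp add: bij_betw_def add_bottom_def segment_def)
    show "\<forall>x\<in>fst (add_bottom T r). \<forall>y\<in>fst (add_bottom T r).
      (x, y) \<in> snd (add_bottom T r) \<longleftrightarrow> (l x, l y) \<in> snd (segment True R (one_plus R ?t))"
      unfolding segment_simps(3)[OF R]
    proof (intro ballI)
      fix x y assume "x \<in> fst (add_bottom T r)" "y \<in> fst (add_bottom T r)"
      then have xy: "x \<in> insert None (Some ` T)" "y \<in> insert None (Some ` T)" by (simp_all add: add_bottom_def)
      have lF: "l y \<in> Field ?W"
	using xy(2) inF[OF kF] FieldI1[OF bot[OF t]] by (auto simp: lSome lNone)
      show "(x, y) \<in> snd (add_bottom T r) \<longleftrightarrow> (l x, l y) \<in> ?W"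
      proof (cases x)
	case None
	then show ?thesis using bot[OF lF] by (simp add: add_bottom_def lNone)
      next
	case (Some s)
	then have s: "s \<in> T" using xy by auto
	show ?thesis
	proof (cases y)
	  case None
	  have "(l x, ?o) \<notin> ?W"
	    using WF(3)[OF _ bot[OF inF[OF kF[OF s]]]] ne[OF s] Some by (auto simp: lSome)
	  then show ?thesis using Some None by (simp add: add_bottom_def lNone)
	next
	  case (Some s')
	  then have s': "s' \<in> T" using xy by auto
	  show ?thesis using order[OF kF[OF s] kF[OF s']] iff s s' Some \<open>x = Some s\<close>
	    by (simp add: add_bottom_def lSome)
	qed
      qed
    qed
  qed
qed

lemma ranks_segment:
  fixes \<alpha> :: "'a rel" and q :: "'q rel"
  assumes q: "q =o \<alpha>" and \<alpha>: "cantor_form \<alpha> f z"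
  shows "\<exists>(R :: 'a option rel) j. Well_order R \<and> j \<in> Field R \<and> fin_supp f \<and> (z \<longleftrightarrow> underS R j = {}) \<and>
    fo_equiv (Field (add_top q), add_top q) (segment True R (f, j)) \<and>
    fo_equiv (add_bottom (Field (add_top q)) (add_top q)) (segment True R (bump z f, j))"
proof -
  obtain R :: "'a option rel" and j where R: "Well_order R" "j \<in> Field R" "fin_supp f" "z \<longleftrightarrow> underS R j = {}"
    and iso: "\<alpha> =o Restr (omega_times R) (underS (omega_times R) (f, j))"
    using \<alpha> unfolding cantor_form_def by blast
  have t: "(f, j) \<in> Field (omega_times R)" using R by (simp add: Field_omega_times)
  obtain k where k: "bij_betw k (Field (add_top q)) {x. (x, (f, j)) \<in> omega_times R}"
    "\<forall>x\<in>Field (add_top q). \<forall>y\<in>Field (add_top q). (x, y) \<in> add_top q \<longleftrightarrow> (k x, k y) \<in> omega_times R"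
    using add_top_segment[OF R(1) t ordIso_transitive[OF q iso]] by blast
  have "fo_equiv (Field (add_top q), add_top q) (segment True R (f, j))"
    by (rule fo_equiv_iso[of k]) (use k in \<open>simp_all add: segment_def\<close>)
  moreover have "fo_equiv (add_bottom (Field (add_top q)) (add_top q)) (segment True R (bump z f, j))"
    using add_bottom_segment[OF R(1,2,3) k] R(4) by simp
  ultimately show ?thesis using R by blast
qed

lemma fo_equiv_cong: "fo_equiv M M' ==> fo_equiv N N' ==> fo_equiv M N \<longleftrightarrow> fo_equiv M' N'"
  using fo_equiv_trans[OF fo_equiv_trans[OF fo_equiv_sym], of M M' N N']
    fo_equiv_trans[OF fo_equiv_trans, of M M' N' N] fo_equiv_sym[of N N'] by blast

lemma ranks_fo_equiv_iff:
  fixes \<alpha> :: "'a rel" and \<beta> :: "'b rel" and q :: "'q rel" and p :: "'p rel"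
  assumes \<alpha>: "q =o \<alpha>" "cantor_form \<alpha> f z" and \<beta>: "p =o \<beta>" "cantor_form \<beta> g y"
  shows "fo_equiv (Field (add_top q), add_top q) (Field (add_top p), add_top p) \<longleftrightarrow> f = g \<and> z = y"
    and "fo_equiv (add_bottom (Field (add_top q)) (add_top q)) (add_bottom (Field (add_top p)) (add_top p))
      \<longleftrightarrow> f = g \<and> z = y"
proof -
  obtain R :: "'a option rel" and i where R: "Well_order R" "i \<in> Field R" "fin_supp f" "z \<longleftrightarrow> underS R i = {}"
    and Rq: "fo_equiv (Field (add_top q), add_top q) (segment True R (f, i))"
      "fo_equiv (add_bottom (Field (add_top q)) (add_top q)) (segment True R (bump z f, i))"
    using ranks_segment[OF \<alpha>] by blast
  obtain S :: "'b option rel" and j where S: "Well_order S" "j \<in> Field S" "fin_supp g" "y \<longleftrightarrow> underS S j = {}"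
    and Sp: "fo_equiv (Field (add_top p), add_top p) (segment True S (g, j))"
      "fo_equiv (add_bottom (Field (add_top p)) (add_top p)) (segment True S (bump y g, j))"
    using ranks_segment[OF \<beta>] by blast
  show "fo_equiv (Field (add_top q), add_top q) (Field (add_top p), add_top p) \<longleftrightarrow> f = g \<and> z = y"
    unfolding fo_equiv_cong[OF Rq(1) Sp(1)] segment_fo_equiv_iff[OF R(1) S(1) R(2) S(2) R(3) S(3)]
    using R(4) S(4) by simp
  show "fo_equiv (add_bottom (Field (add_top q)) (add_top q)) (add_bottom (Field (add_top p)) (add_top p))
      \<longleftrightarrow> f = g \<and> z = y"
    unfolding fo_equiv_cong[OF Rq(2) Sp(2)]
      segment_fo_equiv_iff[OF R(1) S(1) R(2) S(2) fin_supp_bump[OF R(3)] fin_supp_bump[OF S(3)]]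
    unfolding R(4)[symmetric] S(4)[symmetric] using bump_inject(1)[OF R(3) S(3)] by auto
qed

lemma eq_mod_fo_equiv:
  fixes \<alpha> :: "'a rel" and \<beta> :: "'b rel"
  assumes "eq_mod_omega_omega \<alpha> \<beta>"
  shows "fo_equiv (ord_struct \<alpha>) (ord_struct \<beta>)"
proof -
  obtain f z where cf: "cantor_form \<alpha> f z" "cantor_form \<beta> f z" using eq_mod_cantor_form[OF assms] by blast
  obtain R :: "'a option rel" and i where R: "Well_order R" "i \<in> Field R" "fin_supp f" "z \<longleftrightarrow> underS R i = {}"
    "\<alpha> =o Restr (omega_times R) (underS (omega_times R) (f, i))"
    using cf(1) unfolding cantor_form_def by blast
  obtain S :: "'b option rel" and j where S: "Well_order S" "j \<in> Field S" "z \<longleftrightarrow> underS S j = {}"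
    "\<beta> =o Restr (omega_times S) (underS (omega_times S) (f, j))"
    using cf(2) unfolding cantor_form_def by blast
  have "fo_equiv (segment False R (f, i)) (segment False S (f, j))"
    by (rule segment_fo_equiv[OF R(1) S(1) R(2) S(2) R(3)]) (use R(4) S(3) in simp)
  then show ?thesis
    using fo_equiv_cong[OF ord_struct_segment[OF R(1,5)] ord_struct_segment[OF S(1,4)]] by blast
qed

lemma fo_equiv_nonempty: "fo_equiv M N ==> fst M = {} \<longleftrightarrow> fst N = {}"
  using fo_equiv_closed[of M N "FEx 0 (FEq 0 0)" undefined undefined] by auto

lemma fo_equiv_two:
  "fo_equiv M N ==> (\<exists>a\<in>fst M. \<exists>b\<in>fst M. a \<noteq> b) \<longleftrightarrow> (\<exists>a\<in>fst N. \<exists>b\<in>fst N. a \<noteq> b)"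
  using fo_equiv_closed[of M N "FEx 0 (FEx 1 (FNot (FEq 0 1)))" undefined undefined] by auto

lemma add_bottom_two:
  "(\<exists>a\<in>fst (add_bottom T r). \<exists>b\<in>fst (add_bottom T r). a \<noteq> b) \<longleftrightarrow> T \<noteq> {}"
  by (auto simp: add_bottom_def)

text \<open>If one of the index sets is empty, its ordinal is 0 and the other ordinal is not; then the
  structures differ in their numbers of elements and the ordinals in being 0.\<close>

lemma ranks_compare:
  fixes \<alpha> :: "'a rel" and \<beta> :: "'b rel" and T :: "'s option set" and U :: "'t option set"
  assumes WO: "Well_order \<alpha>" "Well_order \<beta>" and neq: "(\<alpha>, \<beta>) \<notin> ordIso"
    and T: "ranks_of \<alpha> T r" and U: "ranks_of \<beta> U s"
  shows "fo_equiv (T, r) (U, s) \<longleftrightarrow> eq_mod_omega_omega \<alpha> \<beta>"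
    and "fo_equiv (add_bottom T r) (add_bottom U s) \<longleftrightarrow> eq_mod_omega_omega \<alpha> \<beta>"
proof -
  have empty: "(\<alpha>, \<beta>) \<in> ordIso" if "\<alpha> = {}" "\<beta> = {}"
    by (rule bij_ordIso[OF WO(2), of "\<lambda>_. undefined"]) (use that in \<open>simp_all add: bij_betw_def\<close>)
  have mixed: "\<not> eq_mod_omega_omega \<alpha> \<beta>" if "\<alpha> = {} \<longleftrightarrow> \<beta> \<noteq> {}"
    using fo_equiv_nonempty[OF eq_mod_fo_equiv[of \<alpha> \<beta>]] that by (auto simp: ord_struct_def Field_eq_empty_iff)
  have sizes: "\<not> fo_equiv (T, r) (U, s)" "\<not> fo_equiv (add_bottom T r) (add_bottom U s)" if "T = {} \<longleftrightarrow> U \<noteq> {}"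
    using that fo_equiv_nonempty[of "(T, r)" "(U, s)"] fo_equiv_two[of "add_bottom T r" "add_bottom U s"]
    unfolding add_bottom_two by auto
  consider "\<alpha> = {} \<longleftrightarrow> \<beta> \<noteq> {}" "T = {} \<longleftrightarrow> U \<noteq> {}"
    | q :: "'s rel" and p :: "'t rel" where "q =o \<alpha>" "T = Field (add_top q)" "r = add_top q"
	"p =o \<beta>" "U = Field (add_top p)" "s = add_top p"
  proof (cases "T = {} \<or> U = {}")
    case True
    have "\<alpha> = {} \<and> \<beta> \<noteq> {} \<and> T = {} \<and> U \<noteq> {} \<or> \<alpha> \<noteq> {} \<and> \<beta> = {} \<and> T \<noteq> {} \<and> U = {}"
      using True T U empty neq unfolding ranks_of_def Field_add_top by blast
    then show thesis using that(1) by blast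
  next
    case False
    then show thesis using T U that(2) unfolding ranks_of_def by blast
  qed
  then have "(fo_equiv (T, r) (U, s) \<longleftrightarrow> eq_mod_omega_omega \<alpha> \<beta>) \<and>
    (fo_equiv (add_bottom T r) (add_bottom U s) \<longleftrightarrow> eq_mod_omega_omega \<alpha> \<beta>)"
  proof cases
    case 1
    then show ?thesis using sizes mixed by blast
  next
    case 2
    obtain f z where f: "cantor_form \<alpha> f z" using cantor_form_exists[OF WO(1)] by blast
    obtain g y where g: "cantor_form \<beta> g y" using cantor_form_exists[OF WO(2)] by blast
    note iff = ranks_fo_equiv_iff[OF 2(1) _ 2(4), folded 2(2,3,5,6)]
    have "eq_mod_omega_omega \<alpha> \<beta> \<longleftrightarrow> f = g \<and> z = y"
    proof
      assume "eq_mod_omega_omega \<alpha> \<beta>"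
      then obtain f' z' where "cantor_form \<alpha> f' z'" "cantor_form \<beta> f' z'" using eq_mod_cantor_form by blast
      then have "fo_equiv (T, r) (U, s)" using iff(1) by blast
      then show "f = g \<and> z = y" using iff(1)[OF f g] by blast
    next
      assume "f = g \<and> z = y"
      then show "eq_mod_omega_omega \<alpha> \<beta>" using cantor_form_eq_mod[OF f] g by blast
    qed
    then show ?thesis using iff(1)[OF f g] iff(2)[OF f g] by blast
  qed
  then show "fo_equiv (T, r) (U, s) \<longleftrightarrow> eq_mod_omega_omega \<alpha> \<beta>"
    and "fo_equiv (add_bottom T r) (add_bottom U s) \<longleftrightarrow> eq_mod_omega_omega \<alpha> \<beta>" by blast+
qed

theorem theorem1p2:
  fixes \<alpha> :: "'a rel" and \<beta> :: "'b rel"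
    and \<kappa> :: "'k rel" and \<mu> :: "'m rel"
  assumes "Well_order \<alpha>" and "Well_order \<beta>" and "(\<alpha>, \<beta>) \<notin> ordIso"
    and "is_aleph \<alpha> \<kappa>" and "has_density_character TYPE('g::complex_hilbert_space) \<kappa>"
    and "is_aleph \<beta> \<mu>" and "has_density_character TYPE('h::complex_hilbert_space) \<mu>"
  shows
    "(fo_equiv
	(mvn_poset (calkin_algebra TYPE('g)) (projections (calkin_algebra TYPE('g))))
	(mvn_poset (calkin_algebra TYPE('h)) (projections (calkin_algebra TYPE('h))))
      \<longleftrightarrow> eq_mod_omega_omega \<alpha> \<beta>) \<and>
     (fo_equiv
	(mvn_poset (bounded_operators TYPE('g)) (infinite_projections (bounded_operators TYPE('g))))
	(mvn_poset (bounded_operators TYPE('h)) (infinite_projections (bounded_operators TYPE('h))))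
      \<longleftrightarrow> eq_mod_omega_omega \<alpha> \<beta>) \<and>
     (\<not> fo_equiv (ord_struct \<alpha>) (ord_struct \<beta>) \<longrightarrow>
	\<not> cstar_equiv (bounded_operators TYPE('g)) (bounded_operators TYPE('h)) \<and>
	\<not> cstar_equiv (calkin_algebra TYPE('g)) (calkin_algebra TYPE('h)))"
proof -
  let ?B = "bounded_operators TYPE('g)" and ?B' = "bounded_operators TYPE('h)"
  let ?C = "calkin_algebra TYPE('g)" and ?C' = "calkin_algebra TYPE('h)"
  obtain E :: "'g set" and T r and crd :: "'k option => 'k set"
    where E: "basis_of E UNIV" and T: "rank_index T r crd E" and \<alpha>: "ranks_of \<alpha> T r"
    using ex_ranks[OF assms(4,5)] by blast
  obtain F :: "'h set" and U s and crd' :: "'m option => 'm set"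
    where F: "basis_of F UNIV" and U: "rank_index U s crd' F" and \<beta>: "ranks_of \<beta> U s"
    using ex_ranks[OF assms(6,7)] by blast
  note compare = ranks_compare[OF assms(1-3) \<alpha> \<beta>]
  have "fo_equiv (mvn_poset ?C (projections ?C)) (mvn_poset ?C' (projections ?C')) \<longleftrightarrow>
      eq_mod_omega_omega \<alpha> \<beta>"
    using fo_equiv_cong[OF calkin_projections_poset[OF T E] calkin_projections_poset[OF U F]] compare(2)
    by blast
  moreover have "fo_equiv (mvn_poset ?B (infinite_projections ?B)) (mvn_poset ?B' (infinite_projections ?B')) \<longleftrightarrow>
      eq_mod_omega_omega \<alpha> \<beta>"
    using fo_equiv_cong[OF infinite_projections_poset[OF T E] infinite_projections_poset[OF U F]] compare(1)
    by blast
  moreover have "fo_equiv (ord_struct \<alpha>) (ord_struct \<beta>)" if "fo_equiv (T, r) (U, s)"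
    using that compare(1) eq_mod_fo_equiv by blast
  moreover have "fo_equiv (T, r) (U, s)" if eq: "cstar_equiv ?B ?B'"
  proof -
    obtain G H where GH: "interprets ?B (T, r) G bounded_universe below_fm"
      "interprets ?B' (U, s) H bounded_universe below_fm"
      using bounded_interprets[OF T E] bounded_interprets[OF U F] by blast
    show ?thesis
      by (rule interprets_fo_equiv[OF GH _ _ _ _ eq])
	(use formulas_wf formulas_free in \<open>auto simp: bounded_universe_def\<close>)
  qed
  moreover have "fo_equiv (T, r) (U, s)" if eq: "cstar_equiv ?C ?C'"
  proof -
    obtain G H where GH: "interprets ?C (T, r) G calkin_universe below_fm"
      "interprets ?C' (U, s) H calkin_universe below_fm"
      using calkin_interprets[OF T E] calkin_interprets[OF U F] by blast
    show ?thesis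
      by (rule interprets_fo_equiv[OF GH _ _ _ _ eq])
	(use formulas_wf formulas_free in \<open>auto simp: calkin_universe_def\<close>)
  qed
  ultimately show ?thesis by blast
qed

end
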